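(* Let $1<p\le n$ and let $A\subset\mathbb{R}^n$ be a $p$-quasi open set of finite measure. Then the following hold. (i) If $\lambda_k$ is a sequence of eigenvalues of the $p$-Laplacian on $A$ such that $\lambda_k\to\lambda$, then $\lambda$ is also an eigenvalue of the $p$-Laplacian on $A$. (ii) If the first eigenvalue $\lambda_1(A)$ is simple, then it is isolated (in the set of eigenvalues of the $p$-Laplacian on $A$).
   Context: For $E\subset\mathbb{R}^n$, the $p$-capacity is $\mathrm{Cap}_p(E)=\inf\{\int_{\mathbb{R}^n}(|u|^p+|\nabla u|^p)\,dx : u\in W^{1,p}(\mathbb{R}^n),\ u\ge 1\text{ a.e. in an open set }U\supset E\}$. A property holds q.e. if it holds except on a set of zero $p$-capacity. A set $A\subset\mathbb{R}^n$ is $p$-quasi open if for every $\varepsilon>0$ there is an open set $A_\varepsilon$ with $\mathrm{Cap}_p(A_\varepsilon)<\varepsilon$ and $A\cup A_\varepsilon$ open. A function $f:A\to\mathbb{R}$ is $p$-quasi continuous if for every $\varepsilon>0$ there is an open set $A_\varepsilon$ with $\mathrm{Cap}_p(A_\varepsilon)<\varepsilon$ such that $f|_{A\setminus A_\varepsilon}$ is continuous. Every $u\in W^{1,p}(\mathbb{R}^n)$ has a $p$-quasi continuous representative, unique up to q.e. equality; functions in $W^{1,p}(\mathbb{R}^n)$ are always identified with it. For a $p$-quasi open set $A$ with $\mathrm{Cap}_p(A)>0$, $W^{1,p}_0(A)$ is the Banach space of all $u\in W^{1,p}(\mathbb{R}^n)$ whose $p$-quasi continuous representative vanishes q.e. in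 $\mathbb{R}^n\setminus A$, with the norm of $W^{1,p}(\mathbb{R}^n)$. A number $\lambda\in\mathbb{R}$ is an eigenvalue of the $p$-Laplacian on $A$ if there is a non-zero $u\in W^{1,p}_0(A)$ (a corresponding eigenfunction) with $\int_A|\nabla u|^{p-2}\nabla u\cdot\nabla\varphi\,dx=\lambda\int_A|u|^{p-2}u\varphi\,dx$ for all $\varphi\in W^{1,p}_0(A)$. The eigenvalue $\lambda$ is simple if the subspace of $W^{1,p}_0(A)$ generated by all its eigenfunctions is one-dimensional. For $A$ of finite measure, $\lambda_1(A)$ is the smallest eigenvalue; it equals $\min\{\int_A|\nabla w|^p\,dx: w\in W^{1,p}_0(A),\ \|w\|_{L^p(A)}=1\}>0$. *)

theory Defs
  imports "HOL-Analysis.Analysis"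
begin

section \<open>Weak gradients and Sobolev functions\<close>

text \<open>
  Functions on \<open>\<real>\<^sup>n\<close> are represented by total functions; functions that agree almost everywhere
  represent the same element of a Lebesgue or Sobolev space. Every measure-theoretic notion refers
  to the completed Lebesgue measure \<open>lebesgue\<close>.
\<close>

primrec Ck :: "nat \<Rightarrow> ('a::euclidean_space \<Rightarrow> real) \<Rightarrow> bool" where
  "Ck 0 f \<longleftrightarrow> continuous_on UNIV f"
| "Ck (Suc k) f \<longleftrightarrow>
     (\<forall>x. f differentiable (at x)) \<and> (\<forall>b\<in>Basis. Ck k (\<lambda>x. frechet_derivative f (at x) b))"

definition test_function :: "('a::euclidean_space \<Rightarrow> real) \<Rightarrow> bool" where
  "test_function \<phi> \<longleftrightarrow> (\<forall>k. Ck k \<phi>) \<and> compact (closure {x. \<phi> x \<noteq> 0})"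

definition locally_integrable :: "('a::euclidean_space \<Rightarrow> 'b::euclidean_space) \<Rightarrow> bool" where
  "locally_integrable f \<longleftrightarrow> (\<forall>K. compact K \<longrightarrow> f absolutely_integrable_on K)"

definition has_weak_gradient ::
    "('a::euclidean_space \<Rightarrow> real) \<Rightarrow> ('a \<Rightarrow> 'a) \<Rightarrow> bool" where
  "has_weak_gradient u G \<longleftrightarrow> locally_integrable u \<and> locally_integrable G \<and>
     (\<forall>\<phi>. test_function \<phi> \<longrightarrow> (\<forall>b\<in>Basis.
        (LINT x|lebesgue. u x * frechet_derivative \<phi> (at x) b) =
        - (LINT x|lebesgue. (G x \<bullet> b) * \<phi> x)))"

text \<open>The weak gradient is determined only up to a null set; \<open>grad u\<close> is some version of it.\<close>

definition grad :: "('a::euclidean_space \<Rightarrow> real) \<Rightarrow> 'a \<Rightarrow> 'a" where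
  "grad u = (SOME G. has_weak_gradient u G)"

definition Lp :: "real \<Rightarrow> ('a::euclidean_space \<Rightarrow> 'b::euclidean_space) set" where
  "Lp p = {f \<in> borel_measurable lebesgue. integrable lebesgue (\<lambda>x. norm (f x) powr p)}"

definition W1p :: "real \<Rightarrow> ('a::euclidean_space \<Rightarrow> real) set" where
  "W1p p = {u \<in> Lp p. \<exists>G \<in> Lp p. has_weak_gradient u G}"


section \<open>Capacity and quasi topology\<close>

definition Cap :: "real \<Rightarrow> 'a::euclidean_space set \<Rightarrow> ennreal" where
  "Cap p E =
     (INF u \<in> {u \<in> W1p p. \<exists>U. open U \<and> E \<subseteq> U \<and> (AE x in lebesgue. x \<in> U \<longrightarrow> u x \<ge> 1)}.
        \<integral>\<^sup>+x. ennreal (\<bar>u x\<bar> powr p + norm (grad u x) powr p) \<partial>lebesgue)"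

definition quasi_open :: "real \<Rightarrow> 'a::euclidean_space set \<Rightarrow> bool" where
  "quasi_open p A \<longleftrightarrow>
     (\<forall>\<epsilon>>0. \<exists>V. open V \<and> Cap p V < ennreal \<epsilon> \<and> open (A \<union> V))"

definition quasi_continuous_on ::
    "real \<Rightarrow> 'a::euclidean_space set \<Rightarrow> ('a \<Rightarrow> real) \<Rightarrow> bool" where
  "quasi_continuous_on p A f \<longleftrightarrow>
     (\<forall>\<epsilon>>0. \<exists>V. open V \<and> Cap p V < ennreal \<epsilon> \<and> continuous_on (A - V) f)"

text \<open>
  A function need not itself be quasi continuous to belong to \<open>W1p0 p A\<close>: the vanishing condition
  outside \<open>A\<close> is imposed on its quasi continuous representative \<open>v\<close>, which is unique up to sets of
  zero capacity.
\<close>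

definition W1p0 :: "real \<Rightarrow> 'a::euclidean_space set \<Rightarrow> ('a \<Rightarrow> real) set" where
  "W1p0 p A = {u \<in> W1p p. \<exists>v. quasi_continuous_on p UNIV v \<and> (AE x in lebesgue. v x = u x) \<and>
     Cap p {x \<in> - A. v x \<noteq> 0} = 0}"


section \<open>Eigenvalues of the p-Laplacian\<close>

text \<open>
  Since \<open>0 powr a = 0\<close> for every \<open>a\<close>, the factors \<open>\<bar>\<nabla>u\<bar>\<^sup>p\<^sup>-\<^sup>2 \<nabla>u\<close> and \<open>\<bar>u\<bar>\<^sup>p\<^sup>-\<^sup>2 u\<close> are zero where
  \<open>\<nabla>u\<close>, respectively \<open>u\<close>, is zero, also if \<open>p < 2\<close>.
\<close>

definition eigenfunction ::
    "real \<Rightarrow> 'a::euclidean_space set \<Rightarrow> real \<Rightarrow> ('a \<Rightarrow> real) \<Rightarrow> bool" where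
  "eigenfunction p A \<mu> u \<longleftrightarrow> u \<in> W1p0 p A \<and> \<not> (AE x in lebesgue. u x = 0) \<and>
     (\<forall>\<phi> \<in> W1p0 p A.
        (LINT x:A|lebesgue. norm (grad u x) powr (p - 2) * (grad u x \<bullet> grad \<phi> x)) =
        \<mu> * (LINT x:A|lebesgue. \<bar>u x\<bar> powr (p - 2) * u x * \<phi> x))"

definition eigenvalue :: "real \<Rightarrow> 'a::euclidean_space set \<Rightarrow> real \<Rightarrow> bool" where
  "eigenvalue p A \<mu> \<longleftrightarrow> (\<exists>u. eigenfunction p A \<mu> u)"

definition first_eigenvalue :: "real \<Rightarrow> 'a::euclidean_space set \<Rightarrow> real" where
  "first_eigenvalue p A = (LEAST \<mu>. eigenvalue p A \<mu>)"

text \<open>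
  The subspace generated by the eigenfunctions lives in a space of functions modulo equality almost
  everywhere. The quotient below contains all such spaces as subspaces.
\<close>

quotient_type (overloaded) 'a ae_fun = "'a::euclidean_space \<Rightarrow> real" /
  "\<lambda>f g. AE x in lebesgue. f x = g x"
  morphisms rep_ae_fun ae_class
proof (rule equivpI)
  show "reflp (\<lambda>(f::'a \<Rightarrow> real) g. AE x in lebesgue. f x = g x)"
    by (simp add: reflp_def)
  show "symp (\<lambda>(f::'a \<Rightarrow> real) g. AE x in lebesgue. f x = g x)"
    by (simp add: symp_def eq_commute)
  show "transp (\<lambda>(f::'a \<Rightarrow> real) g. AE x in lebesgue. f x = g x)"
  proof (rule transpI)
    fix f g h :: "'a \<Rightarrow> real"
    assume "AE x in lebesgue. f x = g x" "AE x in lebesgue. g x = h x"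
    then show "AE x in lebesgue. f x = h x" by eventually_elim simp
  qed
qed

instantiation ae_fun :: (euclidean_space) real_vector
begin

lift_definition zero_ae_fun :: "'a ae_fun" is "\<lambda>x. 0" .

lift_definition plus_ae_fun :: "'a ae_fun \<Rightarrow> 'a ae_fun \<Rightarrow> 'a ae_fun" is "\<lambda>f g x. f x + g x"
  subgoal premises prems using prems by eventually_elim simp
  done

lift_definition uminus_ae_fun :: "'a ae_fun \<Rightarrow> 'a ae_fun" is "\<lambda>f x. - f x"
  subgoal premises prems using prems by eventually_elim simp
  done

lift_definition minus_ae_fun :: "'a ae_fun \<Rightarrow> 'a ae_fun \<Rightarrow> 'a ae_fun" is "\<lambda>f g x. f x - g x"
  subgoal premises prems using prems by eventually_elim simp
  done

lift_definition scaleR_ae_fun :: "real \<Rightarrow> 'a ae_fun \<Rightarrow> 'a ae_fun" is "\<lambda>c f x. c * f x"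
  subgoal premises prems using prems by eventually_elim simp
  done

instance
  by standard (transfer; simp add: algebra_simps)+

end

text \<open>
  \<open>dim\<close> is zero for a subspace of infinite dimension, so \<open>dim _ = 1\<close> does say one-dimensional.
\<close>

definition simple_eigenvalue :: "real \<Rightarrow> 'a::euclidean_space set \<Rightarrow> real \<Rightarrow> bool" where
  "simple_eigenvalue p A \<mu> \<longleftrightarrow>
     eigenvalue p A \<mu> \<and> dim (span (ae_class ` {u. eigenfunction p A \<mu> u})) = 1"

end

theory Submission imports Defs "HOL-Complex_Analysis.Great_Picard" begin

text \<open>
 Write \<open>\<parallel>f\<parallel>\<close> for the \<open>L\<^sup>p\<close> norm; \<open>pint p f\<close> is its \<open>p\<close>-th power. An eigenfunction for \<open>\<mu>\<close> satisfies
 \<open>\<parallel>\<nabla>u\<parallel>\<^sup>p = \<mu> \<parallel>u\<parallel>\<^sup>p\<close>, so normalized eigenfunctions for bounded eigenvalues are bounded in \<open>W\<^sup>1\<^sup>,\<^sup>p\<close>. As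
 \<open>A\<close> has finite measure and mollification at scale \<open>\<epsilon>\<close> moves a function by at most \<open>\<epsilon> \<parallel>\<nabla>u\<parallel>\<close> in \<open>L\<^sup>p\<close>, a
 subsequence converges in \<open>L\<^sup>p\<close> (\<open>W1p_compact\<close>). Subtracting the equations of two eigenfunctions and
 using the monotonicity of \<open>x \<mapsto> |x|\<^sup>p\<^sup>-\<^sup>2 x\<close> shows that closeness in \<open>L\<^sup>p\<close> forces closeness of the gradients
 (\<open>eigenfunctions_close\<close>). Hence the convergence holds in \<open>W\<^sup>1\<^sup>,\<^sup>p\<close>, the limit stays in \<open>W\<^sup>1\<^sup>,\<^sup>p\<^sub>0(A)\<close>
 (\<open>W1p0_limit\<close>), and the equation passes to the limit: the set of eigenvalues is closed
 (\<open>eigenvalues_closed\<close>).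

 Let \<open>m\<close> be the infimum of \<open>\<parallel>\<nabla>w\<parallel>\<^sup>p\<close> over \<open>w \<in> W\<^sup>1\<^sup>,\<^sup>p\<^sub>0(A)\<close> with \<open>\<parallel>w\<parallel> = 1\<close>. By compactness and the uniform
 convexity of \<open>|x|\<^sup>p\<close> minimizing sequences converge (\<open>minimizing_sequence_converges\<close>), and minimizers are
 the eigenfunctions for \<open>m\<close>; so \<open>m\<close> is the first eigenvalue. Passing to \<open>|u|\<close>, there is a minimizer
 \<open>u \<ge> 0\<close>. If \<open>m\<close> is simple, \<open>u\<close> is the only nonnegative normalized minimizer, and every nonnegative
 normalized \<open>w\<close> with energy close to \<open>m\<close> is close to \<open>u\<close> (\<open>near_minimizer_close\<close>). Let \<open>w\<close> be an
 eigenfunction for an eigenvalue \<open>\<mu>\<close> close to \<open>m\<close>. Testing its equation with its positive and negative part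
 shows that both, normalized, have energy \<open>\<mu>\<close>; they cannot both be close to \<open>u\<close>, having disjoint supports.
 So one may take \<open>w \<ge> 0\<close>, and \<open>w\<close> is close to \<open>u\<close>; in particular \<open>w\<close> and \<open>u\<close> do not live on disjoint sets.

 No maximum principle is at hand on a quasi open set, so \<open>w\<close> may vanish where \<open>u\<close> does not. Picone's test
 function \<open>u\<^sup>p w\<^sup>1\<^sup>-\<^sup>p\<close>, made admissible by truncating \<open>u\<close> and shifting \<open>w\<close>, nevertheless gives in the limit
 \<open>\<mu> \<integral>\<^sub>{\<^sub>w\<^sub>>\<^sub>0\<^sub>} u\<^sup>p \<le> \<integral>\<^sub>{\<^sub>w\<^sub>>\<^sub>0\<^sub>} |\<nabla>u|\<^sup>p\<close>, together with \<open>(u/w) |\<nabla>w| \<in> L\<^sup>p\<close> (\<open>picone_limit\<close>). That bound makes \<open>u\<close> times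
 a smoothed indicator of \<open>{w > 0}\<close> an admissible test function for the equation of \<open>u\<close>, whence
 \<open>\<integral>\<^sub>{\<^sub>w\<^sub>>\<^sub>0\<^sub>} |\<nabla>u|\<^sup>p = m \<integral>\<^sub>{\<^sub>w\<^sub>>\<^sub>0\<^sub>} u\<^sup>p\<close> (\<open>positivity_energy_identity\<close>). So \<open>\<mu> \<le> m\<close>, and \<open>\<mu> = m\<close> by minimality.
\<close>

abbreviation "lmeas \<equiv> borel_measurable lebesgue"

section \<open>Inequalities for powers of the norm\<close>

text \<open>Both functions are homogeneous of the same degree, so it suffices to compare them on the unit
 sphere. There \<open>\<Psi>\<close> has a positive lower bound on the compact set where \<open>\<Phi> \<ge> \<delta>\<close>.\<close>

lemma homogeneous_bound:
 fixes \<Phi> \<Psi> :: "'v::euclidean_space \<Rightarrow> real"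
 assumes cont: "continuous_on UNIV \<Phi>" "continuous_on UNIV \<Psi>"
  and hom: "\<And>c x. c > 0 \<Longrightarrow> \<Phi> (c *\<^sub>R x) = c powr p * \<Phi> x"
   "\<And>c x. c > 0 \<Longrightarrow> \<Psi> (c *\<^sub>R x) = c powr p * \<Psi> x"
  and nonneg: "\<And>x. \<Psi> x \<ge> 0" and zero: "\<And>x. \<Psi> x = 0 \<Longrightarrow> \<Phi> x \<le> 0"
  and "\<delta> > 0" and "p > 0"
 obtains C where "C \<ge> 0" "\<And>x. \<Phi> x \<le> \<delta> * norm x powr p + C * \<Psi> x"
proof -
 define S where "S = {x \<in> sphere 0 1. \<Phi> x \<ge> \<delta>}"
 have "S = sphere 0 1 \<inter> \<Phi> -` {\<delta>..}" by (auto simp: S_def)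
 moreover have "closed (\<Phi> -` {\<delta>..})" using cont(1) by (simp add: continuous_on_closed_vimage)
 ultimately have "compact S" by (simp add: compact_Int_closed)
 have pos: "\<Psi> x > 0" if "x \<in> S" for x using that nonneg[of x] zero[of x] \<open>\<delta> > 0\<close> by (force simp: S_def)
 have "\<exists>C\<ge>0. \<forall>x\<in>S. \<Phi> x \<le> C * \<Psi> x"
 proof (cases "S = {}")
  case True
  then show ?thesis by (intro exI[of _ 0]) auto
 next
  case False
  have "continuous_on S (\<lambda>x. \<Phi> x / \<Psi> x)" by (intro continuous_on_divide continuous_on_subset[OF cont(1)]
     continuous_on_subset[OF cont(2)]) (use pos in force)+
  from continuous_attains_sup[OF \<open>compact S\<close> False this]
  obtain z where z: "\<And>x. x \<in> S \<Longrightarrow> \<Phi> x / \<Psi> x \<le> \<Phi> z / \<Psi> z" by blast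
  have "\<Phi> x \<le> max 0 (\<Phi> z / \<Psi> z) * \<Psi> x" if "x \<in> S" for x
  proof -
   have "\<Phi> x = (\<Phi> x / \<Psi> x) * \<Psi> x" using pos[OF that] by simp
   also have "\<dots> \<le> max 0 (\<Phi> z / \<Psi> z) * \<Psi> x" using z[OF that] pos[OF that] by (intro mult_right_mono) auto
   finally show ?thesis .
  qed
  then show ?thesis by (intro exI[of _ "max 0 (\<Phi> z / \<Psi> z)"]) auto
 qed
 then obtain C where C: "C \<ge> 0" "\<And>x. x \<in> S \<Longrightarrow> \<Phi> x \<le> C * \<Psi> x" by blast
 show thesis
 proof (rule that[OF C(1)])
  fix x
  show "\<Phi> x \<le> \<delta> * norm x powr p + C * \<Psi> x"
  proof (cases "x = 0")
   case True
   have "\<Phi> (2 *\<^sub>R 0) = 2 powr p * \<Phi> 0" "\<Psi> (2 *\<^sub>R 0) = 2 powr p * \<Psi> 0" by (rule hom; simp)+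
   moreover have "(2::real) powr p \<noteq> 1" using \<open>p > 0\<close> by (simp add: powr_eq_one_iff_gen)
   ultimately show ?thesis using True by simp
  next
   case False
   define e where "e = x /\<^sub>R norm x"
   have x: "x = norm x *\<^sub>R e" and e: "norm e = 1" using False by (auto simp: e_def)
   have "\<Phi> e \<le> \<delta> + C * \<Psi> e" using C(2)[of e] C(1) e nonneg[of e] \<open>\<delta> > 0\<close>
    by (cases "e \<in> S") (auto simp: S_def intro: order_trans add_increasing2)
   then have "norm x powr p * \<Phi> e \<le> norm x powr p * (\<delta> + C * \<Psi> e)" by (intro mult_left_mono) auto
   moreover have "\<Phi> x = norm x powr p * \<Phi> e" "\<Psi> x = norm x powr p * \<Psi> e" using hom[of "norm x" e] False x by auto
   ultimately show ?thesis by (simp add: algebra_simps)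
  qed
 qed
qed

lemma norm_Pair_powr:
 fixes x :: "'a::real_normed_vector" and y :: "'b::real_normed_vector"
 assumes "p > 0"
 shows "norm (x, y) powr p \<le> 2 powr p * (norm x powr p + norm y powr p)"
proof -
 have "norm (x, y) \<le> norm x + norm y" by (rule norm_Pair_le)
 also have "\<dots> \<le> 2 * max (norm x) (norm y)" by simp
 finally have "norm (x, y) powr p \<le> (2 * max (norm x) (norm y)) powr p" using assms by (intro powr_mono2) auto
 also have "\<dots> = 2 powr p * max (norm x) (norm y) powr p" by (simp add: powr_mult)
 also have "\<dots> \<le> 2 powr p * (norm x powr p + norm y powr p)" by (intro mult_left_mono) (auto simp: max_def)
 finally show ?thesis .
qed

lemma norm_add_powr:
 fixes x y :: "'a::real_normed_vector"
 assumes "p > 0"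
 shows "norm (x + y) powr p \<le> 2 powr p * (norm x powr p + norm y powr p)"
proof -
 have "norm (x + y) \<le> 2 * max (norm x) (norm y)" using norm_triangle_ineq[of x y] by simp
 then have "norm (x + y) powr p \<le> (2 * max (norm x) (norm y)) powr p" using assms by (intro powr_mono2) auto
 also have "\<dots> = 2 powr p * max (norm x) (norm y) powr p" by (simp add: powr_mult)
 also have "\<dots> \<le> 2 powr p * (norm x powr p + norm y powr p)" by (intro mult_left_mono) (auto simp: max_def)
 finally show ?thesis .
qed

lemma homogeneous_bound2:
 fixes \<Phi> \<Psi> :: "'v::euclidean_space \<Rightarrow> 'w::euclidean_space \<Rightarrow> real"
 assumes cont: "continuous_on UNIV (\<lambda>(x, y). \<Phi> x y)" "continuous_on UNIV (\<lambda>(x, y). \<Psi> x y)"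
  and hom: "\<And>c x y. c > 0 \<Longrightarrow> \<Phi> (c *\<^sub>R x) (c *\<^sub>R y) = c powr p * \<Phi> x y"
   "\<And>c x y. c > 0 \<Longrightarrow> \<Psi> (c *\<^sub>R x) (c *\<^sub>R y) = c powr p * \<Psi> x y"
  and nonneg: "\<And>x y. \<Psi> x y \<ge> 0" and zero: "\<And>x y. \<Psi> x y = 0 \<Longrightarrow> \<Phi> x y \<le> 0"
  and "\<delta> > 0" and "p > 0"
 obtains C where "C \<ge> 0"
  "\<And>x y. \<Phi> x y \<le> \<delta> * (norm x powr p + norm y powr p) + C * \<Psi> x y"
proof -
 obtain C where C: "C \<ge> 0" "\<And>z. (\<lambda>(x, y). \<Phi> x y) z \<le> \<delta> / 2 powr p * norm z powr p + C * (\<lambda>(x, y). \<Psi> x y) z"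
  by (rule homogeneous_bound[OF cont, of p "\<delta> / 2 powr p"]) (use assms in \<open>auto simp: split_beta\<close>)
 show thesis
 proof (rule that[OF C(1)])
  fix x y
  have "\<Phi> x y \<le> \<delta> / 2 powr p * norm (x, y) powr p + C * \<Psi> x y" using C(2)[of "(x, y)"] by simp
  also have "\<delta> / 2 powr p * norm (x, y) powr p
    \<le> \<delta> / 2 powr p * (2 powr p * (norm x powr p + norm y powr p))"
   using \<open>\<delta> > 0\<close> \<open>p > 0\<close> by (intro mult_left_mono norm_Pair_powr) auto
  finally show "\<Phi> x y \<le> \<delta> * (norm x powr p + norm y powr p) + C * \<Psi> x y" by simp
 qed
qed

text \<open>The map whose divergence along \<open>\<nabla>u\<close> is the \<open>p\<close>-Laplacian, and the derivative of \<open>|x|\<^sup>p / p\<close>.\<close>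

definition flux :: "real \<Rightarrow> 'a::real_inner \<Rightarrow> 'a" where
 "flux p x = norm x powr (p - 2) *\<^sub>R x"

lemma flux_0 [simp]: "flux p 0 = 0" by (simp add: flux_def)

lemma norm_flux: "norm (flux p x) = norm x powr (p - 1)"
 by (cases "x = 0") (auto simp: flux_def powr_mult_base' powr_diff power2_eq_square)

lemma flux_inner_self: "flux p x \<bullet> x = norm x powr p"
proof (cases "x = 0")
 case False
 then have "norm x powr (p - 2) * (norm x)\<^sup>2 = norm x powr p" by (simp add: powr_diff)
 then show ?thesis by (simp add: flux_def power2_norm_eq_inner)
qed (simp add: flux_def)

lemma flux_scaleR: "c > 0 \<Longrightarrow> flux p (c *\<^sub>R x) = c powr (p - 1) *\<^sub>R flux p x"
 by (simp add: flux_def powr_mult powr_diff field_simps power2_eq_square)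

lemma abs_flux_inner_le: "\<bar>flux p x \<bullet> y\<bar> \<le> norm x powr (p - 1) * norm y"
 using Cauchy_Schwarz_ineq2[of "flux p x" y] by (simp add: norm_flux)

text \<open>Young's inequality with a parameter and without sharp constants: compare \<open>b\<close> with \<open>\<eta> a\<close>.\<close>

lemma powr_m1_mult_le:
 fixes a b :: real
 assumes "a \<ge> 0" "b \<ge> 0" "\<eta> > 0" "p > 1"
 shows "a powr (p - 1) * b \<le> \<eta> * a powr p + \<eta> powr (1 - p) * b powr p"
proof (cases "b \<le> \<eta> * a")
 case True
 have "a powr (p - 1) * b \<le> a powr (p - 1) * (\<eta> * a)" using True by (intro mult_left_mono) auto
 also have "\<dots> = \<eta> * a powr p" using assms by (cases "a = 0") (auto simp: powr_diff)
 finally show ?thesis by (simp add: add_increasing2)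
next
 case False
 then have "a \<le> b / \<eta>" "b > 0" using assms by (auto simp: field_simps intro: order_trans[of _ "\<eta> * a"])
 have "a powr (p - 1) * b \<le> (b / \<eta>) powr (p - 1) * b" using \<open>a \<le> b / \<eta>\<close> assms by (intro mult_right_mono powr_mono2) auto
 also have "\<dots> = \<eta> powr (1 - p) * b powr p" using \<open>b > 0\<close> \<open>\<eta> > 0\<close> by (simp add: powr_divide powr_diff)
 finally show ?thesis using assms by (simp add: add_increasing)
qed

lemma flux_inner_le:
 assumes "\<eta> > 0" "p > 1"
 shows "\<bar>flux p x \<bullet> y\<bar> \<le> \<eta> * norm x powr p + \<eta> powr (1 - p) * norm y powr p"
 using order_trans[OF abs_flux_inner_le powr_m1_mult_le] assms by auto

lemma continuous_flux: "p > 1 \<Longrightarrow> continuous_on UNIV (flux p)"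
 unfolding continuous_on_eq_continuous_within
proof safe
 fix x :: 'a assume p: "p > 1"
 show "isCont (flux p) x"
 proof (cases "x = 0")
  case True
  have "((\<lambda>y::'a. norm y powr (p - 1)) \<longlongrightarrow> 0 powr (p - 1)) (at 0)"
   by (intro tendsto_powr2 tendsto_intros tendsto_norm_zero) (use p in auto)
  then have "((\<lambda>y::'a. norm (flux p y)) \<longlongrightarrow> 0) (at 0)" by (simp add: norm_flux)
  then show ?thesis using True by (simp add: isCont_def tendsto_norm_zero_iff)
 next
  case False
  then show ?thesis unfolding flux_def[abs_def] by (intro continuous_intros) auto
 qed
qed

lemma continuous_on_flux [continuous_intros]:
 "p > 1 \<Longrightarrow> continuous_on S f \<Longrightarrow> continuous_on S (\<lambda>x. flux p (f x))" using continuous_on_compose2[OF continuous_flux] by blast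

lemma borel_measurable_flux [measurable]: "p > 1 \<Longrightarrow> flux p \<in> borel_measurable borel"
 by (intro borel_measurable_continuous_onI continuous_flux)

lemma Bernoulli_powr_strict:
 fixes t :: real
 assumes "p > 1" "t \<ge> 0" "t \<noteq> 1"
 shows "1 + p * (t - 1) < t powr p"
proof (cases "t = 0")
 case False
 then have t: "t > 0" using assms by simp
 have der: "((\<lambda>t. t powr p - p * t) has_real_derivative p * (s powr (p - 1) - 1)) (at s)"
  if "s > 0" for s using that by (auto intro!: derivative_eq_intros simp: algebra_simps)
 show ?thesis
 proof (cases "t < 1")
  case True
  obtain z where z: "t < z" "z < 1" "(1 powr p - p * 1) - (t powr p - p * t) = (1 - t) * (p * (z powr (p - 1) - 1))"
   using MVT2[of t 1 "\<lambda>t. t powr p - p * t" "\<lambda>s. p * (s powr (p - 1) - 1)"] True t der by force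
  have "z powr (p - 1) < 1" using z t assms powr_less_mono2[of "p - 1" z 1] by auto
  then have "(1 - t) * (p * (z powr (p - 1) - 1)) < 0" using True assms by (intro mult_pos_neg) (auto simp: mult_less_0_iff)
  then show ?thesis using z(3) by (simp add: algebra_simps)
 next
  case False
  then have "t > 1" using assms by auto
  obtain z where z: "1 < z" "z < t" "(t powr p - p * t) - (1 powr p - p * 1) = (t - 1) * (p * (z powr (p - 1) - 1))"
   using MVT2[of 1 t "\<lambda>t. t powr p - p * t" "\<lambda>s. p * (s powr (p - 1) - 1)"] \<open>t > 1\<close> der by force
  have "z powr (p - 1) > 1" using z assms powr_less_mono2[of "p - 1" 1 z] by auto
  then have "(t - 1) * (p * (z powr (p - 1) - 1)) > 0" using \<open>t > 1\<close> assms by (intro mult_pos_pos) auto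
  then show ?thesis using z(3) by (simp add: algebra_simps)
 qed
qed (use assms in auto)

lemma Young_powr_strict:
 fixes r s :: real
 assumes "p > 1" "r \<ge> 0" "s \<ge> 0" "r \<noteq> s"
 shows "r powr p + p * r powr (p - 1) * (s - r) < s powr p"
proof (cases "r = 0")
 case False
 then have r: "r > 0" using assms by simp
 have "r powr p * (1 + p * (s / r - 1)) < r powr p * (s / r) powr p"
  using Bernoulli_powr_strict[of p "s / r"] assms r by (intro mult_strict_left_mono) auto
 moreover have "r powr p * (s / r) powr p = s powr p" using r assms by (simp add: powr_divide)
 moreover have "r powr p * (1 + p * (s / r - 1)) = r powr p + p * r powr (p - 1) * (s - r)"
  using r by (simp add: powr_diff field_simps)
 ultimately show ?thesis by simp
qed (use assms in auto)

lemma Young_powr: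
 fixes r s :: real
 assumes "p > 1" "r \<ge> 0" "s \<ge> 0"
 shows "p * r powr (p - 1) * s \<le> (p - 1) * r powr p + s powr p"
proof -
 have "r powr p + p * r powr (p - 1) * (s - r) \<le> s powr p" using Young_powr_strict[OF assms] by (cases "r = s") auto
 moreover have "r powr (p - 1) * r = r powr p" using assms by (cases "r = 0") (auto simp: powr_diff)
 ultimately show ?thesis by (simp add: algebra_simps)
qed

lemma powr_convex_strict:
 fixes x y :: "'a::real_inner"
 assumes "p > 1" and le: "norm y powr p \<le> norm x powr p + p * (flux p x \<bullet> (y - x))"
 shows "x = y"
proof -
 have 1: "flux p x \<bullet> (y - x) = flux p x \<bullet> y - norm x powr p" by (simp add: inner_diff_right flux_inner_self)
 have rr: "norm x powr (p - 1) * norm x = norm x powr p" by (cases "x = 0") (auto simp: powr_diff)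
 have 2: "flux p x \<bullet> y \<le> norm x powr (p - 1) * norm y" using abs_flux_inner_le[of p x y] by linarith
 have 3: "p * (flux p x \<bullet> (y - x)) \<le> p * norm x powr (p - 1) * (norm y - norm x)"
 proof -
  have "flux p x \<bullet> (y - x) \<le> norm x powr (p - 1) * (norm y - norm x)" using 1 2 rr by (simp add: algebra_simps)
  then show ?thesis using assms(1) by (simp add: mult.assoc)
 qed
 have eq: "norm x = norm y" using Young_powr_strict[of p "norm x" "norm y"] le 3 assms(1) by force
 show ?thesis
 proof (cases "x = 0")
  case False
  have "flux p x \<bullet> y \<ge> norm x powr p" using le 1 eq assms(1) by (simp add: zero_le_mult_iff)
  then have "norm x powr (p - 2) * (x \<bullet> y) \<ge> norm x powr (p - 2) * (norm x * norm y)"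
   using False eq by (simp add: flux_def powr_diff power2_eq_square)
  then have "x \<bullet> y \<ge> norm x * norm y" using False by simp
  then have "x \<bullet> y = norm x * norm y" using norm_cauchy_schwarz[of x y] by simp
  then have "norm x *\<^sub>R y = norm y *\<^sub>R x" using norm_cauchy_schwarz_eq[of x y] by blast
  then show ?thesis using eq False by (metis norm_eq_zero scaleR_left_imp_eq)
 qed (use eq in auto)
qed

lemma powr_convex:
 fixes x y :: "'a::real_inner"
 assumes "p > 1"
 shows "norm x powr p + p * (flux p x \<bullet> (y - x)) \<le> norm y powr p"
 using powr_convex_strict[OF assms, of y x] by (cases "x = y") force+

lemma flux_monotone:
 fixes x y :: "'a::real_inner"
 assumes "p > 1"
 shows "(flux p x - flux p y) \<bullet> (x - y) \<ge> 0"
  and "(flux p x - flux p y) \<bullet> (x - y) = 0 \<Longrightarrow> x = y"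
proof -
 have eq: "p * ((flux p x - flux p y) \<bullet> (x - y)) =
  (norm y powr p - norm x powr p - p * (flux p x \<bullet> (y - x))) +
  (norm x powr p - norm y powr p - p * (flux p y \<bullet> (x - y)))" by (simp add: inner_diff_left inner_diff_right algebra_simps)
 have ge: "p * ((flux p x - flux p y) \<bullet> (x - y)) \<ge> 0"
  unfolding eq using powr_convex[OF assms, of x y] powr_convex[OF assms, of y x] by simp
 then show "(flux p x - flux p y) \<bullet> (x - y) \<ge> 0" using assms by (simp add: zero_le_mult_iff)
 assume "(flux p x - flux p y) \<bullet> (x - y) = 0"
 then have "norm y powr p \<le> norm x powr p + p * (flux p x \<bullet> (y - x))"
  using eq powr_convex[OF assms, of x y] powr_convex[OF assms, of y x] by simp
 then show "x = y" using powr_convex_strict[OF assms] by blast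
qed

lemma midpoint_gap:
 fixes x y :: "'a::real_inner"
 assumes "p > 1"
 shows "norm x powr p + norm y powr p - 2 * norm ((1/2) *\<^sub>R (x + y)) powr p \<ge> 0"
  and "norm x powr p + norm y powr p - 2 * norm ((1/2) *\<^sub>R (x + y)) powr p = 0 \<Longrightarrow> x = y"
proof -
 define m where "m = (1/2) *\<^sub>R (x + y)"
 have 0: "flux p m \<bullet> (x - m) + flux p m \<bullet> (y - m) = 0"
 proof -
  have "(x - m) + (y - m) = 0" by (simp add: m_def algebra_simps flip: scaleR_2)
  then show ?thesis by (metis inner_add_right inner_zero_right)
 qed
 have 1: "norm m powr p + p * (flux p m \<bullet> (x - m)) \<le> norm x powr p"
   "norm m powr p + p * (flux p m \<bullet> (y - m)) \<le> norm y powr p" using powr_convex[OF assms] by auto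
 have 2: "p * (flux p m \<bullet> (x - m)) + p * (flux p m \<bullet> (y - m)) = 0" using 0 by (metis distrib_left mult_zero_right)
 show "norm x powr p + norm y powr p - 2 * norm ((1/2) *\<^sub>R (x + y)) powr p \<ge> 0" using 1 2 by (simp add: m_def)
 assume "norm x powr p + norm y powr p - 2 * norm ((1/2) *\<^sub>R (x + y)) powr p = 0"
 then have "norm x powr p \<le> norm m powr p + p * (flux p m \<bullet> (x - m))"
   "norm y powr p \<le> norm m powr p + p * (flux p m \<bullet> (y - m))" using 1 2 by (simp_all add: m_def)
 then show "x = y" using powr_convex_strict[OF assms] by metis
qed

lemma scaleR_powr_p: "c > 0 \<Longrightarrow> norm (c *\<^sub>R x) powr p = c powr p * norm x powr p"
 by (simp add: powr_mult)

lemma flux_diff_inner_scaleR: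
 assumes "c > 0"
 shows "(flux p (c *\<^sub>R x) - flux p (c *\<^sub>R y)) \<bullet> (c *\<^sub>R z) = c powr p * ((flux p x - flux p y) \<bullet> z)"
proof -
 have "flux p (c *\<^sub>R x) - flux p (c *\<^sub>R y) = c powr (p - 1) *\<^sub>R (flux p x - flux p y)"
  using assms by (simp add: flux_scaleR scaleR_diff_right)
 then show ?thesis using assms by (simp add: powr_diff)
qed

lemma continuous_on_norm_powr [continuous_intros]:
 "p > 0 \<Longrightarrow> continuous_on S f \<Longrightarrow> continuous_on S (\<lambda>x. norm (f x) powr (p::real))"
 by (intro continuous_on_powr' continuous_intros) auto

text \<open>Strict monotonicity of the flux in quantitative form: the two sides are homogeneous of degree \<open>p\<close>,
 and the monotonicity gap vanishes only for \<open>x = y\<close>. This treats all \<open>p > 1\<close> alike, without the usual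
 distinction between \<open>p < 2\<close> and \<open>p \<ge> 2\<close>.\<close>

lemma norm_diff_powr_le_monotone:
 assumes "p > 1" "\<delta> > 0"
 obtains C where "C \<ge> 0" "\<And>x y::'a::euclidean_space.
  norm (x - y) powr p \<le> \<delta> * (norm x powr p + norm y powr p) + C * ((flux p x - flux p y) \<bullet> (x - y))"
proof (rule homogeneous_bound2[where p = p and \<delta> = \<delta> and
   \<Phi> = "\<lambda>x y::'a. norm (x - y) powr p" and \<Psi> = "\<lambda>x y. (flux p x - flux p y) \<bullet> (x - y)"])
 show "norm (c *\<^sub>R x - c *\<^sub>R y) powr p = c powr p * norm (x - y) powr p" if "c > 0" for c and x y :: 'a
  using scaleR_powr_p[OF that, of "x - y" p] by (simp add: scaleR_diff_right)
 show "(flux p (c *\<^sub>R x) - flux p (c *\<^sub>R y)) \<bullet> (c *\<^sub>R x - c *\<^sub>R y) =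
   c powr p * ((flux p x - flux p y) \<bullet> (x - y))" if "c > 0" for c and x y :: 'a
  using flux_diff_inner_scaleR[OF that, of p x y "x - y"] by (simp add: scaleR_diff_right)
 show "(flux p x - flux p y) \<bullet> (x - y) = 0 \<Longrightarrow> norm (x - y) powr p \<le> 0" for x y :: 'a
  using flux_monotone(2)[OF assms(1), of x y] by auto
qed (use assms flux_monotone in \<open>auto simp: split_beta intro!: continuous_intros\<close>)

text \<open>Uniform convexity of \<open>|x|\<^sup>p\<close>, by the same homogeneity argument.\<close>

lemma norm_diff_powr_le_gap:
 assumes "p > 1" "\<delta> > 0"
 obtains C where "C \<ge> 0" "\<And>x y::'a::euclidean_space.
  norm (x - y) powr p \<le> \<delta> * (norm x powr p + norm y powr p) +
   C * (norm x powr p + norm y powr p - 2 * norm ((1/2) *\<^sub>R (x + y)) powr p)"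
proof (rule homogeneous_bound2[where p = p and \<delta> = \<delta> and
   \<Phi> = "\<lambda>x y::'a. norm (x - y) powr p" and
   \<Psi> = "\<lambda>x y. norm x powr p + norm y powr p - 2 * norm ((1/2) *\<^sub>R (x + y)) powr p"])
 show "norm (c *\<^sub>R x - c *\<^sub>R y) powr p = c powr p * norm (x - y) powr p" if "c > 0" for c and x y :: 'a
  using scaleR_powr_p[OF that, of "x - y" p] by (simp add: scaleR_diff_right)
 show "norm (c *\<^sub>R x) powr p + norm (c *\<^sub>R y) powr p - 2 * norm ((1/2) *\<^sub>R (c *\<^sub>R x + c *\<^sub>R y)) powr p =
   c powr p * (norm x powr p + norm y powr p - 2 * norm ((1/2) *\<^sub>R (x + y)) powr p)"
  if "c > 0" for c and x y :: 'a
 proof -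
  have "(1/2) *\<^sub>R (c *\<^sub>R x + c *\<^sub>R y) = c *\<^sub>R ((1/2) *\<^sub>R (x + y))" by (simp add: scaleR_add_right)
  then show ?thesis unfolding scaleR_powr_p[OF that] by (simp only: scaleR_powr_p[OF that]) (simp add: algebra_simps)
 qed
 show "norm x powr p + norm y powr p - 2 * norm ((1/2) *\<^sub>R (x + y)) powr p = 0 \<Longrightarrow>
   norm (x - y) powr p \<le> 0" for x y :: 'a using midpoint_gap(2)[OF assms(1), of x y] by auto
 show "norm x powr p + norm y powr p - 2 * norm ((1/2) *\<^sub>R (x + y)) powr p \<ge> 0" for x y :: 'a
  by (rule midpoint_gap(1)[OF assms(1)])
 show "continuous_on UNIV (\<lambda>(x::'a, y). norm x powr p + norm y powr p - 2 * norm ((1/2) *\<^sub>R (x + y)) powr p)"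
  using assms unfolding split_beta by (intro continuous_intros) auto
qed (use assms in \<open>auto simp: split_beta intro!: continuous_intros\<close>)

lemma abs_norm_powr_diff_le:
 assumes "p > 1" "\<delta> > 0"
 obtains C where "C \<ge> 0" "\<And>x y::'a::euclidean_space.
  \<bar>norm x powr p - norm y powr p\<bar> \<le> \<delta> * (norm x powr p + norm y powr p) + C * norm (x - y) powr p"
proof (rule homogeneous_bound2[where p = p and \<delta> = \<delta> and
   \<Phi> = "\<lambda>x y::'a. \<bar>norm x powr p - norm y powr p\<bar>" and \<Psi> = "\<lambda>x y. norm (x - y) powr p"])
 show "norm (c *\<^sub>R x - c *\<^sub>R y) powr p = c powr p * norm (x - y) powr p" if "c > 0" for c and x y :: 'a
  using scaleR_powr_p[OF that, of "x - y" p] by (simp add: scaleR_diff_right)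
 show "\<bar>norm (c *\<^sub>R x) powr p - norm (c *\<^sub>R y) powr p\<bar> = c powr p * \<bar>norm x powr p - norm y powr p\<bar>"
  if "c > 0" for c and x y :: 'a unfolding scaleR_powr_p[OF that] by (simp add: abs_mult flip: right_diff_distrib)
qed (use assms in \<open>auto simp: split_beta intro!: continuous_intros\<close>)

lemma abs_flux_diff_inner_le:
 assumes "p > 1" "\<delta> > 0"
 obtains C where "C \<ge> 0" "\<And>x y z::'a::euclidean_space.
  \<bar>(flux p x - flux p y) \<bullet> z\<bar> \<le>
   \<delta> * (norm x powr p + norm y powr p + norm z powr p) + C * norm (x - y) powr p"
proof -
 define \<delta>' where "\<delta>' = \<delta> / (1 + 2 powr p)"
 have \<delta>': "\<delta>' > 0" "\<delta>' \<le> \<delta>" "\<delta>' * 2 powr p \<le> \<delta>" using assms(2)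
  by (auto simp: \<delta>'_def field_simps add_pos_pos intro!: divide_pos_pos)
 obtain C where C: "C \<ge> 0" "\<And>x (yz::'a\<times>'a).
  \<bar>(flux p x - flux p (fst yz)) \<bullet> snd yz\<bar> \<le> \<delta>' * (norm x powr p + norm yz powr p) +
   C * norm (x - fst yz) powr p"
 proof (rule homogeneous_bound2[where p = p and \<delta> = \<delta>' and
   \<Phi> = "\<lambda>x yz::'a\<times>'a. \<bar>(flux p x - flux p (fst yz)) \<bullet> snd yz\<bar>" and
   \<Psi> = "\<lambda>x yz. norm (x - fst yz) powr p"])
  show "norm (c *\<^sub>R x - fst (c *\<^sub>R y)) powr p = c powr p * norm (x - fst y) powr p"
   if "c > 0" for c x and y :: "'a\<times>'a" using scaleR_powr_p[OF that, of "x - fst y" p] by (simp add: scaleR_diff_right)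
  show "\<bar>(flux p (c *\<^sub>R x) - flux p (fst (c *\<^sub>R y))) \<bullet> snd (c *\<^sub>R y)\<bar> =
   c powr p * \<bar>(flux p x - flux p (fst y)) \<bullet> snd y\<bar>" if "c > 0" for c x and y :: "'a\<times>'a"
   using flux_diff_inner_scaleR[OF that, of p x "fst y" "snd y"] by (simp add: abs_mult)
 qed (use assms \<delta>' in \<open>auto simp: split_beta intro!: continuous_intros\<close>)
 show thesis
 proof (rule that[OF C(1)])
  fix x y z :: 'a
  have "\<bar>(flux p x - flux p y) \<bullet> z\<bar> \<le> \<delta>' * norm x powr p + \<delta>' * norm (y, z) powr p + C * norm (x - y) powr p"
   using C(2)[of x "(y, z)"] by (simp add: distrib_left)
  also have "\<delta>' * norm (y, z) powr p \<le> \<delta>' * (2 powr p * (norm y powr p + norm z powr p))"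
   using \<delta>' assms by (intro mult_left_mono norm_Pair_powr) auto
  also have "\<dots> = (\<delta>' * 2 powr p) * (norm y powr p + norm z powr p)" by simp
  also have "\<dots> \<le> \<delta> * (norm y powr p + norm z powr p)" using \<delta>' by (intro mult_right_mono) auto
  also have "\<delta>' * norm x powr p \<le> \<delta> * norm x powr p" using \<delta>' by (intro mult_right_mono) auto
  finally show "\<bar>(flux p x - flux p y) \<bullet> z\<bar> \<le>
   \<delta> * (norm x powr p + norm y powr p + norm z powr p) + C * norm (x - y) powr p" by (simp add: algebra_simps)
 qed
qed

section \<open>A smooth bump function\<close>

text \<open>All derivatives of \<open>expinv 0\<close> are combinations of the functions \<open>expinv j\<close>, which vanish to infinite
 order at \<open>0\<close>.\<close>

definition expinv :: "nat \<Rightarrow> real \<Rightarrow> real" where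
 "expinv j t = (if t > 0 then exp (- inverse t) * inverse t ^ j else 0)"

lemma expinv_tendsto_0: "(expinv j \<longlongrightarrow> 0) (at 0)"
proof -
 have "((\<lambda>t::real. inverse t ^ j / exp (inverse t)) \<longlongrightarrow> 0) (at_right 0)"
  by (rule filterlim_compose[OF tendsto_power_div_exp_0 filterlim_inverse_at_top_right])
 then have "(expinv j \<longlongrightarrow> 0) (at_right 0)" by (rule Lim_transform_eventually)
   (auto simp: eventually_at_right_field expinv_def exp_minus field_simps intro!: exI[of _ 1])
 moreover have "(expinv j \<longlongrightarrow> 0) (at_left 0)" by (rule Lim_transform_eventually[OF tendsto_const])
   (auto simp: eventually_at_left_field expinv_def intro!: exI[of _ "-1"])
 ultimately show ?thesis by (simp add: filterlim_split_at)
qed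

lemma has_derivative_expinv:
 "(expinv j has_real_derivative (expinv (j + 2) t - real j * expinv (j + 1) t)) (at t)"
proof -
 consider "t > 0" | "t < 0" | "t = 0" by linarith
 then show ?thesis
 proof cases
  case 1
  have "((\<lambda>t. exp (- inverse t) * inverse t ^ j) has_real_derivative
    (expinv (j + 2) t - real j * expinv (j + 1) t)) (at t)"
  proof -
   have "((\<lambda>t. inverse t ^ j) has_real_derivative - real j * inverse t ^ (j + 1)) (at t)"
   proof -
    have "(inverse has_real_derivative - (inverse t)\<^sup>2) (at t)" using 1 DERIV_inverse[of t] by (simp add: numeral_2_eq_2)
    from DERIV_power[OF this, of j] show ?thesis using 1 by (cases j) (auto simp: power2_eq_square algebra_simps)
   qed
   moreover have "((\<lambda>t. exp (- inverse t)) has_real_derivative exp (- inverse t) * (inverse t)\<^sup>2) (at t)"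
    using 1 by (auto intro!: derivative_eq_intros simp: power2_eq_square)
   ultimately have "((\<lambda>t. exp (- inverse t) * inverse t ^ j) has_real_derivative
     (exp (- inverse t) * (inverse t)\<^sup>2) * inverse t ^ j + (- real j * inverse t ^ (j + 1)) * exp (- inverse t)) (at t)"
    by (rule DERIV_mult[rotated])
   then show ?thesis using 1 by (simp add: expinv_def power2_eq_square algebra_simps)
  qed
  then show ?thesis by (rule has_field_derivative_transform_within_open[of _ _ _ "{0<..}"]) (use 1 in \<open>auto simp: expinv_def\<close>)
 next
  case 2
  have "((\<lambda>t. 0) has_real_derivative 0) (at t)" by simp
  then have "(expinv j has_real_derivative 0) (at t)" by (rule has_field_derivative_transform_within_open[of _ _ _ "{..<0}"])
    (use 2 in \<open>auto simp: expinv_def\<close>)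
  then show ?thesis using 2 by (simp add: expinv_def)
 next
  case 3
  have "((\<lambda>h. (expinv j (0 + h) - expinv j 0) / h) \<longlongrightarrow> 0) (at 0)"
   by (rule Lim_transform_eventually[OF expinv_tendsto_0[of "Suc j"]])
    (auto simp: expinv_def divide_inverse intro!: always_eventually)
  then have "(expinv j has_real_derivative 0) (at 0)" by (simp add: DERIV_def)
  then show ?thesis using 3 by (simp add: expinv_def)
 qed
qed

lemma expinv_chain:
 assumes "(f has_derivative f') (at x)"
 shows "((\<lambda>y. expinv j (f y)) has_derivative
  (\<lambda>h. (expinv (j + 2) (f x) - real j * expinv (j + 1) (f x)) * f' h)) (at x)"
 using has_derivative_compose[OF assms, of "expinv j" "(*) (expinv (j + 2) (f x) - real j * expinv (j + 1) (f x))"]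
  has_derivative_expinv[of j "f x"] by (simp add: has_field_derivative_def)

text \<open>A class of functions that contains the bump and is closed under directional derivatives; smoothness
 follows from this closure alone.\<close>

inductive bumplike :: "'a::euclidean_space \<Rightarrow> real \<Rightarrow> ('a \<Rightarrow> real) \<Rightarrow> bool" for c r where
 const: "bumplike c r (\<lambda>_. k)"
| coord: "bumplike c r (\<lambda>y. (y - c) \<bullet> b)"
| expinv: "bumplike c r (\<lambda>y. expinv j (r - (y - c) \<bullet> (y - c)))"
| add: "bumplike c r f \<Longrightarrow> bumplike c r g \<Longrightarrow> bumplike c r (\<lambda>y. f y + g y)"
| mult: "bumplike c r f \<Longrightarrow> bumplike c r g \<Longrightarrow> bumplike c r (\<lambda>y. f y * g y)"

lemma bumplike_derivative:
 assumes "bumplike c r f"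
 shows "\<exists>f'. (\<forall>y. (f has_derivative f' y) (at y)) \<and> (\<forall>b. bumplike c r (\<lambda>y. f' y b))" using assms
proof induction
 case (const k)
 then show ?case by (intro exI[of _ "\<lambda>_ _. 0"]) (auto intro: bumplike.intros)
next
 case (coord b)
 then show ?case by (intro exI[of _ "\<lambda>y h. h \<bullet> b"]) (auto intro!: bumplike.intros derivative_eq_intros)
next
 case (expinv j)
 let ?s = "\<lambda>y. r - (y - c) \<bullet> (y - c)"
 let ?f' = "\<lambda>y h. (expinv (j + 2) (?s y) + (- real j) * expinv (j + 1) (?s y)) * ((-2) * ((y - c) \<bullet> h))"
 have 1: "((\<lambda>y. expinv j (?s y)) has_derivative ?f' y) (at y)" for y
 proof -
  have "(?s has_derivative (\<lambda>h. (-2) * ((y - c) \<bullet> h))) (at y)" by (auto intro!: derivative_eq_intros simp: inner_commute)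
  from expinv_chain[OF this, of j] show ?thesis by simp
 qed
 have 2: "bumplike c r (\<lambda>y. ?f' y h)" for h
 proof -
  have "bumplike c r (\<lambda>y. (-2) * ((y - c) \<bullet> h))" by (rule bumplike.mult[OF bumplike.const bumplike.coord])
  moreover have "bumplike c r (\<lambda>y. expinv (j + 2) (?s y) + (- real j) * expinv (j + 1) (?s y))"
   by (rule bumplike.add[OF bumplike.expinv bumplike.mult[OF bumplike.const bumplike.expinv]])
  ultimately show ?thesis by (rule bumplike.mult[rotated])
 qed
 show ?case by (rule exI[of _ ?f']) (use 1 2 in simp)
next
 case (add f g)
 from add.IH(1) obtain f' where f': "\<And>y. (f has_derivative f' y) (at y)" "\<And>b. bumplike c r (\<lambda>y. f' y b)" by blast
 from add.IH(2) obtain g' where g': "\<And>y. (g has_derivative g' y) (at y)" "\<And>b. bumplike c r (\<lambda>y. g' y b)" by blast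
 show ?case
  by (rule exI[of _ "\<lambda>y h. f' y h + g' y h"]) (use has_derivative_add[OF f'(1) g'(1)] bumplike.add[OF f'(2) g'(2)] in simp)
next
 case (mult f g)
 from mult.IH(1) obtain f' where f': "\<And>y. (f has_derivative f' y) (at y)" "\<And>b. bumplike c r (\<lambda>y. f' y b)" by blast
 from mult.IH(2) obtain g' where g': "\<And>y. (g has_derivative g' y) (at y)" "\<And>b. bumplike c r (\<lambda>y. g' y b)" by blast
 show ?case
  by (rule exI[of _ "\<lambda>y h. f y * g' y h + f' y h * g y"]) (use has_derivative_mult[OF f'(1) g'(1)] bumplike.add[OF bumplike.mult[OF mult.hyps(1) g'(2)] bumplike.mult[OF f'(2) mult.hyps(2)]] in simp)
qed

lemma bumplike_Ck: "bumplike c r f \<Longrightarrow> Ck k f"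
proof (induction k arbitrary: f)
 case 0
 from bumplike_derivative[OF 0] show ?case by (auto simp: continuous_on_eq_continuous_at intro: has_derivative_continuous)
next
 case (Suc k)
 from bumplike_derivative[OF Suc.prems] obtain f' where
  f': "\<And>y. (f has_derivative f' y) (at y)" "\<And>b. bumplike c r (\<lambda>y. f' y b)" by blast
 have "frechet_derivative f (at y) = f' y" for y using f'(1) by (simp add: frechet_derivative_at[symmetric])
 then show ?case using f' Suc.IH by (auto simp: differentiable_def)
qed

subsection \<open>The standard mollifier\<close>

definition bump_mass :: "'a::euclidean_space itself \<Rightarrow> real \<Rightarrow> real" where
 "bump_mass _ eps = (LINT z|lborel. expinv 0 (eps\<^sup>2 - (z::'a) \<bullet> z))"

definition bump :: "real \<Rightarrow> 'a::euclidean_space \<Rightarrow> real" where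
 "bump eps z = inverse (bump_mass TYPE('a) eps) * expinv 0 (eps\<^sup>2 - z \<bullet> z)"

lemma expinv_0_nonneg: "expinv 0 t \<ge> 0" and expinv_0_le_1: "expinv 0 t \<le> 1"
 by (auto simp: expinv_def)

lemma continuous_expinv: "continuous_on S (expinv j)"
 using DERIV_continuous[OF has_derivative_expinv] continuous_at_imp_continuous_on by blast

lemma measurable_expinv [measurable]: "expinv j \<in> borel_measurable borel"
 by (intro borel_measurable_continuous_onI continuous_expinv)

lemma integrable_compact_support:
 fixes f :: "'a::euclidean_space \<Rightarrow> 'b::{banach, second_countable_topology}"
 assumes "f \<in> borel_measurable borel" "\<And>x. norm (f x) \<le> B" "\<And>x. norm x > R \<Longrightarrow> f x = 0"
 shows "integrable lborel f"
proof (rule Bochner_Integration.integrable_bound[where f = "\<lambda>x. indicator (cball 0 R) x * B"])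
 show "integrable lborel (\<lambda>x::'a. indicator (cball 0 R) x * B)"
  by (intro integrable_mult_left integrable_real_indicator) (use emeasure_lborel_cball_finite[of 0 R] in auto)
 show "AE x in lborel. norm (f x) \<le> norm (indicator (cball 0 R) x * B)"
 proof (rule AE_I2)
  fix x show "norm (f x) \<le> norm (indicator (cball 0 R) x * B)" using assms(2)[of x] assms(3)[of x] by (cases "norm x \<le> R") auto
 qed
qed (use assms in simp)

lemma integrable_expinv: "integrable lborel (\<lambda>z::'a::euclidean_space. expinv 0 (eps\<^sup>2 - z \<bullet> z))"
proof (rule integrable_compact_support[where B = 1 and R = "\<bar>eps\<bar>"])
 show "norm x > \<bar>eps\<bar> \<Longrightarrow> expinv 0 (eps\<^sup>2 - x \<bullet> x) = 0" for x :: 'a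
  using power_strict_mono[of "\<bar>eps\<bar>" "norm x" 2] by (simp add: expinv_def dot_square_norm)
qed (auto simp: expinv_0_nonneg expinv_0_le_1)

lemma bump_mass_pos:
 assumes "eps > 0"
 shows "bump_mass TYPE('a::euclidean_space) eps > 0"
proof (rule ccontr)
 assume "\<not> ?thesis"
 moreover have "bump_mass TYPE('a) eps \<ge> 0" unfolding bump_mass_def by (intro integral_nonneg_AE) (simp add: expinv_0_nonneg)
 ultimately have "(LINT z|lborel. expinv 0 (eps\<^sup>2 - (z::'a) \<bullet> z)) = 0" by (simp add: bump_mass_def)
 then have "AE z::'a in lborel. expinv 0 (eps\<^sup>2 - z \<bullet> z) = 0"
  by (subst (asm) integral_nonneg_eq_0_iff_AE) (auto simp: expinv_0_nonneg integrable_expinv)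
 then have "AE z::'a in lborel. z \<notin> ball 0 eps"
 proof eventually_elim
  fix z :: 'a
  assume "expinv 0 (eps\<^sup>2 - z \<bullet> z) = 0"
  then have "eps\<^sup>2 \<le> (norm z)\<^sup>2" by (simp add: expinv_def dot_square_norm split: if_splits)
  then have "eps \<le> norm z" by (rule power2_le_imp_le) simp
  then show "z \<notin> ball 0 eps" by simp
 qed
 then have "emeasure lborel (ball (0::'a) eps) = 0"
 proof -
  assume "AE z::'a in lborel. z \<notin> ball 0 eps"
  then have "emeasure lborel {z \<in> space lborel. z \<in> ball (0::'a) eps} = 0" by (rule emeasure_eq_0_AE)
  moreover have "{z \<in> space lborel. z \<in> ball (0::'a) eps} = ball 0 eps" by auto
  ultimately show ?thesis by simp
 qed
 then show False using content_ball_pos[OF assms, of "0::'a"] by (simp add: measure_def)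
qed

lemma bump_nonneg: "eps > 0 \<Longrightarrow> bump eps z \<ge> 0"
 unfolding bump_def using bump_mass_pos[of eps, where ?'a = 'a] by (simp add: expinv_0_nonneg)

lemma bump_eq_0:
 assumes "eps > 0" "norm z \<ge> eps"
 shows "bump eps z = 0"
proof -
 have "eps\<^sup>2 \<le> (norm z)\<^sup>2" using assms by (intro power_mono) auto
 then have "\<not> 0 < eps\<^sup>2 - z \<bullet> z" by (simp add: dot_square_norm)
 then show ?thesis by (simp only: bump_def expinv_def if_False mult_zero_right)
qed

lemma bump_le: "eps > 0 \<Longrightarrow> bump eps (z::'a) \<le> inverse (bump_mass TYPE('a::euclidean_space) eps)"
 unfolding bump_def using bump_mass_pos[of eps, where ?'a = 'a] expinv_0_le_1 by (simp add: mult_left_le)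

lemma measurable_bump [measurable]: "bump eps \<in> borel_measurable borel"
 unfolding bump_def by measurable

lemma integrable_bump: "integrable lborel (bump eps)"
 unfolding bump_def[abs_def] by (intro integrable_mult_right integrable_expinv)

lemma integral_bump:
 assumes "eps > 0"
 shows "(LINT z|lborel. bump eps (z::'a::euclidean_space)) = 1"
proof -
 have "(LINT z|lborel. bump eps (z::'a)) = inverse (bump_mass TYPE('a) eps) * bump_mass TYPE('a) eps"
  unfolding bump_def bump_mass_def by (rule integral_mult_right_zero)
 then show ?thesis using bump_mass_pos[OF assms, where ?'a = 'a] by simp
qed

lemma nn_integral_bump: "eps > 0 \<Longrightarrow> (\<integral>\<^sup>+z. ennreal (bump eps (z::'a::euclidean_space)) \<partial>lborel) = 1"
 by (subst nn_integral_eq_integral[OF integrable_bump]) (auto simp: integral_bump bump_nonneg)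

lemma test_function_bump:
 fixes x :: "'a::euclidean_space"
 assumes "eps > 0"
 shows "test_function (\<lambda>y. bump eps (y - x))"
proof -
 have "bumplike x (eps\<^sup>2) (\<lambda>y. bump eps (y - x))" unfolding bump_def by (intro bumplike.intros)
 moreover have "closure {y. bump eps (y - x) \<noteq> 0} \<subseteq> cball x eps"
  by (intro closure_minimal) (use bump_eq_0[OF assms] in \<open>force simp: dist_norm norm_minus_commute\<close>, simp)
 then have "compact (closure {y. bump eps (y - x) \<noteq> 0})"
  by (meson bounded_cball bounded_subset closed_closure compact_eq_bounded_closed)
 ultimately show ?thesis by (auto simp: test_function_def intro: bumplike_Ck)
qed

subsection \<open>Continuously differentiable functions\<close>

section \<open>Continuously differentiable functions\<close>

definition C1_grad :: "('a::euclidean_space \<Rightarrow> real) \<Rightarrow> ('a \<Rightarrow> 'a) \<Rightarrow> bool" where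
 "C1_grad f D \<longleftrightarrow> (\<forall>x. (f has_derivative (\<lambda>h. D x \<bullet> h)) (at x)) \<and> continuous_on UNIV D"

lemma C1_gradD: "C1_grad f D \<Longrightarrow> (f has_derivative (\<lambda>h. D x \<bullet> h)) (at x)"
 and C1_grad_continuous: "C1_grad f D \<Longrightarrow> continuous_on UNIV f"
 and C1_grad_continuous_grad: "C1_grad f D \<Longrightarrow> continuous_on UNIV D"
 by (auto simp: C1_grad_def continuous_on_eq_continuous_at intro: has_derivative_continuous)

lemma C1_grad_frechet: "C1_grad f D \<Longrightarrow> frechet_derivative f (at x) b = D x \<bullet> b"
 using frechet_derivative_at[OF C1_gradD] by metis

lemma C1_grad_mult:
 assumes "C1_grad f D" "C1_grad g E"
 shows "C1_grad (\<lambda>x. f x * g x) (\<lambda>x. f x *\<^sub>R E x + g x *\<^sub>R D x)" unfolding C1_grad_def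
proof safe
 show "((\<lambda>x. f x * g x) has_derivative (\<bullet>) (f x *\<^sub>R E x + g x *\<^sub>R D x)) (at x)" for x
  using C1_gradD[OF assms(1), of x] C1_gradD[OF assms(2), of x]
  by (auto intro!: derivative_eq_intros simp: inner_add_left algebra_simps)
 show "continuous_on UNIV (\<lambda>x. f x *\<^sub>R E x + g x *\<^sub>R D x)"
  using assms by (intro continuous_intros) (auto dest: C1_grad_continuous C1_grad_continuous_grad)
qed

lemma C1_grad_eq_0:
 assumes "C1_grad f D" "closed K" "\<And>x. x \<notin> K \<Longrightarrow> f x = 0" "x \<notin> K"
 shows "D x = 0"
proof -
 have "((\<lambda>_. 0) has_derivative (\<lambda>_. 0)) (at x)" by simp
 then have "(f has_derivative (\<lambda>_. 0)) (at x)"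
  by (rule has_derivative_transform_within_open[of _ _ _ _ "- K"]) (use assms in auto)
 then have "(\<lambda>h. D x \<bullet> h) = (\<lambda>_. 0)" using has_derivative_unique C1_gradD[OF assms(1)] by blast
 then show ?thesis by (metis inner_eq_zero_iff)
qed

text \<open>Compact support makes the function and its gradient vanish outside a common ball.\<close>

lemma test_function_C1:
 assumes "test_function \<phi>"
 obtains D R where "C1_grad \<phi> D" "\<And>x. norm x > R \<Longrightarrow> \<phi> x = 0" "\<And>x. norm x > R \<Longrightarrow> D x = 0" "R > 0"
proof -
 have Ck: "Ck (Suc 0) \<phi>" using assms by (simp add: test_function_def del: Ck.simps)
 define D where "D x = (\<Sum>b\<in>Basis. frechet_derivative \<phi> (at x) b *\<^sub>R b)" for x
 have "C1_grad \<phi> D" unfolding C1_grad_def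
 proof safe
  fix x
  have "(\<phi> has_derivative frechet_derivative \<phi> (at x)) (at x)" using Ck by (simp add: frechet_derivative_works)
  moreover from this have "frechet_derivative \<phi> (at x) h = D x \<bullet> h" for h
  proof -
   interpret linear "frechet_derivative \<phi> (at x)"
    using has_derivative_linear[OF \<open>(\<phi> has_derivative frechet_derivative \<phi> (at x)) (at x)\<close>] .
   have "frechet_derivative \<phi> (at x) h = frechet_derivative \<phi> (at x) (\<Sum>b\<in>Basis. (h \<bullet> b) *\<^sub>R b)"
    by (simp add: euclidean_representation)
   also have "\<dots> = (\<Sum>b\<in>Basis. (h \<bullet> b) * frechet_derivative \<phi> (at x) b)" by (simp add: sum scale)
   also have "\<dots> = D x \<bullet> h" unfolding D_def inner_sum_left by (intro sum.cong) (auto simp: inner_commute)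
   finally show ?thesis .
  qed
  then have "frechet_derivative \<phi> (at x) = (\<lambda>h. D x \<bullet> h)" by blast
  ultimately show "(\<phi> has_derivative (\<bullet>) (D x)) (at x)" by simp
 next
  show "continuous_on UNIV D" unfolding D_def using Ck by (intro continuous_intros) auto
 qed
 moreover have "bounded (closure {x. \<phi> x \<noteq> 0})" using assms compact_imp_bounded unfolding test_function_def by blast
 then obtain R where R: "\<And>x. x \<in> closure {x. \<phi> x \<noteq> 0} \<Longrightarrow> norm x \<le> R" unfolding bounded_iff by blast
 have z: "\<phi> x = 0" if "x \<notin> cball 0 (max 1 R)" for x using that R[of x] closure_subset[of "{x. \<phi> x \<noteq> 0}"] by force
 moreover have "D x = 0" if "x \<notin> cball 0 (max 1 R)" for x using C1_grad_eq_0[OF \<open>C1_grad \<phi> D\<close> _ z that] by blast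
 ultimately show thesis using that[of D "max 1 R"] by (metis less_max_iff_disj linorder_not_le mem_cball_0 zero_less_one)
qed

lemma continuous_compact_support_bounded:
 fixes f :: "'a::euclidean_space \<Rightarrow> 'b::real_normed_vector"
 assumes "continuous_on UNIV f" "\<And>x. norm x > R \<Longrightarrow> f x = 0"
 obtains B where "B > 0" "\<And>x. norm (f x) \<le> B"
proof -
 have "compact (f ` cball 0 R)" using assms(1) by (intro compact_continuous_image) (auto intro: continuous_on_subset)
 then obtain B where B: "B > 0" "\<And>y. y \<in> f ` cball 0 R \<Longrightarrow> norm y \<le> B" by (meson bounded_pos compact_imp_bounded)
 have "norm (f x) \<le> B" for x using B assms(2)[of x] by (cases "norm x \<le> R") auto
 then show thesis using that B by blast
qed

lemma continuous_compact_support_uniformly_continuous: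
 fixes f :: "'a::euclidean_space \<Rightarrow> 'b::real_normed_vector"
 assumes "continuous_on UNIV f" "\<And>x. norm x > R \<Longrightarrow> f x = 0"
 shows "uniformly_continuous_on UNIV f"
proof -
 have "uniformly_continuous_on (cball 0 (R + 1)) f"
  using assms(1) by (intro compact_uniformly_continuous) (auto intro: continuous_on_subset)
 show ?thesis unfolding uniformly_continuous_on_def
 proof safe
  fix e :: real assume "e > 0"
  then obtain d where d: "d > 0" "\<And>x y. x \<in> cball 0 (R + 1) \<Longrightarrow> y \<in> cball 0 (R + 1) \<Longrightarrow>
   dist y x < d \<Longrightarrow> dist (f y) (f x) < e"
   using \<open>uniformly_continuous_on (cball 0 (R + 1)) f\<close> unfolding uniformly_continuous_on_def by metis
  show "\<exists>d>0. \<forall>x\<in>UNIV. \<forall>x'\<in>UNIV. dist x' x < d \<longrightarrow> dist (f x') (f x) < e"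
  proof (intro exI[of _ "min d 1"] conjI ballI impI)
   fix x y :: 'a assume xy: "dist y x < min d 1"
   have "norm y \<le> norm x + dist y x" "norm x \<le> norm y + dist y x"
    using norm_triangle_sub[of y x] norm_triangle_sub[of x y] by (simp_all add: dist_norm norm_minus_commute)
   then have "(norm x \<le> R + 1 \<and> norm y \<le> R + 1) \<or> (norm x > R \<and> norm y > R)" using xy by auto
   then show "dist (f y) (f x) < e" using d(2)[of x y] xy assms(2) \<open>e > 0\<close> by auto
  qed (use d in auto)
 qed
qed

lemma C1_grad_Lipschitz:
 assumes "C1_grad f D" "\<And>x. norm (D x) \<le> B"
 shows "\<bar>f x - f y\<bar> \<le> B * norm (x - y)"
proof -
 have "norm (f x - f y) \<le> B * norm (x - y)"
 proof (rule differentiable_bound[of UNIV f "\<lambda>x h. D x \<bullet> h"])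
  show "onorm ((\<bullet>) (D x)) \<le> B" for x
  proof (rule onorm_le)
   fix z show "norm (D x \<bullet> z) \<le> B * norm z"
    using Cauchy_Schwarz_ineq2[of "D x" z] mult_right_mono[OF assms(2)[of x] norm_ge_zero[of z]] by simp
  qed
 qed (use C1_gradD[OF assms(1)] in auto)
 then show ?thesis by simp
qed

lemma C1_grad_linearization:
 assumes "C1_grad f D" "uniformly_continuous_on UNIV D" "e > 0"
 obtains d where "d > 0" "\<And>x h. norm h < d \<Longrightarrow> \<bar>f (x + h) - f x - D x \<bullet> h\<bar> \<le> e * norm h"
proof -
 obtain d where d: "d > 0" "\<And>x y. dist y x < d \<Longrightarrow> dist (D y) (D x) < e"
  using assms(2,3) unfolding uniformly_continuous_on_def by (metis UNIV_I)
 show thesis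
 proof (rule that[OF d(1)])
  fix x h :: 'a assume h: "norm h < d"
  have "norm (f (x + h) - f x - (\<lambda>h. D x \<bullet> h) (x + h - x)) \<le> norm (x + h - x) * e"
  proof (rule differentiable_bound_linearization[where S = "ball x d" and f' = "\<lambda>x h. D x \<bullet> h"])
   fix t assume t: "t \<in> {0..1::real}"
   have "norm (t *\<^sub>R h) < d" using t h by (auto intro: le_less_trans[OF mult_left_le_one_le])
   then show "x + t *\<^sub>R (x + h - x) \<in> ball x d" by (simp add: dist_norm)
  next
   fix y assume "y \<in> ball x d"
   then have *: "norm (D y - D x) \<le> e" using d(2)[of y x] by (simp add: dist_norm norm_minus_commute)
   show "onorm ((\<lambda>h. D y \<bullet> h) - (\<lambda>h. D x \<bullet> h)) \<le> e"
   proof (rule onorm_le)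
    fix z
    show "norm (((\<lambda>h. D y \<bullet> h) - (\<lambda>h. D x \<bullet> h)) z) \<le> e * norm z"
     using Cauchy_Schwarz_ineq2[of "D y - D x" z] mult_right_mono[OF * norm_ge_zero[of z]] by (simp add: inner_diff_left)
   qed
  qed (use C1_gradD[OF assms(1)] d(1) in \<open>auto intro: has_derivative_at_withinI\<close>)
  then show "\<bar>f (x + h) - f x - D x \<bullet> h\<bar> \<le> e * norm h" by (simp add: mult.commute)
 qed
qed

section \<open>Continuity of translations in the mean\<close>

lemma real_tendsto_0_I:
 fixes a :: "'i \<Rightarrow> real"
 assumes "\<And>n. 0 \<le> a n" "\<And>e. e > 0 \<Longrightarrow> eventually (\<lambda>n. a n \<le> e) F"
 shows "(a \<longlongrightarrow> 0) F"
proof (rule tendstoI)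
 fix e :: real assume "e > 0"
 then have "eventually (\<lambda>n. a n \<le> e / 2) F" using assms(2)[of "e / 2"] by simp
 then show "eventually (\<lambda>n. dist (a n) 0 < e) F" by eventually_elim (use assms(1) \<open>e > 0\<close> in \<open>simp add: dist_real_def\<close>)
qed

lemma nn_integral_translate:
 fixes f :: "'a::euclidean_space \<Rightarrow> ennreal"
 assumes [measurable]: "f \<in> borel_measurable borel"
 shows "(\<integral>\<^sup>+x. f (x + h) \<partial>lborel) = (\<integral>\<^sup>+x. f x \<partial>lborel)"
proof -
 have "(\<integral>\<^sup>+x. f x \<partial>lborel) = (\<integral>\<^sup>+x. f x \<partial>distr lborel borel ((+) h))" by (simp add: lborel_distr_plus)
 also have "\<dots> = (\<integral>\<^sup>+x. f (h + x) \<partial>lborel)" by (rule nn_integral_distr) auto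
 finally show ?thesis by (simp add: add.commute)
qed

lemma integral_translate:
 fixes f :: "'a::euclidean_space \<Rightarrow> 'b::{banach, second_countable_topology}"
 assumes [measurable]: "f \<in> borel_measurable borel"
 shows "(LINT x|lborel. f (x + h)) = (LINT x|lborel. f x)"
  and "integrable lborel (\<lambda>x. f (x + h)) \<longleftrightarrow> integrable lborel f"
proof -
 have "(LINT x|lborel. f x) = (LINT x|distr lborel borel ((+) h). f x)" by (simp add: lborel_distr_plus)
 also have "\<dots> = (LINT x|lborel. f (h + x))" by (rule integral_distr) auto
 finally show "(LINT x|lborel. f (x + h)) = (LINT x|lborel. f x)" by (simp add: add.commute)
 have "integrable lborel f \<longleftrightarrow> integrable (distr lborel borel ((+) h)) f" by (simp add: lborel_distr_plus)
 also have "\<dots> \<longleftrightarrow> integrable lborel (\<lambda>x. f (h + x))" by (rule integrable_distr_eq) auto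
 finally show "integrable lborel (\<lambda>x. f (x + h)) \<longleftrightarrow> integrable lborel f" by (simp add: add.commute)
qed

text \<open>For open \<open>U\<close> the indicator of \<open>U\<close> at \<open>x + h\<close> is eventually \<open>1\<close> for every \<open>x \<in> U\<close>; the mass that moves
 out of \<open>U\<close> equals the mass that moves in.\<close>

lemma L1_translation_indicator_open:
 fixes U :: "'a::euclidean_space set"
 assumes "open U" "emeasure lborel U < \<infinity>" "h \<longlonglongrightarrow> 0"
 shows "(\<lambda>n. LINT x|lborel. \<bar>indicator U (x + h n) - indicator U x :: real\<bar>) \<longlonglongrightarrow> 0"
proof -
 have [measurable]: "U \<in> sets borel" using assms by simp
 have int: "integrable lborel (indicator U :: 'a \<Rightarrow> real)" using assms by simp
 have int': "integrable lborel (\<lambda>x. indicator U (x + h n) :: real)" for n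
  using int integral_translate(2)[of "indicator U :: 'a \<Rightarrow> real" "h n"] by simp
 have int2: "integrable lborel (\<lambda>x. indicator U x * indicator U (x + h n) :: real)" for n
  by (rule Bochner_Integration.integrable_bound[OF int]) (auto simp: indicator_def)
 have "(\<lambda>n. LINT x|lborel. indicator U x * indicator U (x + h n) :: real) \<longlonglongrightarrow> (LINT x|lborel. indicator U x)"
 proof (rule integral_dominated_convergence[where w = "indicator U"])
  show "AE x in lborel. (\<lambda>n. indicator U x * indicator U (x + h n) :: real) \<longlonglongrightarrow> indicator U x"
  proof (rule AE_I2)
   fix x :: 'a
   show "(\<lambda>n. indicator U x * indicator U (x + h n) :: real) \<longlonglongrightarrow> indicator U x"
   proof (cases "x \<in> U")
    case True
    have "(\<lambda>n. x + h n) \<longlonglongrightarrow> x + 0" by (intro tendsto_intros assms)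
    then have "eventually (\<lambda>n. x + h n \<in> U) sequentially" using topological_tendstoD[of _ x] assms(1) True by simp
    then have "eventually (\<lambda>n. indicator U x * indicator U (x + h n) = (indicator U x :: real)) sequentially"
     by eventually_elim (use True in simp)
    then show ?thesis by (rule tendsto_eventually)
   qed simp
  qed
 qed (use int in \<open>auto simp: indicator_def\<close>)
 then have "(\<lambda>n. 2 * (LINT x|lborel. indicator U x) - 2 * (LINT x|lborel. indicator U x * indicator U (x + h n) :: real))
  \<longlonglongrightarrow> 2 * (LINT x|lborel. indicator U x) - 2 * (LINT x|lborel. indicator U x)" by (intro tendsto_intros)
 moreover have "(LINT x|lborel. \<bar>indicator U (x + h n) - indicator U x :: real\<bar>) =
  2 * (LINT x|lborel. indicator U x) - 2 * (LINT x|lborel. indicator U x * indicator U (x + h n) :: real)" for n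
 proof -
  have "(LINT x|lborel. \<bar>indicator U (x + h n) - indicator U x :: real\<bar>) =
   (LINT x|lborel. indicator U (x + h n) + indicator U x - 2 * (indicator U x * indicator U (x + h n)))"
   by (intro Bochner_Integration.integral_cong) (auto simp: indicator_def)
  also have "\<dots> = (LINT x|lborel. indicator U (x + h n)) + (LINT x|lborel. indicator U x)
    - 2 * (LINT x|lborel. indicator U x * indicator U (x + h n))" using int int' int2 by simp
  also have "(LINT x|lborel. indicator U (x + h n) :: real) = (LINT x|lborel. indicator U x)" by (rule integral_translate(1)) simp
  finally show ?thesis by simp
 qed
 ultimately show ?thesis by simp
qed

text \<open>Translations preserve the integral, so the property is stable under approximation in the mean.\<close>

lemma L1_translation_approx:
 fixes f :: "'a::euclidean_space \<Rightarrow> 'b::{banach, second_countable_topology}"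
 assumes f: "integrable lborel f"
  and approx: "\<And>e. e > 0 \<Longrightarrow> \<exists>g. integrable lborel g \<and> (LINT x|lborel. norm (g x - f x)) < e \<and>
   (\<lambda>n. LINT x|lborel. norm (g (x + h n) - g x)) \<longlonglongrightarrow> 0"
 shows "(\<lambda>n. LINT x|lborel. norm (f (x + h n) - f x)) \<longlonglongrightarrow> 0"
proof (rule real_tendsto_0_I)
 fix e :: real assume e: "e > 0"
 obtain g where g: "integrable lborel g" "(LINT x|lborel. norm (g x - f x)) < e / 3"
  "(\<lambda>n. LINT x|lborel. norm (g (x + h n) - g x)) \<longlonglongrightarrow> 0" using approx[of "e / 3"] e by auto
 note [measurable] = borel_measurable_integrable[OF f] borel_measurable_integrable[OF g(1)]
 have i: "integrable lborel (\<lambda>x. f (x + k))" "integrable lborel (\<lambda>x. g (x + k))" for k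
  using f g(1) integral_translate(2)[of f k] integral_translate(2)[of g k] by auto
 have "eventually (\<lambda>n. (LINT x|lborel. norm (g (x + h n) - g x)) < e / 3) sequentially"
  using order_tendstoD(2)[OF g(3), of "e / 3"] e by simp
 then show "eventually (\<lambda>n. (LINT x|lborel. norm (f (x + h n) - f x)) \<le> e) sequentially"
 proof eventually_elim
  case (elim n)
  have "(LINT x|lborel. norm (f (x + h n) - f x)) \<le>
   (LINT x|lborel. norm (g (x + h n) - f (x + h n)) + norm (g (x + h n) - g x) + norm (g x - f x))"
  proof (rule integral_mono)
   show "norm (f (x + h n) - f x) \<le> norm (g (x + h n) - f (x + h n)) + norm (g (x + h n) - g x) + norm (g x - f x)" for x
    using norm_triangle_le[OF add_mono[OF norm_triangle_ineq4[of "g (x + h n) - g x" "g (x + h n) - f (x + h n)"] order_refl[of "norm (g x - f x)"]]]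
    by simp
  qed (use i f g(1) in auto)
  also have "\<dots> = (LINT x|lborel. norm (g (x + h n) - f (x + h n))) +
    (LINT x|lborel. norm (g (x + h n) - g x)) + (LINT x|lborel. norm (g x - f x))"
   using i f g(1) by (simp add: Bochner_Integration.integral_add)
  also have "(LINT x|lborel. norm (g (x + h n) - f (x + h n))) = (LINT x|lborel. norm (g x - f x))"
   by (rule integral_translate(1)) measurable
  finally show ?case using elim g(2) by linarith
 qed
qed simp

text \<open>Outer regularity reduces indicators of measurable sets to open sets.\<close>

lemma L1_translation_seq:
 fixes f :: "'a::euclidean_space \<Rightarrow> 'b::{banach, second_countable_topology}"
 assumes "integrable lborel f" and h: "h \<longlonglongrightarrow> 0"
 shows "(\<lambda>n. LINT x|lborel. norm (f (x + h n) - f x)) \<longlonglongrightarrow> 0" using assms(1)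
proof (induction f rule: integrable_induct)
 case (base A c)
 have [measurable]: "A \<in> sets borel" using base by simp
 show ?case
 proof (rule L1_translation_approx)
  show "integrable lborel (\<lambda>x. indicator A x *\<^sub>R c)" using base by simp
  fix e :: real assume "e > 0"
  then have d: "e / (norm c + 1) > 0" by (intro divide_pos_pos add_nonneg_pos) auto
  obtain U where U: "open U" "A \<subseteq> U" "emeasure lborel (U - A) < ennreal (e / (norm c + 1))"
   using outer_regular_lborel[of A "e / (norm c + 1)"] base d by auto
  have [measurable]: "U \<in> sets borel" using U by simp
  have fin: "emeasure lborel (U - A) < \<infinity>" using U(3) by (rule less_trans) simp
  have "emeasure lborel U \<le> emeasure lborel A + emeasure lborel (U - A)"
   using emeasure_subadditive[of A lborel "U - A"] U(2) by (simp add: Un_absorb1)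
  also have "\<dots> < \<infinity>" using base fin by (simp add: ennreal_add_less_top)
  finally have finU: "emeasure lborel U < \<infinity>" .
  have "measure lborel (U - A) < e / (norm c + 1)"
   using U(3) fin d by (simp add: emeasure_eq_ennreal_measure less_top ennreal_less_iff)
  then have "measure lborel (U - A) * (norm c + 1) < e" by (subst (asm) pos_less_divide_eq) (auto intro: add_nonneg_pos)
  then have "measure lborel (U - A) * norm c < e" by (rule le_less_trans[rotated]) (simp add: mult_left_mono)
  moreover have "(LINT x|lborel. norm (indicator U x *\<^sub>R c - indicator A x *\<^sub>R c)) = (LINT x|lborel. indicator (U - A) x * norm c)"
   using U(2) by (intro Bochner_Integration.integral_cong) (auto simp: indicator_def)
  ultimately have "(LINT x|lborel. norm (indicator U x *\<^sub>R c - indicator A x *\<^sub>R c)) < e" by simp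
  moreover have "(\<lambda>n. (LINT x|lborel. \<bar>indicator U (x + h n) - indicator U x :: real\<bar>) * norm c) \<longlonglongrightarrow> 0 * norm c"
   by (intro tendsto_intros L1_translation_indicator_open[OF U(1) finU h])
  then have "(\<lambda>n. LINT x|lborel. norm (indicator U (x + h n) *\<^sub>R c - indicator U x *\<^sub>R c)) \<longlonglongrightarrow> 0" by (simp flip: scaleR_diff_left)
  ultimately show "\<exists>g. integrable lborel g \<and> (LINT x|lborel. norm (g x - indicator A x *\<^sub>R c)) < e \<and>
   (\<lambda>n. LINT x|lborel. norm (g (x + h n) - g x)) \<longlonglongrightarrow> 0" using finU by (intro exI[of _ "\<lambda>x. indicator U x *\<^sub>R c"]) simp
 qed
next
 case (add f g)
 note [measurable] = borel_measurable_integrable[OF add.hyps(1)] borel_measurable_integrable[OF add.hyps(2)]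
 have i: "integrable lborel (\<lambda>x. f (x + k))" "integrable lborel (\<lambda>x. g (x + k))" for k
  using add.hyps integral_translate(2)[of f k] integral_translate(2)[of g k] by auto
 have le: "(LINT x|lborel. norm ((f (x + h n) + g (x + h n)) - (f x + g x))) \<le>
  (LINT x|lborel. norm (f (x + h n) - f x)) + (LINT x|lborel. norm (g (x + h n) - g x))" for n
 proof (subst Bochner_Integration.integral_add[symmetric])
  show "(LINT x|lborel. norm ((f (x + h n) + g (x + h n)) - (f x + g x))) \<le>
   (LINT x|lborel. norm (f (x + h n) - f x) + norm (g (x + h n) - g x))"
   by (rule integral_mono) (use i add.hyps in \<open>auto simp: norm_diff_triangle_ineq\<close>)
 qed (use i add.hyps in auto)
 show ?case by (rule tendsto_sandwich[OF _ _ tendsto_const tendsto_add_zero[OF add.IH]])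
   (use le in \<open>auto intro!: always_eventually\<close>)
next
 case (lim f s)
 note [measurable] = borel_measurable_integrable[OF lim.hyps(4)] borel_measurable_integrable[OF lim.hyps(1)]
 have conv: "(\<lambda>j. LINT x|lborel. norm (s j x - f x)) \<longlonglongrightarrow> (LINT x|(lborel :: 'a measure). 0)"
 proof (rule integral_dominated_convergence[where w = "\<lambda>x. 3 * norm (f x)"])
  show "AE x in lborel. (\<lambda>j. norm (s j x - f x)) \<longlonglongrightarrow> 0" using lim.hyps(2) by (auto intro!: tendsto_norm_zero simp: LIM_zero_iff)
  show "AE x in lborel. norm (norm (s j x - f x)) \<le> 3 * norm (f x)" for j
  proof (rule AE_I2)
   fix x show "norm (norm (s j x - f x)) \<le> 3 * norm (f x)" using norm_triangle_ineq4[of "s j x" "f x"] lim.hyps(3)[of x j] by simp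
  qed
 qed (use lim.hyps in auto)
 show ?case
 proof (rule L1_translation_approx[OF lim.hyps(4)])
  fix e :: real assume "e > 0"
  then have "eventually (\<lambda>j. (LINT x|lborel. norm (s j x - f x)) < e) sequentially" using order_tendstoD(2)[OF conv, of e] by simp
  then obtain j where "(LINT x|lborel. norm (s j x - f x)) < e" by (auto simp: eventually_sequentially)
  then show "\<exists>g. integrable lborel g \<and> (LINT x|lborel. norm (g x - f x)) < e \<and>
   (\<lambda>n. LINT x|lborel. norm (g (x + h n) - g x)) \<longlonglongrightarrow> 0" using lim.hyps(1) lim.IH by (intro exI[of _ "s j"]) simp
 qed
qed

lemma L1_translation:
 fixes f :: "'a::euclidean_space \<Rightarrow> 'b::{banach, second_countable_topology}"
 assumes "integrable lborel f" "e > 0"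
 obtains d where "d > 0" "\<And>h. norm h < d \<Longrightarrow> (LINT x|lborel. norm (f (x + h) - f x)) < e"
proof -
 have "((\<lambda>h. LINT x|lborel. norm (f (x + h) - f x)) \<longlongrightarrow> 0) (at 0)"
  unfolding tendsto_at_iff_sequentially comp_def using L1_translation_seq[OF assms(1)] by auto
 from order_tendstoD(2)[OF this assms(2)]
 obtain d where d: "d > 0" "\<And>h. h \<noteq> 0 \<Longrightarrow> norm h < d \<Longrightarrow> (LINT x|lborel. norm (f (x + h) - f x)) < e" by (auto simp: eventually_at)
 show thesis
 proof (rule that[OF d(1)])
  fix h :: 'a assume "norm h < d"
  then show "(LINT x|lborel. norm (f (x + h) - f x)) < e" using d(2)[of h] assms(2) by (cases "h = 0") auto
 qed
qed

subsection \<open>Jensen's inequality\<close>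

section \<open>Mollification\<close>

text \<open>The tangent inequality \<open>powr_convex\<close> at the mean value, integrated; if the right-hand side is
 infinite there is nothing to show.\<close>

lemma Jensen_powr:
 fixes g :: "'x \<Rightarrow> 'b::euclidean_space"
 assumes p: "p > 1" and \<psi>: "integrable M \<psi>" "\<And>x. \<psi> x \<ge> 0" "(LINT x|M. \<psi> x) = 1"
  and g: "integrable M (\<lambda>x. \<psi> x *\<^sub>R g x)" and [measurable]: "g \<in> borel_measurable M"
 shows "ennreal (norm (LINT x|M. \<psi> x *\<^sub>R g x) powr p) \<le> (\<integral>\<^sup>+x. ennreal (\<psi> x * norm (g x) powr p) \<partial>M)"
proof (cases "(\<integral>\<^sup>+x. ennreal (\<psi> x * norm (g x) powr p) \<partial>M) = \<infinity>")
 case False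
 have [measurable]: "\<psi> \<in> borel_measurable M" using \<psi>(1) by auto
 define m where "m = (LINT x|M. \<psi> x *\<^sub>R g x)"
 have int: "integrable M (\<lambda>x. \<psi> x * norm (g x) powr p)"
  using False \<psi>(2) by (intro integrableI_nonneg) (auto simp: top.not_eq_extremum)
 have int2: "integrable M (\<lambda>x. p * (flux p m \<bullet> (\<psi> x *\<^sub>R g x)))" by (intro integrable_mult_right integrable_inner_right g)
 have "norm m powr p = (LINT x|M. \<psi> x * (norm m powr p - p * (flux p m \<bullet> m)) + p * (flux p m \<bullet> (\<psi> x *\<^sub>R g x)))"
 proof -
  have "(LINT x|M. flux p m \<bullet> (\<psi> x *\<^sub>R g x)) = flux p m \<bullet> m" unfolding m_def by (rule integral_inner_right[OF g])
  then show ?thesis using int2 \<psi> g by (subst Bochner_Integration.integral_add) auto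
 qed
 also have "\<dots> \<le> (LINT x|M. \<psi> x * norm (g x) powr p)"
 proof (rule integral_mono)
  show "integrable M (\<lambda>x. \<psi> x * (norm m powr p - p * (flux p m \<bullet> m)) + p * (flux p m \<bullet> (\<psi> x *\<^sub>R g x)))"
   using int2 \<psi> by (intro Bochner_Integration.integrable_add integrable_mult_left) auto
  fix x
  have "\<psi> x * (norm m powr p + p * (flux p m \<bullet> (g x - m))) \<le> \<psi> x * norm (g x) powr p"
   using powr_convex[OF p, of m "g x"] \<psi>(2)[of x] by (intro mult_left_mono) auto
  then show "\<psi> x * (norm m powr p - p * (flux p m \<bullet> m)) + p * (flux p m \<bullet> (\<psi> x *\<^sub>R g x)) \<le> \<psi> x * norm (g x) powr p"
   by (simp add: inner_diff_right algebra_simps)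
 qed (use int in auto)
 finally show ?thesis unfolding m_def using \<psi>(2) int by (subst nn_integral_eq_integral) (auto intro: ennreal_leI)
qed auto

lemma norm_integral_le:
 fixes f :: "'x \<Rightarrow> 'b::{banach, second_countable_topology}"
 assumes "integrable M f" "integrable M g" "\<And>x. norm (f x) \<le> g x"
 shows "norm (LINT x|M. f x) \<le> (LINT x|M. g x)" by (rule order_trans[OF integral_norm_bound integral_mono]) (use assms in auto)

text \<open>Borel measurability allows Fubini's theorem and translations with respect to \<open>lborel\<close>; almost
 everywhere equal versions lead from \<open>lebesgue\<close> to this situation.\<close>

definition loc_int :: "('a::euclidean_space \<Rightarrow> 'b::euclidean_space) \<Rightarrow> bool" where
 "loc_int u \<longleftrightarrow> u \<in> borel_measurable borel \<and> (\<forall>R. integrable lborel (\<lambda>x. indicator (cball 0 R) x *\<^sub>R u x))"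

lemma loc_int_measurable [measurable_dest]: "loc_int u \<Longrightarrow> u \<in> borel_measurable borel"
 by (simp add: loc_int_def)

lemma loc_int_integrable: "loc_int u \<Longrightarrow> integrable lborel (\<lambda>x. indicator (cball 0 R) x *\<^sub>R u x)"
 by (simp add: loc_int_def)

lemma loc_int_bound:
 fixes u :: "'a::euclidean_space \<Rightarrow> 'b::euclidean_space" and f :: "'a \<Rightarrow> 'c::{banach, second_countable_topology}"
 assumes "loc_int u" "f \<in> borel_measurable borel" "\<And>y. norm (f y) \<le> B * norm (u y)"
  "\<And>y. norm y > R \<Longrightarrow> f y = 0"
 shows "integrable lborel f"
proof (rule Bochner_Integration.integrable_bound)
 show "integrable lborel (\<lambda>x. B *\<^sub>R (indicator (cball 0 R) x *\<^sub>R u x))"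
  using assms(1) by (intro integrable_scaleR_right loc_int_integrable)
 show "AE x in lborel. norm (f x) \<le> norm (B *\<^sub>R (indicator (cball 0 R) x *\<^sub>R u x))"
 proof (rule AE_I2)
  fix x show "norm (f x) \<le> norm (B *\<^sub>R (indicator (cball 0 R) x *\<^sub>R u x))"
  proof (cases "norm x \<le> R")
   case True
   have "norm (f x) \<le> \<bar>B\<bar> * norm (u x)" using order_trans[OF assms(3)[of x] mult_right_mono[of B "\<bar>B\<bar>" "norm (u x)"]] by simp
   then show ?thesis using True by simp
  qed (use assms(4)[of x] in simp)
 qed
qed (use assms in simp)

lemma integrable_imp_loc_int:
 assumes "integrable lborel u" shows "loc_int u" unfolding loc_int_def
 using assms by (auto intro!: Bochner_Integration.integrable_bound[OF assms] simp: indicator_def)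

definition mollify :: "real \<Rightarrow> ('a::euclidean_space \<Rightarrow> 'b::euclidean_space) \<Rightarrow> 'a \<Rightarrow> 'b" where
 "mollify eps u x = (LINT y|lborel. bump eps (y - x) *\<^sub>R u y)"

lemma bump_shift_eq_0:
 assumes "eps > 0" "norm y > norm x + eps" shows "bump eps (y - x) = 0"
 using assms norm_triangle_ineq2[of y x] by (intro bump_eq_0) auto

lemma integrable_bump_shift:
 fixes u :: "'a::euclidean_space \<Rightarrow> 'b::euclidean_space"
 assumes "loc_int u" "eps > 0"
 shows "integrable lborel (\<lambda>y. bump eps (y - x) *\<^sub>R u y)"
proof (rule loc_int_bound[OF assms(1), where R = "norm x + eps" and B = "inverse (bump_mass TYPE('a) eps)"])
 show "norm (bump eps (y - x) *\<^sub>R u y) \<le> inverse (bump_mass TYPE('a) eps) * norm (u y)" for y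
  using bump_le[OF assms(2), of "y - x"] bump_nonneg[OF assms(2), of "y - x"] by (simp add: mult_right_mono)
qed (use assms bump_shift_eq_0 in auto)

lemma mollify_alt:
 fixes u :: "'a::euclidean_space \<Rightarrow> 'b::euclidean_space"
 assumes [measurable]: "u \<in> borel_measurable borel"
 shows "mollify eps u x = (LINT y|lborel. bump eps y *\<^sub>R u (x + y))"
  and "integrable lborel (\<lambda>y. bump eps y *\<^sub>R u (x + y)) \<longleftrightarrow> integrable lborel (\<lambda>y. bump eps (y - x) *\<^sub>R u y)"
 using integral_translate[of "\<lambda>y. bump eps (y - x) *\<^sub>R u y" x] by (simp_all add: mollify_def add.commute)

lemma bump_C1:
 assumes "eps > 0"
 obtains D R where "C1_grad (bump eps :: 'a::euclidean_space \<Rightarrow> real) D" "\<And>x. norm x > R \<Longrightarrow> bump eps (x::'a) = 0"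
  "\<And>x. norm x > R \<Longrightarrow> D x = 0" "R > 0"
proof -
 have "test_function (bump eps :: 'a \<Rightarrow> real)" using test_function_bump[OF assms, of "0::'a"] by simp
 then show thesis using that by (rule test_function_C1)
qed

lemma bump_Lipschitz:
 assumes "eps > 0"
 obtains B where "B > 0" "\<And>z w::'a::euclidean_space. \<bar>bump eps z - bump eps w\<bar> \<le> B * norm (z - w)"
proof -
 obtain D R where D: "C1_grad (bump eps :: 'a \<Rightarrow> real) D" "\<And>x. norm x > R \<Longrightarrow> D x = 0" using bump_C1[OF assms] by metis
 obtain B where "B > 0" "\<And>x. norm (D x) \<le> B"
  using continuous_compact_support_bounded[OF C1_grad_continuous_grad[OF D(1)] D(2)] by metis
 then show thesis using that C1_grad_Lipschitz[OF D(1)] by blast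
qed

lemma mollify_continuous:
 fixes G :: "'a::euclidean_space \<Rightarrow> 'b::euclidean_space"
 assumes G: "loc_int G" and "eps > 0"
 shows "continuous_on UNIV (mollify eps G)" unfolding continuous_on_eq_continuous_within isCont_def
proof
 fix x :: 'a
 note [measurable] = loc_int_measurable[OF G]
 obtain B where B: "B > 0" "\<And>z w::'a. \<bar>bump eps z - bump eps w\<bar> \<le> B * norm (z - w)" using bump_Lipschitz[OF assms(2)] by blast
 define R where "R = norm x + 1 + eps"
 define I where "I = (LINT y|lborel. norm (indicator (cball 0 R) y *\<^sub>R G y))"
 have "norm (mollify eps G x' - mollify eps G x) \<le> B * norm (x' - x) * I" if "norm (x' - x) < 1" for x'
 proof -
  have "mollify eps G x' - mollify eps G x = (LINT y|lborel. (bump eps (y - x') - bump eps (y - x)) *\<^sub>R G y)"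
   using integrable_bump_shift[OF assms] by (simp add: mollify_def scaleR_diff_left)
  also have "norm \<dots> \<le> (LINT y|lborel. B * norm (x' - x) * norm (indicator (cball 0 R) y *\<^sub>R G y))"
  proof (rule norm_integral_le)
   show "integrable lborel (\<lambda>y. (bump eps (y - x') - bump eps (y - x)) *\<^sub>R G y)"
    using integrable_bump_shift[OF assms] by (simp add: scaleR_diff_left)
   show "integrable lborel (\<lambda>y. B * norm (x' - x) * norm (indicator (cball 0 R) y *\<^sub>R G y))"
    by (intro integrable_mult_right integrable_norm loc_int_integrable G)
   show "norm ((bump eps (y - x') - bump eps (y - x)) *\<^sub>R G y) \<le> B * norm (x' - x) * norm (indicator (cball 0 R) y *\<^sub>R G y)" for y
   proof (cases "norm y \<le> R")
    case True
    have "\<bar>bump eps (y - x') - bump eps (y - x)\<bar> \<le> B * norm (x' - x)"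
     using B(2)[of "y - x'" "y - x"] by (simp add: norm_minus_commute)
    from mult_right_mono[OF this norm_ge_zero[of "G y"]] show ?thesis using True by simp
   next
    case False
    moreover have "norm x' \<le> norm x + 1" using that norm_triangle_ineq2[of x' x] by linarith
    ultimately show ?thesis using bump_shift_eq_0[OF assms(2), of x y] bump_shift_eq_0[OF assms(2), of x' y] by (simp add: R_def)
   qed
  qed
  also have "\<dots> = B * norm (x' - x) * I" unfolding I_def by simp
  finally show ?thesis .
 qed
 then have "eventually (\<lambda>x'. norm (mollify eps G x' - mollify eps G x) \<le> B * norm (x' - x) * I) (at x)"
  by (auto simp: eventually_at dist_norm intro!: exI[of _ 1])
 moreover have "((\<lambda>x'. B * norm (x' - x) * I) \<longlongrightarrow> B * norm (x - x) * I) (at x)" by (intro tendsto_intros)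
 then have "((\<lambda>x'. B * norm (x' - x) * I) \<longlongrightarrow> 0) (at x)" by simp
 ultimately have "((\<lambda>x'. mollify eps G x' - mollify eps G x) \<longlongrightarrow> 0) (at x)" by (rule Lim_null_comparison)
 then show "(mollify eps G \<longlongrightarrow> mollify eps G x) (at x)" by (simp add: LIM_zero_iff)
qed

text \<open>The derivative falls on the kernel, which is a test function of the integration variable; the
 definition of the weak gradient then moves it to \<open>G\<close>.\<close>

lemma mollify_C1_grad:
 fixes u :: "'a::euclidean_space \<Rightarrow> real"
 assumes u: "loc_int u" and G: "loc_int G" and "eps > 0"
  and weak: "\<And>\<phi> b. test_function \<phi> \<Longrightarrow> b \<in> Basis \<Longrightarrow>
    (LINT x|lborel. u x * frechet_derivative \<phi> (at x) b) = - (LINT x|lborel. (G x \<bullet> b) * \<phi> x)"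
 shows "C1_grad (mollify eps u) (mollify eps G)" unfolding C1_grad_def
proof safe
 fix x :: 'a
 note [measurable] = loc_int_measurable[OF u] loc_int_measurable[OF G]
 obtain D R where D: "C1_grad (bump eps :: 'a \<Rightarrow> real) D" "\<And>x. norm x > R \<Longrightarrow> bump eps (x::'a) = 0"
  "\<And>x. norm x > R \<Longrightarrow> D x = 0" "R > 0" using bump_C1[OF assms(3)] by metis
 have [measurable]: "D \<in> borel_measurable borel" by (intro borel_measurable_continuous_onI C1_grad_continuous_grad[OF D(1)])
 obtain B where B: "B > 0" "\<And>x. norm (D x) \<le> B"
  using continuous_compact_support_bounded[OF C1_grad_continuous_grad[OF D(1)] D(3)] by metis
 have norm_big: "norm (y - x) > r" if "norm y > norm x + r" for y :: 'a and r using that norm_triangle_ineq2[of y x] by linarith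
 have intD: "integrable lborel (\<lambda>y. u y *\<^sub>R D (y - x))"
 proof (rule loc_int_bound[OF u, where B = B and R = "norm x + R"])
  show "norm (u y *\<^sub>R D (y - x)) \<le> B * norm (u y)" for y
   using mult_left_mono[OF B(2)[of "y - x"] abs_ge_zero[of "u y"]] by (simp add: mult.commute)
 qed (use norm_big D(3) in auto)
 define L where "L = (LINT y|lborel. u y *\<^sub>R D (y - x))"
 have "L \<bullet> b = - mollify eps G x \<bullet> b" if "b \<in> Basis" for b
 proof -
  have "frechet_derivative (\<lambda>y. bump eps (y - x)) (at y) b = D (y - x) \<bullet> b" for y
  proof -
   have "((\<lambda>y. bump eps (y - x)) has_derivative (\<lambda>h. D (y - x) \<bullet> h)) (at y)"
   proof -
    have "((\<lambda>y. y - x) has_derivative (\<lambda>h. h)) (at y)" by (auto intro!: derivative_eq_intros)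
    from has_derivative_compose[OF this C1_gradD[OF D(1)]] show ?thesis .
   qed
   then show ?thesis using frechet_derivative_at by metis
  qed
  then have "L \<bullet> b = (LINT y|lborel. u y * frechet_derivative (\<lambda>y. bump eps (y - x)) (at y) b)"
   unfolding L_def using intD by (subst integral_inner_left[symmetric]) auto
  also have "\<dots> = - (LINT y|lborel. (G y \<bullet> b) * bump eps (y - x))" by (rule weak[OF test_function_bump[OF assms(3)] that])
  also have "(LINT y|lborel. (G y \<bullet> b) * bump eps (y - x)) = mollify eps G x \<bullet> b"
   unfolding mollify_def using integrable_bump_shift[OF G assms(3)]
   by (subst integral_inner_left[symmetric]) (auto simp: mult.commute)
  finally show ?thesis by simp
 qed
 then have L: "mollify eps G x = - L" by (metis euclidean_eqI minus_equation_iff)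
 define r where "r = norm x + R + 1"
 define I where "I = (LINT y|lborel. norm (indicator (cball 0 r) y *\<^sub>R u y))"
 have "I \<ge> 0" unfolding I_def by simp
 have "\<exists>d>0. \<forall>y. norm (y - x) < d \<longrightarrow>
   norm (mollify eps u y - mollify eps u x - mollify eps G x \<bullet> (y - x)) \<le> e * norm (y - x)" if "e > 0" for e
 proof -
  have "e / (I + 1) > 0" using that \<open>I \<ge> 0\<close> by simp
  with C1_grad_linearization[OF D(1) continuous_compact_support_uniformly_continuous[OF C1_grad_continuous_grad[OF D(1)] D(3)]]
  obtain d where d: "d > 0" "\<And>x h. norm h < d \<Longrightarrow> \<bar>bump eps (x + h) - bump eps x - D x \<bullet> h\<bar> \<le> e / (I + 1) * norm h" by metis
  have "norm (mollify eps u x' - mollify eps u x - mollify eps G x \<bullet> (x' - x)) \<le> e * norm (x' - x)"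
   if x': "norm (x' - x) < min d 1" for x'
  proof -
   let ?k = "\<lambda>y. (bump eps (y - x + (x - x')) - bump eps (y - x) - D (y - x) \<bullet> (x - x')) *\<^sub>R u y"
   have i1: "integrable lborel (\<lambda>y. bump eps (y - z) *\<^sub>R u y)" for z by (rule integrable_bump_shift[OF u assms(3)])
   have i2: "integrable lborel (\<lambda>y. (D (y - x) \<bullet> (x - x')) *\<^sub>R u y)"
    using integrable_inner_left[OF intD, of "x - x'"] by (simp add: mult.commute)
   have k: "?k y = bump eps (y - x') *\<^sub>R u y - bump eps (y - x) *\<^sub>R u y - (D (y - x) \<bullet> (x - x')) *\<^sub>R u y" for y
    by (simp add: algebra_simps)
   have ik: "integrable lborel ?k" unfolding k using i1 i2 by (intro Bochner_Integration.integrable_diff)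
   have "L \<bullet> (x - x') = (LINT y|lborel. (D (y - x) \<bullet> (x - x')) *\<^sub>R u y)"
    unfolding L_def using intD by (subst integral_inner_left[symmetric]) (auto simp: mult.commute)
   then have "mollify eps u x' - mollify eps u x - mollify eps G x \<bullet> (x' - x) = (LINT y|lborel. ?k y)"
    unfolding k L using i1 i2 by (simp add: mollify_def inner_diff_right)
   also have "norm \<dots> \<le> (LINT y|lborel. e / (I + 1) * norm (x - x') * norm (indicator (cball 0 r) y *\<^sub>R u y))"
   proof (rule norm_integral_le[OF ik])
    show "integrable lborel (\<lambda>y. e / (I + 1) * norm (x - x') * norm (indicator (cball 0 r) y *\<^sub>R u y))"
     by (intro integrable_mult_right integrable_norm loc_int_integrable u)
    show "norm (?k y) \<le> e / (I + 1) * norm (x - x') * norm (indicator (cball 0 r) y *\<^sub>R u y)" for y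
    proof (cases "norm y \<le> r")
     case True
     have "\<bar>bump eps (y - x + (x - x')) - bump eps (y - x) - D (y - x) \<bullet> (x - x')\<bar> \<le> e / (I + 1) * norm (x - x')"
      by (rule d(2)) (use x' in \<open>simp add: norm_minus_commute\<close>)
     from mult_right_mono[OF this norm_ge_zero[of "u y"]] show ?thesis using True by (simp add: abs_mult)
    next
     case False
     have 1: "norm (y - x) > R" using False norm_big[of R y] by (simp add: r_def)
     have "norm (y - x) > R + 1" using False norm_big[of "R + 1" y] by (simp add: r_def)
     moreover have "norm (y - x) \<le> norm (y - x') + norm (x' - x)" using norm_triangle_ineq[of "y - x'" "x' - x"] by simp
     ultimately have 2: "norm (y - x') > R" using x' by linarith
     show ?thesis using D(2)[OF 1] D(2)[OF 2] D(3)[OF 1] \<open>I \<ge> 0\<close> \<open>e > 0\<close> by simp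
    qed
   qed
   also have "\<dots> = e / (I + 1) * norm (x - x') * I" unfolding I_def by simp
   also have "\<dots> = (I / (I + 1)) * (e * norm (x' - x))" by (simp add: norm_minus_commute)
   also have "\<dots> \<le> 1 * (e * norm (x' - x))" using \<open>I \<ge> 0\<close> \<open>e > 0\<close> by (intro mult_right_mono) auto
   finally show ?thesis by simp
  qed
  then show ?thesis using d(1) by (intro exI[of _ "min d 1"]) auto
 qed
 then show "(mollify eps u has_derivative (\<bullet>) (mollify eps G x)) (at x)"
  by (auto simp: has_derivative_at_alt bounded_linear_inner_right)
next
 show "continuous_on UNIV (mollify eps G)" by (rule mollify_continuous[OF G assms(3)])
qed

subsection \<open>Convergence of mollifications\<close>

lemma Fubini_lborel:
 fixes f :: "'a::euclidean_space \<Rightarrow> 'b::euclidean_space \<Rightarrow> ennreal"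
 assumes "(\<lambda>(x, y). f x y) \<in> borel_measurable (borel \<Otimes>\<^sub>M borel)"
 shows "(\<integral>\<^sup>+x. \<integral>\<^sup>+y. f x y \<partial>lborel \<partial>lborel) = (\<integral>\<^sup>+y. \<integral>\<^sup>+x. f x y \<partial>lborel \<partial>lborel)"
proof -
 have "case_prod f \<in> borel_measurable (lborel \<Otimes>\<^sub>M lborel)" using assms by (simp cong: measurable_cong_sets sets_pair_measure_cong)
 from lborel_pair.Fubini'[OF this] show ?thesis by simp
qed

lemma mollify_powr_le:
 assumes G: "loc_int G" and "eps > 0" "p > 1"
 shows "ennreal (norm (mollify eps G x) powr p) \<le> (\<integral>\<^sup>+y. ennreal (bump eps y * norm (G (x + y)) powr p) \<partial>lborel)"
proof -
 note [measurable] = loc_int_measurable[OF G]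
 show ?thesis unfolding mollify_alt(1)[OF loc_int_measurable[OF G]]
  using integrable_bump_shift[OF G assms(2)] mollify_alt(2)[OF loc_int_measurable[OF G], of eps x] assms
  by (intro Jensen_powr) (auto simp: integrable_bump integral_bump bump_nonneg)
qed

lemma nn_integral_mollify_powr_le:
 fixes G :: "'a::euclidean_space \<Rightarrow> 'b::euclidean_space"
 assumes G: "loc_int G" and "eps > 0" "p > 1"
 shows "(\<integral>\<^sup>+x. ennreal (norm (mollify eps G x) powr p) \<partial>lborel) \<le> (\<integral>\<^sup>+x. ennreal (norm (G x) powr p) \<partial>lborel)"
proof -
 note [measurable] = loc_int_measurable[OF G]
 have "(\<integral>\<^sup>+x. ennreal (norm (mollify eps G x) powr p) \<partial>lborel) \<le>
  (\<integral>\<^sup>+x. \<integral>\<^sup>+y. ennreal (bump eps y * norm (G (x + y)) powr p) \<partial>lborel \<partial>lborel)" by (intro nn_integral_mono mollify_powr_le assms)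
 also have "\<dots> = (\<integral>\<^sup>+y. \<integral>\<^sup>+x. ennreal (bump eps y * norm (G (x + y)) powr p) \<partial>lborel \<partial>lborel)" by (rule Fubini_lborel) measurable
 also have "\<dots> = (\<integral>\<^sup>+y. ennreal (bump eps (y::'a)) * (\<integral>\<^sup>+x. ennreal (norm (G x) powr p) \<partial>lborel) \<partial>lborel)"
 proof (rule nn_integral_cong)
  fix y :: 'a
  have "(\<integral>\<^sup>+x. ennreal (bump eps y * norm (G (x + y)) powr p) \<partial>lborel) =
   ennreal (bump eps y) * (\<integral>\<^sup>+x. ennreal (norm (G (x + y)) powr p) \<partial>lborel)"
   using bump_nonneg[OF assms(2), of y] by (simp add: ennreal_mult nn_integral_cmult)
  also have "(\<integral>\<^sup>+x. ennreal (norm (G (x + y)) powr p) \<partial>lborel) = (\<integral>\<^sup>+x. ennreal (norm (G x) powr p) \<partial>lborel)"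
   by (rule nn_integral_translate) measurable
  finally show "(\<integral>\<^sup>+x. ennreal (bump eps y * norm (G (x + y)) powr p) \<partial>lborel) =
   ennreal (bump eps y) * (\<integral>\<^sup>+x. ennreal (norm (G x) powr p) \<partial>lborel)" .
 qed
 also have "\<dots> = (\<integral>\<^sup>+x. ennreal (norm (G x) powr p) \<partial>lborel)"
  using nn_integral_bump[OF assms(2), where ?'a = 'a] by (simp add: nn_integral_multc)
 finally show ?thesis .
qed

lemma mollify_diff:
 fixes f :: "'a::euclidean_space \<Rightarrow> 'b::euclidean_space"
 assumes f: "loc_int f" and "eps > 0"
 shows "mollify eps f x - f x = (LINT y|lborel. bump eps y *\<^sub>R (f (x + y) - f x))"
  and "integrable lborel (\<lambda>y. bump eps y *\<^sub>R (f (x + y) - f x))"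
proof -
 note [measurable] = loc_int_measurable[OF f]
 have i: "integrable lborel (\<lambda>y. bump eps y *\<^sub>R f (x + y))"
  using integrable_bump_shift[OF assms] mollify_alt(2)[OF loc_int_measurable[OF f]] by blast
 have j: "integrable lborel (\<lambda>y::'a. bump eps y *\<^sub>R f x)" "(LINT y|lborel. bump eps (y::'a) *\<^sub>R f x) = f x"
  using integrable_bump[of eps, where ?'a = 'a] integral_bump[OF assms(2), where ?'a = 'a]
  by (simp_all add: integrable_scaleR_left)
 show "integrable lborel (\<lambda>y. bump eps y *\<^sub>R (f (x + y) - f x))" using i j by (simp add: scaleR_diff_right)
 show "mollify eps f x - f x = (LINT y|lborel. bump eps y *\<^sub>R (f (x + y) - f x))"
  unfolding mollify_alt(1)[OF loc_int_measurable[OF f]] using i j by (simp add: scaleR_diff_right)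
qed

lemma mollify_L1_close:
 fixes f :: "'a::euclidean_space \<Rightarrow> 'b::euclidean_space"
 assumes f: "integrable lborel f" and "e > 0"
 obtains d where "d > 0" "\<And>eps. eps > 0 \<Longrightarrow> eps < d \<Longrightarrow>
  (\<integral>\<^sup>+x. ennreal (norm (mollify eps f x - f x)) \<partial>lborel) \<le> ennreal e"
proof -
 note [measurable] = borel_measurable_integrable[OF f, simplified]
 obtain d where d: "d > 0" "\<And>h. norm h < d \<Longrightarrow> (LINT x|lborel. norm (f (x + h) - f x)) < e" using L1_translation[OF assms] by blast
 show thesis
 proof (rule that[OF d(1)])
  fix eps :: real assume eps: "eps > 0" "eps < d"
  have "(\<integral>\<^sup>+x. ennreal (norm (mollify eps f x - f x)) \<partial>lborel) \<le>
   (\<integral>\<^sup>+x. \<integral>\<^sup>+y. ennreal (bump eps y * norm (f (x + y) - f x)) \<partial>lborel \<partial>lborel)"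
  proof (rule nn_integral_mono)
   fix x
   have "ennreal (norm (mollify eps f x - f x)) \<le> (\<integral>\<^sup>+y. ennreal (norm (bump eps y *\<^sub>R (f (x + y) - f x))) \<partial>lborel)"
    unfolding mollify_diff(1)[OF integrable_imp_loc_int[OF f] eps(1)]
    by (rule integral_norm_bound_ennreal[OF mollify_diff(2)[OF integrable_imp_loc_int[OF f] eps(1)]])
   then show "ennreal (norm (mollify eps f x - f x)) \<le> (\<integral>\<^sup>+y. ennreal (bump eps y * norm (f (x + y) - f x)) \<partial>lborel)"
    by (simp only: norm_scaleR abs_of_nonneg[OF bump_nonneg[OF eps(1)]])
  qed
  also have "\<dots> = (\<integral>\<^sup>+y. \<integral>\<^sup>+x. ennreal (bump eps y * norm (f (x + y) - f x)) \<partial>lborel \<partial>lborel)" by (rule Fubini_lborel) measurable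
  also have "\<dots> \<le> (\<integral>\<^sup>+y. ennreal (bump eps (y::'a)) * ennreal e \<partial>lborel)"
  proof (rule nn_integral_mono)
   fix y :: 'a
   have eq: "(\<integral>\<^sup>+x. ennreal (bump eps y * norm (f (x + y) - f x)) \<partial>lborel) =
    ennreal (bump eps y) * (\<integral>\<^sup>+x. ennreal (norm (f (x + y) - f x)) \<partial>lborel)"
    using bump_nonneg[OF eps(1), of y] by (simp add: ennreal_mult nn_integral_cmult)
   show "(\<integral>\<^sup>+x. ennreal (bump eps y * norm (f (x + y) - f x)) \<partial>lborel) \<le> ennreal (bump eps y) * ennreal e"
   proof (cases "norm y < d")
    case True
    have "integrable lborel (\<lambda>x. f (x + y) - f x)" using f integral_translate(2)[of f y] by simp
    then have "(\<integral>\<^sup>+x. ennreal (norm (f (x + y) - f x)) \<partial>lborel) = ennreal (LINT x|lborel. norm (f (x + y) - f x))"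
     by (intro nn_integral_eq_integral) auto
    also have "\<dots> \<le> ennreal e" using d(2)[OF True] by (intro ennreal_leI) simp
    finally show ?thesis unfolding eq by (intro mult_left_mono) auto
   next
    case False
    then have "bump eps y = 0" using eps by (intro bump_eq_0) auto
    then show ?thesis by simp
   qed
  qed
  also have "\<dots> = ennreal e" using nn_integral_bump[OF eps(1), where ?'a = 'a] by (simp add: nn_integral_multc)
  finally show "(\<integral>\<^sup>+x. ennreal (norm (mollify eps f x - f x)) \<partial>lborel) \<le> ennreal e" .
 qed
qed

lemma mollify_L1_loc_close:
 assumes u: "loc_int u" and "e > 0"
 obtains d where "d > 0" "\<And>eps. eps > 0 \<Longrightarrow> eps < d \<Longrightarrow>
  (\<integral>\<^sup>+x\<in>cball 0 R. ennreal (norm (mollify eps u x - u x)) \<partial>lborel) \<le> ennreal e"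
proof -
 define f where "f x = indicator (cball 0 (R + 1)) x *\<^sub>R u x" for x
 have f: "integrable lborel f" unfolding f_def using u by (rule loc_int_integrable)
 obtain d where d: "d > 0" "\<And>eps. eps > 0 \<Longrightarrow> eps < d \<Longrightarrow>
  (\<integral>\<^sup>+x. ennreal (norm (mollify eps f x - f x)) \<partial>lborel) \<le> ennreal e" using mollify_L1_close[OF f \<open>e > 0\<close>] by blast
 show thesis
 proof (rule that[of "min d 1"])
  fix eps :: real assume eps: "eps > 0" "eps < min d 1"
  have "mollify eps u x = mollify eps f x" if "norm x \<le> R" for x unfolding mollify_def
  proof (rule Bochner_Integration.integral_cong)
   fix y
   show "bump eps (y - x) *\<^sub>R u y = bump eps (y - x) *\<^sub>R f y"
    using bump_shift_eq_0[OF eps(1), of x y] that eps(2) by (cases "norm y \<le> R + 1") (auto simp: f_def)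
  qed simp
  then have "(\<integral>\<^sup>+x\<in>cball 0 R. ennreal (norm (mollify eps u x - u x)) \<partial>lborel) \<le>
   (\<integral>\<^sup>+x. ennreal (norm (mollify eps f x - f x)) \<partial>lborel)" by (intro nn_integral_mono) (auto simp: indicator_def f_def)
  also have "\<dots> \<le> ennreal e" using d(2) eps by simp
  finally show "(\<integral>\<^sup>+x\<in>cball 0 R. ennreal (norm (mollify eps u x - u x)) \<partial>lborel) \<le> ennreal e" .
 qed (use d(1) in simp)
qed

text \<open>Write the difference as an integral of the derivative along the segment from \<open>x\<close> to \<open>x + h\<close>, and use
 Jensen's inequality and Fubini's theorem.\<close>

lemma C1_translation_estimate:
 assumes f: "C1_grad f D" and "p > 1"
 shows "(\<integral>\<^sup>+x. ennreal (\<bar>f (x + h) - f x\<bar> powr p) \<partial>lborel) \<le>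
  ennreal (norm h powr p) * (\<integral>\<^sup>+x. ennreal (norm (D x) powr p) \<partial>lborel)"
proof -
 have [measurable]: "D \<in> borel_measurable borel" "f \<in> borel_measurable borel"
  by (intro borel_measurable_continuous_onI C1_grad_continuous_grad[OF f] C1_grad_continuous[OF f])+
 have ptw: "ennreal (\<bar>f (x + h) - f x\<bar> powr p) \<le>
  (\<integral>\<^sup>+t. ennreal (indicator {0..1} t * (norm h powr p * norm (D (x + t *\<^sub>R h)) powr p)) \<partial>(lborel :: real measure))" for x
 proof -
  have cont: "continuous_on {0..1::real} (\<lambda>t. D (x + t *\<^sub>R h) \<bullet> h)"
   by (intro continuous_intros continuous_on_compose2[OF C1_grad_continuous_grad[OF f]]) auto
  have der: "((\<lambda>t. f (x + t *\<^sub>R h)) has_vector_derivative (D (x + t *\<^sub>R h) \<bullet> h)) (at t within {0..1})" for t :: real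
  proof -
   have "((\<lambda>t. f (x + t *\<^sub>R h)) has_derivative (\<lambda>s. D (x + t *\<^sub>R h) \<bullet> (s *\<^sub>R h))) (at t within {0..1})"
    by (rule has_derivative_compose[OF _ C1_gradD[OF f]]) (auto intro!: derivative_eq_intros)
   then show ?thesis by (simp add: has_vector_derivative_def)
  qed
  have "(LINT t|lborel. indicator {0..1} t *\<^sub>R (D (x + t *\<^sub>R h) \<bullet> h)) = f (x + 1 *\<^sub>R h) - f (x + 0 *\<^sub>R h)"
   by (rule integral_FTC_atLeastAtMost) (use der cont in auto)
  then have eq: "f (x + h) - f x = (LINT t|lborel. indicator {0..1::real} t *\<^sub>R (D (x + t *\<^sub>R h) \<bullet> h))" by simp
  have "ennreal (norm (f (x + h) - f x) powr p) \<le>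
   (\<integral>\<^sup>+t. ennreal (indicator {0..1::real} t * norm (D (x + t *\<^sub>R h) \<bullet> h) powr p) \<partial>lborel)" unfolding eq
  proof (rule Jensen_powr)
   show "integrable lborel (\<lambda>t. indicator {0..1::real} t *\<^sub>R (D (x + t *\<^sub>R h) \<bullet> h))"
    using borel_integrable_atLeastAtMost'[OF cont] by (simp add: set_integrable_def)
  qed (use assms in auto)
  also have "\<dots> \<le> (\<integral>\<^sup>+t. ennreal (indicator {0..1} t * (norm h powr p * norm (D (x + t *\<^sub>R h)) powr p)) \<partial>lborel)"
  proof (intro nn_integral_mono ennreal_leI mult_left_mono)
   fix t
   have "norm (D (x + t *\<^sub>R h) \<bullet> h) powr p \<le> (norm (D (x + t *\<^sub>R h)) * norm h) powr p"
    using assms(2) Cauchy_Schwarz_ineq2 by (intro powr_mono2) auto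
   then show "norm (D (x + t *\<^sub>R h) \<bullet> h) powr p \<le> norm h powr p * norm (D (x + t *\<^sub>R h)) powr p"
    by (simp add: powr_mult mult.commute)
  qed auto
  finally show ?thesis by simp
 qed
 have "(\<integral>\<^sup>+x. ennreal (\<bar>f (x + h) - f x\<bar> powr p) \<partial>lborel) \<le>
  (\<integral>\<^sup>+x. \<integral>\<^sup>+t. ennreal (indicator {0..1} t * (norm h powr p * norm (D (x + t *\<^sub>R h)) powr p)) \<partial>(lborel :: real measure) \<partial>lborel)"
  by (intro nn_integral_mono ptw)
 also have "\<dots> = (\<integral>\<^sup>+t. \<integral>\<^sup>+x. ennreal (indicator {0..1} t * (norm h powr p * norm (D (x + t *\<^sub>R h)) powr p)) \<partial>lborel \<partial>(lborel :: real measure))"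
  by (rule Fubini_lborel) measurable
 also have "\<dots> = (\<integral>\<^sup>+t. indicator {0..1::real} t * (ennreal (norm h powr p) * (\<integral>\<^sup>+x. ennreal (norm (D x) powr p) \<partial>lborel)) \<partial>lborel)"
 proof (rule nn_integral_cong)
  fix t :: real
  have "(\<integral>\<^sup>+x. ennreal (indicator {0..1} t * (norm h powr p * norm (D (x + t *\<^sub>R h)) powr p)) \<partial>lborel) =
   indicator {0..1} t * (ennreal (norm h powr p) * (\<integral>\<^sup>+x. ennreal (norm (D (x + t *\<^sub>R h)) powr p) \<partial>lborel))"
   by (cases "t \<in> {0..1}") (simp_all add: ennreal_mult nn_integral_cmult)
  also have "(\<integral>\<^sup>+x. ennreal (norm (D (x + t *\<^sub>R h)) powr p) \<partial>lborel) = (\<integral>\<^sup>+x. ennreal (norm (D x) powr p) \<partial>lborel)"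
   by (rule nn_integral_translate) measurable
  finally show "(\<integral>\<^sup>+x. ennreal (indicator {0..1} t * (norm h powr p * norm (D (x + t *\<^sub>R h)) powr p)) \<partial>lborel) =
   indicator {0..1} t * (ennreal (norm h powr p) * (\<integral>\<^sup>+x. ennreal (norm (D x) powr p) \<partial>lborel))" .
 qed
 also have "\<dots> = ennreal (norm h powr p) * (\<integral>\<^sup>+x. ennreal (norm (D x) powr p) \<partial>lborel)" by (subst nn_integral_multc) auto
 finally show ?thesis .
qed

subsection \<open>Local convergence in the mean\<close>

section \<open>Local convergence in the mean and weak gradients\<close>

lemma measurable_cball_lebesgue [measurable]: "cball c R \<in> sets lebesgue"
 by simp

text \<open>Convergence to zero in \<open>L\<^sup>1\<close> on every ball, a mode of convergence under which weak gradients are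
 stable.\<close>

definition loc_null :: "(nat \<Rightarrow> 'a::euclidean_space \<Rightarrow> real) \<Rightarrow> bool" where
 "loc_null a \<longleftrightarrow> (\<forall>R. (\<lambda>n. \<integral>\<^sup>+x\<in>cball 0 R. ennreal (a n x) \<partial>lebesgue) \<longlonglongrightarrow> 0)"

lemma loc_nullD: "loc_null a \<Longrightarrow> (\<lambda>n. \<integral>\<^sup>+x\<in>cball 0 R. ennreal (a n x) \<partial>lebesgue) \<longlonglongrightarrow> 0"
 by (simp add: loc_null_def)

lemma ennreal_tendsto_0_le:
 fixes a b :: "'i \<Rightarrow> ennreal"
 assumes "(b \<longlongrightarrow> 0) F" "\<And>n. a n \<le> b n"
 shows "(a \<longlongrightarrow> 0) F" by (rule tendsto_sandwich[OF _ _ tendsto_const assms(1)]) (use assms(2) in auto)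

lemma loc_null_mono:
 assumes "loc_null b" "\<And>n. AE x in lebesgue. a n x \<le> b n x"
 shows "loc_null a" unfolding loc_null_def
proof
 fix R
 show "(\<lambda>n. \<integral>\<^sup>+x\<in>cball 0 R. ennreal (a n x) \<partial>lebesgue) \<longlonglongrightarrow> 0"
 proof (rule ennreal_tendsto_0_le[OF loc_nullD[OF assms(1)]])
  fix n
  show "(\<integral>\<^sup>+x\<in>cball 0 R. ennreal (a n x) \<partial>lebesgue) \<le> (\<integral>\<^sup>+x\<in>cball 0 R. ennreal (b n x) \<partial>lebesgue)"
  proof (rule nn_integral_mono_AE)
   show "AE x in lebesgue. ennreal (a n x) * indicator (cball 0 R) x \<le> ennreal (b n x) * indicator (cball 0 R) x"
    using assms(2)[of n] by eventually_elim (auto intro!: mult_right_mono ennreal_leI)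
  qed
 qed
qed

lemma loc_null_add:
 assumes "loc_null a" "loc_null b" and [measurable]: "\<And>n. a n \<in> lmeas" "\<And>n. b n \<in> lmeas"
  and "\<And>n x. a n x \<ge> 0" "\<And>n x. b n x \<ge> 0"
 shows "loc_null (\<lambda>n x. a n x + b n x)" unfolding loc_null_def
proof
 fix R
 have "(\<lambda>n. (\<integral>\<^sup>+x\<in>cball 0 R. ennreal (a n x) \<partial>lebesgue) + (\<integral>\<^sup>+x\<in>cball 0 R. ennreal (b n x) \<partial>lebesgue)) \<longlonglongrightarrow> 0 + 0"
  by (intro tendsto_add loc_nullD assms)
 moreover have "(\<integral>\<^sup>+x\<in>cball 0 R. ennreal (a n x + b n x) \<partial>lebesgue) =
  (\<integral>\<^sup>+x\<in>cball 0 R. ennreal (a n x) \<partial>lebesgue) + (\<integral>\<^sup>+x\<in>cball 0 R. ennreal (b n x) \<partial>lebesgue)" for n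
 proof -
  have [measurable]: "a n \<in> lmeas" "b n \<in> lmeas" by fact+
  show ?thesis by (subst nn_integral_add[symmetric], measurable) (simp add: assms ennreal_plus distrib_right)
 qed
 ultimately show "(\<lambda>n. \<integral>\<^sup>+x\<in>cball 0 R. ennreal (a n x + b n x) \<partial>lebesgue) \<longlonglongrightarrow> 0" by simp
qed

lemma loc_null_cmult:
 assumes "loc_null a" and [measurable]: "\<And>n. a n \<in> lmeas"
  and "C \<ge> 0" "\<And>n x. a n x \<ge> 0"
 shows "loc_null (\<lambda>n x. C * a n x)" unfolding loc_null_def
proof
 fix R
 have "(\<lambda>n. ennreal C * (\<integral>\<^sup>+x\<in>cball 0 R. ennreal (a n x) \<partial>lebesgue)) \<longlonglongrightarrow> ennreal C * 0"
  by (intro ennreal_tendsto_cmult loc_nullD assms) simp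
 moreover have "(\<integral>\<^sup>+x\<in>cball 0 R. ennreal (C * a n x) \<partial>lebesgue) = ennreal C * (\<integral>\<^sup>+x\<in>cball 0 R. ennreal (a n x) \<partial>lebesgue)" for n
 proof -
  have [measurable]: "a n \<in> lmeas" by fact
  show ?thesis by (subst nn_integral_cmult[symmetric], measurable) (simp add: assms ennreal_mult mult.assoc)
 qed
 ultimately show "(\<lambda>n. \<integral>\<^sup>+x\<in>cball 0 R. ennreal (C * a n x) \<partial>lebesgue) \<longlonglongrightarrow> 0" by simp
qed

lemma loc_null_subseq: "loc_null a \<Longrightarrow> strict_mono r \<Longrightarrow> loc_null (\<lambda>n. a (r n))"
 unfolding loc_null_def using LIMSEQ_subseq_LIMSEQ by (fastforce simp: comp_def)

lemma strict_mono_choice: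
 assumes "\<And>(n::nat) k. \<exists>m>k. P n (m::nat)"
 obtains r where "strict_mono r" "\<And>n. P n (r n)"
proof -
 have "\<exists>r. \<forall>n. P n (r n) \<and> r n < r (Suc n)" by (rule dependent_nat_choice) (use assms in blast)+
 then show thesis using that by (auto simp: strict_mono_Suc_iff)
qed

lemma loc_null_AE_subseq:
 assumes "loc_null a" and [measurable]: "\<And>n. a n \<in> lmeas" and nn: "\<And>n x. a n x \<ge> 0"
 obtains r where "strict_mono r" "AE x in lebesgue. (\<lambda>n. a (r n) x) \<longlonglongrightarrow> 0"
proof -
 have ex: "\<exists>m>k. (\<integral>\<^sup>+x\<in>cball 0 (real n). ennreal (a m x) \<partial>lebesgue) < ennreal ((1/2) ^ n)" for n k
 proof -
  have "eventually (\<lambda>m. (\<integral>\<^sup>+x\<in>cball 0 (real n). ennreal (a m x) \<partial>lebesgue) < ennreal ((1/2) ^ n)) sequentially"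
   by (rule order_tendstoD(2)[OF loc_nullD[OF assms(1)]]) simp
  then have "eventually (\<lambda>m. (\<integral>\<^sup>+x\<in>cball 0 (real n). ennreal (a m x) \<partial>lebesgue) < ennreal ((1/2) ^ n) \<and> m > k) sequentially"
   using eventually_gt_at_top by (rule eventually_conj)
  from eventually_happens'[OF sequentially_bot this] show ?thesis by blast
 qed
 obtain r where r: "strict_mono r" "\<And>n. (\<integral>\<^sup>+x\<in>cball 0 (real n). ennreal (a (r n) x) \<partial>lebesgue) < ennreal ((1/2) ^ n)"
  using strict_mono_choice[of "\<lambda>n m. (\<integral>\<^sup>+x\<in>cball 0 (real n). ennreal (a m x) \<partial>lebesgue) < ennreal ((1/2) ^ n)", OF ex] by blast
 have bd: "(\<integral>\<^sup>+x\<in>cball 0 (real n). ennreal (a (r n) x) \<partial>lebesgue) \<le> ennreal ((1/2) ^ n)" for n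
  using r(2)[of n] by (rule less_imp_le)
 have "(\<integral>\<^sup>+x. (\<Sum>n. ennreal (a (r n) x) * indicator (cball 0 (real n)) x) \<partial>lebesgue) =
  (\<Sum>n. \<integral>\<^sup>+x\<in>cball 0 (real n). ennreal (a (r n) x) \<partial>lebesgue)" by (rule nn_integral_suminf) measurable
 also have "\<dots> \<le> (\<Sum>n. ennreal ((1/2) ^ n))" by (intro suminf_le bd) auto
 also have "\<dots> = ennreal (\<Sum>n. (1/2) ^ n)" by (intro suminf_ennreal2) auto
 also have "\<dots> < \<infinity>" by simp
 finally have "AE x in lebesgue. (\<Sum>n. ennreal (a (r n) x) * indicator (cball 0 (real n)) x) \<noteq> \<infinity>"
  by (intro nn_integral_PInf_AE) (auto simp: less_top)
 then have "AE x in lebesgue. (\<lambda>n. a (r n) x) \<longlonglongrightarrow> 0"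
 proof eventually_elim
  fix x :: 'a
  assume *: "(\<Sum>n. ennreal (a (r n) x) * indicator (cball 0 (real n)) x) \<noteq> \<infinity>"
  have "(\<Sum>n. ennreal (a (r n) x * indicator (cball 0 (real n)) x)) \<noteq> \<infinity>" using * by (simp add: ennreal_mult'' ennreal_indicator)
  then have "summable (\<lambda>n. a (r n) x * indicator (cball 0 (real n)) x)" by (intro summable_suminf_not_top) (auto simp: nn)
  then have "(\<lambda>n. a (r n) x * indicator (cball 0 (real n)) x) \<longlonglongrightarrow> 0" by (rule summable_LIMSEQ_zero)
  moreover have "eventually (\<lambda>n. a (r n) x * indicator (cball 0 (real n)) x = a (r n) x) sequentially"
   using eventually_ge_at_top[of "nat \<lceil>norm x\<rceil>"] by eventually_elim (auto simp: indicator_def)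
  ultimately show "(\<lambda>n. a (r n) x) \<longlonglongrightarrow> 0" by (rule Lim_transform_eventually)
 qed
 then show thesis using that r(1) by blast
qed

lemma locally_integrable_measurable:
 fixes f :: "'a::euclidean_space \<Rightarrow> 'b::euclidean_space"
 assumes "locally_integrable f" shows "f \<in> lmeas"
proof (rule borel_measurable_LIMSEQ_metric)
 show "(\<lambda>x. indicator (cball 0 (real n)) x *\<^sub>R f x) \<in> lmeas" for n
 proof (rule borel_measurable_integrable)
  have "compact (cball (0::'a) (real n))" by simp
  then show "integrable lebesgue (\<lambda>x. indicator (cball 0 (real n)) x *\<^sub>R f x)"
   using assms unfolding locally_integrable_def set_integrable_def by blast
 qed
 show "(\<lambda>n. indicator (cball 0 (real n)) x *\<^sub>R f x) \<longlonglongrightarrow> f x" for x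
 proof (rule tendsto_eventually)
  show "eventually (\<lambda>n. indicator (cball 0 (real n)) x *\<^sub>R f x = f x) sequentially" using eventually_ge_at_top[of "nat \<lceil>norm x\<rceil>"]
  proof eventually_elim
   case (elim n)
   then have "norm x \<le> real n" by linarith
   then show ?case by simp
  qed
 qed
qed

lemma locally_integrableI:
 fixes f :: "'a::euclidean_space \<Rightarrow> 'b::euclidean_space"
 assumes [measurable]: "f \<in> lmeas"
  and fin: "\<And>R. (\<integral>\<^sup>+x\<in>cball 0 R. ennreal (norm (f x)) \<partial>lebesgue) < \<infinity>"
 shows "locally_integrable f" unfolding locally_integrable_def
proof safe
 fix K :: "'a set" assume "compact K"
 from bounded_subset_ballD[OF compact_imp_bounded[OF this], of 0] obtain R where R: "K \<subseteq> cball 0 R"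
  using ball_subset_cball by blast
 have [measurable]: "K \<in> sets lebesgue" using \<open>compact K\<close> by (simp add: compact_imp_closed)
 show "f absolutely_integrable_on K" unfolding set_integrable_def
 proof (rule integrableI_bounded)
  have "(\<integral>\<^sup>+x. ennreal (norm (indicator K x *\<^sub>R f x)) \<partial>lebesgue) \<le> (\<integral>\<^sup>+x\<in>cball 0 R. ennreal (norm (f x)) \<partial>lebesgue)"
   using R by (intro nn_integral_mono) (auto simp: indicator_def)
  then show "(\<integral>\<^sup>+x. ennreal (norm (indicator K x *\<^sub>R f x)) \<partial>lebesgue) < \<infinity>" using fin le_less_trans by blast
 qed measurable
qed

lemma locally_integrable_finite:
 assumes "locally_integrable f"
 shows "(\<integral>\<^sup>+x\<in>cball 0 R. ennreal (norm (f x)) \<partial>lebesgue) < \<infinity>"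
proof -
 have "integrable lebesgue (\<lambda>x. indicator (cball 0 R) x *\<^sub>R f x)"
  using assms compact_cball unfolding locally_integrable_def set_integrable_def by blast
 then have "(\<integral>\<^sup>+x. ennreal (norm (indicator (cball 0 R) x *\<^sub>R f x)) \<partial>lebesgue) < \<infinity>" by (simp add: integrable_iff_bounded)
 also have "(\<integral>\<^sup>+x. ennreal (norm (indicator (cball 0 R) x *\<^sub>R f x)) \<partial>lebesgue) =
  (\<integral>\<^sup>+x\<in>cball 0 R. ennreal (norm (f x)) \<partial>lebesgue)" by (intro nn_integral_cong) (auto simp: indicator_def)
 finally show ?thesis .
qed

lemma locally_integrable_bound:
 fixes f :: "'a::euclidean_space \<Rightarrow> 'b::euclidean_space" and g :: "'a \<Rightarrow> real"
 assumes [measurable]: "f \<in> lmeas" and "locally_integrable g" "AE x in lebesgue. norm (f x) \<le> g x"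
 shows "locally_integrable f"
proof (rule locally_integrableI[OF assms(1)])
 fix R
 have "(\<integral>\<^sup>+x\<in>cball 0 R. ennreal (norm (f x)) \<partial>lebesgue) \<le> (\<integral>\<^sup>+x\<in>cball 0 R. ennreal (norm (g x)) \<partial>lebesgue)"
 proof (rule nn_integral_mono_AE)
  show "AE x in lebesgue. ennreal (norm (f x)) * indicator (cball 0 R) x \<le> ennreal (norm (g x)) * indicator (cball 0 R) x"
   using assms(3) by eventually_elim (auto intro!: mult_right_mono ennreal_leI)
 qed
 then show "(\<integral>\<^sup>+x\<in>cball 0 R. ennreal (norm (f x)) \<partial>lebesgue) < \<infinity>"
  using locally_integrable_finite[OF assms(2), of R] by (rule le_less_trans)
qed

lemma locally_integrable_add:
 assumes "locally_integrable f" "locally_integrable g"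
 shows "locally_integrable (\<lambda>x. f x + g x)" using assms unfolding locally_integrable_def
 by (auto simp: set_integrable_def scaleR_add_right)

lemma locally_integrable_scaleR:
 fixes f :: "'a::euclidean_space \<Rightarrow> 'b::euclidean_space"
 assumes "locally_integrable f"
 shows "locally_integrable (\<lambda>x. c *\<^sub>R f x)" unfolding locally_integrable_def set_integrable_def
proof safe
 fix K :: "'a set" assume "compact K"
 then have "integrable lebesgue (\<lambda>x. c *\<^sub>R (indicator K x *\<^sub>R f x))"
  using assms by (intro integrable_scaleR_right) (auto simp: locally_integrable_def set_integrable_def)
 then show "integrable lebesgue (\<lambda>x. indicator K x *\<^sub>R c *\<^sub>R f x)" by (simp only: scaleR_left_commute)
qed

lemma locally_integrable_norm:
 assumes "locally_integrable f"
 shows "locally_integrable (\<lambda>x. norm (f x))"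
proof (rule locally_integrableI)
 show "(\<lambda>x. norm (f x)) \<in> lmeas" using locally_integrable_measurable[OF assms] by measurable
qed (use locally_integrable_finite[OF assms] in simp)

lemma loc_null_dominated:
 fixes w :: "'a::euclidean_space \<Rightarrow> real"
 assumes [measurable]: "\<And>n. a n \<in> lmeas" and w: "locally_integrable w"
  and "\<And>n. AE x in lebesgue. a n x \<le> w x" "AE x in lebesgue. (\<lambda>n. a n x) \<longlonglongrightarrow> 0"
 shows "loc_null a" unfolding loc_null_def
proof
 fix R
 note [measurable] = locally_integrable_measurable[OF w]
 have "(\<lambda>n. \<integral>\<^sup>+x\<in>cball 0 R. ennreal (a n x) \<partial>lebesgue) \<longlonglongrightarrow> (\<integral>\<^sup>+(x::'a). 0 \<partial>lebesgue)"
 proof (rule nn_integral_dominated_convergence[where w = "\<lambda>x. ennreal (norm (w x)) * indicator (cball 0 R) x"])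
  show "AE x in lebesgue. ennreal (a n x) * indicator (cball 0 R) x \<le> ennreal (norm (w x)) * indicator (cball 0 R) x" for n
   using assms(3)[of n] by eventually_elim (auto intro!: mult_right_mono ennreal_leI)
  show "AE x in lebesgue. (\<lambda>n. ennreal (a n x) * indicator (cball 0 R) x) \<longlonglongrightarrow> 0" using assms(4)
  proof eventually_elim
   case (elim x)
   then have "(\<lambda>n. ennreal (a n x)) \<longlonglongrightarrow> ennreal 0" by (rule tendsto_ennrealI)
   then show ?case by (auto simp: indicator_def)
  qed
 qed (use locally_integrable_finite[OF w, of R] in auto)
 then show "(\<lambda>n. \<integral>\<^sup>+x\<in>cball 0 R. ennreal (a n x) \<partial>lebesgue) \<longlonglongrightarrow> 0" by simp
qed

subsection \<open>Borel representatives\<close>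

lemma borel_version:
 fixes f :: "'a::euclidean_space \<Rightarrow> 'b::euclidean_space"
 assumes [measurable]: "f \<in> lmeas"
 obtains g where "g \<in> borel_measurable borel" "AE x in lebesgue. f x = g x"
proof -
 have "\<forall>b. \<exists>h. h \<in> borel_measurable lborel \<and> (AE x in lborel. f x \<bullet> b = h x)"
 proof
  fix b
  have "(\<lambda>x. f x \<bullet> b) \<in> lmeas" by measurable
  from completion_ex_borel_measurable_real[OF this]
  show "\<exists>h. h \<in> borel_measurable lborel \<and> (AE x in lborel. f x \<bullet> b = h x)" by blast
 qed
 then obtain h where h: "\<And>b. h b \<in> borel_measurable lborel" "\<And>b. AE x in lborel. f x \<bullet> b = h b x" by metis
 define g where "g x = (\<Sum>b\<in>Basis. h b x *\<^sub>R b)" for x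
 have "g \<in> borel_measurable borel" unfolding g_def using h(1) by simp
 moreover have "AE x in lborel. \<forall>b\<in>Basis. f x \<bullet> b = h b x" using h(2) by (intro AE_finite_allI) auto
 then have "AE x in lborel. f x = g x"
 proof eventually_elim
  case (elim x)
  then have "g x = (\<Sum>b\<in>Basis. (f x \<bullet> b) *\<^sub>R b)" by (simp add: g_def)
  then show ?case by (simp add: euclidean_representation)
 qed
 then have "AE x in lebesgue. f x = g x" by (rule AE_completion)
 ultimately show thesis using that by blast
qed

lemma loc_int_iff:
 assumes "u \<in> borel_measurable borel"
 shows "loc_int u \<longleftrightarrow> locally_integrable u"
proof
 assume "loc_int u"
 then have "integrable lborel (\<lambda>x. indicator (cball 0 R) x *\<^sub>R u x)" for R by (rule loc_int_integrable)
 then have "integrable lebesgue (\<lambda>x. indicator (cball 0 R) x *\<^sub>R u x)" for R using assms by (subst integrable_completion) auto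
 then show "locally_integrable u"
 proof (intro locally_integrableI)
  fix R
  assume *: "\<And>R. integrable lebesgue (\<lambda>x. indicator (cball 0 R) x *\<^sub>R u x)"
  have "(\<integral>\<^sup>+x. ennreal (norm (indicator (cball 0 R) x *\<^sub>R u x)) \<partial>lebesgue) < \<infinity>"
   using *[of R] by (simp add: integrable_iff_bounded)
  also have "(\<integral>\<^sup>+x. ennreal (norm (indicator (cball 0 R) x *\<^sub>R u x)) \<partial>lebesgue) =
   (\<integral>\<^sup>+x\<in>cball 0 R. ennreal (norm (u x)) \<partial>lebesgue)" by (intro nn_integral_cong) (auto simp: indicator_def)
  finally show "(\<integral>\<^sup>+x\<in>cball 0 R. ennreal (norm (u x)) \<partial>lebesgue) < \<infinity>" .
 qed (use assms in \<open>auto intro: measurable_completion\<close>)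
next
 assume "locally_integrable u"
 then have "integrable lebesgue (\<lambda>x. indicator (cball 0 R) x *\<^sub>R u x)" for R
  using compact_cball unfolding locally_integrable_def set_integrable_def by blast
 moreover have "(\<lambda>x. indicator (cball 0 R) x *\<^sub>R u x) \<in> borel_measurable lborel" for R
  using assms by (intro borel_measurable_scaleR borel_measurable_indicator) auto
 ultimately show "loc_int u" using assms integrable_completion unfolding loc_int_def by blast
qed

lemma locally_integrable_cong_AE:
 fixes f g :: "'a::euclidean_space \<Rightarrow> 'b::euclidean_space"
 assumes "locally_integrable f" "AE x in lebesgue. f x = g x" "g \<in> lmeas"
 shows "locally_integrable g" by (rule locally_integrable_bound[OF assms(3) locally_integrable_norm[OF assms(1)]])
  (use assms(2) in \<open>eventually_elim, simp\<close>)

lemma loc_int_version: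
 assumes "locally_integrable f"
 obtains g where "loc_int g" "AE x in lebesgue. f x = g x"
proof -
 obtain g where g: "g \<in> borel_measurable borel" "AE x in lebesgue. f x = g x"
  using borel_version[OF locally_integrable_measurable[OF assms]] by blast
 then have "locally_integrable g" by (intro locally_integrable_cong_AE[OF assms]) (auto intro: measurable_completion)
 then show thesis using that g loc_int_iff by blast
qed

lemma has_weak_gradient_locally_integrable:
 assumes "has_weak_gradient u G"
 shows "locally_integrable u" "locally_integrable G" using assms by (auto simp: has_weak_gradient_def)

lemma bounded_of_compact_support:
 fixes f :: "'a::euclidean_space \<Rightarrow> 'b::real_normed_vector"
 assumes "continuous_on UNIV f" "\<And>x. norm x > R \<Longrightarrow> f x = 0"
 shows "\<exists>B>0. \<forall>x. norm (f x) \<le> B" using assms by (rule continuous_compact_support_bounded[of f R]) auto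

lemma ennreal_tendsto_0_D:
 assumes "((\<lambda>n. ennreal (a n)) \<longlongrightarrow> 0) F" "\<And>n. a n \<ge> 0"
 shows "(a \<longlongrightarrow> 0) F" using assms tendsto_ennreal_iff[of a F 0] by simp

lemma test_integral_le:
 fixes f :: "'a::euclidean_space \<Rightarrow> real"
 assumes "f \<in> lmeas" "\<And>x. \<bar>f x\<bar> \<le> B * g x" "\<And>x. norm x > R \<Longrightarrow> f x = 0" "B \<ge> 0" "\<And>x. g x \<ge> 0"
  and "g \<in> lmeas"
 shows "ennreal \<bar>LINT x|lebesgue. f x\<bar> \<le> ennreal B * (\<integral>\<^sup>+x\<in>cball 0 R. ennreal (g x) \<partial>lebesgue)"
proof (cases "integrable lebesgue f")
 case True
 have [measurable]: "g \<in> lmeas" by fact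
 have "ennreal \<bar>LINT x|lebesgue. f x\<bar> \<le> (\<integral>\<^sup>+x. ennreal (norm (f x)) \<partial>lebesgue)" using integral_norm_bound_ennreal[OF True] by simp
 also have "\<dots> \<le> (\<integral>\<^sup>+x. ennreal B * (ennreal (g x) * indicator (cball 0 R) x) \<partial>lebesgue)"
 proof (rule nn_integral_mono)
  fix x
  show "ennreal (norm (f x)) \<le> ennreal B * (ennreal (g x) * indicator (cball 0 R) x)"
  proof (cases "norm x \<le> R")
   case True
   have "ennreal (norm (f x)) \<le> ennreal (B * g x)" using assms(2)[of x] by (intro ennreal_leI) simp
   then show ?thesis using True assms by (simp add: ennreal_mult)
  qed (use assms(3)[of x] in simp)
 qed
 also have "\<dots> = ennreal B * (\<integral>\<^sup>+x\<in>cball 0 R. ennreal (g x) \<partial>lebesgue)" by (rule nn_integral_cmult) measurable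
 finally show ?thesis .
qed (simp add: not_integrable_integral_eq)

lemma test_integrable:
 fixes f :: "'a::euclidean_space \<Rightarrow> 'c::euclidean_space" and u :: "'a \<Rightarrow> 'b::euclidean_space"
 assumes "f \<in> lmeas" "\<And>x. norm (f x) \<le> B * norm (u x)" "\<And>x. norm x > R \<Longrightarrow> f x = 0"
  and u: "locally_integrable u"
 shows "integrable lebesgue f"
proof (rule Bochner_Integration.integrable_bound)
 show "integrable lebesgue (\<lambda>x. B *\<^sub>R (indicator (cball 0 R) x *\<^sub>R u x))"
  using u compact_cball unfolding locally_integrable_def set_integrable_def by (intro integrable_scaleR_right) blast
 show "AE x in lebesgue. norm (f x) \<le> norm (B *\<^sub>R (indicator (cball 0 R) x *\<^sub>R u x))"
 proof (rule AE_I2)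
  fix x show "norm (f x) \<le> norm (B *\<^sub>R (indicator (cball 0 R) x *\<^sub>R u x))"
  proof (cases "norm x \<le> R")
   case True
   then show ?thesis using order_trans[OF assms(2)[of x] mult_right_mono[of B "\<bar>B\<bar>" "norm (u x)"]] by simp
  qed (use assms(3)[of x] in simp)
 qed
qed (use assms in simp)

lemma test_function_data:
 assumes "test_function \<phi>"
 obtains D R B where "C1_grad \<phi> D" "\<And>x. norm x > R \<Longrightarrow> \<phi> x = 0" "\<And>x. norm x > R \<Longrightarrow> D x = 0"
  "B > 0" "\<And>x. \<bar>\<phi> x\<bar> \<le> B" "\<And>x. norm (D x) \<le> B" "\<phi> \<in> lmeas" "D \<in> lmeas"
proof -
 obtain D R where D: "C1_grad \<phi> D" "\<And>x. norm x > R \<Longrightarrow> \<phi> x = 0" "\<And>x. norm x > R \<Longrightarrow> D x = 0" "R > 0"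
  by (rule test_function_C1[OF assms]) (rule that)
 obtain B1 where B1: "B1 > 0" "\<And>x. norm (\<phi> x) \<le> B1" using bounded_of_compact_support[OF C1_grad_continuous[OF D(1)] D(2)] by blast
 obtain B2 where B2: "B2 > 0" "\<And>x. norm (D x) \<le> B2"
  using bounded_of_compact_support[OF C1_grad_continuous_grad[OF D(1)] D(3)] by blast
 have "\<phi> \<in> lmeas" "D \<in> lmeas" by (rule measurable_completion, simp, rule borel_measurable_continuous_onI,
    rule C1_grad_continuous[OF D(1)] C1_grad_continuous_grad[OF D(1)])+
 moreover have "\<bar>\<phi> x\<bar> \<le> max B1 B2" "norm (D x) \<le> max B1 B2" for x using B1(2)[of x] B2(2)[of x] by auto
 ultimately show thesis using that[of D R "max B1 B2"] D(1-3) B1(1) by simp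
qed

lemma abs_inner_le_mult:
 fixes D b :: "'a::euclidean_space"
 assumes "norm D \<le> B" "b \<in> Basis" shows "\<bar>D \<bullet> b\<bar> \<le> B" using Basis_le_norm[OF assms(2), of D] assms(1) by simp

text \<open>Test functions and their derivatives are bounded with support in a ball, so both integrals of the
 defining identity converge.\<close>

lemma has_weak_gradient_limit:
 fixes u :: "'a::euclidean_space \<Rightarrow> real"
 assumes w: "\<And>n. has_weak_gradient (un n) (Gn n)"
  and cu: "loc_null (\<lambda>n x. \<bar>un n x - u x\<bar>)" and cG: "loc_null (\<lambda>n x. norm (Gn n x - G x))"
  and u: "locally_integrable u" and G: "locally_integrable G"
 shows "has_weak_gradient u G" unfolding has_weak_gradient_def
proof (intro conjI allI impI ballI u G)
 fix \<phi> :: "'a \<Rightarrow> real" and b :: 'a assume \<phi>: "test_function \<phi>" and b: "b \<in> Basis"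
 note un = has_weak_gradient_locally_integrable[OF w]
 note [measurable] = locally_integrable_measurable[OF u] locally_integrable_measurable[OF G]
  locally_integrable_measurable[OF un(1)] locally_integrable_measurable[OF un(2)]
 obtain D R B where D: "C1_grad \<phi> D" "\<And>x. norm x > R \<Longrightarrow> \<phi> x = 0" "\<And>x. norm x > R \<Longrightarrow> D x = 0"
  "B > 0" "\<And>x. \<bar>\<phi> x\<bar> \<le> B" "\<And>x. norm (D x) \<le> B"
  and [measurable]: "\<phi> \<in> lmeas" "D \<in> lmeas" by (rule test_function_data[OF \<phi>]) (rule that)
 have Db: "\<bar>D x \<bullet> b\<bar> \<le> B" for x by (rule abs_inner_le_mult[OF D(6) b])
 have fr: "frechet_derivative \<phi> (at x) b = D x \<bullet> b" for x by (rule C1_grad_frechet[OF D(1)])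
 have i1: "integrable lebesgue (\<lambda>x. v x * (D x \<bullet> b))" if v: "locally_integrable v" for v
 proof (rule test_integrable[OF _ _ _ v, where B = B and R = R])
  note [measurable] = locally_integrable_measurable[OF v]
  show "(\<lambda>x. v x * (D x \<bullet> b)) \<in> lmeas" by measurable
  show "norm (v x * (D x \<bullet> b)) \<le> B * norm (v x)" for x
   using mult_right_mono[OF Db[of x] abs_ge_zero[of "v x"]] by (simp add: abs_mult mult.commute)
 qed (use D in auto)
 have i2: "integrable lebesgue (\<lambda>x. (H x \<bullet> b) * \<phi> x)" if H: "locally_integrable H" for H
 proof (rule test_integrable[OF _ _ _ H, where B = B and R = R])
  note [measurable] = locally_integrable_measurable[OF H]
  show "(\<lambda>x. (H x \<bullet> b) * \<phi> x) \<in> lmeas" by measurable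
  show "norm ((H x \<bullet> b) * \<phi> x) \<le> B * norm (H x)" for x
   using mult_mono[OF D(5)[of x] Basis_le_norm[OF b, of "H x"]] D(4) by (simp add: abs_mult mult.commute)
 qed (use D in auto)
 have l1: "(\<lambda>n. LINT x|lebesgue. un n x * (D x \<bullet> b)) \<longlonglongrightarrow> (LINT x|lebesgue. u x * (D x \<bullet> b))"
 proof -
  have "(\<lambda>n. ennreal \<bar>LINT x|lebesgue. (un n x - u x) * (D x \<bullet> b)\<bar>) \<longlonglongrightarrow> 0"
  proof (rule ennreal_tendsto_0_le)
   have "(\<lambda>n. ennreal B * (\<integral>\<^sup>+x\<in>cball 0 R. ennreal \<bar>un n x - u x\<bar> \<partial>lebesgue)) \<longlonglongrightarrow> ennreal B * 0"
    by (intro ennreal_tendsto_cmult loc_nullD[OF cu]) simp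
   then show "(\<lambda>n. ennreal B * (\<integral>\<^sup>+x\<in>cball 0 R. ennreal \<bar>un n x - u x\<bar> \<partial>lebesgue)) \<longlonglongrightarrow> 0" by simp
   show "ennreal \<bar>LINT x|lebesgue. (un n x - u x) * (D x \<bullet> b)\<bar> \<le>
    ennreal B * (\<integral>\<^sup>+x\<in>cball 0 R. ennreal \<bar>un n x - u x\<bar> \<partial>lebesgue)" for n
   proof (rule test_integral_le)
    show "\<bar>(un n x - u x) * (D x \<bullet> b)\<bar> \<le> B * \<bar>un n x - u x\<bar>" for x
     using mult_right_mono[OF Db[of x] abs_ge_zero[of "un n x - u x"]] by (simp add: abs_mult mult.commute)
   qed (use D in auto)
  qed
  then have "(\<lambda>n. \<bar>LINT x|lebesgue. (un n x - u x) * (D x \<bullet> b)\<bar>) \<longlonglongrightarrow> 0" by (rule ennreal_tendsto_0_D) simp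
  moreover have "(LINT x|lebesgue. (un n x - u x) * (D x \<bullet> b)) =
   (LINT x|lebesgue. un n x * (D x \<bullet> b)) - (LINT x|lebesgue. u x * (D x \<bullet> b))" for n
   using i1[OF u] i1[OF un(1)] by (simp add: left_diff_distrib)
  ultimately show ?thesis by (simp add: tendsto_rabs_zero_iff LIM_zero_iff)
 qed
 have l2: "(\<lambda>n. LINT x|lebesgue. (Gn n x \<bullet> b) * \<phi> x) \<longlonglongrightarrow> (LINT x|lebesgue. (G x \<bullet> b) * \<phi> x)"
 proof -
  have "(\<lambda>n. ennreal \<bar>LINT x|lebesgue. ((Gn n x - G x) \<bullet> b) * \<phi> x\<bar>) \<longlonglongrightarrow> 0"
  proof (rule ennreal_tendsto_0_le)
   have "(\<lambda>n. ennreal B * (\<integral>\<^sup>+x\<in>cball 0 R. ennreal (norm (Gn n x - G x)) \<partial>lebesgue)) \<longlonglongrightarrow> ennreal B * 0"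
    by (intro ennreal_tendsto_cmult loc_nullD[OF cG]) simp
   then show "(\<lambda>n. ennreal B * (\<integral>\<^sup>+x\<in>cball 0 R. ennreal (norm (Gn n x - G x)) \<partial>lebesgue)) \<longlonglongrightarrow> 0" by simp
   show "ennreal \<bar>LINT x|lebesgue. ((Gn n x - G x) \<bullet> b) * \<phi> x\<bar> \<le>
    ennreal B * (\<integral>\<^sup>+x\<in>cball 0 R. ennreal (norm (Gn n x - G x)) \<partial>lebesgue)" for n
   proof (rule test_integral_le)
    show "\<bar>((Gn n x - G x) \<bullet> b) * \<phi> x\<bar> \<le> B * norm (Gn n x - G x)" for x
     using mult_mono[OF D(5)[of x] Basis_le_norm[OF b, of "Gn n x - G x"]] D(4) by (simp add: abs_mult mult.commute)
   qed (use D in auto)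
  qed
  then have "(\<lambda>n. \<bar>LINT x|lebesgue. ((Gn n x - G x) \<bullet> b) * \<phi> x\<bar>) \<longlonglongrightarrow> 0" by (rule ennreal_tendsto_0_D) simp
  moreover have "(LINT x|lebesgue. ((Gn n x - G x) \<bullet> b) * \<phi> x) =
   (LINT x|lebesgue. (Gn n x \<bullet> b) * \<phi> x) - (LINT x|lebesgue. (G x \<bullet> b) * \<phi> x)" for n
   using i2[OF G] i2[OF un(2)] by (simp add: left_diff_distrib inner_diff_left)
  ultimately show ?thesis by (simp add: tendsto_rabs_zero_iff LIM_zero_iff)
 qed
 have "(LINT x|lebesgue. un n x * (D x \<bullet> b)) = - (LINT x|lebesgue. (Gn n x \<bullet> b) * \<phi> x)" for n
 proof -
  have "(LINT x|lebesgue. un n x * frechet_derivative \<phi> (at x) b) = - (LINT x|lebesgue. (Gn n x \<bullet> b) * \<phi> x)"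
   using w[of n] \<phi> b by (simp add: has_weak_gradient_def)
  then show ?thesis by (simp only: fr)
 qed
 then have "(\<lambda>n. LINT x|lebesgue. un n x * (D x \<bullet> b)) \<longlonglongrightarrow> - (LINT x|lebesgue. (G x \<bullet> b) * \<phi> x)" using tendsto_minus[OF l2] by simp
 with l1 show "(LINT x|lebesgue. u x * frechet_derivative \<phi> (at x) b) = - (LINT x|lebesgue. (G x \<bullet> b) * \<phi> x)"
  unfolding fr using LIMSEQ_unique by blast
qed

text \<open>The difference quotients have integral zero by translation invariance.\<close>

lemma integral_C1_deriv_eq_0:
 fixes f :: "'a::euclidean_space \<Rightarrow> real"
 assumes f: "C1_grad f D" and supp: "\<And>x. norm x > R \<Longrightarrow> f x = 0"
 shows "(LINT x|lborel. D x \<bullet> b) = 0"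
proof -
 have supp': "D x = 0" if "norm x > R" for x using C1_grad_eq_0[OF f closed_cball, of 0 R x] supp that by auto
 have [measurable]: "f \<in> borel_measurable borel" "D \<in> borel_measurable borel"
  by (intro borel_measurable_continuous_onI C1_grad_continuous[OF f] C1_grad_continuous_grad[OF f])+
 obtain B where B: "B > 0" "\<And>x. norm (D x) \<le> B" using bounded_of_compact_support[OF C1_grad_continuous_grad[OF f] supp'] by blast
 obtain B' where B': "B' > 0" "\<And>x. norm (f x) \<le> B'" using bounded_of_compact_support[OF C1_grad_continuous[OF f] supp] by blast
 have intf: "integrable lborel f" by (rule integrable_compact_support[OF _ B'(2) supp]) measurable
 define q where "q n x = (f (x + (1 / real (Suc n)) *\<^sub>R b) - f x) * real (Suc n)" for n x
 have "(\<lambda>n. LINT x|lborel. q n x) \<longlonglongrightarrow> (LINT x|lborel. D x \<bullet> b)"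
 proof (rule integral_dominated_convergence[where w = "\<lambda>x. indicator (cball 0 (R + norm b)) x * (B * norm b)"])
  show "integrable lborel (\<lambda>x::'a. indicator (cball 0 (R + norm b)) x * (B * norm b))"
   using emeasure_lborel_cball_finite[of 0 "R + norm b"] by (intro integrable_mult_left integrable_real_indicator) auto
  show "AE x in lborel. (\<lambda>n. q n x) \<longlonglongrightarrow> D x \<bullet> b"
  proof (rule AE_I2)
   fix x
   have "((\<lambda>t. f (x + t *\<^sub>R b)) has_derivative (\<lambda>s. D (x + 0 *\<^sub>R b) \<bullet> (s *\<^sub>R b))) (at 0)"
    by (rule has_derivative_compose[OF _ C1_gradD[OF f]]) (auto intro!: derivative_eq_intros)
   moreover have "(\<lambda>s. D (x + 0 *\<^sub>R b) \<bullet> (s *\<^sub>R b)) = (*) (D x \<bullet> b)" by auto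
   ultimately have "((\<lambda>t. f (x + t *\<^sub>R b)) has_real_derivative (D x \<bullet> b)) (at 0)" unfolding has_field_derivative_def by simp
   then have "((\<lambda>h. (f (x + h *\<^sub>R b) - f x) / h) \<longlongrightarrow> D x \<bullet> b) (at 0)" by (simp add: DERIV_def)
   moreover have "filterlim (\<lambda>n. 1 / real (Suc n)) (at 0) sequentially"
    unfolding filterlim_at using LIMSEQ_Suc[OF lim_1_over_n] by (simp del: of_nat_Suc)
   ultimately have "(\<lambda>n. (f (x + (1 / real (Suc n)) *\<^sub>R b) - f x) / (1 / real (Suc n))) \<longlonglongrightarrow> D x \<bullet> b" by (rule filterlim_compose)
   then show "(\<lambda>n. q n x) \<longlonglongrightarrow> D x \<bullet> b" by (simp add: q_def)
  qed
  show "AE x in lborel. norm (q n x) \<le> indicator (cball 0 (R + norm b)) x * (B * norm b)" for n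
  proof (rule AE_I2)
   fix x
   show "norm (q n x) \<le> indicator (cball 0 (R + norm b)) x * (B * norm b)"
   proof (cases "norm x \<le> R + norm b")
    case True
    have "\<bar>f (x + (1 / real (Suc n)) *\<^sub>R b) - f x\<bar> \<le> B * norm ((1 / real (Suc n)) *\<^sub>R b)"
     using C1_grad_Lipschitz[OF f B(2), of "x + (1 / real (Suc n)) *\<^sub>R b" x] by simp
    then have "\<bar>f (x + (1 / real (Suc n)) *\<^sub>R b) - f x\<bar> * real (Suc n) \<le> B * norm ((1 / real (Suc n)) *\<^sub>R b) * real (Suc n)"
     by (rule mult_right_mono) simp
    also have "\<dots> = B * norm b" by simp
    finally show ?thesis using True by (simp add: q_def abs_mult)
   next
    case False
    have "norm ((1 / real (Suc n)) *\<^sub>R b) \<le> norm b" by (simp add: divide_le_eq mult_left_le mult_le_cancel_left1)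
    then have "norm (x + (1 / real (Suc n)) *\<^sub>R b) > R" using False norm_diff_ineq[of x "(1 / real (Suc n)) *\<^sub>R b"] by linarith
    moreover have "norm x > R" using False norm_ge_zero[of b] by linarith
    ultimately show ?thesis using supp False by (simp add: q_def)
   qed
  qed
  show "q n \<in> borel_measurable lborel" for n unfolding q_def by measurable
 qed measurable
 moreover have "(LINT x|lborel. q n x) = 0" for n
 proof -
  have "(LINT x|lborel. q n x) = ((LINT x|lborel. f (x + (1 / real (Suc n)) *\<^sub>R b)) - (LINT x|lborel. f x)) * real (Suc n)"
   using intf integral_translate(2)[of f "(1 / real (Suc n)) *\<^sub>R b"] by (simp add: q_def)
  also have "(LINT x|lborel. f (x + (1 / real (Suc n)) *\<^sub>R b)) = (LINT x|lborel. f x)" by (rule integral_translate(1)) measurable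
  finally show ?thesis by simp
 qed
 ultimately show ?thesis using LIMSEQ_unique[of "\<lambda>n. 0" 0] by fastforce
qed

lemma continuous_locally_integrable:
 fixes f :: "'a::euclidean_space \<Rightarrow> 'b::euclidean_space"
 assumes "continuous_on UNIV f"
 shows "locally_integrable f"
proof -
 have [measurable]: "f \<in> borel_measurable borel" using assms by (rule borel_measurable_continuous_onI)
 have "loc_int f" unfolding loc_int_def
 proof (intro conjI allI)
  fix R
  have "compact (f ` cball 0 R)" using assms by (intro compact_continuous_image) (auto intro: continuous_on_subset)
  then obtain B where B: "B > 0" "\<And>y. y \<in> f ` cball 0 R \<Longrightarrow> norm y \<le> B" by (meson bounded_pos compact_imp_bounded)
  show "integrable lborel (\<lambda>x. indicator (cball 0 R) x *\<^sub>R f x)"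
  proof (rule integrable_compact_support)
   show "(\<lambda>x. indicator (cball 0 R) x *\<^sub>R f x) \<in> borel_measurable borel"
    by (intro borel_measurable_scaleR borel_measurable_indicator) auto
   show "norm (indicator (cball 0 R) x *\<^sub>R f x) \<le> B" for x using B by (cases "norm x \<le> R") auto
   show "norm x > R \<Longrightarrow> indicator (cball 0 R) x *\<^sub>R f x = 0" for x by simp
  qed
 qed simp
 then show ?thesis by (subst (asm) loc_int_iff) simp_all
qed

lemma C1_has_weak_gradient:
 assumes f: "C1_grad f D"
 shows "has_weak_gradient f D" unfolding has_weak_gradient_def
proof (intro conjI allI impI ballI continuous_locally_integrable C1_grad_continuous[OF f] C1_grad_continuous_grad[OF f])
 fix \<phi> :: "'a \<Rightarrow> real" and b :: 'a assume \<phi>: "test_function \<phi>" and b: "b \<in> Basis"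
 obtain E R where E: "C1_grad \<phi> E" "\<And>x. norm x > R \<Longrightarrow> \<phi> x = 0" "\<And>x. norm x > R \<Longrightarrow> E x = 0" "R > 0"
  by (rule test_function_C1[OF \<phi>]) (rule that)
 have fr: "frechet_derivative \<phi> (at x) b = E x \<bullet> b" for x by (rule C1_grad_frechet[OF E(1)])
 have [measurable]: "f \<in> borel_measurable borel" "D \<in> borel_measurable borel" "\<phi> \<in> borel_measurable borel" "E \<in> borel_measurable borel"
  by (intro borel_measurable_continuous_onI C1_grad_continuous[OF f] C1_grad_continuous_grad[OF f]
    C1_grad_continuous[OF E(1)] C1_grad_continuous_grad[OF E(1)])+
 have i1: "integrable lborel (\<lambda>x. f x * (E x \<bullet> b))"
 proof -
  have c: "continuous_on UNIV (\<lambda>x. f x * (E x \<bullet> b))"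
   by (intro continuous_intros C1_grad_continuous[OF f] C1_grad_continuous_grad[OF E(1)])
  obtain B where "\<And>x. norm (f x * (E x \<bullet> b)) \<le> B" using bounded_of_compact_support[OF c, of R] E(3) by auto
  then show ?thesis by (rule integrable_compact_support[rotated, where R = R]) (use E(3) in auto)
 qed
 have i2: "integrable lborel (\<lambda>x. (D x \<bullet> b) * \<phi> x)"
 proof -
  have c: "continuous_on UNIV (\<lambda>x. (D x \<bullet> b) * \<phi> x)"
   by (intro continuous_intros C1_grad_continuous[OF E(1)] C1_grad_continuous_grad[OF f])
  obtain B where "\<And>x. norm ((D x \<bullet> b) * \<phi> x) \<le> B" using bounded_of_compact_support[OF c, of R] E(2) by auto
  then show ?thesis by (rule integrable_compact_support[rotated, where R = R]) (use E(2) in auto)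
 qed
 have "(LINT x|lborel. (f x *\<^sub>R E x + \<phi> x *\<^sub>R D x) \<bullet> b) = 0"
  by (rule integral_C1_deriv_eq_0[OF C1_grad_mult[OF f E(1)], of R]) (use E(2) in simp)
 then have "(LINT x|lborel. f x * (E x \<bullet> b)) = - (LINT x|lborel. (D x \<bullet> b) * \<phi> x)"
  using i1 i2 by (simp add: inner_add_left mult.commute)
 then show "(LINT x|lebesgue. f x * frechet_derivative \<phi> (at x) b) = - (LINT x|lebesgue. (D x \<bullet> b) * \<phi> x)"
  unfolding fr by (subst (1 2) integral_completion) simp_all
qed

lemma has_weak_gradient_cong_AE:
 assumes w: "has_weak_gradient u G" and "AE x in lebesgue. u x = u' x" "AE x in lebesgue. G x = G' x"
  and [measurable]: "u' \<in> lmeas" "G' \<in> lmeas"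
 shows "has_weak_gradient u' G'"
proof (rule has_weak_gradient_limit[where un = "\<lambda>_. u" and Gn = "\<lambda>_. G"])
 note l = has_weak_gradient_locally_integrable[OF w]
 have z: "loc_null (\<lambda>n x. 0 :: real)" by (simp add: loc_null_def)
 show "loc_null (\<lambda>n x. \<bar>u x - u' x\<bar>)" by (rule loc_null_mono[OF z]) (use assms(2) in \<open>eventually_elim, simp\<close>)
 show "loc_null (\<lambda>n x. norm (G x - G' x))" by (rule loc_null_mono[OF z]) (use assms(3) in \<open>eventually_elim, simp\<close>)
 show "locally_integrable u'" "locally_integrable G'" using locally_integrable_cong_AE l assms by blast+
qed (use w in simp)

section \<open>Smooth approximation and the chain rule\<close>

lemma has_weak_gradient_borel:
 fixes u :: "'a::euclidean_space \<Rightarrow> real"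
 assumes "has_weak_gradient u G"
 obtains u' G' where "loc_int u'" "loc_int G'" "AE x in lebesgue. u x = u' x" "AE x in lebesgue. G x = G' x"
  "\<And>\<phi> b. test_function \<phi> \<Longrightarrow> b \<in> Basis \<Longrightarrow>
    (LINT x|lborel. u' x * frechet_derivative \<phi> (at x) b) = - (LINT x|lborel. (G' x \<bullet> b) * \<phi> x)"
proof -
 obtain u' where u': "loc_int u'" "AE x in lebesgue. u x = u' x"
  using loc_int_version[OF has_weak_gradient_locally_integrable(1)[OF assms]] by blast
 obtain G' where G': "loc_int G'" "AE x in lebesgue. G x = G' x"
  using loc_int_version[OF has_weak_gradient_locally_integrable(2)[OF assms]] by blast
 note [measurable] = loc_int_measurable[OF u'(1)] loc_int_measurable[OF G'(1)]
 have w: "has_weak_gradient u' G'" by (rule has_weak_gradient_cong_AE[OF assms u'(2) G'(2)]) (auto intro: measurable_completion)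
 show thesis
 proof (rule that[OF u'(1) G'(1) u'(2) G'(2)])
  fix \<phi> :: "'a \<Rightarrow> real" and b :: 'a assume \<phi>: "test_function \<phi>" and b: "b \<in> Basis"
  obtain E R where E: "C1_grad \<phi> E" "\<And>x. norm x > R \<Longrightarrow> \<phi> x = 0" "\<And>x. norm x > R \<Longrightarrow> E x = 0" "R > 0"
   by (rule test_function_C1[OF \<phi>]) (rule that)
  have fr: "frechet_derivative \<phi> (at x) b = E x \<bullet> b" for x by (rule C1_grad_frechet[OF E(1)])
  have [measurable]: "\<phi> \<in> borel_measurable borel" "E \<in> borel_measurable borel"
   by (intro borel_measurable_continuous_onI C1_grad_continuous[OF E(1)] C1_grad_continuous_grad[OF E(1)])+
  have "(LINT x|lebesgue. u' x * frechet_derivative \<phi> (at x) b) = - (LINT x|lebesgue. (G' x \<bullet> b) * \<phi> x)"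
   using w \<phi> b by (simp add: has_weak_gradient_def)
  then show "(LINT x|lborel. u' x * frechet_derivative \<phi> (at x) b) = - (LINT x|lborel. (G' x \<bullet> b) * \<phi> x)"
   unfolding fr by (subst (asm) (1 2) integral_completion) simp_all
 qed
qed

lemma mollify_loc_null:
 assumes "loc_int u"
 shows "loc_null (\<lambda>n x. norm (mollify (1 / real (Suc n)) u x - u x))" unfolding loc_null_def
proof
 fix R
 show "(\<lambda>n. \<integral>\<^sup>+x\<in>cball 0 R. ennreal (norm (mollify (1 / real (Suc n)) u x - u x)) \<partial>lebesgue) \<longlonglongrightarrow> 0"
 proof (rule order_tendstoI)
  fix e :: ennreal assume "0 < e"
  then obtain e' :: real where e': "e' > 0" "ennreal e' < e"
   by (metis dense ennreal_cases ennreal_less_zero_iff less_top_ennreal order.strict_trans top.not_eq_extremum)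
  obtain d where d: "d > 0" "\<And>eps. eps > 0 \<Longrightarrow> eps < d \<Longrightarrow>
   (\<integral>\<^sup>+x\<in>cball 0 R. ennreal (norm (mollify eps u x - u x)) \<partial>lborel) \<le> ennreal e'"
   using mollify_L1_loc_close[OF assms e'(1)] by blast
  have "(\<lambda>n. 1 / real (Suc n)) \<longlonglongrightarrow> 0" by (rule LIMSEQ_Suc[OF lim_1_over_n])
  then have "eventually (\<lambda>n. 1 / real (Suc n) < d) sequentially" using order_tendstoD(2) d(1) by blast
  then show "eventually (\<lambda>n. (\<integral>\<^sup>+x\<in>cball 0 R. ennreal (norm (mollify (1 / real (Suc n)) u x - u x)) \<partial>lebesgue) < e) sequentially"
  proof eventually_elim
   case (elim n)
   have "(\<integral>\<^sup>+x\<in>cball 0 R. ennreal (norm (mollify (1 / real (Suc n)) u x - u x)) \<partial>lborel) \<le> ennreal e'"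
    using d(2)[of "1 / real (Suc n)"] elim by simp
   then show ?case using e'(2) unfolding nn_integral_completion by (rule le_less_trans)
  qed
 qed simp
qed

lemma weak_gradient_approx:
 assumes "has_weak_gradient u G"
 obtains un Gn where "\<And>n. C1_grad (un n) (Gn n)" "loc_null (\<lambda>n x. \<bar>un n x - u x\<bar>)"
  "loc_null (\<lambda>n x. norm (Gn n x - G x))"
  "\<And>n p. p > 1 \<Longrightarrow> (\<integral>\<^sup>+x. ennreal (norm (Gn n x) powr p) \<partial>lborel) \<le> (\<integral>\<^sup>+x. ennreal (norm (G x) powr p) \<partial>lebesgue)"
proof -
 obtain u' G' where u': "loc_int u'" and G': "loc_int G'" and ae: "AE x in lebesgue. u x = u' x" "AE x in lebesgue. G x = G' x"
  and weak: "\<And>\<phi> b. test_function \<phi> \<Longrightarrow> b \<in> Basis \<Longrightarrow>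
    (LINT x|lborel. u' x * frechet_derivative \<phi> (at x) b) = - (LINT x|lborel. (G' x \<bullet> b) * \<phi> x)"
  by (rule has_weak_gradient_borel[OF assms]) (rule that)
 define un where "un n = mollify (1 / real (Suc n)) u'" for n
 define Gn where "Gn n = mollify (1 / real (Suc n)) G'" for n
 show thesis
 proof (rule that[of un Gn])
  show "C1_grad (un n) (Gn n)" for n unfolding un_def Gn_def by (rule mollify_C1_grad[OF u' G']) (use weak in auto)
  show "loc_null (\<lambda>n x. \<bar>un n x - u x\<bar>)"
   by (rule loc_null_mono[OF mollify_loc_null[OF u']], use ae(1) in eventually_elim) (simp add: un_def)
  show "loc_null (\<lambda>n x. norm (Gn n x - G x))"
   by (rule loc_null_mono[OF mollify_loc_null[OF G']], use ae(2) in eventually_elim) (simp add: Gn_def)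
  show "(\<integral>\<^sup>+x. ennreal (norm (Gn n x) powr p) \<partial>lborel) \<le> (\<integral>\<^sup>+x. ennreal (norm (G x) powr p) \<partial>lebesgue)" if "p > 1" for n p
  proof -
   have "(\<integral>\<^sup>+x. ennreal (norm (Gn n x) powr p) \<partial>lborel) \<le> (\<integral>\<^sup>+x. ennreal (norm (G' x) powr p) \<partial>lborel)"
    unfolding Gn_def by (rule nn_integral_mollify_powr_le[OF G' _ that]) simp
   also have "\<dots> = (\<integral>\<^sup>+x. ennreal (norm (G' x) powr p) \<partial>lebesgue)" by (simp add: nn_integral_completion)
   also have "\<dots> = (\<integral>\<^sup>+x. ennreal (norm (G x) powr p) \<partial>lebesgue)"
    by (rule nn_integral_cong_AE) (use ae(2) in \<open>eventually_elim, simp\<close>)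
   finally show ?thesis .
  qed
 qed
qed

text \<open>Both gradients have the same mollifications, namely the gradients of the mollified function.\<close>

lemma weak_gradient_unique:
 assumes "has_weak_gradient u G" "has_weak_gradient u H"
 shows "AE x in lebesgue. G x = H x"
proof -
 obtain u1 G1 where u1: "loc_int u1" and G1: "loc_int G1" and ae1: "AE x in lebesgue. u x = u1 x" "AE x in lebesgue. G x = G1 x"
  and w1: "\<And>\<phi> b. test_function \<phi> \<Longrightarrow> b \<in> Basis \<Longrightarrow>
    (LINT x|lborel. u1 x * frechet_derivative \<phi> (at x) b) = - (LINT x|lborel. (G1 x \<bullet> b) * \<phi> x)"
  by (rule has_weak_gradient_borel[OF assms(1)]) (rule that)
 obtain u2 H1 where u2: "loc_int u2" and H1: "loc_int H1" and ae2: "AE x in lebesgue. u x = u2 x" "AE x in lebesgue. H x = H1 x"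
  and w2: "\<And>\<phi> b. test_function \<phi> \<Longrightarrow> b \<in> Basis \<Longrightarrow>
    (LINT x|lborel. u2 x * frechet_derivative \<phi> (at x) b) = - (LINT x|lborel. (H1 x \<bullet> b) * \<phi> x)"
  by (rule has_weak_gradient_borel[OF assms(2)]) (rule that)
 note [measurable] = loc_int_measurable[OF u1] loc_int_measurable[OF u2]
  loc_int_measurable[OF G1] loc_int_measurable[OF H1]
 have "AE x in lebesgue. u1 x = u2 x" using ae1(1) ae2(1) by eventually_elim simp
 then have ae: "AE x in lborel. u1 x = u2 x" by (simp add: AE_completion_iff)
 have eq: "mollify eps u1 = mollify eps u2" for eps
  unfolding mollify_def by (intro ext integral_cong_AE) (use ae in \<open>measurable, eventually_elim, simp\<close>)
 have C: "C1_grad (mollify eps u1) (mollify eps G1)" "C1_grad (mollify eps u1) (mollify eps H1)" if "eps > 0" for eps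
  using mollify_C1_grad[OF u1 G1 that w1] mollify_C1_grad[OF u2 H1 that w2] by (simp_all add: eq)
 have GH: "mollify eps G1 x = mollify eps H1 x" if "eps > 0" for eps x
 proof -
  have "(\<lambda>h. mollify eps G1 x \<bullet> h) = (\<lambda>h. mollify eps H1 x \<bullet> h)"
   using C1_gradD[OF C(1)[OF that], of x] C1_gradD[OF C(2)[OF that], of x] by (rule has_derivative_unique)
  then show ?thesis by (metis inner_eq_zero_iff inner_diff_left right_minus_eq)
 qed
 define e where "e n = 1 / real (Suc n)" for n
 have e: "e n > 0" for n by (simp add: e_def)
 have m[measurable]: "mollify (e n) G1 \<in> borel_measurable borel" "mollify (e n) H1 \<in> borel_measurable borel" for n
  by (intro borel_measurable_continuous_onI mollify_continuous G1 H1 e)+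
 have "loc_null (\<lambda>n x. norm (mollify (e n) G1 x - G1 x) + norm (mollify (e n) H1 x - H1 x))"
  by (rule loc_null_add[OF mollify_loc_null[OF G1, folded e_def] mollify_loc_null[OF H1, folded e_def]])
   (auto intro!: measurable_completion)
 then obtain r where "AE x in lebesgue. (\<lambda>n. norm (mollify (e (r n)) G1 x - G1 x) + norm (mollify (e (r n)) H1 x - H1 x)) \<longlonglongrightarrow> 0"
  by (rule loc_null_AE_subseq) (auto intro!: measurable_completion)
 then have "AE x in lebesgue. G1 x = H1 x"
 proof eventually_elim
  case (elim x)
  have "norm (G1 x - H1 x) \<le> 0"
  proof (rule LIMSEQ_le[OF tendsto_const elim])
   have "norm (G1 x - H1 x) \<le> norm (mollify (e (r n)) G1 x - G1 x) + norm (mollify (e (r n)) H1 x - H1 x)" for n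
    using norm_triangle_ineq4[of "mollify (e (r n)) H1 x - H1 x" "mollify (e (r n)) G1 x - G1 x"] GH[OF e, of "r n" x]
    by (simp add: add.commute)
   then show "\<exists>N. \<forall>n\<ge>N. norm (G1 x - H1 x) \<le> norm (mollify (e (r n)) G1 x - G1 x) + norm (mollify (e (r n)) H1 x - H1 x)" by blast
  qed
  then show ?case by simp
 qed
 then show ?thesis using ae1(2) ae2(2) by eventually_elim simp
qed

text \<open>The rule is classical for mollifications. In the limit the gradients converge in the mean, while the
 factors \<open>F1\<close> and \<open>F2\<close> are bounded and converge almost everywhere along a subsequence.\<close>

lemma has_weak_gradient_chain:
 fixes u v :: "'a::euclidean_space \<Rightarrow> real" and F :: "real \<Rightarrow> real \<Rightarrow> real"
 assumes uG: "has_weak_gradient u G" and vH: "has_weak_gradient v H"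
  and F: "\<And>s t. ((\<lambda>z. F (fst z) (snd z)) has_derivative (\<lambda>z. F1 s t * fst z + F2 s t * snd z)) (at (s, t))"
  and c1: "continuous_on UNIV (\<lambda>z. F1 (fst z) (snd z))" and c2: "continuous_on UNIV (\<lambda>z. F2 (fst z) (snd z))"
  and b1: "\<And>s t. \<bar>F1 s t\<bar> \<le> C" and b2: "\<And>s t. \<bar>F2 s t\<bar> \<le> C"
 shows "has_weak_gradient (\<lambda>x. F (u x) (v x)) (\<lambda>x. F1 (u x) (v x) *\<^sub>R G x + F2 (u x) (v x) *\<^sub>R H x)"
  and "\<And>s t s' t'. \<bar>F s t - F s' t'\<bar> \<le> 2 * C * (\<bar>s - s'\<bar> + \<bar>t - t'\<bar>)"
proof -
 have "C \<ge> 0" using b1[of 0 0] by simp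
 show Lip: "\<bar>F s t - F s' t'\<bar> \<le> 2 * C * (\<bar>s - s'\<bar> + \<bar>t - t'\<bar>)" for s t s' t'
 proof -
  have "norm (F (fst (s, t)) (snd (s, t)) - F (fst (s', t')) (snd (s', t'))) \<le> 2 * C * norm ((s, t) - (s', t'))"
  proof (rule differentiable_bound[of UNIV "\<lambda>z. F (fst z) (snd z)" "\<lambda>z w. F1 (fst z) (snd z) * fst w + F2 (fst z) (snd z) * snd w"])
   show "((\<lambda>z. F (fst z) (snd z)) has_derivative (\<lambda>w. F1 (fst z) (snd z) * fst w + F2 (fst z) (snd z) * snd w)) (at z within UNIV)" for z
    using F[of "fst z" "snd z"] by simp
   show "onorm (\<lambda>w. F1 (fst z) (snd z) * fst w + F2 (fst z) (snd z) * snd w) \<le> 2 * C" for z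
   proof (rule onorm_le)
    fix w :: "real \<times> real"
    have "\<bar>F1 (fst z) (snd z) * fst w\<bar> \<le> C * norm w"
     using mult_mono[OF b1[of "fst z" "snd z"] norm_fst_le[of "fst w" "snd w"]] \<open>C \<ge> 0\<close> by (simp add: abs_mult)
    moreover have "\<bar>F2 (fst z) (snd z) * snd w\<bar> \<le> C * norm w"
     using mult_mono[OF b2[of "fst z" "snd z"] norm_snd_le[of "snd w" "fst w"]] \<open>C \<ge> 0\<close> by (simp add: abs_mult)
    ultimately show "norm (F1 (fst z) (snd z) * fst w + F2 (fst z) (snd z) * snd w) \<le> 2 * C * norm w" by simp
   qed
  qed auto
  also have "\<dots> \<le> 2 * C * (\<bar>s - s'\<bar> + \<bar>t - t'\<bar>)" using norm_Pair_le[of "s - s'" "t - t'"] \<open>C \<ge> 0\<close> by (intro mult_left_mono) auto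
  finally show ?thesis by simp
 qed
 note lu = has_weak_gradient_locally_integrable[OF uG] and lv = has_weak_gradient_locally_integrable[OF vH]
 note [measurable] = locally_integrable_measurable[OF lu(1)] locally_integrable_measurable[OF lu(2)]
  locally_integrable_measurable[OF lv(1)] locally_integrable_measurable[OF lv(2)]
 have cF: "continuous_on UNIV (\<lambda>z. F (fst z) (snd z))"
  using F by (auto simp: continuous_on_eq_continuous_at intro!: has_derivative_continuous)
 have mF: "(\<lambda>x. K (f x) (g x)) \<in> borel_measurable M" if "continuous_on UNIV (\<lambda>z. K (fst z) (snd z))"
  "f \<in> borel_measurable M" "g \<in> borel_measurable M" for K :: "real \<Rightarrow> real \<Rightarrow> real" and f g and M :: "'a measure"
  by (rule borel_measurable_continuous_Pair[OF that(2,3,1)])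
 obtain un Gn where un: "\<And>n. C1_grad (un n) (Gn n)" "loc_null (\<lambda>n x. \<bar>un n x - u x\<bar>)"
  "loc_null (\<lambda>n x. norm (Gn n x - G x))" by (rule weak_gradient_approx[OF uG]) (rule that)
 obtain vn Hn where vn: "\<And>n. C1_grad (vn n) (Hn n)" "loc_null (\<lambda>n x. \<bar>vn n x - v x\<bar>)"
  "loc_null (\<lambda>n x. norm (Hn n x - H x))" by (rule weak_gradient_approx[OF vH]) (rule that)
 have [measurable]: "un n \<in> lmeas" "Gn n \<in> lmeas"
  "vn n \<in> lmeas" "Hn n \<in> lmeas" for n using C1_grad_continuous[OF un(1)] C1_grad_continuous_grad[OF un(1)]
   C1_grad_continuous[OF vn(1)] C1_grad_continuous_grad[OF vn(1)]
  by (auto intro!: measurable_completion borel_measurable_continuous_onI)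
 have uv: "loc_null (\<lambda>n x. \<bar>un n x - u x\<bar> + \<bar>vn n x - v x\<bar>)" by (rule loc_null_add[OF un(2) vn(2)]) auto
 then obtain r where r: "strict_mono r" "AE x in lebesgue. (\<lambda>n. \<bar>un (r n) x - u x\<bar> + \<bar>vn (r n) x - v x\<bar>) \<longlonglongrightarrow> 0"
  by (rule loc_null_AE_subseq) (auto intro: that)
 have ae: "AE x in lebesgue. (\<lambda>n. (un (r n) x, vn (r n) x)) \<longlonglongrightarrow> (u x, v x)" using r(2)
 proof eventually_elim
  case (elim x)
  have "(\<lambda>n. un (r n) x - u x) \<longlonglongrightarrow> 0" "(\<lambda>n. vn (r n) x - v x) \<longlonglongrightarrow> 0" by (rule Lim_null_comparison[OF _ elim]; simp)+
  then show ?case by (intro tendsto_Pair) (simp_all add: LIM_zero_iff)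
 qed
 \<comment> \<open>The gradient given by the chain rule for functions \<open>f\<close>, \<open>g\<close> with gradients \<open>V\<close>, \<open>W\<close>.\<close>
 define K where "K f g V W x = F1 (f x) (g x) *\<^sub>R V x + F2 (f x) (g x) *\<^sub>R W x" for f g :: "'a \<Rightarrow> real" and V W :: "'a \<Rightarrow> 'a" and x
 have mK[measurable]: "K f g V W \<in> lmeas" if "f \<in> lmeas" "g \<in> lmeas"
  "V \<in> lmeas" "W \<in> lmeas" for f g V W unfolding K_def[abs_def]
  by (intro borel_measurable_add borel_measurable_scaleR mF[OF c1 that(1,2)] mF[OF c2 that(1,2)] that(3,4))
 have w: "has_weak_gradient (\<lambda>x. F (un (r n) x) (vn (r n) x)) (K (un (r n)) (vn (r n)) (Gn (r n)) (Hn (r n)))" for n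
 proof (rule C1_has_weak_gradient, unfold C1_grad_def, intro conjI allI)
  fix x
  have "((\<lambda>x. (un (r n) x, vn (r n) x)) has_derivative (\<lambda>h. (Gn (r n) x \<bullet> h, Hn (r n) x \<bullet> h))) (at x)"
   by (intro has_derivative_Pair C1_gradD[OF un(1)] C1_gradD[OF vn(1)])
  note comp = has_derivative_compose[OF this F]
  have "(\<bullet>) (K (un (r n)) (vn (r n)) (Gn (r n)) (Hn (r n)) x) =
   (\<lambda>h. F1 (un (r n) x) (vn (r n) x) * (Gn (r n) x \<bullet> h) + F2 (un (r n) x) (vn (r n) x) * (Hn (r n) x \<bullet> h))"
   by (simp add: fun_eq_iff K_def inner_add_left)
  then show "((\<lambda>x. F (un (r n) x) (vn (r n) x)) has_derivative (\<bullet>) (K (un (r n)) (vn (r n)) (Gn (r n)) (Hn (r n)) x)) (at x)"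
   using comp by simp
  have c: "continuous_on UNIV (\<lambda>x. (un (r n) x, vn (r n) x))"
   by (intro continuous_intros C1_grad_continuous[OF un(1)] C1_grad_continuous[OF vn(1)])
  show "continuous_on UNIV (K (un (r n)) (vn (r n)) (Gn (r n)) (Hn (r n)))" unfolding K_def[abs_def]
   using continuous_on_compose2[OF c1 c] continuous_on_compose2[OF c2 c]
   by (intro continuous_intros C1_grad_continuous_grad[OF un(1)] C1_grad_continuous_grad[OF vn(1)]) auto
 qed
 have lF: "locally_integrable (\<lambda>x. F (u x) (v x))"
 proof (rule locally_integrable_bound)
  show "(\<lambda>x. F (u x) (v x)) \<in> lmeas" by (rule mF[OF cF]) measurable
  show "locally_integrable (\<lambda>x. \<bar>F 0 0\<bar> + ((2 * C) *\<^sub>R (norm (u x)) + (2 * C) *\<^sub>R (norm (v x))))"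
   by (intro locally_integrable_add locally_integrable_scaleR locally_integrable_norm lu lv
     continuous_locally_integrable continuous_intros)
  show "AE x in lebesgue. norm (F (u x) (v x)) \<le> \<bar>F 0 0\<bar> + ((2 * C) *\<^sub>R (norm (u x)) + (2 * C) *\<^sub>R (norm (v x)))"
  proof (rule AE_I2)
   fix x
   show "norm (F (u x) (v x)) \<le> \<bar>F 0 0\<bar> + ((2 * C) *\<^sub>R (norm (u x)) + (2 * C) *\<^sub>R (norm (v x)))"
    using Lip[of "u x" "v x" 0 0] by (simp add: distrib_left)
  qed
 qed
 have bK: "norm (K f g V W x) \<le> C * norm (V x) + C * norm (W x)" for f g V W x
 proof -
  have "norm (K f g V W x) \<le> \<bar>F1 (f x) (g x)\<bar> * norm (V x) + \<bar>F2 (f x) (g x)\<bar> * norm (W x)"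
   unfolding K_def by (rule order_trans[OF norm_triangle_ineq]) simp
  also have "\<dots> \<le> C * norm (V x) + C * norm (W x)" by (intro add_mono mult_right_mono b1 b2) auto
  finally show ?thesis .
 qed
 have lK: "locally_integrable (K u v G H)"
 proof (rule locally_integrable_bound)
  show "locally_integrable (\<lambda>x. C *\<^sub>R norm (G x) + C *\<^sub>R norm (H x))"
   by (intro locally_integrable_add locally_integrable_scaleR locally_integrable_norm lu lv)
  show "AE x in lebesgue. norm (K u v G H x) \<le> C *\<^sub>R norm (G x) + C *\<^sub>R norm (H x)" using bK by simp
 qed measurable
 have KK: "(\<lambda>x. F1 (u x) (v x) *\<^sub>R G x + F2 (u x) (v x) *\<^sub>R H x) = K u v G H" by (simp add: K_def fun_eq_iff)
 show "has_weak_gradient (\<lambda>x. F (u x) (v x)) (\<lambda>x. F1 (u x) (v x) *\<^sub>R G x + F2 (u x) (v x) *\<^sub>R H x)" unfolding KK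
 proof (rule has_weak_gradient_limit[OF w _ _ lF lK])
  have "loc_null (\<lambda>n x. (2 * C) * (\<bar>un (r n) x - u x\<bar> + \<bar>vn (r n) x - v x\<bar>))"
   by (rule loc_null_cmult[OF loc_null_subseq[OF uv r(1)]]) (use \<open>C \<ge> 0\<close> in auto)
  then show "loc_null (\<lambda>n x. \<bar>F (un (r n) x) (vn (r n) x) - F (u x) (v x)\<bar>)" by (rule loc_null_mono) (use Lip in auto)
  have 1: "loc_null (\<lambda>n x. C * (norm (Gn (r n) x - G x) + norm (Hn (r n) x - H x)))"
   by (rule loc_null_cmult[OF loc_null_subseq[OF loc_null_add[OF un(3) vn(3)] r(1)]]) (use \<open>C \<ge> 0\<close> in auto)
  have 2: "loc_null (\<lambda>n x. norm (K (un (r n)) (vn (r n)) G H x - K u v G H x))"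
  proof (rule loc_null_dominated)
   show "locally_integrable (\<lambda>x. (2 * C) *\<^sub>R norm (G x) + (2 * C) *\<^sub>R norm (H x))"
    by (intro locally_integrable_add locally_integrable_scaleR locally_integrable_norm lu lv)
   show "AE x in lebesgue. norm (K (un (r n)) (vn (r n)) G H x - K u v G H x) \<le> (2 * C) *\<^sub>R norm (G x) + (2 * C) *\<^sub>R norm (H x)" for n
   proof (rule AE_I2)
    fix x
    show "norm (K (un (r n)) (vn (r n)) G H x - K u v G H x) \<le> (2 * C) *\<^sub>R norm (G x) + (2 * C) *\<^sub>R norm (H x)"
     using norm_triangle_ineq4[of "K (un (r n)) (vn (r n)) G H x" "K u v G H x"]
      bK[of "un (r n)" "vn (r n)" G H x] bK[of u v G H x] by simp
   qed
   show "AE x in lebesgue. (\<lambda>n. norm (K (un (r n)) (vn (r n)) G H x - K u v G H x)) \<longlonglongrightarrow> 0" using ae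
   proof eventually_elim
    case (elim x)
    have "isCont (\<lambda>z. F1 (fst z) (snd z)) (u x, v x)" "isCont (\<lambda>z. F2 (fst z) (snd z)) (u x, v x)"
     using c1 c2 by (auto simp: continuous_on_eq_continuous_at)
    then have "(\<lambda>n. F1 (fst (un (r n) x, vn (r n) x)) (snd (un (r n) x, vn (r n) x))) \<longlonglongrightarrow> F1 (fst (u x, v x)) (snd (u x, v x))"
     "(\<lambda>n. F2 (fst (un (r n) x, vn (r n) x)) (snd (un (r n) x, vn (r n) x))) \<longlonglongrightarrow> F2 (fst (u x, v x)) (snd (u x, v x))"
     using isCont_tendsto_compose[OF _ elim] by blast+
    then have "(\<lambda>n. K (un (r n)) (vn (r n)) G H x) \<longlonglongrightarrow> K u v G H x" unfolding K_def by (intro tendsto_intros) simp_all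
    then show ?case by (simp add: tendsto_norm_zero LIM_zero)
   qed
  qed measurable
  show "loc_null (\<lambda>n x. norm (K (un (r n)) (vn (r n)) (Gn (r n)) (Hn (r n)) x - K u v G H x))"
  proof (rule loc_null_mono[OF loc_null_add[OF 1 2]])
   show "AE x in lebesgue. norm (K (un (r n)) (vn (r n)) (Gn (r n)) (Hn (r n)) x - K u v G H x) \<le>
    C * (norm (Gn (r n) x - G x) + norm (Hn (r n) x - H x)) + norm (K (un (r n)) (vn (r n)) G H x - K u v G H x)" for n
   proof (rule AE_I2)
    fix x
    have "K (un (r n)) (vn (r n)) (Gn (r n)) (Hn (r n)) x - K u v G H x =
      K (un (r n)) (vn (r n)) (\<lambda>x. Gn (r n) x - G x) (\<lambda>x. Hn (r n) x - H x) x +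
      (K (un (r n)) (vn (r n)) G H x - K u v G H x)" by (simp add: K_def algebra_simps)
    then show "norm (K (un (r n)) (vn (r n)) (Gn (r n)) (Hn (r n)) x - K u v G H x) \<le>
     C * (norm (Gn (r n) x - G x) + norm (Hn (r n) x - H x)) + norm (K (un (r n)) (vn (r n)) G H x - K u v G H x)"
     using norm_triangle_ineq[of "K (un (r n)) (vn (r n)) (\<lambda>x. Gn (r n) x - G x) (\<lambda>x. Hn (r n) x - H x) x"
       "K (un (r n)) (vn (r n)) G H x - K u v G H x"]
      bK[of "un (r n)" "vn (r n)" "\<lambda>x. Gn (r n) x - G x" "\<lambda>x. Hn (r n) x - H x" x] by (simp only: distrib_left)
   qed
  qed (use \<open>C \<ge> 0\<close> in auto)
 qed
qed

subsection \<open>Translations of Sobolev functions\<close>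

section \<open>Differences of translates\<close>

lemma nn_integral_lim_le:
 assumes "\<And>n. f n \<in> borel_measurable M" "AE x in M. (\<lambda>n. f n x) \<longlonglongrightarrow> g x" "\<And>n. (\<integral>\<^sup>+x. f n x \<partial>M) \<le> B"
 shows "(\<integral>\<^sup>+x. g x \<partial>M) \<le> (B :: ennreal)"
proof -
 have "(\<integral>\<^sup>+x. g x \<partial>M) = (\<integral>\<^sup>+x. liminf (\<lambda>n. f n x) \<partial>M)"
  by (rule nn_integral_cong_AE, use assms(2) in eventually_elim) (simp add: lim_imp_Liminf)
 also have "\<dots> \<le> liminf (\<lambda>n. \<integral>\<^sup>+x. f n x \<partial>M)" by (rule nn_integral_liminf[OF assms(1)])
 also have "\<dots> \<le> liminf (\<lambda>n. B)" by (intro Liminf_mono always_eventually allI assms(3))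
 also have "\<dots> = B" by (simp add: Liminf_const)
 finally show ?thesis .
qed

lemma AE_translate:
 fixes h :: "'a::euclidean_space"
 assumes "AE x in lborel. P x"
 shows "AE x in lborel. P (x + h)"
proof -
 obtain N where N: "{x \<in> space lborel. \<not> P x} \<subseteq> N" "N \<in> sets lborel" "emeasure lborel N = 0"
  using assms by (auto elim!: AE_E simp: null_sets_def)
 have "emeasure (distr lborel borel ((+) h)) N = 0" using N by (simp add: lborel_distr_plus)
 then have "emeasure lborel ((+) h -` N) = 0" using N(2) by (subst (asm) emeasure_distr) auto
 moreover have "(+) h -` N \<in> sets lborel" using measurable_sets[of "(+) h" borel borel N] N(2) by auto
 ultimately show ?thesis using N(1) by (intro AE_I'[of "(+) h -` N"]) (auto simp: null_sets_def add.commute)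
qed

lemma weak_gradient_translation_estimate:
 assumes w: "has_weak_gradient u G" and [measurable]: "u \<in> borel_measurable borel" and p: "p > 1"
 shows "(\<integral>\<^sup>+x. ennreal (\<bar>u (x + h) - u x\<bar> powr p) \<partial>lborel) \<le>
  ennreal (norm h powr p) * (\<integral>\<^sup>+x. ennreal (norm (G x) powr p) \<partial>lebesgue)"
proof -
 obtain un Gn where un: "\<And>n. C1_grad (un n) (Gn n)" "loc_null (\<lambda>n x. \<bar>un n x - u x\<bar>)"
  "loc_null (\<lambda>n x. norm (Gn n x - G x))"
  "\<And>n p. p > 1 \<Longrightarrow> (\<integral>\<^sup>+x. ennreal (norm (Gn n x) powr p) \<partial>lborel) \<le> (\<integral>\<^sup>+x. ennreal (norm (G x) powr p) \<partial>lebesgue)"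
  by (rule weak_gradient_approx[OF w]) (rule that)
 have m[measurable]: "un n \<in> borel_measurable borel" for n
  by (rule borel_measurable_continuous_onI[OF C1_grad_continuous[OF un(1)]])
 obtain r where "AE x in lebesgue. (\<lambda>n. \<bar>un (r n) x - u x\<bar>) \<longlonglongrightarrow> 0"
  by (rule loc_null_AE_subseq[OF un(2)]) (auto intro!: measurable_completion intro: that)
 then have "AE x in lborel. (\<lambda>n. \<bar>un (r n) x - u x\<bar>) \<longlonglongrightarrow> 0" by (simp add: AE_completion_iff)
 then have ae: "AE x in lborel. (\<lambda>n. un (r n) x) \<longlonglongrightarrow> u x" by eventually_elim (simp add: tendsto_rabs_zero_iff LIM_zero_iff)
 show ?thesis
 proof (rule nn_integral_lim_le)
  show "AE x in lborel. (\<lambda>n. ennreal (\<bar>un (r n) (x + h) - un (r n) x\<bar> powr p)) \<longlonglongrightarrow> ennreal (\<bar>u (x + h) - u x\<bar> powr p)"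
   using ae AE_translate[OF ae, of h] by eventually_elim (use p in \<open>auto intro!: tendsto_intros tendsto_powr2\<close>)
  show "(\<integral>\<^sup>+x. ennreal (\<bar>un (r n) (x + h) - un (r n) x\<bar> powr p) \<partial>lborel) \<le>
   ennreal (norm h powr p) * (\<integral>\<^sup>+x. ennreal (norm (G x) powr p) \<partial>lebesgue)" for n
   by (rule order_trans[OF C1_translation_estimate[OF un(1) p] mult_left_mono[OF un(4)[OF p]]]) simp
 qed measurable
qed

text \<open>The rate at which mollifications approach \<open>u\<close> depends on the gradient only. This is what makes bounded
 sets of Sobolev functions totally bounded.\<close>

lemma mollify_estimate:
 fixes u :: "'a::euclidean_space \<Rightarrow> real"
 assumes w: "has_weak_gradient u G" and m[measurable]: "u \<in> borel_measurable borel" and p: "p > 1" and eps: "eps > 0"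
 shows "(\<integral>\<^sup>+x. ennreal (\<bar>mollify eps u x - u x\<bar> powr p) \<partial>lborel) \<le>
  ennreal (eps powr p) * (\<integral>\<^sup>+x. ennreal (norm (G x) powr p) \<partial>lebesgue)"
proof -
 have u: "loc_int u" using w m loc_int_iff has_weak_gradient_locally_integrable by blast
 have "(\<integral>\<^sup>+x. ennreal (\<bar>mollify eps u x - u x\<bar> powr p) \<partial>lborel) \<le>
  (\<integral>\<^sup>+x. \<integral>\<^sup>+y. ennreal (bump eps y * \<bar>u (x + y) - u x\<bar> powr p) \<partial>lborel \<partial>lborel)"
 proof (rule nn_integral_mono)
  fix x
  have "ennreal (norm (LINT y|lborel. bump eps y *\<^sub>R (u (x + y) - u x)) powr p) \<le>
   (\<integral>\<^sup>+y. ennreal (bump eps y * norm (u (x + y) - u x) powr p) \<partial>lborel)"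
   using mollify_diff(2)[OF u eps] by (intro Jensen_powr p integrable_bump bump_nonneg[OF eps] integral_bump[OF eps]) auto
  then show "ennreal (\<bar>mollify eps u x - u x\<bar> powr p) \<le> (\<integral>\<^sup>+y. ennreal (bump eps y * \<bar>u (x + y) - u x\<bar> powr p) \<partial>lborel)"
   unfolding mollify_diff(1)[OF u eps] by simp
 qed
 also have "\<dots> = (\<integral>\<^sup>+y. \<integral>\<^sup>+x. ennreal (bump eps y * \<bar>u (x + y) - u x\<bar> powr p) \<partial>lborel \<partial>lborel)" by (rule Fubini_lborel) measurable
 also have "\<dots> \<le> (\<integral>\<^sup>+y. ennreal (bump eps (y::'a)) * (ennreal (eps powr p) * (\<integral>\<^sup>+x. ennreal (norm (G x) powr p) \<partial>lebesgue)) \<partial>lborel)"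
 proof (rule nn_integral_mono)
  fix y :: 'a
  have eq: "(\<integral>\<^sup>+x. ennreal (bump eps y * \<bar>u (x + y) - u x\<bar> powr p) \<partial>lborel) =
   ennreal (bump eps y) * (\<integral>\<^sup>+x. ennreal (\<bar>u (x + y) - u x\<bar> powr p) \<partial>lborel)"
   using bump_nonneg[OF eps, of y] by (simp add: ennreal_mult nn_integral_cmult)
  show "(\<integral>\<^sup>+x. ennreal (bump eps y * \<bar>u (x + y) - u x\<bar> powr p) \<partial>lborel) \<le>
   ennreal (bump eps y) * (ennreal (eps powr p) * (\<integral>\<^sup>+x. ennreal (norm (G x) powr p) \<partial>lebesgue))"
  proof (cases "norm y < eps")
   case True
   have "(\<integral>\<^sup>+x. ennreal (\<bar>u (x + y) - u x\<bar> powr p) \<partial>lborel) \<le>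
    ennreal (norm y powr p) * (\<integral>\<^sup>+x. ennreal (norm (G x) powr p) \<partial>lebesgue)"
    by (rule weak_gradient_translation_estimate[OF w m p])
   also have "\<dots> \<le> ennreal (eps powr p) * (\<integral>\<^sup>+x. ennreal (norm (G x) powr p) \<partial>lebesgue)"
    using True p by (intro mult_right_mono ennreal_leI powr_mono2) auto
   finally show ?thesis unfolding eq by (intro mult_left_mono) auto
  next
   case False
   then show ?thesis using bump_eq_0[OF eps, of y] by simp
  qed
 qed
 also have "\<dots> = ennreal (eps powr p) * (\<integral>\<^sup>+x. ennreal (norm (G x) powr p) \<partial>lebesgue)"
  using nn_integral_bump[OF eps, where ?'a = 'a] by (simp add: nn_integral_multc)
 finally show ?thesis .
qed

section \<open>Lebesgue and Sobolev functions\<close>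

definition pint :: "real \<Rightarrow> ('a::euclidean_space \<Rightarrow> 'b::euclidean_space) \<Rightarrow> real" where
 "pint p f = (LINT x|lebesgue. norm (f x) powr p)"

lemma Lp_measurable: "f \<in> Lp p \<Longrightarrow> f \<in> lmeas"
 and Lp_integrable: "f \<in> Lp p \<Longrightarrow> integrable lebesgue (\<lambda>x. norm (f x) powr p)" by (auto simp: Lp_def)

lemma pint_nonneg: "pint p f \<ge> 0"
 unfolding pint_def by (intro integral_nonneg_AE) simp

lemma pint_0 [simp]: "pint p (\<lambda>x. 0) = 0" by (simp add: pint_def)

lemma pint_cong_AE:
 fixes f :: "'a::euclidean_space \<Rightarrow> 'b::euclidean_space" and g :: "'a \<Rightarrow> 'c::euclidean_space"
 assumes "AE x in lebesgue. norm (f x) = norm (g x)" "f \<in> lmeas" "g \<in> lmeas"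
 shows "pint p f = pint p g" unfolding pint_def
proof (rule integral_cong_AE)
 note [measurable] = assms(2,3)
 show "(\<lambda>x. norm (f x) powr p) \<in> lmeas" "(\<lambda>x. norm (g x) powr p) \<in> lmeas" by measurable
 show "AE x in lebesgue. norm (f x) powr p = norm (g x) powr p" using assms(1) by eventually_elim simp
qed

lemma nn_integral_pint: "f \<in> Lp p \<Longrightarrow> (\<integral>\<^sup>+x. ennreal (norm (f x) powr p) \<partial>lebesgue) = ennreal (pint p f)"
 unfolding pint_def by (intro nn_integral_eq_integral Lp_integrable) auto

lemma Lp_bound:
 fixes f :: "'a::euclidean_space \<Rightarrow> 'b::euclidean_space"
 assumes m[measurable]: "f \<in> lmeas" and "integrable lebesgue g" "AE x in lebesgue. norm (f x) powr p \<le> g x"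
 shows "f \<in> Lp p" "pint p f \<le> (LINT x|lebesgue. g x)"
proof -
 have i: "integrable lebesgue (\<lambda>x. norm (f x) powr p)"
 proof (rule Bochner_Integration.integrable_bound[OF assms(2)])
  show "AE x in lebesgue. norm (norm (f x) powr p) \<le> norm (g x)" using assms(3) by eventually_elim simp
 qed measurable
 then show "f \<in> Lp p" using m by (simp add: Lp_def)
 show "pint p f \<le> (LINT x|lebesgue. g x)" unfolding pint_def by (rule integral_mono_AE[OF i assms(2,3)])
qed

lemma Lp_cong_AE:
 fixes f g :: "'a::euclidean_space \<Rightarrow> 'b::euclidean_space"
 assumes "f \<in> Lp p" "AE x in lebesgue. f x = g x" "g \<in> lmeas"
 shows "g \<in> Lp p" by (rule Lp_bound(1)[OF assms(3) Lp_integrable[OF assms(1)]]) (use assms(2) in \<open>eventually_elim, simp\<close>)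

lemma Lp_dominated:
 fixes f :: "'a::euclidean_space \<Rightarrow> 'b::euclidean_space" and g :: "'a \<Rightarrow> 'c::euclidean_space"
 assumes "f \<in> lmeas" "g \<in> Lp p" "AE x in lebesgue. norm (f x) \<le> C * norm (g x)" "p > 0" "C \<ge> 0"
 shows "f \<in> Lp p" "pint p f \<le> C powr p * pint p g"
proof -
 have "AE x in lebesgue. norm (f x) powr p \<le> C powr p * norm (g x) powr p" using assms(3)
 proof eventually_elim
  case (elim x)
  then have "norm (f x) powr p \<le> (C * norm (g x)) powr p" using assms by (intro powr_mono2) auto
  then show ?case using assms(5) by (simp add: powr_mult)
 qed
 with Lp_bound[OF assms(1), of "\<lambda>x. C powr p * norm (g x) powr p" p]
 show "f \<in> Lp p" "pint p f \<le> C powr p * pint p g" using Lp_integrable[OF assms(2)] by (auto simp: pint_def)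
qed

text \<open>The constant \<open>2\<^sup>p\<close> in place of Minkowski's inequality is harmless throughout.\<close>

lemma Lp_add:
 assumes "f \<in> Lp p" "g \<in> Lp p" "p > 0"
 shows "(\<lambda>x. f x + g x) \<in> Lp p" "pint p (\<lambda>x. f x + g x) \<le> 2 powr p * (pint p f + pint p g)"
proof -
 note [measurable] = Lp_measurable[OF assms(1)] Lp_measurable[OF assms(2)]
 have i: "integrable lebesgue (\<lambda>x. 2 powr p * (norm (f x) powr p + norm (g x) powr p))"
  using Lp_integrable[OF assms(1)] Lp_integrable[OF assms(2)] by simp
 have m: "(\<lambda>x. f x + g x) \<in> lmeas" by measurable
 have ae: "AE x in lebesgue. norm (f x + g x) powr p \<le> 2 powr p * (norm (f x) powr p + norm (g x) powr p)"
  using norm_add_powr[OF assms(3)] by auto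
 show "(\<lambda>x. f x + g x) \<in> Lp p" by (rule Lp_bound(1)[OF m i ae])
 have "pint p (\<lambda>x. f x + g x) \<le> (LINT x|lebesgue. 2 powr p * (norm (f x) powr p + norm (g x) powr p))"
  by (rule Lp_bound(2)[OF m i ae])
 also have "\<dots> = 2 powr p * (pint p f + pint p g)"
  using Lp_integrable[OF assms(1)] Lp_integrable[OF assms(2)] by (simp add: pint_def)
 finally show "pint p (\<lambda>x. f x + g x) \<le> 2 powr p * (pint p f + pint p g)" .
qed

lemma pint_scaleR: "pint p (\<lambda>x. c *\<^sub>R f x) = \<bar>c\<bar> powr p * pint p f"
 by (simp add: pint_def powr_mult)

lemma Lp_scaleR: "f \<in> Lp p \<Longrightarrow> (\<lambda>x. c *\<^sub>R f x) \<in> Lp p"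
 by (auto simp: Lp_def powr_mult)

lemma pint_uminus: "pint p (\<lambda>x. - f x) = pint p f" by (simp add: pint_def)

lemma pint_commute: "pint p (\<lambda>x. f x - g x) = pint p (\<lambda>x. g x - f x)"
 by (simp add: pint_def norm_minus_commute)

lemma Lp_uminus: "f \<in> Lp p \<Longrightarrow> (\<lambda>x. - f x) \<in> Lp p"
 by (auto simp: Lp_def)

lemma Lp_diff:
 assumes "f \<in> Lp p" "g \<in> Lp p" "p > 0"
 shows "(\<lambda>x. f x - g x) \<in> Lp p" "pint p (\<lambda>x. f x - g x) \<le> 2 powr p * (pint p f + pint p g)"
 using Lp_add[OF assms(1) Lp_uminus[OF assms(2)] assms(3)] by (simp_all add: pint_uminus)

lemma pint_triangle:
 assumes "f \<in> Lp p" "g \<in> Lp p" "h \<in> Lp p" "p > 0"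
 shows "pint p (\<lambda>x. f x - h x) \<le> 2 powr p * (pint p (\<lambda>x. f x - g x) + pint p (\<lambda>x. g x - h x))"
 using Lp_add(2)[OF Lp_diff(1)[OF assms(1,2,4)] Lp_diff(1)[OF assms(2,3,4)] assms(4)] by simp

lemma pint_eq_0_iff:
 assumes "f \<in> Lp p" shows "pint p f = 0 \<longleftrightarrow> (AE x in lebesgue. f x = 0)"
 unfolding pint_def using Lp_integrable[OF assms] by (subst integral_nonneg_eq_0_iff_AE) auto

lemma Lp_zero: "(\<lambda>x. 0) \<in> Lp p" by (simp add: Lp_def)

lemma Lp_locally_integrable:
 assumes "f \<in> Lp p" "p \<ge> 1"
 shows "locally_integrable f"
proof (rule locally_integrable_bound[OF Lp_measurable[OF assms(1)]])
 have "AE x in lebesgue. norm (f x) \<le> 1 + norm (f x) powr p"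
 proof (rule AE_I2)
  fix x show "norm (f x) \<le> 1 + norm (f x) powr p"
  proof (cases "norm (f x) \<le> 1")
   case False
   then show ?thesis using powr_mono[of 1 p "norm (f x)"] assms(2) by simp
  qed (simp add: add_increasing2)
 qed
 then show "AE x in lebesgue. norm (f x) \<le> 1 + norm (f x) powr p" .
 have "locally_integrable (\<lambda>x. norm (f x) powr p)"
 proof (rule locally_integrableI)
  show "(\<lambda>x. norm (f x) powr p) \<in> lmeas" using Lp_integrable[OF assms(1)] by auto
  fix R
  have "(\<integral>\<^sup>+x\<in>cball 0 R. ennreal (norm (norm (f x) powr p)) \<partial>lebesgue) \<le> (\<integral>\<^sup>+x. ennreal (norm (f x) powr p) \<partial>lebesgue)"
   by (intro nn_integral_mono) (auto simp: indicator_def)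
  also have "\<dots> < \<infinity>" by (simp add: nn_integral_pint[OF assms(1)])
  finally show "(\<integral>\<^sup>+x\<in>cball 0 R. ennreal (norm (norm (f x) powr p)) \<partial>lebesgue) < \<infinity>" .
 qed
 then show "locally_integrable (\<lambda>x. 1 + norm (f x) powr p)"
  by (rule locally_integrable_add[OF continuous_locally_integrable[OF continuous_on_const]])
qed

lemma Lp_tendsto_loc_null:
 fixes g :: "nat \<Rightarrow> 'a::euclidean_space \<Rightarrow> 'b::euclidean_space"
 assumes g: "\<And>n. g n \<in> Lp p" and lim: "(\<lambda>n. pint p (g n)) \<longlonglongrightarrow> 0" and p: "p > 1"
 shows "loc_null (\<lambda>n x. norm (g n x))" unfolding loc_null_def
proof
 fix R
 have [measurable]: "g n \<in> lmeas" for n by (rule Lp_measurable[OF g])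
 define V where "V = measure lebesgue (cball (0::'a) R)"
 have fin: "emeasure lebesgue (cball (0::'a) R) < \<infinity>" using emeasure_lborel_cball_finite[of "0::'a" R] by simp
 have V: "emeasure lebesgue (cball (0::'a) R) = ennreal V" "V \<ge> 0"
  unfolding V_def using fin by (auto simp: emeasure_eq_ennreal_measure)
 have le: "(\<integral>\<^sup>+x\<in>cball 0 R. ennreal (norm (g n x)) \<partial>lebesgue) \<le> ennreal (\<delta> * V + \<delta> powr (1 - p) * pint p (g n))"
  if "\<delta> > 0" for \<delta> n
 proof -
  have ptw: "norm (g n x) \<le> \<delta> + \<delta> powr (1 - p) * norm (g n x) powr p" for x
  proof (cases "norm (g n x) \<le> \<delta>")
   case False
   then have "norm (g n x) * (\<delta> powr (p - 1)) \<le> norm (g n x) * norm (g n x) powr (p - 1)"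
    using p that by (intro mult_left_mono powr_mono2) auto
   also have "\<dots> = norm (g n x) powr p" using False that by (simp add: powr_diff)
   finally have "norm (g n x) * \<delta> powr (p - 1) * \<delta> powr (1 - p) \<le> norm (g n x) powr p * \<delta> powr (1 - p)"
    by (intro mult_right_mono) auto
   then have "norm (g n x) * (\<delta> powr (p - 1) * \<delta> powr (1 - p)) \<le> \<delta> powr (1 - p) * norm (g n x) powr p"
    by (simp only: mult.assoc mult.commute[of "norm (g n x) powr p"])
   moreover have "\<delta> powr (p - 1) * \<delta> powr (1 - p) = 1" using that by (simp flip: powr_add)
   ultimately have "norm (g n x) \<le> \<delta> powr (1 - p) * norm (g n x) powr p" by simp
   then show ?thesis using that by simp
  qed (simp add: add_increasing2)
  have "(\<integral>\<^sup>+x\<in>cball 0 R. ennreal (norm (g n x)) \<partial>lebesgue) \<le>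
   (\<integral>\<^sup>+x. ennreal \<delta> * indicator (cball 0 R) x + ennreal (\<delta> powr (1 - p)) * ennreal (norm (g n x) powr p) \<partial>lebesgue)"
  proof (rule nn_integral_mono)
   fix x
   show "ennreal (norm (g n x)) * indicator (cball 0 R) x \<le>
    ennreal \<delta> * indicator (cball 0 R) x + ennreal (\<delta> powr (1 - p)) * ennreal (norm (g n x) powr p)"
    using ennreal_leI[OF ptw[of x]] that by (auto simp: indicator_def ennreal_plus ennreal_mult)
  qed
  also have "\<dots> = ennreal \<delta> * ennreal V + ennreal (\<delta> powr (1 - p)) * ennreal (pint p (g n))" by (subst nn_integral_add, measurable)
    (simp add: nn_integral_cmult nn_integral_cmult_indicator V nn_integral_pint[OF g])
  also have "\<dots> = ennreal (\<delta> * V + \<delta> powr (1 - p) * pint p (g n))"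
   using that V pint_nonneg[of p "g n"] by (simp add: ennreal_mult ennreal_plus)
  finally show ?thesis .
 qed
 show "(\<lambda>n. \<integral>\<^sup>+x\<in>cball 0 R. ennreal (norm (g n x)) \<partial>lebesgue) \<longlonglongrightarrow> 0"
 proof (rule order_tendstoI)
  fix e :: ennreal assume "0 < e"
  then obtain e' :: real where e': "e' > 0" "ennreal e' < e"
   by (metis dense ennreal_cases ennreal_less_zero_iff less_top_ennreal order.strict_trans top.not_eq_extremum)
  define \<delta> where "\<delta> = e' / (2 * (V + 1))"
  have \<delta>: "\<delta> > 0" "\<delta> * V \<le> e' / 2" using e' V by (auto simp: \<delta>_def field_simps)
  have "(\<lambda>n. \<delta> powr (1 - p) * pint p (g n)) \<longlonglongrightarrow> \<delta> powr (1 - p) * 0" by (intro tendsto_intros lim)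
  then have "eventually (\<lambda>n. \<delta> powr (1 - p) * pint p (g n) < e' / 2) sequentially"
   using order_tendstoD(2)[of _ 0 sequentially "e' / 2"] e' by simp
  then show "eventually (\<lambda>n. (\<integral>\<^sup>+x\<in>cball 0 R. ennreal (norm (g n x)) \<partial>lebesgue) < e) sequentially"
  proof eventually_elim
   case (elim n)
   have "(\<integral>\<^sup>+x\<in>cball 0 R. ennreal (norm (g n x)) \<partial>lebesgue) \<le> ennreal (\<delta> * V + \<delta> powr (1 - p) * pint p (g n))"
    by (rule le[OF \<delta>(1)])
   also have "\<dots> \<le> ennreal e'" using elim \<delta> by (intro ennreal_leI) simp
   finally show ?case using e'(2) by (rule le_less_trans)
  qed
 qed simp
qed

lemma Lp_tendsto_AE_subseq:
 fixes f :: "nat \<Rightarrow> 'a::euclidean_space \<Rightarrow> 'b::euclidean_space"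
 assumes f: "\<And>n. f n \<in> Lp p" "g \<in> Lp p" and lim: "(\<lambda>n. pint p (\<lambda>x. f n x - g x)) \<longlonglongrightarrow> 0" and p: "p > 1"
 obtains r where "strict_mono r" "AE x in lebesgue. (\<lambda>n. f (r n) x) \<longlonglongrightarrow> g x"
proof -
 have d: "(\<lambda>x. f n x - g x) \<in> Lp p" for n using Lp_diff(1)[OF f(1) f(2)] p by simp
 have "loc_null (\<lambda>n x. norm (f n x - g x))" by (rule Lp_tendsto_loc_null[OF d lim p])
 then obtain r where r: "strict_mono r" "AE x in lebesgue. (\<lambda>n. norm (f (r n) x - g x)) \<longlonglongrightarrow> 0"
  by (rule loc_null_AE_subseq) (use Lp_measurable[OF d] in \<open>auto intro: that\<close>)
 have "AE x in lebesgue. (\<lambda>n. f (r n) x) \<longlonglongrightarrow> g x" using r(2) by eventually_elim (simp add: tendsto_norm_zero_iff LIM_zero_iff)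
 then show thesis using that r(1) by blast
qed

text \<open>A subsequence with geometrically small differences converges almost everywhere; Fatou's lemma
 transfers the Cauchy estimate to the limit.\<close>

lemma Lp_complete:
 fixes f :: "nat \<Rightarrow> 'a::euclidean_space \<Rightarrow> 'b::euclidean_space"
 assumes f: "\<And>n. f n \<in> Lp p" and p: "p > 1"
  and cauchy: "\<And>e. e > 0 \<Longrightarrow> \<exists>N. \<forall>m\<ge>N. \<forall>n\<ge>N. pint p (\<lambda>x. f m x - f n x) \<le> e"
 obtains g where "g \<in> Lp p" "(\<lambda>n. pint p (\<lambda>x. f n x - g x)) \<longlonglongrightarrow> 0"
proof -
 have [measurable]: "f n \<in> lmeas" for n by (rule Lp_measurable[OF f])
 have d: "(\<lambda>x. f m x - f n x) \<in> Lp p" for m n using Lp_diff(1)[OF f f] p by simp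
 have ex: "\<exists>m>k. \<forall>i\<ge>m. \<forall>l\<ge>m. pint p (\<lambda>x. f i x - f l x) \<le> 4 powr (- p * real n)" for n k
 proof -
  obtain N where "\<forall>i\<ge>N. \<forall>l\<ge>N. pint p (\<lambda>x. f i x - f l x) \<le> 4 powr (- p * real n)" using cauchy[of "4 powr (- p * real n)"] by auto
  then show ?thesis by (intro exI[of _ "max N (Suc k)"]) auto
 qed
 obtain r where r: "strict_mono r" "\<And>n. \<forall>i\<ge>r n. \<forall>l\<ge>r n. pint p (\<lambda>x. f i x - f l x) \<le> 4 powr (- p * real n)"
  using strict_mono_choice[of "\<lambda>n m. \<forall>i\<ge>m. \<forall>l\<ge>m. pint p (\<lambda>x. f i x - f l x) \<le> 4 powr (- p * real n)", OF ex] by blast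
 define D where "D n x = f (r (Suc n)) x - f (r n) x" for n x
 have [measurable]: "D n \<in> lmeas" for n unfolding D_def[abs_def] by measurable
 have DL: "D n \<in> Lp p" for n unfolding D_def[abs_def] by (rule d)
 have "r n \<le> r (Suc n)" for n using strict_monoD[OF r(1), of n "Suc n"] by simp
 then have bd: "pint p (D n) \<le> 4 powr (- p * real n)" for n unfolding D_def[abs_def] using r(2)[of n] by simp
 have eq4: "2 powr (p * real n) * 4 powr (- p * real n) = (2 powr (- p)) ^ n" for n
 proof -
  have "(4::real) powr (- p * real n) = (2 powr 2) powr (- p * real n)" by simp
  also have "\<dots> = 2 powr (- 2 * p * real n)" by (subst powr_powr) (simp add: mult.assoc)
  finally have "2 powr (p * real n) * 4 powr (- p * real n) = 2 powr (- p * real n)" by (simp flip: powr_add)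
  also have "\<dots> = (2 powr (- p)) powr real n" by (simp only: powr_powr)
  finally show ?thesis by (simp add: powr_realpow)
 qed
 have "(\<integral>\<^sup>+x. (\<Sum>n. ennreal (2 powr (p * real n) * norm (D n x) powr p)) \<partial>lebesgue) =
  (\<Sum>n. \<integral>\<^sup>+x. ennreal (2 powr (p * real n) * norm (D n x) powr p) \<partial>lebesgue)" by (rule nn_integral_suminf) measurable
 also have "\<dots> \<le> (\<Sum>n. ennreal ((2 powr (- p)) ^ n))"
 proof (intro suminf_le)
  fix n
  have "(\<integral>\<^sup>+x. ennreal (2 powr (p * real n) * norm (D n x) powr p) \<partial>lebesgue) = ennreal (2 powr (p * real n) * pint p (D n))"
   using pint_nonneg[of p "D n"] by (simp add: ennreal_mult nn_integral_cmult nn_integral_pint[OF DL])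
  also have "\<dots> \<le> ennreal (2 powr (p * real n) * 4 powr (- p * real n))" by (intro ennreal_leI mult_left_mono bd) simp
  finally show "(\<integral>\<^sup>+x. ennreal (2 powr (p * real n) * norm (D n x) powr p) \<partial>lebesgue) \<le> ennreal ((2 powr (- p)) ^ n)"
   by (simp only: eq4)
 qed auto
 also have "\<dots> = ennreal (\<Sum>n. (2 powr (- p)) ^ n)" using p by (intro suminf_ennreal2 summable_geometric) (auto simp: powr_less_one)
 also have "\<dots> < \<infinity>" by simp
 finally have "AE x in lebesgue. (\<Sum>n. ennreal (2 powr (p * real n) * norm (D n x) powr p)) \<noteq> \<infinity>"
  by (intro nn_integral_PInf_AE) (auto simp: less_top)
 then have conv: "AE x in lebesgue. convergent (\<lambda>n. f (r n) x)"
 proof eventually_elim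
  case (elim x)
  then have "summable (\<lambda>n. 2 powr (p * real n) * norm (D n x) powr p)" by (intro summable_suminf_not_top) auto
  then have "(\<lambda>n. 2 powr (p * real n) * norm (D n x) powr p) \<longlonglongrightarrow> 0" by (rule summable_LIMSEQ_zero)
  then have "eventually (\<lambda>n. 2 powr (p * real n) * norm (D n x) powr p < 1) sequentially" by (rule order_tendstoD(2)) simp
  then have "eventually (\<lambda>n. norm (D n x) \<le> (1/2) ^ n) sequentially"
  proof eventually_elim
   case (elim n)
   have "(2 ^ n * norm (D n x)) powr p = 2 powr (p * real n) * norm (D n x) powr p"
    by (simp add: powr_mult powr_powr mult.commute flip: powr_realpow)
   then have "(2 ^ n * norm (D n x)) powr p < 1 powr p" using elim by simp
   then have "2 ^ n * norm (D n x) < 1" using p powr_mono2[of p 1 "2 ^ n * norm (D n x)"] by force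
   then show ?case by (simp add: field_simps)
  qed
  then have "summable (\<lambda>n. D n x)" by (intro summable_comparison_test_ev[OF _ summable_geometric]) auto
  then have "(\<lambda>n. \<Sum>i<n. D i x) \<longlonglongrightarrow> (\<Sum>n. D n x)" by (rule summable_LIMSEQ)
  moreover have "(\<Sum>i<n. D i x) = f (r n) x - f (r 0) x" for n unfolding D_def by (rule sum_lessThan_telescope)
  ultimately have "(\<lambda>n. f (r n) x - f (r 0) x + f (r 0) x) \<longlonglongrightarrow> (\<Sum>n. D n x) + f (r 0) x" by (intro tendsto_add) auto
  then show ?case by (auto simp: convergent_def)
 qed
 define g where "g x = lim (\<lambda>n. f (r n) x)" for x
 have [measurable]: "g \<in> lmeas" unfolding g_def by measurable
 have lim: "AE x in lebesgue. (\<lambda>n. f (r n) x) \<longlonglongrightarrow> g x" using conv by eventually_elim (simp add: g_def convergent_LIMSEQ_iff)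
 have est: "(\<integral>\<^sup>+x. ennreal (norm (f m x - g x) powr p) \<partial>lebesgue) \<le> ennreal e"
  if N: "\<forall>m\<ge>N. \<forall>n\<ge>N. pint p (\<lambda>x. f m x - f n x) \<le> e" "m \<ge> N" for m e N
 proof (rule nn_integral_lim_le)
  show "AE x in lebesgue. (\<lambda>n. ennreal (norm (f m x - f (r (n + N)) x) powr p)) \<longlonglongrightarrow> ennreal (norm (f m x - g x) powr p)" using lim
  proof eventually_elim
   case (elim x)
   have "(\<lambda>n. f (r (n + N)) x) \<longlonglongrightarrow> g x" using elim by (rule LIMSEQ_ignore_initial_segment)
   then show ?case using p by (intro tendsto_ennrealI tendsto_powr2 tendsto_intros) auto
  qed
  have "r (n + N) \<ge> N" for n using seq_suble[OF r(1), of "n + N"] by simp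
  then show "(\<integral>\<^sup>+x. ennreal (norm (f m x - f (r (n + N)) x) powr p) \<partial>lebesgue) \<le> ennreal e" for n
   using N by (subst nn_integral_pint[OF d]) (auto intro: ennreal_leI)
 qed measurable
 have gd: "(\<lambda>x. f m x - g x) \<in> Lp p" if "\<forall>m\<ge>N. \<forall>n\<ge>N. pint p (\<lambda>x. f m x - f n x) \<le> e" "m \<ge> N" for m e N
  unfolding Lp_def using est[OF that] le_less_trans[OF est[OF that] ennreal_less_top] by (auto intro!: integrableI_nonneg)
 obtain N1 where N1: "\<forall>m\<ge>N1. \<forall>n\<ge>N1. pint p (\<lambda>x. f m x - f n x) \<le> 1" using cauchy[of 1] by auto
 have "(\<lambda>x. f N1 x - (f N1 x - g x)) \<in> Lp p" using Lp_diff(1)[OF f[of N1] gd[OF N1, of N1]] p by simp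
 then have g: "g \<in> Lp p" by simp
 have gd': "(\<lambda>x. f m x - g x) \<in> Lp p" for m using Lp_diff(1)[OF f g] p by simp
 have "(\<lambda>n. pint p (\<lambda>x. f n x - g x)) \<longlonglongrightarrow> 0"
 proof (rule real_tendsto_0_I[OF pint_nonneg])
  fix e :: real assume "e > 0"
  then obtain N where N: "\<forall>m\<ge>N. \<forall>n\<ge>N. pint p (\<lambda>x. f m x - f n x) \<le> e" using cauchy by blast
  show "eventually (\<lambda>n. pint p (\<lambda>x. f n x - g x) \<le> e) sequentially" using eventually_ge_at_top[of N]
  proof eventually_elim
   case (elim n)
   then show ?case using est[OF N elim] \<open>e > 0\<close> by (subst (asm) nn_integral_pint[OF gd']) simp
  qed
 qed
 then show thesis using that g by blast
qed

subsection \<open>Sobolev functions\<close>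

lemma W1p_Lp: "u \<in> W1p p \<Longrightarrow> u \<in> Lp p" by (simp add: W1p_def)

lemma W1p_measurable: "u \<in> W1p p \<Longrightarrow> u \<in> lmeas" by (simp add: W1p_def Lp_def)

lemma W1pD:
 assumes "u \<in> W1p p"
 shows "has_weak_gradient u (grad u)" "grad u \<in> Lp p"
proof -
 obtain G where G: "G \<in> Lp p" "has_weak_gradient u G" using assms by (auto simp: W1p_def)
 show w: "has_weak_gradient u (grad u)" unfolding grad_def by (rule someI[of _ G]) (rule G)
 show "grad u \<in> Lp p" by (rule Lp_cong_AE[OF G(1) weak_gradient_unique[OF G(2) w]])
   (rule locally_integrable_measurable[OF has_weak_gradient_locally_integrable(2)[OF w]])
qed

lemma grad_measurable:
 fixes u :: "'a::euclidean_space \<Rightarrow> real"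
 shows "u \<in> W1p p \<Longrightarrow> grad u \<in> lmeas" by (rule Lp_measurable[OF W1pD(2)])

lemma W1pI:
 assumes "u \<in> Lp p" "G \<in> Lp p" "has_weak_gradient u G"
 shows "u \<in> W1p p" "AE x in lebesgue. grad u x = G x"
proof -
 show "u \<in> W1p p" using assms by (auto simp: W1p_def)
 then show "AE x in lebesgue. grad u x = G x" using weak_gradient_unique W1pD(1) assms(3) by blast
qed

lemma W1p_cong_AE:
 assumes u: "u \<in> W1p p" and ae: "AE x in lebesgue. u x = v x" and v: "v \<in> lmeas"
 shows "v \<in> W1p p" "AE x in lebesgue. grad v x = grad u x"
proof -
 have w: "has_weak_gradient v (grad u)" by (rule has_weak_gradient_cong_AE[OF W1pD(1)[OF u] ae _ v grad_measurable[OF u]]) simp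
 show "v \<in> W1p p" "AE x in lebesgue. grad v x = grad u x"
  using W1pI[OF Lp_cong_AE[OF W1p_Lp[OF u] ae v] W1pD(2)[OF u] w] by blast+
qed

lemma W1p_limit:
 fixes u :: "'a::euclidean_space \<Rightarrow> real"
 assumes un: "\<And>n. un n \<in> W1p p" and u: "u \<in> Lp p" and G: "G \<in> Lp p" and p: "p > 1"
  and lu: "(\<lambda>n. pint p (\<lambda>x. un n x - u x)) \<longlonglongrightarrow> 0" and lG: "(\<lambda>n. pint p (\<lambda>x. grad (un n) x - G x)) \<longlonglongrightarrow> 0"
 shows "u \<in> W1p p" "AE x in lebesgue. grad u x = G x"
proof -
 have "has_weak_gradient u G"
 proof (rule has_weak_gradient_limit[OF W1pD(1)[OF un]])
  have "loc_null (\<lambda>n x. norm (un n x - u x))"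
   by (rule Lp_tendsto_loc_null[OF Lp_diff(1)[OF W1p_Lp[OF un] u] lu p]) (use p in simp)
  then show "loc_null (\<lambda>n x. \<bar>un n x - u x\<bar>)" by simp
  show "loc_null (\<lambda>n x. norm (grad (un n) x - G x))"
   by (rule Lp_tendsto_loc_null[OF Lp_diff(1)[OF W1pD(2)[OF un] G] lG p]) (use p in simp)
 qed (use u G p in \<open>auto intro: Lp_locally_integrable\<close>)
 then show "u \<in> W1p p" "AE x in lebesgue. grad u x = G x" using W1pI[OF u G] by blast+
qed

lemma W1p_chain:
 fixes u v :: "'a::euclidean_space \<Rightarrow> real" and F :: "real \<Rightarrow> real \<Rightarrow> real"
 assumes u: "u \<in> W1p p" and v: "v \<in> W1p p" and p: "p > 1"
  and F: "\<And>s t. ((\<lambda>z. F (fst z) (snd z)) has_derivative (\<lambda>z. F1 s t * fst z + F2 s t * snd z)) (at (s, t))"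
  and c1: "continuous_on UNIV (\<lambda>z. F1 (fst z) (snd z))" and c2: "continuous_on UNIV (\<lambda>z. F2 (fst z) (snd z))"
  and b1: "\<And>s t. \<bar>F1 s t\<bar> \<le> C" and b2: "\<And>s t. \<bar>F2 s t\<bar> \<le> C" and F0: "F 0 0 = 0"
 shows "(\<lambda>x. F (u x) (v x)) \<in> W1p p"
  "AE x in lebesgue. grad (\<lambda>x. F (u x) (v x)) x = F1 (u x) (v x) *\<^sub>R grad u x + F2 (u x) (v x) *\<^sub>R grad v x"
proof -
 have "C \<ge> 0" using b1[of 0 0] by simp
 note wc = has_weak_gradient_chain[OF W1pD(1)[OF u] W1pD(1)[OF v] F c1 c2 b1 b2]
 note li = has_weak_gradient_locally_integrable[OF wc(1)]
 have 1: "(\<lambda>x. F (u x) (v x)) \<in> Lp p"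
 proof (rule Lp_dominated(1)[where g = "\<lambda>x. \<bar>u x\<bar> + \<bar>v x\<bar>" and C = "2 * C"])
  show "(\<lambda>x. F (u x) (v x)) \<in> lmeas" by (rule locally_integrable_measurable[OF li(1)])
  have "(\<lambda>x. \<bar>u x\<bar>) \<in> Lp p" "(\<lambda>x. \<bar>v x\<bar>) \<in> Lp p" using W1p_Lp[OF u] W1p_Lp[OF v] by (auto simp: Lp_def)
  then show "(\<lambda>x. \<bar>u x\<bar> + \<bar>v x\<bar>) \<in> Lp p" using p by (intro Lp_add) auto
  show "AE x in lebesgue. norm (F (u x) (v x)) \<le> 2 * C * norm (\<bar>u x\<bar> + \<bar>v x\<bar>)"
  proof (rule AE_I2)
   fix x show "norm (F (u x) (v x)) \<le> 2 * C * norm (\<bar>u x\<bar> + \<bar>v x\<bar>)" using wc(2)[of "u x" "v x" 0 0] F0 by simp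
  qed
 qed (use p \<open>C \<ge> 0\<close> in auto)
 have 2: "(\<lambda>x. F1 (u x) (v x) *\<^sub>R grad u x + F2 (u x) (v x) *\<^sub>R grad v x) \<in> Lp p"
 proof (rule Lp_dominated(1)[where g = "\<lambda>x. norm (grad u x) + norm (grad v x)" and C = C])
  show "(\<lambda>x. F1 (u x) (v x) *\<^sub>R grad u x + F2 (u x) (v x) *\<^sub>R grad v x) \<in> lmeas" by (rule locally_integrable_measurable[OF li(2)])
  have "(\<lambda>x. norm (grad u x)) \<in> Lp p" "(\<lambda>x. norm (grad v x)) \<in> Lp p" using W1pD(2)[OF u] W1pD(2)[OF v] by (auto simp: Lp_def)
  then show "(\<lambda>x. norm (grad u x) + norm (grad v x)) \<in> Lp p" using p by (intro Lp_add) auto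
  show "AE x in lebesgue. norm (F1 (u x) (v x) *\<^sub>R grad u x + F2 (u x) (v x) *\<^sub>R grad v x) \<le> C * norm (norm (grad u x) + norm (grad v x))"
  proof (rule AE_I2)
   fix x
   have "norm (F1 (u x) (v x) *\<^sub>R grad u x + F2 (u x) (v x) *\<^sub>R grad v x) \<le>
    \<bar>F1 (u x) (v x)\<bar> * norm (grad u x) + \<bar>F2 (u x) (v x)\<bar> * norm (grad v x)" by (rule order_trans[OF norm_triangle_ineq]) simp
   also have "\<dots> \<le> C * norm (grad u x) + C * norm (grad v x)" by (intro add_mono mult_right_mono b1 b2) auto
   finally show "norm (F1 (u x) (v x) *\<^sub>R grad u x + F2 (u x) (v x) *\<^sub>R grad v x) \<le> C * norm (norm (grad u x) + norm (grad v x))"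
    by (simp add: distrib_left)
  qed
 qed (use p \<open>C \<ge> 0\<close> in auto)
 show "(\<lambda>x. F (u x) (v x)) \<in> W1p p"
  "AE x in lebesgue. grad (\<lambda>x. F (u x) (v x)) x = F1 (u x) (v x) *\<^sub>R grad u x + F2 (u x) (v x) *\<^sub>R grad v x"
  using W1pI[OF 1 2 wc(1)] by blast+
qed

lemma W1p_lincomb:
 assumes u: "u \<in> W1p p" and v: "v \<in> W1p p" and p: "p > 1"
 shows "(\<lambda>x. a * u x + b * v x) \<in> W1p p" "AE x in lebesgue. grad (\<lambda>x. a * u x + b * v x) x = a *\<^sub>R grad u x + b *\<^sub>R grad v x"
proof -
 have "((\<lambda>z. a * fst z + b * snd z) has_derivative (\<lambda>z. a * fst z + b * snd z)) (at (s, t))" for s t :: real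
  by (auto intro!: derivative_eq_intros)
 note * = W1p_chain[OF u v p, where F = "\<lambda>s t. a * s + b * t" and ?F1.0 = "\<lambda>s t. a" and ?F2.0 = "\<lambda>s t. b"
   and C = "max \<bar>a\<bar> \<bar>b\<bar>", OF this]
 show "(\<lambda>x. a * u x + b * v x) \<in> W1p p" by (rule *(1)) auto
 show "AE x in lebesgue. grad (\<lambda>x. a * u x + b * v x) x = a *\<^sub>R grad u x + b *\<^sub>R grad v x" by (rule *(2)) auto
qed

lemma W1p_chain1:
 fixes u :: "'a::euclidean_space \<Rightarrow> real" and f :: "real \<Rightarrow> real"
 assumes u: "u \<in> W1p p" and p: "p > 1"
  and f: "\<And>s. (f has_real_derivative f' s) (at s)" and c: "continuous_on UNIV f'"
  and b: "\<And>s. \<bar>f' s\<bar> \<le> C" and f0: "f 0 = 0"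
 shows "(\<lambda>x. f (u x)) \<in> W1p p" "AE x in lebesgue. grad (\<lambda>x. f (u x)) x = f' (u x) *\<^sub>R grad u x"
proof -
 have "C \<ge> 0" using b[of 0] by simp
 have d: "((\<lambda>z. f (fst z)) has_derivative (\<lambda>z. f' s * fst z + 0 * snd z)) (at (s, t))" for s t :: real
 proof -
  have "((\<lambda>z. f (fst z)) has_derivative (\<lambda>z. f' s * fst z)) (at (s, t))"
   by (rule has_derivative_compose[of fst fst _ _ f "(*) (f' s)"])
    (use f[of s] in \<open>auto intro!: derivative_intros simp: has_field_derivative_def has_derivative_at_withinI\<close>)
  then show ?thesis by simp
 qed
 have cc: "continuous_on UNIV (\<lambda>z::real\<times>real. f' (fst z))" by (rule continuous_on_compose2[OF c]) (auto intro: continuous_intros)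
 from W1p_chain[OF u u p, where F = "\<lambda>s t. f s" and ?F1.0 = "\<lambda>s t. f' s" and ?F2.0 = "\<lambda>s t. 0", OF d cc _ b]
 show "(\<lambda>x. f (u x)) \<in> W1p p" "AE x in lebesgue. grad (\<lambda>x. f (u x)) x = f' (u x) *\<^sub>R grad u x" using f0 \<open>C \<ge> 0\<close> by auto
qed

lemma Lp_dominated_convergence:
 fixes f :: "nat \<Rightarrow> 'a::euclidean_space \<Rightarrow> 'b::euclidean_space" and w :: "'a \<Rightarrow> real"
 assumes [measurable]: "\<And>n. f n \<in> lmeas" "g \<in> lmeas" and w: "w \<in> Lp p"
  and le: "\<And>n. AE x in lebesgue. norm (f n x) \<le> w x" and lim: "AE x in lebesgue. (\<lambda>n. f n x) \<longlonglongrightarrow> g x" and p: "p > 1"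
 shows "\<And>n. f n \<in> Lp p" "g \<in> Lp p" "(\<lambda>n. pint p (\<lambda>x. f n x - g x)) \<longlonglongrightarrow> 0"
proof -
 have all: "AE x in lebesgue. \<forall>n. norm (f n x) \<le> w x" using le by (simp add: AE_all_countable)
 have gle: "AE x in lebesgue. norm (g x) \<le> w x" using all lim
 proof eventually_elim
  case (elim x)
  then show ?case by (intro LIMSEQ_le_const2[OF tendsto_norm[OF elim(2)]]) auto
 qed
 show fL: "f n \<in> Lp p" for n by (rule Lp_dominated(1)[OF _ w, where C = 1]) (use le[of n] p in \<open>auto elim: eventually_mono\<close>)
 show gL: "g \<in> Lp p" by (rule Lp_dominated(1)[OF _ w, where C = 1]) (use gle p in \<open>auto elim: eventually_mono\<close>)
 have "(\<lambda>n. LINT x|lebesgue. norm (f n x - g x) powr p) \<longlonglongrightarrow> (LINT x|(lebesgue :: 'a measure). 0)"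
 proof (rule integral_dominated_convergence[where w = "\<lambda>x. 2 powr p * norm (w x) powr p"])
  show "integrable lebesgue (\<lambda>x. 2 powr p * norm (w x) powr p)" using Lp_integrable[OF w] by simp
  show "AE x in lebesgue. (\<lambda>n. norm (f n x - g x) powr p) \<longlonglongrightarrow> 0" using lim
  proof eventually_elim
   case (elim x)
   then have "(\<lambda>n. norm (f n x - g x)) \<longlonglongrightarrow> 0" by (simp add: LIM_zero tendsto_norm_zero)
   then have "(\<lambda>n. norm (f n x - g x) powr p) \<longlonglongrightarrow> 0 powr p" using p by (intro tendsto_powr2 tendsto_intros) auto
   then show ?case using p by simp
  qed
  show "AE x in lebesgue. norm (norm (f n x - g x) powr p) \<le> 2 powr p * norm (w x) powr p" for n using all gle
  proof eventually_elim
   case (elim x)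
   have "norm (f n x - g x) \<le> 2 * norm (w x)"
    using norm_triangle_ineq4[of "f n x" "g x"] elim by (simp add: abs_if) (smt (verit) elim norm_ge_zero)
   then have "norm (f n x - g x) powr p \<le> (2 * norm (w x)) powr p" using p by (intro powr_mono2) auto
   then show ?case by (simp add: powr_mult)
  qed
 qed measurable
 then show "(\<lambda>n. pint p (\<lambda>x. f n x - g x)) \<longlonglongrightarrow> 0" by (simp add: pint_def)
qed

lemma pint_tendsto:
 fixes f :: "nat \<Rightarrow> 'a::euclidean_space \<Rightarrow> 'b::euclidean_space"
 assumes f: "\<And>n. f n \<in> Lp p" and g: "g \<in> Lp p" and lim: "(\<lambda>n. pint p (\<lambda>x. f n x - g x)) \<longlonglongrightarrow> 0" and p: "p > 1"
 shows "(\<lambda>n. pint p (f n)) \<longlonglongrightarrow> pint p g"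
proof -
 have d: "(\<lambda>x. f n x - g x) \<in> Lp p" for n using Lp_diff(1)[OF f g] p by simp
 define B where "B = 2 powr p * (1 + pint p g) + pint p g"
 have B: "B \<ge> 0" unfolding B_def using pint_nonneg[of p g] by (intro add_nonneg_nonneg mult_nonneg_nonneg) auto
 have "(\<lambda>n. \<bar>pint p (f n) - pint p g\<bar>) \<longlonglongrightarrow> 0"
 proof (rule real_tendsto_0_I)
  fix e :: real assume "e > 0"
  define \<delta> where "\<delta> = e / (2 * (B + 1))"
  have \<delta>: "\<delta> > 0" "\<delta> * B \<le> e / 2" using \<open>e > 0\<close> B by (auto simp: \<delta>_def field_simps)
  obtain C where C: "C \<ge> 0" "\<And>x y::'b. \<bar>norm x powr p - norm y powr p\<bar> \<le> \<delta> * (norm x powr p + norm y powr p) + C * norm (x - y) powr p"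
   by (rule abs_norm_powr_diff_le[OF p \<delta>(1)]) (rule that)
  have le: "\<bar>pint p (f n) - pint p g\<bar> \<le> \<delta> * (pint p (f n) + pint p g) + C * pint p (\<lambda>x. f n x - g x)" for n
  proof -
   note i = Lp_integrable[OF f[of n]] Lp_integrable[OF g] Lp_integrable[OF d[of n]]
   have "\<bar>pint p (f n) - pint p g\<bar> = norm (LINT x|lebesgue. norm (f n x) powr p - norm (g x) powr p)"
    using i by (simp add: pint_def)
   also have "\<dots> \<le> (LINT x|lebesgue. \<delta> * (norm (f n x) powr p + norm (g x) powr p) + C * norm (f n x - g x) powr p)"
    using i C(2) by (intro norm_integral_le) auto
   also have "\<dots> = \<delta> * (pint p (f n) + pint p g) + C * pint p (\<lambda>x. f n x - g x)" using i by (simp add: pint_def)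
   finally show ?thesis .
  qed
  have "(\<lambda>n. C * pint p (\<lambda>x. f n x - g x)) \<longlonglongrightarrow> C * 0" by (intro tendsto_intros lim)
  then have "eventually (\<lambda>n. C * pint p (\<lambda>x. f n x - g x) < e / 2) sequentially"
   using order_tendstoD(2)[of _ 0 sequentially "e / 2"] \<open>e > 0\<close> by simp
  moreover have "eventually (\<lambda>n. pint p (\<lambda>x. f n x - g x) < 1) sequentially" using order_tendstoD(2)[OF lim, of 1] by simp
  ultimately show "eventually (\<lambda>n. \<bar>pint p (f n) - pint p g\<bar> \<le> e) sequentially"
  proof eventually_elim
   case (elim n)
   have "pint p (f n) = pint p (\<lambda>x. (f n x - g x) + g x)" by simp
   also have "\<dots> \<le> 2 powr p * (pint p (\<lambda>x. f n x - g x) + pint p g)" by (rule Lp_add(2)[OF d g]) (use p in simp)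
   also have "\<dots> \<le> 2 powr p * (1 + pint p g)" using elim by (intro mult_left_mono) auto
   finally have le_B: "pint p (f n) + pint p g \<le> B" by (simp add: B_def)
   have "\<delta> * (pint p (f n) + pint p g) \<le> e / 2" using order_trans[OF mult_left_mono[OF le_B, of \<delta>] \<delta>(2)] \<delta>(1) by simp
   then show ?case using le[of n] elim by linarith
  qed
 qed simp
 then show ?thesis by (simp add: tendsto_rabs_zero_iff LIM_zero_iff)
qed

subsection \<open>Positive part and absolute value\<close>

section \<open>Positive parts\<close>

lemma has_derivative_max_sq:
 "((\<lambda>s::real. (max s 0)\<^sup>2) has_real_derivative 2 * max s 0) (at s)"
proof -
 consider "s > 0" | "s < 0" | "s = 0" by linarith
 then show ?thesis
 proof cases
  case 1
  have "((\<lambda>s::real. s\<^sup>2) has_real_derivative 2 * s) (at s)" by (auto intro!: derivative_eq_intros)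
  then have "((\<lambda>s::real. (max s 0)\<^sup>2) has_real_derivative 2 * s) (at s)"
   by (rule has_field_derivative_transform_within_open[of _ _ _ "{0<..}"]) (use 1 in auto)
  then show ?thesis using 1 by simp
 next
  case 2
  have "((\<lambda>s::real. 0) has_real_derivative 0) (at s)" by simp
  then have "((\<lambda>s::real. (max s 0)\<^sup>2) has_real_derivative 0) (at s)"
   by (rule has_field_derivative_transform_within_open[of _ _ _ "{..<0}"]) (use 2 in auto)
  then show ?thesis using 2 by simp
 next
  case 3
  have "((\<lambda>h::real. max h 0) \<longlongrightarrow> max 0 0) (at 0)" by (intro tendsto_intros)
  moreover have "eventually (\<lambda>h::real. max h 0 = ((max (0 + h) 0)\<^sup>2 - (max 0 0)\<^sup>2) / h) (at 0)"
   by (auto simp: eventually_at max_def power2_eq_square intro!: exI[of _ 1])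
  ultimately have "((\<lambda>h::real. ((max (0 + h) 0)\<^sup>2 - (max 0 0)\<^sup>2) / h) \<longlongrightarrow> max 0 0) (at 0)" by (rule Lim_transform_eventually)
  then show ?thesis using 3 by (simp add: DERIV_def)
 qed
qed

lemma DERIV_sqrt_shift:
 assumes "(g has_real_derivative D) (at s)" "g s > 0"
 shows "((\<lambda>s. sqrt (g s) - c) has_real_derivative D / (2 * sqrt (g s))) (at s)"
 using assms by (auto intro!: derivative_eq_intros simp: field_simps)

lemma sqrt_max_bounds:
 fixes s e :: real
 assumes "e > 0"
 shows "0 \<le> sqrt ((max s 0)\<^sup>2 + e\<^sup>2) - e" "sqrt ((max s 0)\<^sup>2 + e\<^sup>2) - e \<le> max s 0"
  "max s 0 / sqrt ((max s 0)\<^sup>2 + e\<^sup>2) \<le> 1" "0 \<le> max s 0 / sqrt ((max s 0)\<^sup>2 + e\<^sup>2)"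
proof -
 have "e \<le> sqrt ((max s 0)\<^sup>2 + e\<^sup>2)" using assms by (intro real_le_rsqrt) simp
 then show "0 \<le> sqrt ((max s 0)\<^sup>2 + e\<^sup>2) - e" by simp
 show "sqrt ((max s 0)\<^sup>2 + e\<^sup>2) - e \<le> max s 0" using sqrt_sum_squares_le_sum[of "max s 0" e] assms by simp
 have "sqrt ((max s 0)\<^sup>2 + e\<^sup>2) > 0" using assms by (simp add: add_nonneg_pos)
 moreover have "max s 0 \<le> sqrt ((max s 0)\<^sup>2 + e\<^sup>2)" by (intro real_le_rsqrt) simp
 ultimately show "max s 0 / sqrt ((max s 0)\<^sup>2 + e\<^sup>2) \<le> 1" "0 \<le> max s 0 / sqrt ((max s 0)\<^sup>2 + e\<^sup>2)" by (simp_all add: divide_le_eq)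
qed

text \<open>Approximate \<open>max s 0\<close> by \<open>sqrt ((max s 0)\<^sup>2 + e\<^sup>2) - e\<close>, which is continuously differentiable.\<close>

lemma W1p_pos:
 assumes u: "u \<in> W1p p" and p: "p > 1"
 shows "(\<lambda>x. max (u x) 0) \<in> W1p p"
  "AE x in lebesgue. grad (\<lambda>x. max (u x) 0) x = (if u x > 0 then grad u x else 0)"
proof -
 note [measurable] = W1p_measurable[OF u] grad_measurable[OF u]
 define e where "e n = 1 / real (Suc n)" for n
 have e: "e n > 0" for n by (simp add: e_def)
 have elim0: "e \<longlonglongrightarrow> 0" unfolding e_def by (rule LIMSEQ_Suc[OF lim_1_over_n])
 define f where "f n s = sqrt ((max s 0)\<^sup>2 + (e n)\<^sup>2) - e n" for n s
 define f' where "f' n s = max s 0 / sqrt ((max s 0)\<^sup>2 + (e n)\<^sup>2)" for n s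
 have pos: "(max s 0)\<^sup>2 + (e n)\<^sup>2 > 0" for s n using e[of n] by (intro add_nonneg_pos) auto
 have der: "(f n has_real_derivative f' n s) (at s)" for n s
 proof -
  have "((\<lambda>s. (max s 0)\<^sup>2 + (e n)\<^sup>2) has_real_derivative 2 * max s 0 + 0) (at s)"
   by (rule DERIV_add[OF has_derivative_max_sq DERIV_const])
  from DERIV_sqrt_shift[where g = "\<lambda>s. (max s 0)\<^sup>2 + (e n)\<^sup>2" and c = "e n", OF this pos]
  have "((\<lambda>s. sqrt ((max s 0)\<^sup>2 + (e n)\<^sup>2) - e n) has_real_derivative f' n s) (at s)" unfolding f'_def by simp
  then show ?thesis by (simp add: f_def[abs_def])
 qed
 have cf': "continuous_on UNIV (f' n)" for n
  unfolding f'_def[abs_def] using e by (intro continuous_intros) (auto simp: add_nonneg_eq_0_iff less_imp_neq[symmetric])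
 have bf': "\<bar>f' n s\<bar> \<le> 1" for n s unfolding f'_def using sqrt_max_bounds(3,4)[OF e[of n], of s] by simp
 have f0: "f n 0 = 0" for n using e[of n] by (simp add: f_def)
 note W = W1p_chain1[OF u p der cf' bf' f0]
 have L1: "(\<lambda>n. f n s) \<longlonglongrightarrow> max s 0" for s
 proof -
  have "(\<lambda>n. sqrt ((max s 0)\<^sup>2 + (e n)\<^sup>2) - e n) \<longlonglongrightarrow> sqrt ((max s 0)\<^sup>2 + 0\<^sup>2) - 0" by (intro tendsto_intros elim0)
  then show ?thesis by (simp add: f_def)
 qed
 have L2: "(\<lambda>n. f' n s) \<longlonglongrightarrow> (if s > 0 then 1 else 0)" for s
 proof (cases "s > 0")
  case True
  have "(\<lambda>n. max s 0 / sqrt ((max s 0)\<^sup>2 + (e n)\<^sup>2)) \<longlonglongrightarrow> max s 0 / sqrt ((max s 0)\<^sup>2 + 0\<^sup>2)"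
   using True by (intro tendsto_intros elim0) simp
  then show ?thesis using True by (simp add: f'_def)
 qed (simp add: f'_def)
 define G where "G x = (if u x > 0 then 1 else 0) *\<^sub>R grad u x" for x
 have mG[measurable]: "G \<in> lmeas" unfolding G_def by measurable
 have mg: "grad (\<lambda>x. f n (u x)) \<in> lmeas" for n by (rule grad_measurable[OF W(1)])
 have absu: "(\<lambda>x. \<bar>u x\<bar>) \<in> Lp p" "(\<lambda>x. norm (grad u x)) \<in> Lp p" using W1p_Lp[OF u] W1pD(2)[OF u] by (auto simp: Lp_def)
 have A: "(\<lambda>x. max (u x) 0) \<in> Lp p" "(\<lambda>n. pint p (\<lambda>x. f n (u x) - max (u x) 0)) \<longlonglongrightarrow> 0"
 proof -
  have 1: "AE x in lebesgue. norm (f n (u x)) \<le> \<bar>u x\<bar>" for n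
  proof (rule AE_I2)
   fix x show "norm (f n (u x)) \<le> \<bar>u x\<bar>"
    using sqrt_max_bounds(1,2)[OF e[of n], of "u x"] by (simp add: f_def max_def split: if_splits)
  qed
  have 2: "AE x in lebesgue. (\<lambda>n. f n (u x)) \<longlonglongrightarrow> max (u x) 0" using L1 by simp
  have 3: "(\<lambda>x. max (u x) 0) \<in> lmeas" by measurable
  show "(\<lambda>x. max (u x) 0) \<in> Lp p" "(\<lambda>n. pint p (\<lambda>x. f n (u x) - max (u x) 0)) \<longlonglongrightarrow> 0"
   using Lp_dominated_convergence[OF W1p_measurable[OF W(1)] 3 absu(1) 1 2 p] by blast+
 qed
 have B: "G \<in> Lp p" "(\<lambda>n. pint p (\<lambda>x. grad (\<lambda>x. f n (u x)) x - G x)) \<longlonglongrightarrow> 0"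
 proof -
  have ae: "AE x in lebesgue. \<forall>n. grad (\<lambda>x. f n (u x)) x = f' n (u x) *\<^sub>R grad u x" using W(2) by (simp add: AE_all_countable)
  have 1: "AE x in lebesgue. norm (grad (\<lambda>x. f n (u x)) x) \<le> norm (grad u x)" for n
   using ae by eventually_elim (use bf' in \<open>simp add: mult_left_le_one_le\<close>)
  have 2: "AE x in lebesgue. (\<lambda>n. grad (\<lambda>x. f n (u x)) x) \<longlonglongrightarrow> G x" using ae
  proof eventually_elim
   case (elim x)
   show ?case using tendsto_scaleR[OF L2[of "u x"] tendsto_const[of "grad u x"]] by (simp only: elim G_def)
  qed
  show "G \<in> Lp p" "(\<lambda>n. pint p (\<lambda>x. grad (\<lambda>x. f n (u x)) x - G x)) \<longlonglongrightarrow> 0"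
   using Lp_dominated_convergence[OF mg mG absu(2) 1 2 p] by blast+
 qed
 show "(\<lambda>x. max (u x) 0) \<in> W1p p" by (rule W1p_limit(1)[OF W(1) A(1) B(1) p A(2) B(2)])
 have "AE x in lebesgue. grad (\<lambda>x. max (u x) 0) x = G x" by (rule W1p_limit(2)[OF W(1) A(1) B(1) p A(2) B(2)])
 then show "AE x in lebesgue. grad (\<lambda>x. max (u x) 0) x = (if u x > 0 then grad u x else 0)" by eventually_elim (simp add: G_def)
qed

lemma W1p_uminus:
 assumes u: "u \<in> W1p p" and p: "p > 1"
 shows "(\<lambda>x. - u x) \<in> W1p p" "AE x in lebesgue. grad (\<lambda>x. - u x) x = - grad u x" using W1p_lincomb[OF u u p, of "-1" 0] by auto

text \<open>On \<open>{u = 0}\<close> the gradients of the positive parts of \<open>u\<close> and \<open>-u\<close> both vanish.\<close>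

lemma grad_eq_0_AE:
 assumes u: "u \<in> W1p p" and p: "p > 1"
 shows "AE x in lebesgue. u x = 0 \<longrightarrow> grad u x = 0"
proof -
 note P = W1p_pos[OF u p] and N = W1p_pos[OF W1p_uminus(1)[OF u p] p]
 have eq: "(\<lambda>x. 1 * max (u x) 0 + (-1) * max (- u x) 0) = u" by (auto simp: fun_eq_iff max_def)
 have "AE x in lebesgue. grad u x = 1 *\<^sub>R grad (\<lambda>x. max (u x) 0) x + (-1) *\<^sub>R grad (\<lambda>x. max (- u x) 0) x"
  using W1p_lincomb(2)[OF P(1) N(1) p, of 1 "-1"] unfolding eq .
 then show ?thesis using P(2) N(2)
 proof eventually_elim
  case (elim x)
  show ?case
  proof
   assume "u x = 0"
   then have "grad (\<lambda>x. max (u x) 0) x = 0" "grad (\<lambda>x. max (- u x) 0) x = 0" using elim(2,3) by simp_all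
   then show "grad u x = 0" using elim(1) by (simp only:) simp
  qed
 qed
qed

lemma W1p_abs:
 assumes u: "u \<in> W1p p" and p: "p > 1"
 shows "(\<lambda>x. \<bar>u x\<bar>) \<in> W1p p" "AE x in lebesgue. norm (grad (\<lambda>x. \<bar>u x\<bar>) x) = norm (grad u x)"
proof -
 note P = W1p_pos[OF u p] and N = W1p_pos[OF W1p_uminus(1)[OF u p] p]
 have eq: "(\<lambda>x. 1 * max (u x) 0 + 1 * max (- u x) 0) = (\<lambda>x. \<bar>u x\<bar>)" by (auto simp: fun_eq_iff max_def)
 show "(\<lambda>x. \<bar>u x\<bar>) \<in> W1p p" using W1p_lincomb(1)[OF P(1) N(1) p, of 1 1] unfolding eq .
 have "AE x in lebesgue. grad (\<lambda>x. \<bar>u x\<bar>) x = 1 *\<^sub>R grad (\<lambda>x. max (u x) 0) x + 1 *\<^sub>R grad (\<lambda>x. max (- u x) 0) x"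
  using W1p_lincomb(2)[OF P(1) N(1) p, of 1 1] unfolding eq .
 then show "AE x in lebesgue. norm (grad (\<lambda>x. \<bar>u x\<bar>) x) = norm (grad u x)"
  using P(2) N(2) W1p_uminus(2)[OF u p] grad_eq_0_AE[OF u p]
 proof eventually_elim
  case (elim x)
  then show ?case by (cases "u x > 0"; cases "u x < 0") auto
 qed
qed

section \<open>Capacity and quasi continuous representatives\<close>

lemma nn_integral_energy:
 assumes "u \<in> W1p p"
 shows "(\<integral>\<^sup>+x. ennreal (\<bar>u x\<bar> powr p + norm (grad u x) powr p) \<partial>lebesgue) = ennreal (pint p u + pint p (grad u))"
proof -
 note i = Lp_integrable[OF W1p_Lp[OF assms]] Lp_integrable[OF W1pD(2)[OF assms]]
 have "(\<integral>\<^sup>+x. ennreal (\<bar>u x\<bar> powr p + norm (grad u x) powr p) \<partial>lebesgue) =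
  ennreal (LINT x|lebesgue. \<bar>u x\<bar> powr p + norm (grad u x) powr p)" using i by (intro nn_integral_eq_integral) auto
 then show ?thesis using i by (simp add: pint_def)
qed

lemma Cap_lessD:
 fixes E :: "'a::euclidean_space set"
 assumes "Cap p E < c"
 obtains u U where "u \<in> W1p p" "open U" "E \<subseteq> U" "AE x in lebesgue. x \<in> U \<longrightarrow> u x \<ge> 1"
  "ennreal (pint p u + pint p (grad u)) < c"
proof -
 obtain u where u: "u \<in> W1p p" "\<exists>U. open U \<and> E \<subseteq> U \<and> (AE x in lebesgue. x \<in> U \<longrightarrow> u x \<ge> 1)"
  "(\<integral>\<^sup>+x. ennreal (\<bar>u x\<bar> powr p + norm (grad u x) powr p) \<partial>lebesgue) < c" using assms unfolding Cap_def INF_less_iff by blast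
 then show thesis using that nn_integral_energy[OF u(1)] by auto
qed

lemma Cap_leI:
 assumes "u \<in> W1p p" "open U" "E \<subseteq> U" "AE x in lebesgue. x \<in> U \<longrightarrow> u x \<ge> 1"
 shows "Cap p E \<le> ennreal (pint p u + pint p (grad u))" unfolding Cap_def nn_integral_energy[OF assms(1), symmetric]
 by (rule INF_lower) (use assms in blast)

lemma Cap_mono:
 fixes E :: "'a::euclidean_space set"
 shows "E \<subseteq> F \<Longrightarrow> Cap p E \<le> Cap p F" unfolding Cap_def by (rule INF_superset_mono) auto

lemma W1p_zero: "(\<lambda>x::'a::euclidean_space. 0) \<in> W1p p" "p > 1 \<Longrightarrow> AE x::'a in lebesgue. grad (\<lambda>x. 0) x = 0"
proof -
 have "C1_grad (\<lambda>x::'a. 0) (\<lambda>x. 0)" by (simp add: C1_grad_def)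
 from W1pI[OF Lp_zero Lp_zero C1_has_weak_gradient[OF this]]
 show "(\<lambda>x::'a. 0) \<in> W1p p" "p > 1 \<Longrightarrow> AE x::'a in lebesgue. grad (\<lambda>x. 0) x = 0" by auto
qed

lemma Cap_empty:
 assumes "p > 1" shows "Cap p ({} :: 'a::euclidean_space set) = 0"
proof -
 have "Cap p ({} :: 'a set) \<le> ennreal (pint p (\<lambda>x::'a. 0 :: real) + pint p (grad (\<lambda>x::'a. 0)))"
  by (rule Cap_leI[OF W1p_zero(1), of "{}"]) auto
 also have "pint p (grad (\<lambda>x::'a. 0)) = 0" using pint_eq_0_iff[OF W1pD(2)[OF W1p_zero(1)]] W1p_zero(2)[OF assms] by blast
 finally show ?thesis by simp
qed

text \<open>A weighted substitute for the triangle inequality of the \<open>L\<^sup>p\<close> norm that works with \<open>p\<close>-th powers: the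
 \<open>i\<close>-th summand may be \<open>2\<^sup>i\<^sup>+\<^sup>1\<close> times as large as its share.\<close>

lemma norm_sum_powr_le:
 fixes x :: "nat \<Rightarrow> 'b::real_normed_vector"
 assumes "finite I" "p > 0"
 shows "norm (\<Sum>i\<in>I. x i) powr p \<le> (\<Sum>i\<in>I. (2 ^ Suc i * norm (x i)) powr p)"
proof -
 define S where "S = (\<Sum>i\<in>I. (2 ^ Suc i * norm (x i)) powr p)"
 define M where "M = S powr (1 / p)"
 have S: "S \<ge> 0" unfolding S_def by (intro sum_nonneg) simp
 have MS: "M powr p = S" unfolding M_def using assms S by (simp add: powr_powr)
 have le: "norm (x i) \<le> (1/2) ^ Suc i * M" if "i \<in> I" for i
 proof -
  have "(2 ^ Suc i * norm (x i)) powr p \<le> S" unfolding S_def using that assms(1) by (intro member_le_sum) auto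
  then have "((2 ^ Suc i * norm (x i)) powr p) powr (1 / p) \<le> M" unfolding M_def using assms by (intro powr_mono2) auto
  then have "2 ^ Suc i * norm (x i) \<le> M" using assms by (simp add: powr_powr)
  then show ?thesis by (simp add: field_simps)
 qed
 have "norm (\<Sum>i\<in>I. x i) \<le> (\<Sum>i\<in>I. (1/2) ^ Suc i * M)" by (rule order_trans[OF norm_sum]) (intro sum_mono le)
 also have "\<dots> = (\<Sum>i\<in>I. (1/2) ^ Suc i) * M" by (simp add: sum_distrib_right)
 also have "\<dots> \<le> 1 * M"
 proof (rule mult_right_mono)
  have "(\<Sum>i\<in>I. (1/2 :: real) ^ Suc i) \<le> (\<Sum>i. (1/2) ^ Suc i)"
   by (rule sum_le_suminf) (use assms power_half_series in \<open>auto simp: sums_iff\<close>)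
  also have "\<dots> = 1" using power_half_series by (simp add: sums_iff)
  finally show "(\<Sum>i\<in>I. (1/2 :: real) ^ Suc i) \<le> 1" .
 qed (simp add: M_def)
 finally have "norm (\<Sum>i\<in>I. x i) powr p \<le> M powr p" using assms by (intro powr_mono2) auto
 then show ?thesis by (simp add: MS S_def)
qed

lemma pint_sum_le:
 fixes f :: "nat \<Rightarrow> 'a::euclidean_space \<Rightarrow> 'b::euclidean_space"
 assumes "finite I" "p > 0" and f: "\<And>i. f i \<in> Lp p"
 shows "(\<lambda>x. \<Sum>i\<in>I. f i x) \<in> Lp p" "pint p (\<lambda>x. \<Sum>i\<in>I. f i x) \<le> (\<Sum>i\<in>I. 2 powr (p * real (Suc i)) * pint p (f i))"
proof -
 have [measurable]: "f i \<in> lmeas" for i by (rule Lp_measurable[OF f])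
 have i: "integrable lebesgue (\<lambda>x. \<Sum>i\<in>I. 2 powr (p * real (Suc i)) * norm (f i x) powr p)" using Lp_integrable[OF f] by simp
 have m: "(\<lambda>x. \<Sum>i\<in>I. f i x) \<in> lmeas" by measurable
 have ae: "AE x in lebesgue. norm (\<Sum>i\<in>I. f i x) powr p \<le> (\<Sum>i\<in>I. 2 powr (p * real (Suc i)) * norm (f i x) powr p)"
 proof (rule AE_I2)
  fix x
  have "(2 ^ Suc i * norm (f i x)) powr p = 2 powr (p * real (Suc i)) * norm (f i x) powr p" for i
   by (simp add: powr_mult powr_powr mult.commute del: power_Suc flip: powr_realpow)
  then show "norm (\<Sum>i\<in>I. f i x) powr p \<le> (\<Sum>i\<in>I. 2 powr (p * real (Suc i)) * norm (f i x) powr p)"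
   using norm_sum_powr_le[OF assms(1,2), of "\<lambda>i. f i x"] by simp
 qed
 show "(\<lambda>x. \<Sum>i\<in>I. f i x) \<in> Lp p" by (rule Lp_bound(1)[OF m i ae])
 have "pint p (\<lambda>x. \<Sum>i\<in>I. f i x) \<le> (LINT x|lebesgue. (\<Sum>i\<in>I. 2 powr (p * real (Suc i)) * norm (f i x) powr p))"
  by (rule Lp_bound(2)[OF m i ae])
 also have "\<dots> = (\<Sum>i\<in>I. 2 powr (p * real (Suc i)) * pint p (f i))" using Lp_integrable[OF f] by (simp add: pint_def)
 finally show "pint p (\<lambda>x. \<Sum>i\<in>I. f i x) \<le> (\<Sum>i\<in>I. 2 powr (p * real (Suc i)) * pint p (f i))" .
qed

lemma W1p_sum:
 fixes w :: "nat \<Rightarrow> 'a::euclidean_space \<Rightarrow> real"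
 assumes w: "\<And>i. w i \<in> W1p p" and p: "p > 1"
 shows "(\<lambda>x. \<Sum>i<n. w i x) \<in> W1p p \<and> (AE x in lebesgue. grad (\<lambda>x. \<Sum>i<n. w i x) x = (\<Sum>i<n. grad (w i) x))"
proof (induction n)
 case 0
 then show ?case using W1p_zero[of p] p by auto
next
 case (Suc n)
 have "(\<lambda>x. 1 * (\<Sum>i<n. w i x) + 1 * w n x) \<in> W1p p"
  "AE x in lebesgue. grad (\<lambda>x. 1 * (\<Sum>i<n. w i x) + 1 * w n x) x = 1 *\<^sub>R grad (\<lambda>x. \<Sum>i<n. w i x) x + 1 *\<^sub>R grad (w n) x"
  using W1p_lincomb[OF conjunct1[OF Suc] w[of n] p, of 1 1] by blast+
 then have 1: "(\<lambda>x. \<Sum>i<Suc n. w i x) \<in> W1p p"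
  and 2: "AE x in lebesgue. grad (\<lambda>x. \<Sum>i<Suc n. w i x) x = grad (\<lambda>x. \<Sum>i<n. w i x) x + grad (w n) x" by simp_all
 have "AE x in lebesgue. grad (\<lambda>x. \<Sum>i<Suc n. w i x) x = (\<Sum>i<Suc n. grad (w i) x)"
  using 2 conjunct2[OF Suc] by eventually_elim simp
 with 1 show ?case by blast
qed

lemma powr_two_four:
 "2 powr (p * real (Suc i)) * 4 powr (- p * real (Suc i)) = 2 powr (- p * real (Suc i))"
proof -
 have "(4::real) powr (- p * real (Suc i)) = (2 powr 2) powr (- p * real (Suc i))" by simp
 also have "\<dots> = 2 powr (- 2 * p * real (Suc i))" by (subst powr_powr) (simp add: mult.assoc)
 finally show ?thesis by (simp flip: powr_add)
qed

lemma two_powr_le_half: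
 assumes "p \<ge> 1" shows "2 powr (- p * real (Suc i)) \<le> (1/2) ^ Suc i"
proof -
 have "(2::real) powr (- p * real (Suc i)) \<le> 2 powr (- real (Suc i))"
 proof (rule powr_mono)
  have "- p * real (Suc i) \<le> - 1 * real (Suc i)" using assms by (intro mult_right_mono) auto
  then show "- p * real (Suc i) \<le> - real (Suc i)" by (simp only: mult_minus1)
 qed simp
 also have "\<dots> = (1/2) ^ Suc i" by (simp only: powr_minus powr_realpow zero_less_numeral) (simp add: power_one_over inverse_eq_divide)
 finally show ?thesis .
qed

lemma W1p_complete:
 fixes u :: "nat \<Rightarrow> 'a::euclidean_space \<Rightarrow> real"
 assumes u: "\<And>n. u n \<in> W1p p" and p: "p > 1"
  and c1: "\<And>e. e > 0 \<Longrightarrow> \<exists>N. \<forall>m\<ge>N. \<forall>n\<ge>N. pint p (\<lambda>x. u m x - u n x) \<le> e"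
  and c2: "\<And>e. e > 0 \<Longrightarrow> \<exists>N. \<forall>m\<ge>N. \<forall>n\<ge>N. pint p (\<lambda>x. grad (u m) x - grad (u n) x) \<le> e"
 obtains v where "v \<in> W1p p" "(\<lambda>n. pint p (\<lambda>x. u n x - v x)) \<longlonglongrightarrow> 0"
  "(\<lambda>n. pint p (\<lambda>x. grad (u n) x - grad v x)) \<longlonglongrightarrow> 0"
proof -
 obtain v where v: "v \<in> Lp p" "(\<lambda>n. pint p (\<lambda>x. u n x - v x)) \<longlonglongrightarrow> 0" by (rule Lp_complete[OF W1p_Lp[OF u] p c1]) (auto intro: that)
 obtain G where G: "G \<in> Lp p" "(\<lambda>n. pint p (\<lambda>x. grad (u n) x - G x)) \<longlonglongrightarrow> 0"
  by (rule Lp_complete[OF W1pD(2)[OF u] p c2]) (auto intro: that)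
 have vW: "v \<in> W1p p" and ae: "AE x in lebesgue. grad v x = G x" using W1p_limit[OF u v(1) G(1) p v(2) G(2)] by auto
 have "pint p (\<lambda>x. grad (u n) x - grad v x) = pint p (\<lambda>x. grad (u n) x - G x)" for n
 proof (rule pint_cong_AE)
  note [measurable] = grad_measurable[OF u] grad_measurable[OF vW] Lp_measurable[OF G(1)]
  show "AE x in lebesgue. norm (grad (u n) x - grad v x) = norm (grad (u n) x - G x)" using ae by eventually_elim simp
  show "(\<lambda>x. grad (u n) x - grad v x) \<in> lmeas" "(\<lambda>x. grad (u n) x - G x) \<in> lmeas" by measurable
 qed
 with G(2) have "(\<lambda>n. pint p (\<lambda>x. grad (u n) x - grad v x)) \<longlonglongrightarrow> 0" by simp
 with that vW v(2) show thesis by blast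
qed

text \<open>A weak form of countable subadditivity that suffices for null sets and for quasi continuity. The sum
 of the absolute values of admissible functions is admissible for the union; the factors \<open>4\<^sup>-\<^sup>p\<^sup>(\<^sup>i\<^sup>+\<^sup>1\<^sup>)\<close>
 absorb the weights \<open>2\<^sup>p\<^sup>(\<^sup>i\<^sup>+\<^sup>1\<^sup>)\<close> of \<open>pint_sum_le\<close> and still leave a geometric series.\<close>

lemma Cap_countable_union:
 fixes E :: "nat \<Rightarrow> 'a::euclidean_space set"
 assumes p: "p > 1" and "eps > 0" and E: "\<And>i. Cap p (E i) < ennreal (eps * 4 powr (- p * real (Suc i)))"
 shows "Cap p (\<Union>i. E i) \<le> ennreal eps"
proof -
 have "\<forall>i. \<exists>u U. u \<in> W1p p \<and> open U \<and> E i \<subseteq> U \<and> (AE x in lebesgue. x \<in> U \<longrightarrow> u x \<ge> 1) \<and>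
  ennreal (pint p u + pint p (grad u)) < ennreal (eps * 4 powr (- p * real (Suc i)))"
 proof
  fix i
  show "\<exists>u U. u \<in> W1p p \<and> open U \<and> E i \<subseteq> U \<and> (AE x in lebesgue. x \<in> U \<longrightarrow> u x \<ge> 1) \<and>
   ennreal (pint p u + pint p (grad u)) < ennreal (eps * 4 powr (- p * real (Suc i)))" by (rule Cap_lessD[OF E[of i]]) blast
 qed
 then obtain \<psi> U where \<psi>: "\<And>i. \<psi> i \<in> W1p p" and U: "\<And>i. open (U i)" "\<And>i. E i \<subseteq> U i"
  and ge: "\<And>i. AE x in lebesgue. x \<in> U i \<longrightarrow> \<psi> i x \<ge> 1"
  and en: "\<And>i. ennreal (pint p (\<psi> i) + pint p (grad (\<psi> i))) < ennreal (eps * 4 powr (- p * real (Suc i)))"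
  unfolding choice_iff by blast
 define w where "w i x = \<bar>\<psi> i x\<bar>" for i x
 have w: "w i \<in> W1p p" for i unfolding w_def[abs_def] by (rule W1p_abs(1)[OF \<psi> p])
 have pw: "pint p (w i) = pint p (\<psi> i)" for i by (simp add: w_def[abs_def] pint_def)
 have pgw: "pint p (grad (w i)) = pint p (grad (\<psi> i))" for i
  by (rule pint_cong_AE) (use W1p_abs(2)[OF \<psi> p] grad_measurable[OF w] grad_measurable[OF \<psi>] in \<open>auto simp: w_def[abs_def]\<close>)
 have en': "pint p (w i) + pint p (grad (w i)) \<le> eps * 4 powr (- p * real (Suc i))" for i
 proof -
  have "0 \<le> pint p (\<psi> i) + pint p (grad (\<psi> i))" by (intro add_nonneg_nonneg pint_nonneg)
  then have "pint p (\<psi> i) + pint p (grad (\<psi> i)) < eps * 4 powr (- p * real (Suc i))" using en[of i] ennreal_less_iff by blast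
  then show ?thesis unfolding pw pgw by (rule less_imp_le)
 qed
 have bd: "2 powr (p * real (Suc i)) * pint p (w i) + 2 powr (p * real (Suc i)) * pint p (grad (w i)) \<le> eps * (1/2) ^ Suc i" for i
 proof -
  have "2 powr (p * real (Suc i)) * (pint p (w i) + pint p (grad (w i))) \<le>
   2 powr (p * real (Suc i)) * (eps * 4 powr (- p * real (Suc i)))" by (intro mult_left_mono en') simp
  also have "\<dots> = eps * (2 powr (p * real (Suc i)) * 4 powr (- p * real (Suc i)))" by (rule mult.left_commute)
  also have "\<dots> = eps * 2 powr (- p * real (Suc i))" by (simp only: powr_two_four)
  also have "\<dots> \<le> eps * (1/2) ^ Suc i" using two_powr_le_half[of p i] p \<open>eps > 0\<close> by (intro mult_left_mono) auto
  finally show ?thesis by (simp add: distrib_left)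
 qed
 have geo: "(\<Sum>i\<in>{m..<n}. (1/2::real) ^ Suc i) \<le> (1/2) ^ m" if "m \<le> n" for m n
 proof -
  have "(\<Sum>i\<in>{m..<n}. (1/2::real) ^ Suc i) = (1/2) ^ m - (1/2) ^ n" using that by (induction rule: dec_induct) auto
  then show ?thesis by simp
 qed
 define S where "S n x = (\<Sum>i<n. w i x)" for n x
 have S: "S n \<in> W1p p" "AE x in lebesgue. grad (S n) x = (\<Sum>i<n. grad (w i) x)" for n
  unfolding S_def[abs_def] using W1p_sum[of w p n, OF w p] by auto
 have sum_diff: "(\<Sum>i<n. f i) - (\<Sum>i<m. f i) = (\<Sum>i\<in>{m..<n}. f i)" if "m \<le> n" for m n and f :: "nat \<Rightarrow> 'c::ab_group_add"
  using that by (simp add: sum_diff_nat_ivl lessThan_atLeast0)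
 have P: "pint p (\<lambda>x. S n x - S m x) \<le> (\<Sum>i\<in>{m..<n}. 2 powr (p * real (Suc i)) * pint p (w i))" if "m \<le> n" for m n
  using pint_sum_le(2)[of "{m..<n}" p w] W1p_Lp[OF w] p that by (simp add: S_def sum_diff)
 have Q: "pint p (\<lambda>x. grad (S n) x - grad (S m) x) \<le> (\<Sum>i\<in>{m..<n}. 2 powr (p * real (Suc i)) * pint p (grad (w i)))" if "m \<le> n" for m n
 proof -
  have "pint p (\<lambda>x. grad (S n) x - grad (S m) x) = pint p (\<lambda>x. \<Sum>i\<in>{m..<n}. grad (w i) x)"
  proof (rule pint_cong_AE)
   note [measurable] = grad_measurable[OF S(1)] grad_measurable[OF w]
   show "(\<lambda>x. grad (S n) x - grad (S m) x) \<in> lmeas" "(\<lambda>x. \<Sum>i\<in>{m..<n}. grad (w i) x) \<in> lmeas" by measurable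
   show "AE x in lebesgue. norm (grad (S n) x - grad (S m) x) = norm (\<Sum>i\<in>{m..<n}. grad (w i) x)"
    using S(2)[of n] S(2)[of m] by eventually_elim (use that in \<open>simp add: sum_diff\<close>)
  qed
  also have "\<dots> \<le> (\<Sum>i\<in>{m..<n}. 2 powr (p * real (Suc i)) * pint p (grad (w i)))"
   by (rule pint_sum_le(2)) (use W1pD(2)[OF w] p in auto)
  finally show ?thesis .
 qed
 have PQ: "pint p (\<lambda>x. S n x - S m x) + pint p (\<lambda>x. grad (S n) x - grad (S m) x) \<le> eps * (1/2) ^ m" if "m \<le> n" for m n
 proof -
  have "pint p (\<lambda>x. S n x - S m x) + pint p (\<lambda>x. grad (S n) x - grad (S m) x) \<le>
   (\<Sum>i\<in>{m..<n}. 2 powr (p * real (Suc i)) * pint p (w i) + 2 powr (p * real (Suc i)) * pint p (grad (w i)))"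
   using add_mono[OF P[OF that] Q[OF that]] by (simp add: sum.distrib)
  also have "\<dots> \<le> (\<Sum>i\<in>{m..<n}. eps * (1/2) ^ Suc i)" by (intro sum_mono bd)
  also have "\<dots> = eps * (\<Sum>i\<in>{m..<n}. (1/2) ^ Suc i)" by (simp only: sum_distrib_left)
  also have "\<dots> \<le> eps * (1/2) ^ m" using geo[OF that] \<open>eps > 0\<close> by (intro mult_left_mono) auto
  finally show ?thesis .
 qed
 have small: "\<exists>N. \<forall>m\<ge>N. \<forall>n\<ge>N. pint p (\<lambda>x. S m x - S n x) \<le> e \<and> pint p (\<lambda>x. grad (S m) x - grad (S n) x) \<le> e" if "e > 0" for e
 proof -
  have "(\<lambda>m. eps * (1/2) ^ m) \<longlonglongrightarrow> eps * 0" by (intro tendsto_intros LIMSEQ_realpow_zero) auto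
  then have "eventually (\<lambda>m. eps * (1/2) ^ m < e) sequentially" using order_tendstoD(2)[of _ 0 _ e] that by simp
  then obtain N where N: "\<And>m. m \<ge> N \<Longrightarrow> eps * (1/2) ^ m < e" by (auto simp: eventually_sequentially)
  have le: "pint p (\<lambda>x. S n x - S m x) \<le> e \<and> pint p (\<lambda>x. grad (S n) x - grad (S m) x) \<le> e" if "m \<ge> N" "m \<le> n" for m n
   using PQ[OF that(2)] N[OF that(1)] pint_nonneg[of p "\<lambda>x. S n x - S m x"] pint_nonneg[of p "\<lambda>x. grad (S n) x - grad (S m) x"]
   by linarith
  show ?thesis
  proof (intro exI[of _ N] allI impI)
   fix m n assume "m \<ge> N" "n \<ge> N"
   then show "pint p (\<lambda>x. S m x - S n x) \<le> e \<and> pint p (\<lambda>x. grad (S m) x - grad (S n) x) \<le> e"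
    using le[of m n] le[of n m] pint_commute[of p "S m" "S n"] pint_commute[of p "grad (S m)" "grad (S n)"]
    by (cases "m \<le> n") auto
  qed
 qed
 obtain v where v: "v \<in> W1p p" "(\<lambda>n. pint p (\<lambda>x. S n x - v x)) \<longlonglongrightarrow> 0"
  "(\<lambda>n. pint p (\<lambda>x. grad (S n) x - grad v x)) \<longlonglongrightarrow> 0"
   proof (rule W1p_complete[of S p, OF S(1) p])
  show "\<exists>N. \<forall>m\<ge>N. \<forall>n\<ge>N. pint p (\<lambda>x. S m x - S n x) \<le> e" if "e > 0" for e using small[OF that] by blast
  show "\<exists>N. \<forall>m\<ge>N. \<forall>n\<ge>N. pint p (\<lambda>x. grad (S m) x - grad (S n) x) \<le> e" if "e > 0" for e using small[OF that] by blast
 qed (rule that)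
 have "(\<lambda>n. pint p (S n) + pint p (grad (S n))) \<longlonglongrightarrow> pint p v + pint p (grad v)"
  by (intro tendsto_add pint_tendsto[OF W1p_Lp[OF S(1)] W1p_Lp[OF v(1)] v(2) p]
    pint_tendsto[OF W1pD(2)[OF S(1)] W1pD(2)[OF v(1)] v(3) p])
 moreover have "pint p (S n) + pint p (grad (S n)) \<le> eps" for n
 proof -
  have "pint p (\<lambda>x. S n x - S 0 x) = pint p (S n)" by (simp add: S_def[abs_def])
  moreover have "pint p (\<lambda>x. grad (S n) x - grad (S 0) x) = pint p (grad (S n))"
  proof (rule pint_cong_AE)
   note [measurable] = grad_measurable[OF S(1)]
   show "AE x in lebesgue. norm (grad (S n) x - grad (S 0) x) = norm (grad (S n) x)" using S(2)[of 0] by eventually_elim simp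
   show "(\<lambda>x. grad (S n) x - grad (S 0) x) \<in> lmeas" "grad (S n) \<in> lmeas" by measurable
  qed
  ultimately show ?thesis using PQ[OF le0, of n] by (simp only: power_0 mult_1_right)
 qed
 ultimately have vE: "pint p v + pint p (grad v) \<le> eps" by (intro LIMSEQ_le_const2) auto
 obtain r where r: "strict_mono r" "AE x in lebesgue. (\<lambda>n. S (r n) x) \<longlonglongrightarrow> v x"
  by (rule Lp_tendsto_AE_subseq[OF W1p_Lp[OF S(1)] W1p_Lp[OF v(1)] v(2) p]) (rule that)
 have ge': "AE x in lebesgue. \<forall>i. x \<in> U i \<longrightarrow> \<psi> i x \<ge> 1" using ge by (simp add: AE_all_countable)
 have "AE x in lebesgue. x \<in> (\<Union>i. U i) \<longrightarrow> v x \<ge> 1" using r(2) ge'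
 proof eventually_elim
  case (elim x)
  show ?case
  proof
   assume "x \<in> (\<Union>i. U i)"
   then obtain i where i: "x \<in> U i" by blast
   have "S (r n) x \<ge> 1" if "n \<ge> Suc i" for n
   proof -
    have "r n \<ge> Suc i" using seq_suble[OF r(1), of n] that by simp
    then have "w i x \<le> S (r n) x" unfolding S_def by (intro member_le_sum) (auto simp: w_def)
    moreover have "w i x \<ge> 1" using elim(2) i by (auto simp: w_def)
    ultimately show ?thesis by simp
   qed
   then show "v x \<ge> 1" by (intro LIMSEQ_le_const[OF elim(1)]) blast
  qed
 qed
 then have "Cap p (\<Union>i. E i) \<le> ennreal (pint p v + pint p (grad v))" using U by (intro Cap_leI[OF v(1), of "\<Union>i. U i"]) auto
 also have "\<dots> \<le> ennreal eps" using vE by (rule ennreal_leI)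
 finally show ?thesis .
qed

lemma Cap_Un_le:
 fixes E F :: "'a::euclidean_space set"
 assumes p: "p > 1" and "eps > 0" "Cap p E < ennreal (eps * 4 powr (- p * 2))" "Cap p F < ennreal (eps * 4 powr (- p * 2))"
 shows "Cap p (E \<union> F) \<le> ennreal eps"
proof -
 define X where "X i = (if i = 0 then E else if i = 1 then F else {})" for i :: nat
 have mono: "4 powr (- p * 2) \<le> (4::real) powr (- p * real (Suc i))" if "i \<le> 1" for i
  using that p by (intro powr_mono) (auto simp: le_Suc_eq)
 have "Cap p (X i) < ennreal (eps * 4 powr (- p * real (Suc i)))" for i
 proof (cases "i \<le> 1")
  case True
  then have "Cap p (X i) < ennreal (eps * 4 powr (- p * 2))" using assms by (auto simp: X_def le_Suc_eq)
  also have "\<dots> \<le> ennreal (eps * 4 powr (- p * real (Suc i)))"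
   using mono[OF True] \<open>eps > 0\<close> by (intro ennreal_leI mult_left_mono) auto
  finally show ?thesis .
 next
  case False
  then show ?thesis using Cap_empty[OF p, where ?'a = 'a] \<open>eps > 0\<close> by (simp add: X_def)
 qed
 from Cap_countable_union[OF p \<open>eps > 0\<close>, of X, OF this] have "Cap p (\<Union>i. X i) \<le> ennreal eps" .
 moreover have "E \<union> F \<subseteq> (\<Union>i. X i)"
 proof -
  have "X 0 = E" "X 1 = F" by (auto simp: X_def)
  then show ?thesis by blast
 qed
 ultimately show ?thesis using Cap_mono order_trans by blast
qed

lemma Cap_emeasure_le:
 fixes U :: "'a::euclidean_space set"
 assumes "u \<in> W1p p" "open U" "AE x in lebesgue. x \<in> U \<longrightarrow> u x \<ge> 1" "p > 0"
 shows "emeasure lebesgue U \<le> ennreal (pint p u + pint p (grad u))"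
proof -
 have "emeasure lebesgue U = (\<integral>\<^sup>+x. indicator U x \<partial>lebesgue)" using assms(2) by simp
 also have "\<dots> \<le> (\<integral>\<^sup>+x. ennreal (norm (u x) powr p) \<partial>lebesgue)"
 proof (rule nn_integral_mono_AE)
  show "AE x in lebesgue. indicator U x \<le> ennreal (norm (u x) powr p)"
   using assms(3) by eventually_elim (use assms(4) in \<open>auto simp: indicator_def intro!: ge_one_powr_ge_zero\<close>)
 qed
 also have "\<dots> = ennreal (pint p u)" by (rule nn_integral_pint[OF W1p_Lp[OF assms(1)]])
 also have "\<dots> \<le> ennreal (pint p u + pint p (grad u))" using pint_nonneg[of p "grad u"] by (intro ennreal_leI) simp
 finally show ?thesis .
qed

text \<open>An admissible function for a set of small capacity is at least \<open>1\<close> on it, so the set has small measure.\<close>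

lemma AE_not_in_of_small_Cap:
 fixes N :: "'a::euclidean_space set"
 assumes "p > 0" and small: "\<And>e. e > 0 \<Longrightarrow> Cap p N < ennreal e"
 shows "AE x in lebesgue. x \<notin> N"
proof -
 have "\<exists>U. open U \<and> N \<subseteq> U \<and> emeasure lebesgue U \<le> ennreal (1 / real (Suc n))" for n
 proof -
  obtain u U where "u \<in> W1p p" "open U" "N \<subseteq> U" "AE x in lebesgue. x \<in> U \<longrightarrow> u x \<ge> 1"
   "ennreal (pint p u + pint p (grad u)) < ennreal (1 / real (Suc n))"
   by (rule Cap_lessD[OF small[of "1 / real (Suc n)"]]) (auto intro: that)
  then show ?thesis using Cap_emeasure_le[of u p U] assms(1) by (meson less_imp_le order_trans)
 qed
 then obtain U where U: "\<And>n. open (U n)" "\<And>n. N \<subseteq> U n" "\<And>n. emeasure lebesgue (U n) \<le> ennreal (1 / real (Suc n))" by metis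
 have m: "(\<Inter>n. U n) \<in> sets lebesgue" using U(1) by (intro sets.countable_INT) auto
 have "emeasure lebesgue (\<Inter>n. U n) \<le> ennreal (1 / real (Suc n))" for n
  using order_trans[OF emeasure_mono U(3)] U(1) by (metis INT_lower UNIV_I lmeasurable_open borel_open sets_completionI_sets sets_lborel)
 moreover have "(\<lambda>n. ennreal (1 / real (Suc n))) \<longlonglongrightarrow> ennreal 0" by (intro tendsto_ennrealI LIMSEQ_Suc[OF lim_1_over_n])
 ultimately have "emeasure lebesgue (\<Inter>n. U n) \<le> ennreal 0" by (intro LIMSEQ_le_const) auto
 then have "(\<Inter>n. U n) \<in> null_sets lebesgue" using m by (auto simp: null_sets_def)
 then show ?thesis by (rule AE_I') (use U(2) in auto)
qed

lemma Cap_eq_0I: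
 assumes "\<And>e. e > 0 \<Longrightarrow> Cap p N \<le> ennreal e" shows "Cap p N = 0"
proof -
 have "Cap p N \<le> 0" by (rule ennreal_le_epsilon) (use assms in simp)
 then show ?thesis by simp
qed

lemma Cap_0_less: "Cap p N = 0 \<Longrightarrow> e > 0 \<Longrightarrow> Cap p N < ennreal e" by simp

lemma quasi_continuous_pair:
 fixes v w :: "'a::euclidean_space \<Rightarrow> real"
 assumes p: "p > 1" and v: "quasi_continuous_on p UNIV v" and w: "quasi_continuous_on p UNIV w" and e: "e > 0"
 obtains V where "open V" "Cap p V < ennreal e" "continuous_on (- V) v" "continuous_on (- V) w"
proof -
 define d where "d = (e / 2) * 4 powr (- p * 2)"
 have d: "d > 0" using e by (simp add: d_def)
 obtain V1 where V1: "open V1" "Cap p V1 < ennreal d" "continuous_on (UNIV - V1) v"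
  using v d unfolding quasi_continuous_on_def by blast
 obtain V2 where V2: "open V2" "Cap p V2 < ennreal d" "continuous_on (UNIV - V2) w"
  using w d unfolding quasi_continuous_on_def by blast
 have "Cap p (V1 \<union> V2) \<le> ennreal (e / 2)" using V1(2) V2(2) e p by (intro Cap_Un_le) (auto simp: d_def)
 also have "\<dots> < ennreal e" using e by (intro ennreal_lessI) auto
 finally show thesis using that[of "V1 \<union> V2"] V1 V2 by (auto intro: continuous_on_subset)
qed

lemma quasi_continuous_comp:
 fixes v w :: "'a::euclidean_space \<Rightarrow> real" and g :: "real \<Rightarrow> real \<Rightarrow> real"
 assumes p: "p > 1" and v: "quasi_continuous_on p UNIV v" and w: "quasi_continuous_on p UNIV w"
  and g: "continuous_on UNIV (\<lambda>z. g (fst z) (snd z))"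
 shows "quasi_continuous_on p UNIV (\<lambda>x. g (v x) (w x))" unfolding quasi_continuous_on_def
proof (intro allI impI)
 fix e :: real assume "e > 0"
 obtain V where V: "open V" "Cap p V < ennreal e" "continuous_on (- V) v" "continuous_on (- V) w"
  by (rule quasi_continuous_pair[OF p v w \<open>e > 0\<close>]) (rule that)
 have "continuous_on (- V) (\<lambda>x. (v x, w x))" using V by (intro continuous_intros)
 from continuous_on_compose2[OF g this] have "continuous_on (UNIV - V) (\<lambda>x. g (v x) (w x))"
  by (simp add: Compl_eq_Diff_UNIV[symmetric])
 with V show "\<exists>V. open V \<and> Cap p V < ennreal e \<and> continuous_on (UNIV - V) (\<lambda>x. g (v x) (w x))" by blast
qed

lemma W1p0_W1p: "u \<in> W1p0 p A \<Longrightarrow> u \<in> W1p p" by (simp add: W1p0_def)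

text \<open>The composition of the quasi continuous representatives is quasi continuous and vanishes wherever
 both of them vanish.\<close>

lemma W1p0_comp:
 assumes p: "p > 1" and u: "u \<in> W1p0 p A" and v: "v \<in> W1p0 p A"
  and g: "continuous_on UNIV (\<lambda>z. g (fst z) (snd z))" and g0: "g 0 0 = 0" and W: "(\<lambda>x. g (u x) (v x)) \<in> W1p p"
 shows "(\<lambda>x. g (u x) (v x)) \<in> W1p0 p A"
proof -
 obtain u' where u': "quasi_continuous_on p UNIV u'" "AE x in lebesgue. u' x = u x" "Cap p {x \<in> - A. u' x \<noteq> 0} = 0"
  using u by (auto simp: W1p0_def)
 obtain v' where v': "quasi_continuous_on p UNIV v'" "AE x in lebesgue. v' x = v x" "Cap p {x \<in> - A. v' x \<noteq> 0} = 0"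
  using v by (auto simp: W1p0_def)
 have "AE x in lebesgue. g (u' x) (v' x) = g (u x) (v x)" using u'(2) v'(2) by eventually_elim simp
 moreover have "Cap p {x \<in> - A. g (u' x) (v' x) \<noteq> 0} = 0"
 proof -
  have "Cap p {x \<in> - A. g (u' x) (v' x) \<noteq> 0} \<le> ennreal e" if "e > 0" for e
  proof -
   have "Cap p {x \<in> - A. g (u' x) (v' x) \<noteq> 0} \<le> Cap p ({x \<in> - A. u' x \<noteq> 0} \<union> {x \<in> - A. v' x \<noteq> 0})"
    by (rule Cap_mono) (use g0 in auto)
   also have "\<dots> \<le> ennreal e" by (rule Cap_Un_le[OF p that]) (use u'(3) v'(3) that in auto)
   finally show ?thesis .
  qed
  then show ?thesis by (rule Cap_eq_0I)
 qed
 moreover have "quasi_continuous_on p UNIV (\<lambda>x. g (u' x) (v' x))" by (rule quasi_continuous_comp[OF p u'(1) v'(1) g])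
 ultimately show ?thesis using W unfolding W1p0_def mem_Collect_eq by (intro conjI exI[of _ "\<lambda>x. g (u' x) (v' x)"])
qed

lemma W1p0_vanishes:
 assumes p: "p > 1" and u: "u \<in> W1p0 p A"
 shows "AE x in lebesgue. x \<notin> A \<longrightarrow> u x = 0" "AE x in lebesgue. x \<notin> A \<longrightarrow> grad u x = 0"
proof -
 obtain u' where u': "AE x in lebesgue. u' x = u x" "Cap p {x \<in> - A. u' x \<noteq> 0} = 0" using u by (auto simp: W1p0_def)
 have "AE x in lebesgue. x \<notin> {x \<in> - A. u' x \<noteq> 0}" by (rule AE_not_in_of_small_Cap[of p]) (use p u'(2) in auto)
 with u'(1) show 1: "AE x in lebesgue. x \<notin> A \<longrightarrow> u x = 0" by eventually_elim auto
 show "AE x in lebesgue. x \<notin> A \<longrightarrow> grad u x = 0" using 1 grad_eq_0_AE[OF W1p0_W1p[OF u] p] by eventually_elim auto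
qed

lemma W1p0_lincomb:
 assumes p: "p > 1" and u: "u \<in> W1p0 p A" and v: "v \<in> W1p0 p A"
 shows "(\<lambda>x. a * u x + b * v x) \<in> W1p0 p A" by (rule W1p0_comp[OF p u v, of "\<lambda>s t. a * s + b * t"])
  (auto intro!: continuous_intros W1p_lincomb(1) p W1p0_W1p[OF u] W1p0_W1p[OF v])

lemma W1p0_cong_AE:
 assumes u: "u \<in> W1p0 p A" and ae: "AE x in lebesgue. u x = v x" and m: "v \<in> lmeas"
 shows "v \<in> W1p0 p A"
proof -
 obtain u' where u': "quasi_continuous_on p UNIV u'" "AE x in lebesgue. u' x = u x" "Cap p {x \<in> - A. u' x \<noteq> 0} = 0"
  using u by (auto simp: W1p0_def)
 have "AE x in lebesgue. u' x = v x" using u'(2) ae by eventually_elim simp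
 with u'(1,3) W1p_cong_AE(1)[OF W1p0_W1p[OF u] ae m] show ?thesis unfolding W1p0_def mem_Collect_eq by (intro conjI exI[of _ u'])
qed

lemma W1p0_pos:
 assumes p: "p > 1" and u: "u \<in> W1p0 p A"
 shows "(\<lambda>x. max (u x) 0) \<in> W1p0 p A" by (rule W1p0_comp[OF p u u, of "\<lambda>s t. max s 0"])
  (auto intro!: continuous_intros W1p_pos(1) p W1p0_W1p[OF u])

lemma geometric_limit:
 fixes a :: "nat \<Rightarrow> real"
 assumes "\<And>j. j \<ge> m \<Longrightarrow> \<bar>a (Suc j) - a j\<bar> \<le> (1/2) ^ j"
 shows "a \<longlonglongrightarrow> lim a" "\<And>j. j \<ge> m \<Longrightarrow> \<bar>a j - lim a\<bar> \<le> 2 * (1/2) ^ j"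
proof -
 have step: "\<bar>a (j + k) - a j\<bar> \<le> 2 * (1/2) ^ j - 2 * (1/2) ^ (j + k)" if "j \<ge> m" for j k
 proof (induction k)
  case (Suc k)
  have "\<bar>a (Suc (j + k)) - a (j + k)\<bar> \<le> (1/2) ^ (j + k)" using that by (intro assms) simp
  moreover have "(1/2::real) ^ (j + Suc k) = (1/2) ^ (j + k) / 2" by simp
  ultimately show ?case using Suc unfolding add_Suc_right by linarith
 qed simp
 have step': "\<bar>a i - a j\<bar> \<le> 2 * (1/2) ^ j" if "j \<ge> m" "i \<ge> j" for i j
 proof -
  have eq: "j + (i - j) = i" using that by simp
  have "\<bar>a i - a j\<bar> \<le> 2 * (1/2) ^ j - 2 * (1/2) ^ i" using step[OF that(1), of "i - j"] unfolding eq .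
  moreover have "(1/2::real) ^ i \<ge> 0" by simp
  ultimately show ?thesis by linarith
 qed
 have "Cauchy a"
 proof (rule CauchyI')
  fix e :: real assume "e > 0"
  then obtain n where n: "(1/2::real) ^ n < e / 2" using real_arch_pow_inv[of "e / 2" "1/2"] by auto
  show "\<exists>M. \<forall>m\<ge>M. \<forall>n>m. dist (a m) (a n) < e"
  proof (intro exI[of _ "max m n"] allI impI)
   fix i j assume ij: "max m n \<le> i" "i < j"
   have "\<bar>a j - a i\<bar> \<le> 2 * (1/2) ^ i" using ij by (intro step') auto
   also have "(1/2::real) ^ i \<le> (1/2) ^ n" using ij by (intro power_decreasing) auto
   finally show "dist (a i) (a j) < e" using n by (simp add: dist_real_def abs_minus_commute)
  qed
 qed
 then show lim: "a \<longlonglongrightarrow> lim a" by (simp add: Cauchy_convergent_iff convergent_LIMSEQ_iff)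
 show "\<bar>a j - lim a\<bar> \<le> 2 * (1/2) ^ j" if "j \<ge> m" for j
 proof -
  have "(\<lambda>i. \<bar>a i - a j\<bar>) \<longlonglongrightarrow> \<bar>lim a - a j\<bar>" by (intro tendsto_intros lim)
  then have "\<bar>lim a - a j\<bar> \<le> 2 * (1/2) ^ j" by (rule LIMSEQ_le_const2) (use step'[OF that] in blast)
  then show ?thesis by (simp add: abs_minus_commute)
 qed
qed

lemma four_powr_small:
 assumes "p > 0" "e > 0"
 obtains m :: nat where "4 powr (- p * real m) < (e::real)"
proof -
 have "4 powr (- p) < (1::real)" using assms by (simp add: powr_less_one)
 then obtain m where "(4 powr (- p)) ^ m < e" using real_arch_pow_inv[OF assms(2)] by blast
 moreover have "(4 powr (- p)) ^ m = (4::real) powr (- p * real m)" by (simp add: powr_powr flip: powr_realpow)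
 ultimately show thesis using that by metis
qed

text \<open>Pass to a subsequence whose differences are so small in \<open>W\<^sup>1\<^sup>,\<^sup>p\<close> that, by the definition of capacity,
 the representatives \<open>vn\<close> differ by at most \<open>2\<^sup>-\<^sup>j\<close> outside an open set of capacity below \<open>4\<^sup>-\<^sup>p\<^sup>(\<^sup>j\<^sup>+\<^sup>1\<^sup>)\<close>. Outside the
 union of these sets from \<open>m\<close> on they converge uniformly, so their limit is quasi continuous, represents \<open>u\<close>,
 and vanishes outside \<open>A\<close> up to a set of capacity zero.\<close>

lemma W1p0_limit:
 assumes p: "p > 1" and un: "\<And>n. un n \<in> W1p0 p A" and u: "u \<in> W1p p"
  and l1: "(\<lambda>n. pint p (\<lambda>x. un n x - u x)) \<longlonglongrightarrow> 0" and l2: "(\<lambda>n. pint p (\<lambda>x. grad (un n) x - grad u x)) \<longlonglongrightarrow> 0"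
 shows "u \<in> W1p0 p A"
proof -
 have unW: "un n \<in> W1p p" for n by (rule W1p0_W1p[OF un])
 have "\<forall>n. \<exists>v. quasi_continuous_on p UNIV v \<and> (AE x in lebesgue. v x = un n x) \<and> Cap p {x \<in> - A. v x \<noteq> 0} = 0"
  using un by (simp add: W1p0_def)
 then obtain vn where vn: "\<And>n. quasi_continuous_on p UNIV (vn n)" "\<And>n. AE x in lebesgue. vn n x = un n x"
  "\<And>n. Cap p {x \<in> - A. vn n x \<noteq> 0} = 0" unfolding choice_iff by blast
 define \<kappa> where "\<kappa> j = 4 powr (- p * real (Suc j))" for j :: nat
 have \<kappa>: "\<kappa> j > 0" for j by (simp add: \<kappa>_def)
 \<comment> \<open>The factor \<open>(2 ^ j) powr p\<close> pays for dividing the difference by \<open>(1/2) ^ j\<close> in the estimate of its level set.\<close>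
 define \<tau> where "\<tau> j = \<kappa> j / (4 * 2 powr p * (2 ^ j) powr p)" for j
 have \<tau>: "\<tau> j > 0" for j using \<kappa>[of j] by (simp add: \<tau>_def)
 define En where "En m n = pint p (\<lambda>x. un m x - un n x) + pint p (\<lambda>x. grad (un m) x - grad (un n) x)" for m n
 have En_le: "En m n \<le> 2 powr p * ((pint p (\<lambda>x. un m x - u x) + pint p (\<lambda>x. grad (un m) x - grad u x)) +
   (pint p (\<lambda>x. un n x - u x) + pint p (\<lambda>x. grad (un n) x - grad u x)))" for m n
  using pint_triangle[OF W1p_Lp[OF unW[of m]] W1p_Lp[OF u] W1p_Lp[OF unW[of n]]]
   pint_triangle[OF W1pD(2)[OF unW[of m]] W1pD(2)[OF u] W1pD(2)[OF unW[of n]]] p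
   pint_commute[of p u "un n"] pint_commute[of p "grad u" "grad (un n)"] by (simp add: En_def algebra_simps)
 have ex: "\<exists>m>k. \<forall>i\<ge>m. \<forall>l\<ge>m. En i l \<le> \<tau> j" for j k
 proof -
  have "(\<lambda>n. pint p (\<lambda>x. un n x - u x) + pint p (\<lambda>x. grad (un n) x - grad u x)) \<longlonglongrightarrow> 0 + 0" by (intro tendsto_add l1 l2)
  then have "eventually (\<lambda>n. pint p (\<lambda>x. un n x - u x) + pint p (\<lambda>x. grad (un n) x - grad u x) < \<tau> j / (2 * 2 powr p)) sequentially"
   using order_tendstoD(2)[of _ 0 sequentially "\<tau> j / (2 * 2 powr p)"] \<tau>[of j] by simp
  then obtain N where N: "\<And>n. n \<ge> N \<Longrightarrow> pint p (\<lambda>x. un n x - u x) + pint p (\<lambda>x. grad (un n) x - grad u x) < \<tau> j / (2 * 2 powr p)"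
   by (auto simp: eventually_sequentially)
  show ?thesis
  proof (intro exI[of _ "max N (Suc k)"] conjI allI impI)
   fix i l assume "i \<ge> max N (Suc k)" "l \<ge> max N (Suc k)"
   then have "(pint p (\<lambda>x. un i x - u x) + pint p (\<lambda>x. grad (un i) x - grad u x)) +
    (pint p (\<lambda>x. un l x - u x) + pint p (\<lambda>x. grad (un l) x - grad u x)) \<le> \<tau> j / (2 * 2 powr p) + \<tau> j / (2 * 2 powr p)"
    using N[of i] N[of l] by (intro add_mono) auto
   from mult_left_mono[OF this, of "2 powr p"] show "En i l \<le> \<tau> j" using En_le[of i l] by simp
  qed simp
 qed
 obtain r where r: "strict_mono r" "\<And>j. \<forall>i\<ge>r j. \<forall>l\<ge>r j. En i l \<le> \<tau> j"
  using strict_mono_choice[of "\<lambda>j m. \<forall>i\<ge>m. \<forall>l\<ge>m. En i l \<le> \<tau> j", OF ex] by blast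
 have rle: "r j \<le> r (Suc j)" for j using strict_monoD[OF r(1), of j "Suc j"] by simp
 have Er: "En (r (Suc j)) (r j) \<le> \<tau> j" for j using r(2)[of j] rle[of j] by blast
 define \<sigma> where "\<sigma> j = \<kappa> j / (4 * 2 powr p)" for j
 have \<sigma>: "\<sigma> j > 0" for j using \<kappa>[of j] by (simp add: \<sigma>_def)
 have "\<forall>j. \<exists>V. open V \<and> Cap p V < ennreal (\<sigma> j) \<and> continuous_on (- V) (vn (r j)) \<and> continuous_on (- V) (vn (r (Suc j)))"
 proof
  fix j
  show "\<exists>V. open V \<and> Cap p V < ennreal (\<sigma> j) \<and> continuous_on (- V) (vn (r j)) \<and> continuous_on (- V) (vn (r (Suc j)))"
   by (rule quasi_continuous_pair[OF p vn(1)[of "r j"] vn(1)[of "r (Suc j)"] \<sigma>[of j]]) blast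
 qed
 then obtain V where V: "\<And>j. open (V j)" "\<And>j. Cap p (V j) < ennreal (\<sigma> j)"
  "\<And>j. continuous_on (- V j) (vn (r j))" "\<And>j. continuous_on (- V j) (vn (r (Suc j)))" unfolding choice_iff by blast
 \<comment> \<open>Adding the exceptional set \<open>V j\<close> makes the level set open.\<close>
 define O' where "O' j = {x. \<bar>vn (r (Suc j)) x - vn (r j) x\<bar> > (1/2) ^ j} \<union> V j" for j
 have openO: "open (O' j)" for j
 proof -
  have "continuous_on (- V j) (\<lambda>x. \<bar>vn (r (Suc j)) x - vn (r j) x\<bar>)" by (intro continuous_intros V)
  from continuous_openin_preimage_gen[OF this, of "{(1/2) ^ j<..}"]
  obtain T where T: "open T" "- V j \<inter> (\<lambda>x. \<bar>vn (r (Suc j)) x - vn (r j) x\<bar>) -` {(1/2) ^ j<..} = - V j \<inter> T"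
   by (auto simp: openin_open)
  have "O' j = T \<union> V j"
  proof (rule set_eqI)
   fix x
   have "x \<in> - V j \<inter> (\<lambda>x. \<bar>vn (r (Suc j)) x - vn (r j) x\<bar>) -` {(1/2) ^ j<..} \<longleftrightarrow> x \<in> - V j \<inter> T" using T(2) by simp
   then show "x \<in> O' j \<longleftrightarrow> x \<in> T \<union> V j" by (auto simp: O'_def)
  qed
  then show ?thesis using open_Un[OF T(1) V(1)[of j]] by simp
 qed
 have CapO: "Cap p (O' j) < ennreal (\<kappa> j)" for j
 proof -
  obtain \<psi> U where \<psi>: "\<psi> \<in> W1p p" "open U" "V j \<subseteq> U" "AE x in lebesgue. x \<in> U \<longrightarrow> \<psi> x \<ge> 1"
   "ennreal (pint p \<psi> + pint p (grad \<psi>)) < ennreal (\<sigma> j)" by (rule Cap_lessD[OF V(2)[of j]]) (rule that)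
  have "0 \<le> pint p \<psi> + pint p (grad \<psi>)" by (intro add_nonneg_nonneg pint_nonneg)
  then have E\<psi>: "pint p \<psi> + pint p (grad \<psi>) < \<sigma> j" using \<psi>(5) ennreal_less_iff by blast
  define d where "d x = 1 * un (r (Suc j)) x + (-1) * un (r j) x" for x
  have d: "d \<in> W1p p" "AE x in lebesgue. grad d x = 1 *\<^sub>R grad (un (r (Suc j))) x + (-1) *\<^sub>R grad (un (r j)) x"
   unfolding d_def[abs_def] by (rule W1p_lincomb[OF unW unW p])+
  have Ed: "pint p d + pint p (grad d) \<le> \<tau> j"
  proof -
   have "pint p d = pint p (\<lambda>x. un (r (Suc j)) x - un (r j) x)" by (simp add: d_def[abs_def])
   moreover have "pint p (grad d) = pint p (\<lambda>x. grad (un (r (Suc j))) x - grad (un (r j)) x)"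
   proof (rule pint_cong_AE)
    note [measurable] = grad_measurable[OF unW]
    show "(\<lambda>x. grad (un (r (Suc j))) x - grad (un (r j)) x) \<in> lmeas" by measurable
    show "AE x in lebesgue. norm (grad d x) = norm (grad (un (r (Suc j))) x - grad (un (r j)) x)"
     using d(2) by eventually_elim simp
   qed (rule grad_measurable[OF d(1)])
   ultimately show ?thesis using Er[of j] by (simp add: En_def)
  qed
  note ad = W1p_abs[OF d(1) p] and a\<psi> = W1p_abs[OF \<psi>(1) p]
  define w where "w x = 2 ^ j * \<bar>d x\<bar> + 1 * \<bar>\<psi> x\<bar>" for x
  have w: "w \<in> W1p p" "AE x in lebesgue. grad w x = (2 ^ j) *\<^sub>R grad (\<lambda>x. \<bar>d x\<bar>) x + 1 *\<^sub>R grad (\<lambda>x. \<bar>\<psi> x\<bar>) x"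
   unfolding w_def[abs_def] by (rule W1p_lincomb[OF ad(1) a\<psi>(1) p])+
  have gad: "pint p (grad (\<lambda>x. \<bar>d x\<bar>)) = pint p (grad d)"
   by (rule pint_cong_AE[OF ad(2) grad_measurable[OF ad(1)] grad_measurable[OF d(1)]])
  have ga\<psi>: "pint p (grad (\<lambda>x. \<bar>\<psi> x\<bar>)) = pint p (grad \<psi>)"
   by (rule pint_cong_AE[OF a\<psi>(2) grad_measurable[OF a\<psi>(1)] grad_measurable[OF \<psi>(1)]])
  have "pint p w \<le> 2 powr p * ((2 ^ j) powr p * pint p d + pint p \<psi>)"
  proof -
   have "pint p w = pint p (\<lambda>x. (2 ^ j) *\<^sub>R \<bar>d x\<bar> + \<bar>\<psi> x\<bar>)" by (simp add: w_def[abs_def])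
   also have "\<dots> \<le> 2 powr p * (pint p (\<lambda>x. (2 ^ j) *\<^sub>R \<bar>d x\<bar>) + pint p (\<lambda>x. \<bar>\<psi> x\<bar>))"
    using p by (intro Lp_add(2) Lp_scaleR W1p_Lp[OF ad(1)] W1p_Lp[OF a\<psi>(1)]) auto
   also have "pint p (\<lambda>x. (2 ^ j) *\<^sub>R \<bar>d x\<bar>) = (2 ^ j) powr p * pint p d" unfolding pint_scaleR by (simp add: pint_def)
   also have "pint p (\<lambda>x. \<bar>\<psi> x\<bar>) = pint p \<psi>" by (simp add: pint_def)
   finally show ?thesis .
  qed
  moreover have "pint p (grad w) \<le> 2 powr p * ((2 ^ j) powr p * pint p (grad d) + pint p (grad \<psi>))"
  proof -
   have "pint p (grad w) = pint p (\<lambda>x. (2 ^ j) *\<^sub>R grad (\<lambda>x. \<bar>d x\<bar>) x + grad (\<lambda>x. \<bar>\<psi> x\<bar>) x)"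
   proof (rule pint_cong_AE)
    note [measurable] = grad_measurable[OF ad(1)] grad_measurable[OF a\<psi>(1)]
    show "(\<lambda>x. (2 ^ j) *\<^sub>R grad (\<lambda>x. \<bar>d x\<bar>) x + grad (\<lambda>x. \<bar>\<psi> x\<bar>) x) \<in> lmeas" by measurable
    show "AE x in lebesgue. norm (grad w x) = norm ((2 ^ j) *\<^sub>R grad (\<lambda>x. \<bar>d x\<bar>) x + grad (\<lambda>x. \<bar>\<psi> x\<bar>) x)"
     using w(2) by eventually_elim simp
   qed (rule grad_measurable[OF w(1)])
   also have "\<dots> \<le> 2 powr p * (pint p (\<lambda>x. (2 ^ j) *\<^sub>R grad (\<lambda>x. \<bar>d x\<bar>) x) + pint p (grad (\<lambda>x. \<bar>\<psi> x\<bar>)))"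
    using p by (intro Lp_add(2) Lp_scaleR W1pD(2)[OF ad(1)] W1pD(2)[OF a\<psi>(1)]) auto
   finally show ?thesis by (simp add: pint_scaleR gad ga\<psi>)
  qed
  ultimately have "pint p w + pint p (grad w) \<le>
   2 powr p * ((2 ^ j) powr p * (pint p d + pint p (grad d)) + (pint p \<psi> + pint p (grad \<psi>)))" by (simp add: algebra_simps)
  also have "\<dots> \<le> 2 powr p * ((2 ^ j) powr p * \<tau> j + \<sigma> j)" using Ed E\<psi> by (intro mult_left_mono add_mono) auto
  also have "\<dots> = \<kappa> j / 2" by (simp add: \<tau>_def \<sigma>_def field_simps)
  also have "\<dots> < \<kappa> j" using \<kappa>[of j] by simp
  finally have Ew: "pint p w + pint p (grad w) < \<kappa> j" .
  have "Cap p (O' j) \<le> ennreal (pint p w + pint p (grad w))"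
  proof (rule Cap_leI[OF w(1) openO subset_refl])
   show "AE x in lebesgue. x \<in> O' j \<longrightarrow> 1 \<le> w x" using \<psi>(4) vn(2)[of "r j"] vn(2)[of "r (Suc j)"]
   proof eventually_elim
    case (elim x)
    show ?case
    proof
     assume "x \<in> O' j"
     then consider "x \<in> V j" | "\<bar>vn (r (Suc j)) x - vn (r j) x\<bar> > (1/2) ^ j" by (auto simp: O'_def)
     then show "1 \<le> w x"
     proof cases
      case 1
      then have "\<psi> x \<ge> 1" using elim(1) \<psi>(3) by blast
      moreover have "2 ^ j * \<bar>d x\<bar> \<ge> 0" by simp
      ultimately show ?thesis unfolding w_def by linarith
     next
      case 2
      then have "\<bar>d x\<bar> \<ge> (1/2) ^ j" using elim(2,3) by (simp add: d_def)
      then have "2 ^ j * \<bar>d x\<bar> \<ge> 2 ^ j * (1/2) ^ j" by (intro mult_left_mono) auto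
      also have "(2::real) ^ j * (1/2) ^ j = 1" by (simp flip: power_mult_distrib)
      finally show ?thesis unfolding w_def by simp
     qed
    qed
   qed
  qed
  also have "\<dots> < ennreal (\<kappa> j)" using Ew \<kappa>[of j] by (intro ennreal_lessI)
  finally show ?thesis .
 qed
 define W where "W m = (\<Union>i. O' (m + i))" for m
 have openW: "open (W m)" for m unfolding W_def using openO by blast
 have CapW: "Cap p (W m) \<le> ennreal (4 powr (- p * real m))" for m unfolding W_def
 proof (rule Cap_countable_union[OF p])
  fix i
  have "4 powr (- p * real m) * 4 powr (- p * real (Suc i)) = \<kappa> (m + i)"
   unfolding \<kappa>_def by (simp add: algebra_simps flip: powr_add)
  then show "Cap p (O' (m + i)) < ennreal (4 powr (- p * real m) * 4 powr (- p * real (Suc i)))" using CapO[of "m + i"] by simp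
 qed simp
 define v where "v x = lim (\<lambda>j. vn (r j) x)" for x
 have close: "\<bar>vn (r (Suc j)) x - vn (r j) x\<bar> \<le> (1/2) ^ j" if "x \<notin> W m" "j \<ge> m" for x m j
 proof -
  have "x \<notin> O' (m + (j - m))" using that(1) by (auto simp: W_def)
  then show ?thesis using that(2) by (auto simp: O'_def)
 qed
 have conv: "(\<lambda>j. vn (r j) x) \<longlonglongrightarrow> v x" if "x \<notin> W m" for x m unfolding v_def by (rule geometric_limit(1)[OF close[OF that]])
 have rate: "\<bar>vn (r j) x - v x\<bar> \<le> 2 * (1/2) ^ j" if "x \<notin> W m" "j \<ge> m" for x m j
  unfolding v_def using geometric_limit(2)[of m "\<lambda>j. vn (r j) x" j] close[OF that(1)] that(2) by blast
 have contv: "continuous_on (- W m) v" for m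
 proof (rule uniform_limit_theorem[where f = "\<lambda>j. vn (r j)" and F = sequentially])
  show "\<forall>\<^sub>F n in sequentially. continuous_on (- W m) (vn (r n))" using eventually_ge_at_top[of m]
  proof eventually_elim
   case (elim n)
   have "V n \<subseteq> O' (m + (n - m))" using elim by (simp add: O'_def)
   then have "- W m \<subseteq> - V n" by (auto simp: W_def)
   then show ?case using V(3) continuous_on_subset by blast
  qed
  show "uniform_limit (- W m) (\<lambda>j. vn (r j)) v sequentially"
  proof (rule uniform_limitI)
   fix e :: real assume "e > 0"
   then obtain n where n: "(1/2::real) ^ n < e / 2" using real_arch_pow_inv[of "e / 2" "1/2"] by auto
   show "\<forall>\<^sub>F j in sequentially. \<forall>x\<in>- W m. dist (vn (r j) x) (v x) < e" using eventually_ge_at_top[of "max m n"]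
   proof eventually_elim
    case (elim j)
    show ?case
    proof
     fix x assume "x \<in> - W m"
     then have "\<bar>vn (r j) x - v x\<bar> \<le> 2 * (1/2) ^ j" using rate elim by auto
     also have "(1/2::real) ^ j \<le> (1/2) ^ n" using elim by (intro power_decreasing) auto
     finally show "dist (vn (r j) x) (v x) < e" using n by (simp add: dist_real_def)
    qed
   qed
  qed
 qed simp
 have qcv: "quasi_continuous_on p UNIV v" unfolding quasi_continuous_on_def
 proof (intro allI impI)
  fix e :: real assume "e > 0"
  obtain m where m: "4 powr (- p * real m) < e" by (rule four_powr_small[of p e]) (use p \<open>e > 0\<close> in \<open>auto intro: that\<close>)
  have "Cap p (W m) < ennreal e" using CapW[of m] m \<open>e > 0\<close> by (metis ennreal_lessI le_less_trans)
  moreover have "continuous_on (UNIV - W m) v" using contv[of m] by (simp add: Compl_eq_Diff_UNIV)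
  ultimately show "\<exists>V. open V \<and> Cap p V < ennreal e \<and> continuous_on (UNIV - V) v" using openW by blast
 qed
 have out: "AE x in lebesgue. x \<notin> (\<Inter>m. W m)"
 proof (rule AE_not_in_of_small_Cap[of p])
  fix e :: real assume "e > 0"
  obtain m where m: "4 powr (- p * real m) < e" by (rule four_powr_small[of p e]) (use p \<open>e > 0\<close> in \<open>auto intro: that\<close>)
  have "Cap p (\<Inter>m. W m) \<le> Cap p (W m)" by (rule Cap_mono) blast
  also have "\<dots> \<le> ennreal (4 powr (- p * real m))" by (rule CapW)
  also have "\<dots> < ennreal e" using m \<open>e > 0\<close> by (intro ennreal_lessI)
  finally show "Cap p (\<Inter>m. W m) < ennreal e" .
 qed (use p in simp)
 obtain s where s: "strict_mono s" "AE x in lebesgue. (\<lambda>n. un (r (s n)) x) \<longlonglongrightarrow> u x"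
 proof (rule Lp_tendsto_AE_subseq[of "\<lambda>n. un (r n)" p u])
  show "(\<lambda>n. pint p (\<lambda>x. un (r n) x - u x)) \<longlonglongrightarrow> 0" using LIMSEQ_subseq_LIMSEQ[OF l1 r(1)] by (simp add: comp_def)
 qed (use W1p_Lp[OF unW] W1p_Lp[OF u] p in \<open>auto intro: that\<close>)
 have "AE x in lebesgue. \<forall>n. vn n x = un n x" using vn(2) by (simp add: AE_all_countable)
 with out s(2) have vu: "AE x in lebesgue. v x = u x"
 proof eventually_elim
  case (elim x)
  then obtain m where "x \<notin> W m" by blast
  then have "(\<lambda>j. vn (r j) x) \<longlonglongrightarrow> v x" by (rule conv)
  from LIMSEQ_subseq_LIMSEQ[OF this s(1)] have "(\<lambda>n. un (r (s n)) x) \<longlonglongrightarrow> v x" using elim by (simp add: comp_def)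
  then show ?case using elim LIMSEQ_unique by blast
 qed
 have "Cap p {x \<in> - A. v x \<noteq> 0} = 0"
 proof (rule Cap_eq_0I)
  fix e :: real assume e: "e > 0"
  define N where "N = (\<Union>j. {x \<in> - A. vn (r j) x \<noteq> 0})"
  have N0: "Cap p N = 0" unfolding N_def
  proof (rule Cap_eq_0I)
   fix e :: real assume "e > 0"
   then show "Cap p (\<Union>j. {x \<in> - A. vn (r j) x \<noteq> 0}) \<le> ennreal e"
    by (intro Cap_countable_union[OF p] Cap_0_less[OF vn(3)]) simp_all
  qed
  obtain m where m: "4 powr (- p * real m) < e * 4 powr (- p * 2)"
   by (rule four_powr_small[of p "e * 4 powr (- p * 2)"]) (use p e in \<open>auto intro: that\<close>)
  have "Cap p (W m) < ennreal (e * 4 powr (- p * 2))"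
   using CapW[of m] m e by (metis ennreal_lessI le_less_trans less_trans powr_gt_zero zero_neq_numeral)
  moreover have "Cap p N < ennreal (e * 4 powr (- p * 2))" using e by (intro Cap_0_less[OF N0]) simp
  ultimately have "Cap p (N \<union> W m) \<le> ennreal e" by (intro Cap_Un_le[OF p e])
  moreover have "{x \<in> - A. v x \<noteq> 0} \<subseteq> N \<union> W m"
  proof
   fix x assume x: "x \<in> {x \<in> - A. v x \<noteq> 0}"
   show "x \<in> N \<union> W m"
   proof (rule ccontr)
    assume nx: "x \<notin> N \<union> W m"
    then have "(\<lambda>j. vn (r j) x) \<longlonglongrightarrow> v x" using conv by blast
    moreover have "vn (r j) x = 0" for j using nx x by (auto simp: N_def)
    ultimately have "v x = 0" by (simp add: LIMSEQ_const_iff)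
    then show False using x by simp
   qed
  qed
  ultimately show "Cap p {x \<in> - A. v x \<noteq> 0} \<le> ennreal e" using Cap_mono order_trans by blast
 qed
 then show ?thesis using u vu qcv unfolding W1p0_def mem_Collect_eq by (intro conjI exI[of _ v])
qed

section \<open>Compactness\<close>

lemma Lp_of_nn_integral:
 fixes f :: "'a::euclidean_space \<Rightarrow> 'b::euclidean_space"
 assumes m[measurable]: "f \<in> lmeas" and le: "(\<integral>\<^sup>+x. ennreal (norm (f x) powr p) \<partial>lebesgue) \<le> ennreal c" and "c \<ge> 0"
 shows "f \<in> Lp p" "pint p f \<le> c"
proof -
 have "(\<integral>\<^sup>+x. ennreal (norm (f x) powr p) \<partial>lebesgue) < \<infinity>" using le ennreal_less_top le_less_trans by (metis infinity_ennreal_def)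
 then show L: "f \<in> Lp p" by (auto simp: Lp_def intro!: integrableI_nonneg m)
 show "pint p f \<le> c" using le \<open>c \<ge> 0\<close> by (simp add: nn_integral_pint[OF L])
qed

lemma indicator_Lp:
 assumes "A \<in> lmeasurable" shows "(\<lambda>x. indicator A x * c :: real) \<in> Lp p"
proof -
 have [measurable]: "A \<in> sets lebesgue" using assms by (rule fmeasurableD)
 have "integrable lebesgue (\<lambda>x. indicator A x * \<bar>c\<bar> powr p :: real)"
  using assms by (intro integrable_mult_left integrable_real_indicator) (auto simp: fmeasurable_def)
 moreover have "norm (indicator A x * c) powr p = indicator A x * \<bar>c\<bar> powr p" for x by (auto simp: indicator_def)
 ultimately show ?thesis unfolding Lp_def by simp
qed

lemma mollify_Lp_close:
 assumes u: "u \<in> W1p p" and m[measurable]: "u \<in> borel_measurable borel" and p: "p > 1" and eps: "eps > 0"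
 shows "(\<lambda>x. mollify eps u x - u x) \<in> Lp p" "pint p (\<lambda>x. mollify eps u x - u x) \<le> eps powr p * pint p (grad u)"
proof -
 have l: "loc_int u" using has_weak_gradient_locally_integrable(1)[OF W1pD(1)[OF u]] loc_int_iff[OF m] by blast
 have [measurable]: "mollify eps u \<in> borel_measurable borel" by (intro borel_measurable_continuous_onI mollify_continuous l eps)
 have mm: "(\<lambda>x. mollify eps u x - u x) \<in> lmeas" by (rule measurable_completion) simp
 have "(\<integral>\<^sup>+x. ennreal (norm (mollify eps u x - u x) powr p) \<partial>lebesgue) = (\<integral>\<^sup>+x. ennreal (\<bar>mollify eps u x - u x\<bar> powr p) \<partial>lborel)"
  by (simp add: nn_integral_completion)
 also have "\<dots> \<le> ennreal (eps powr p) * (\<integral>\<^sup>+x. ennreal (norm (grad u x) powr p) \<partial>lebesgue)"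
  by (rule mollify_estimate[OF W1pD(1)[OF u] m p eps])
 also have "\<dots> = ennreal (eps powr p * pint p (grad u))" by (simp add: nn_integral_pint[OF W1pD(2)[OF u]] ennreal_mult pint_nonneg)
 finally have le: "(\<integral>\<^sup>+x. ennreal (norm (mollify eps u x - u x) powr p) \<partial>lebesgue) \<le> ennreal (eps powr p * pint p (grad u))" .
 have "0 \<le> eps powr p * pint p (grad u)" by (intro mult_nonneg_nonneg pint_nonneg) simp
 from Lp_of_nn_integral[OF mm le this]
 show "(\<lambda>x. mollify eps u x - u x) \<in> Lp p" "pint p (\<lambda>x. mollify eps u x - u x) \<le> eps powr p * pint p (grad u)" by auto
qed

text \<open>A diagonal argument over \<open>j\<close> and a countable dense set at once; the Lipschitz bound extends convergence
 to all points.\<close>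

lemma equi_Lipschitz_convergent_subseq:
 fixes v :: "nat \<Rightarrow> nat \<Rightarrow> 'a::euclidean_space \<Rightarrow> real"
 assumes bd: "\<And>j n x. \<bar>v j n x\<bar> \<le> K j" and lip: "\<And>j n x y. \<bar>v j n x - v j n y\<bar> \<le> L j * norm (x - y)"
 obtains k :: "nat \<Rightarrow> nat" where "strict_mono k" "\<And>j x. convergent (\<lambda>n. v j (k n) x)"
proof -
 obtain D :: "'a set" where D: "countable D" "\<And>X. open X \<Longrightarrow> X \<noteq> {} \<Longrightarrow> \<exists>d\<in>D. d \<in> X" by (rule countable_dense_setE) blast
 have K: "K j \<ge> 0" for j using bd[of j 0 0] by simp
 have L: "L j \<ge> 0" for j
 proof -
  obtain b :: 'a where "b \<in> Basis" using nonempty_Basis by blast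
  then have "0 \<le> L j * 1" using lip[of j 0 b 0] by (simp add: norm_Basis)
  then show ?thesis by simp
 qed
 define f where "f n = (\<lambda>(j, d). v j n d / (K j + 1))" for n
 have "norm (f n z) \<le> 1" for n z
 proof -
  obtain j d where z: "z = (j, d)" by force
  have "\<bar>v j n d\<bar> \<le> K j + 1" using bd[of j n d] by simp
  then show ?thesis using K[of j] by (simp add: f_def z divide_le_eq abs_div_pos[symmetric] abs_divide)
 qed
 then obtain k :: "nat \<Rightarrow> nat" where k: "strict_mono k" "\<And>z. z \<in> UNIV \<times> D \<Longrightarrow> \<exists>l. (\<lambda>n. f (k n) z) \<longlonglongrightarrow> l"
  using function_convergent_subsequence[of "UNIV \<times> D" f 1] D(1) by (metis countable_SIGMA uncountable_def countableI_type)
 have cD: "convergent (\<lambda>n. v j (k n) d)" if dD: "d \<in> D" for j d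
 proof -
  obtain l where "(\<lambda>n. f (k n) (j, d)) \<longlonglongrightarrow> l" using k(2)[of "(j, d)"] dD by auto
  then have "(\<lambda>n. v j (k n) d / (K j + 1) * (K j + 1)) \<longlonglongrightarrow> l * (K j + 1)" unfolding f_def by (intro tendsto_intros) simp
  moreover have "K j + 1 \<noteq> 0" using K[of j] by simp
  ultimately show ?thesis by (auto simp: convergent_def)
 qed
 have "convergent (\<lambda>n. v j (k n) x)" for j x
 proof -
  have "Cauchy (\<lambda>n. v j (k n) x)"
  proof (rule CauchyI)
   fix e :: real assume e: "e > 0"
   define \<rho> where "\<rho> = e / (3 * (L j + 1))"
   have \<rho>: "\<rho> > 0" "L j * \<rho> < e / 3" using e L[of j] by (auto simp: \<rho>_def field_simps)
   obtain d where d: "d \<in> D" "d \<in> ball x \<rho>" using D(2)[of "ball x \<rho>"] \<rho>(1) by auto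
   have near: "\<bar>v j n x - v j n d\<bar> < e / 3" for n
   proof -
    have "L j * norm (x - d) \<le> L j * \<rho>" using d(2) L[of j] by (intro mult_left_mono) (auto simp: dist_norm)
    then show ?thesis using lip[of j n x d] \<rho>(2) by linarith
   qed
   have "Cauchy (\<lambda>n. v j (k n) d)" using cD[OF d(1)] by (simp add: Cauchy_convergent_iff)
   then obtain M where M: "\<And>m n. m \<ge> M \<Longrightarrow> n \<ge> M \<Longrightarrow> norm (v j (k m) d - v j (k n) d) < e / 3"
    using e unfolding Cauchy_iff by (metis divide_pos_pos zero_less_numeral)
   show "\<exists>M. \<forall>m\<ge>M. \<forall>n\<ge>M. norm (v j (k m) x - v j (k n) x) < e"
   proof (intro exI[of _ M] allI impI)
    fix m n assume "m \<ge> M" "n \<ge> M"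
    then show "norm (v j (k m) x - v j (k n) x) < e" using M[of m n] near[of "k m"] near[of "k n"]
     unfolding real_norm_def by linarith
   qed
  qed
  then show ?thesis by (simp add: Cauchy_convergent_iff)
 qed
 with k(1) that show thesis by blast
qed

text \<open>For every scale the mollified functions are bounded and equi-Lipschitz, so along one subsequence they
 converge everywhere, and in \<open>L\<^sup>p(A)\<close> by dominated convergence since \<open>A\<close> has finite measure. The
 mollification error is uniformly small.\<close>

lemma W1p_compact:
 fixes u :: "nat \<Rightarrow> 'a::euclidean_space \<Rightarrow> real"
 assumes p: "p > 1" and A: "A \<in> lmeasurable" and u: "\<And>n. u n \<in> W1p p"
  and van: "\<And>n. AE x in lebesgue. x \<notin> A \<longrightarrow> u n x = 0"
  and b1: "\<And>n. pint p (u n) \<le> B" and b2: "\<And>n. pint p (grad (u n)) \<le> B"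
 obtains r :: "nat \<Rightarrow> nat" where "strict_mono r" "\<And>e. e > 0 \<Longrightarrow> \<exists>N. \<forall>m\<ge>N. \<forall>n\<ge>N. pint p (\<lambda>x. u (r m) x - u (r n) x) \<le> e"
proof -
 have Ameas[measurable]: "A \<in> sets lebesgue" using A by (rule fmeasurableD)
 have B: "B \<ge> 0" using order_trans[OF pint_nonneg b1] .
 have "\<forall>n. \<exists>w. w \<in> borel_measurable borel \<and> (AE x in lebesgue. u n x = w x)"
 proof
  fix n
  show "\<exists>w. w \<in> borel_measurable borel \<and> (AE x in lebesgue. u n x = w x)"
   by (rule borel_version[OF W1p_measurable[OF u[of n]]]) blast
 qed
 then obtain w where wm[measurable]: "\<And>n. w n \<in> borel_measurable borel" and wae: "\<And>n. AE x in lebesgue. u n x = w n x"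
  unfolding choice_iff by blast
 have wml[measurable]: "w n \<in> lmeas" for n by (rule measurable_completion) (simp add: wm)
 have w: "w n \<in> W1p p" for n by (rule W1p_cong_AE(1)[OF u wae wml])
 have gw: "pint p (grad (w n)) \<le> B" for n
 proof -
  have "pint p (grad (w n)) = pint p (grad (u n))" by (rule pint_cong_AE[OF _ grad_measurable[OF w] grad_measurable[OF u]])
    (use W1p_cong_AE(2)[OF u wae wml, of n] in \<open>eventually_elim, simp\<close>)
  then show ?thesis using b2 by simp
 qed
 have pw: "pint p (w n) \<le> B" for n
 proof -
  have "pint p (w n) = pint p (u n)"
   by (rule pint_cong_AE[OF _ wml W1p_measurable[OF u]]) (use wae[of n] in \<open>eventually_elim, simp\<close>)
  then show ?thesis using b1 by simp
 qed
 define a where "a n x = indicator A x * w n x" for n x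
 have [measurable]: "a n \<in> lmeas" for n unfolding a_def[abs_def] by measurable
 have aw: "AE x in lebesgue. a n x = w n x" for n using van[of n] wae[of n] by eventually_elim (auto simp: a_def indicator_def)
 have aL: "a n \<in> Lp p" for n by (rule Lp_cong_AE[OF W1p_Lp[OF w[of n]]]) (use aw[of n] in \<open>eventually_elim, simp\<close>, measurable)
 define M where "M = measure lebesgue A + B"
 have M: "M \<ge> 0" using B by (simp add: M_def)
 have intA: "integrable lebesgue (indicator A :: 'a \<Rightarrow> real)"
  using A by (intro integrable_real_indicator) (auto simp: fmeasurable_def)
 have wbd: "AE x in lebesgue. norm (w n x) \<le> indicator A x + norm (w n x) powr p" for n using aw[of n]
 proof eventually_elim
  case (elim x)
  show ?case
  proof (cases "x \<in> A")
   case True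
   then show ?thesis
   proof (cases "norm (w n x) \<le> 1")
    case False
    then show ?thesis using powr_mono[of 1 p "norm (w n x)"] p \<open>x \<in> A\<close> by simp
   qed (use True in \<open>simp add: add_increasing2\<close>)
  qed (use elim in \<open>simp add: a_def\<close>)
 qed
 have wint: "integrable lebesgue (w n)" for n
 proof (rule Bochner_Integration.integrable_bound)
  show "integrable lebesgue (\<lambda>x. indicator A x + norm (w n x) powr p)"
   by (intro Bochner_Integration.integrable_add intA Lp_integrable W1p_Lp w)
  show "AE x in lebesgue. norm (w n x) \<le> norm (indicator A x + norm (w n x) powr p)" using wbd[of n] by eventually_elim simp
 qed measurable
 have wint': "integrable lborel (w n)" for n using wint[of n] wm[of n] by (subst (asm) integrable_completion) auto
 have wM: "(LINT x|lborel. \<bar>w n x\<bar>) \<le> M" for n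
 proof -
  have "(LINT x|lborel. \<bar>w n x\<bar>) = (LINT x|lebesgue. norm (w n x))" using wm[of n] by (subst integral_completion) auto
  also have "\<dots> \<le> (LINT x|lebesgue. indicator A x + norm (w n x) powr p)"
   by (rule integral_mono_AE) (use wint wbd intA Lp_integrable[OF W1p_Lp[OF w[of n]]] in auto)
  also have "\<dots> = measure lebesgue A + pint p (w n)" using intA Lp_integrable[OF W1p_Lp[OF w[of n]]] by (simp add: pint_def)
  also have "\<dots> \<le> M" using pw by (simp add: M_def)
  finally show ?thesis .
 qed
 define eps where "eps j = 1 / real (Suc j)" for j
 have eps: "eps j > 0" for j by (simp add: eps_def)
 define v where "v j n = mollify (eps j) (w n)" for j n
 define Kb where "Kb j = inverse (bump_mass TYPE('a) (eps j))" for j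
 have Kb: "\<bar>bump (eps j) z\<bar> \<le> Kb j" for j and z :: 'a
  using bump_le[OF eps, of j z] bump_nonneg[OF eps, of j z] by (simp add: Kb_def)
 have Kb0: "Kb j \<ge> 0" for j using order_trans[OF abs_ge_zero Kb] .
 have "\<forall>j. \<exists>Lb>0. \<forall>z y::'a. \<bar>bump (eps j) z - bump (eps j) y\<bar> \<le> Lb * norm (z - y)"
 proof
  fix j show "\<exists>Lb>0. \<forall>z y::'a. \<bar>bump (eps j) z - bump (eps j) y\<bar> \<le> Lb * norm (z - y)" by (rule bump_Lipschitz[OF eps[of j]]) blast
 qed
 then obtain Lb where Lb: "\<And>j. Lb j > 0" "\<And>j (z::'a) y. \<bar>bump (eps j) z - bump (eps j) y\<bar> \<le> Lb j * norm (z - y)" by metis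
 have li: "loc_int (w n)" for n by (rule integrable_imp_loc_int[OF wint'])
 have vb: "\<bar>v j n x\<bar> \<le> Kb j * M" for j n x
 proof -
  have "norm (v j n x) \<le> (LINT y|lborel. Kb j * \<bar>w n y\<bar>)" unfolding v_def mollify_def
  proof (rule norm_integral_le[OF integrable_bump_shift[OF li eps]])
   show "integrable lborel (\<lambda>y. Kb j * \<bar>w n y\<bar>)" using wint' by simp
   show "norm (bump (eps j) (y - x) *\<^sub>R w n y) \<le> Kb j * \<bar>w n y\<bar>" for y
    using mult_right_mono[OF Kb[of j "y - x"] abs_ge_zero[of "w n y"]] by (simp add: abs_mult)
  qed
  also have "\<dots> \<le> Kb j * M" using mult_left_mono[OF wM[of n] Kb0[of j]] by simp
  finally show ?thesis by simp
 qed
 have vlip: "\<bar>v j n x - v j n y\<bar> \<le> (Lb j * M) * norm (x - y)" for j n x y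
 proof -
  have i: "integrable lborel (\<lambda>z. bump (eps j) (z - x) *\<^sub>R w n z)" for x by (rule integrable_bump_shift[OF li eps])
  have "v j n x - v j n y = (LINT z|lborel. bump (eps j) (z - x) *\<^sub>R w n z - bump (eps j) (z - y) *\<^sub>R w n z)"
   unfolding v_def mollify_def using i by (subst Bochner_Integration.integral_diff) auto
  also have "norm \<dots> \<le> (LINT z|lborel. (Lb j * norm (x - y)) * \<bar>w n z\<bar>)"
  proof (rule norm_integral_le)
   show "integrable lborel (\<lambda>z. bump (eps j) (z - x) *\<^sub>R w n z - bump (eps j) (z - y) *\<^sub>R w n z)"
    by (intro Bochner_Integration.integrable_diff i)
   show "integrable lborel (\<lambda>z. (Lb j * norm (x - y)) * \<bar>w n z\<bar>)" using wint' by simp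
   fix z
   have "norm ((z - x) - (z - y)) = norm (x - y)" by (simp add: norm_minus_commute)
   then have "\<bar>bump (eps j) (z - x) - bump (eps j) (z - y)\<bar> \<le> Lb j * norm (x - y)" using Lb(2)[of j "z - x" "z - y"] by simp
   from mult_right_mono[OF this abs_ge_zero[of "w n z"]]
   show "norm (bump (eps j) (z - x) *\<^sub>R w n z - bump (eps j) (z - y) *\<^sub>R w n z) \<le> (Lb j * norm (x - y)) * \<bar>w n z\<bar>"
    by (simp add: abs_mult flip: left_diff_distrib)
  qed
  also have "\<dots> = (Lb j * norm (x - y)) * (LINT z|lborel. \<bar>w n z\<bar>)" by (rule integral_mult_right_zero)
  also have "\<dots> \<le> (Lb j * norm (x - y)) * M" using Lb(1)[of j] by (intro mult_left_mono wM) (simp add: less_imp_le)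
  finally show ?thesis by (simp add: mult_ac)
 qed
 obtain k :: "nat \<Rightarrow> nat" where k: "strict_mono k" "\<And>j x. convergent (\<lambda>n. v j (k n) x)"
  by (rule equi_Lipschitz_convergent_subseq[of v "\<lambda>j. Kb j * M" "\<lambda>j. Lb j * M", OF vb vlip]) (rule that)
 have vm: "v j n \<in> lmeas" for j n
 proof (rule measurable_completion)
  show "v j n \<in> borel_measurable lborel"
   unfolding v_def using borel_measurable_continuous_onI[OF mollify_continuous[OF li eps]] by simp
 qed
 define g where "g j n x = indicator A x * v j (k n) x" for j n x
 define h where "h j x = indicator A x * lim (\<lambda>n. v j (k n) x)" for j x
 note [measurable] = vm
 have gm[measurable]: "g j n \<in> lmeas" for j n unfolding g_def[abs_def] by measurable
 have hm[measurable]: "h j \<in> lmeas" for j unfolding h_def[abs_def] by measurable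
 have ub: "AE x in lebesgue. norm (g j n x) \<le> indicator A x * (Kb j * M)" for j n using vb by (auto simp: g_def indicator_def)
 have lg: "AE x in lebesgue. (\<lambda>n. g j n x) \<longlonglongrightarrow> h j x" for j
 proof (rule AE_I2)
  fix x show "(\<lambda>n. g j n x) \<longlonglongrightarrow> h j x"
   using k(2)[of j x] unfolding g_def h_def by (intro tendsto_intros) (simp add: convergent_LIMSEQ_iff)
 qed
 note dc = Lp_dominated_convergence[OF gm hm indicator_Lp[OF A] ub lg p]
 have ag: "pint p (\<lambda>x. a (k n) x - g j n x) \<le> eps j powr p * B" for j n
 proof -
  have "pint p (\<lambda>x. a (k n) x - g j n x) \<le> 1 powr p * pint p (\<lambda>x. v j (k n) x - w (k n) x)"
  proof (rule Lp_dominated(2))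
   show "(\<lambda>x. v j (k n) x - w (k n) x) \<in> Lp p" unfolding v_def by (rule mollify_Lp_close(1)[OF w wm p eps])
   show "AE x in lebesgue. norm (a (k n) x - g j n x) \<le> 1 * norm (v j (k n) x - w (k n) x)"
    by (auto simp: a_def g_def indicator_def abs_minus_commute)
  qed (use p in auto)
  also have "\<dots> \<le> eps j powr p * pint p (grad (w (k n)))"
   unfolding v_def using mollify_Lp_close(2)[OF w wm p eps, of j "k n"] by simp
  also have "\<dots> \<le> eps j powr p * B" using gw by (intro mult_left_mono) auto
  finally show ?thesis .
 qed
 show thesis
 proof (rule that[OF k(1)])
  fix e :: real assume e: "e > 0"
  define Q where "Q = 2 powr p"
  have Q: "Q \<ge> 1" using p unfolding Q_def by (intro ge_one_powr_ge_zero) auto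
  have "(\<lambda>j. Q * Q * (eps j powr p * B)) \<longlonglongrightarrow> Q * Q * (0 powr p * B)" using LIMSEQ_Suc[OF lim_1_over_n] p unfolding eps_def
   by (intro tendsto_intros tendsto_powr2) auto
  then have "eventually (\<lambda>j. Q * Q * (eps j powr p * B) < e / (4 * Q)) sequentially"
   using order_tendstoD(2)[of _ 0 sequentially "e / (4 * Q)"] e p Q by simp
  then obtain j where j: "Q * Q * (eps j powr p * B) < e / (4 * Q)" by (auto simp: eventually_sequentially)
  have "(\<lambda>n. Q * Q * pint p (\<lambda>x. g j n x - h j x)) \<longlonglongrightarrow> Q * Q * 0" by (intro tendsto_intros dc(3))
  then have "eventually (\<lambda>n. Q * Q * pint p (\<lambda>x. g j n x - h j x) < e / (4 * Q)) sequentially"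
   using order_tendstoD(2)[of _ 0 sequentially "e / (4 * Q)"] e Q by simp
  then obtain N where N: "\<And>n. n \<ge> N \<Longrightarrow> Q * Q * pint p (\<lambda>x. g j n x - h j x) < e / (4 * Q)" by (auto simp: eventually_sequentially)
  have ah: "pint p (\<lambda>x. a (k n) x - h j x) \<le> e / (2 * Q)" if "n \<ge> N" for n
  proof -
   have "pint p (\<lambda>x. a (k n) x - h j x) \<le> Q * (pint p (\<lambda>x. a (k n) x - g j n x) + pint p (\<lambda>x. g j n x - h j x))"
    unfolding Q_def by (rule pint_triangle[OF aL dc(1) dc(2)]) (use p in simp)
   also have "\<dots> \<le> Q * (Q * (pint p (\<lambda>x. a (k n) x - g j n x) + pint p (\<lambda>x. g j n x - h j x)))"
    using Q pint_nonneg[of p "\<lambda>x. a (k n) x - g j n x"] pint_nonneg[of p "\<lambda>x. g j n x - h j x"]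
    by (intro mult_left_mono) (auto intro: mult_left_mono[of 1 Q, simplified] simp: mult_le_cancel_right1)
   also have "\<dots> \<le> Q * Q * (eps j powr p * B) + Q * Q * pint p (\<lambda>x. g j n x - h j x)"
    using mult_left_mono[OF ag[of n j], of "Q * Q"] Q by (simp add: algebra_simps)
   also have "\<dots> \<le> e / (4 * Q) + e / (4 * Q)" using j N[OF that] by linarith
   finally show ?thesis by simp
  qed
  show "\<exists>N. \<forall>m\<ge>N. \<forall>n\<ge>N. pint p (\<lambda>x. u (k m) x - u (k n) x) \<le> e"
  proof (intro exI[of _ N] allI impI)
   fix m n assume mn: "m \<ge> N" "n \<ge> N"
   have "pint p (\<lambda>x. u (k m) x - u (k n) x) = pint p (\<lambda>x. a (k m) x - a (k n) x)"
   proof (rule pint_cong_AE)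
    note [measurable] = W1p_measurable[OF u]
    show "(\<lambda>x. u (k m) x - u (k n) x) \<in> lmeas" "(\<lambda>x. a (k m) x - a (k n) x) \<in> lmeas" by measurable
    show "AE x in lebesgue. norm (u (k m) x - u (k n) x) = norm (a (k m) x - a (k n) x)"
     using aw[of "k m"] aw[of "k n"] wae[of "k m"] wae[of "k n"] by eventually_elim simp
   qed
   also have "\<dots> \<le> Q * (pint p (\<lambda>x. a (k m) x - h j x) + pint p (\<lambda>x. h j x - a (k n) x))"
    unfolding Q_def by (rule pint_triangle[OF aL dc(2) aL]) (use p in simp)
   also have "\<dots> \<le> Q * (e / (2 * Q) + e / (2 * Q))"
    using ah[OF mn(1)] ah[OF mn(2)] pint_commute[of p "h j" "a (k n)"] Q by (intro mult_left_mono add_mono) auto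
   also have "\<dots> = e" using Q by simp
   finally show "pint p (\<lambda>x. u (k m) x - u (k n) x) \<le> e" .
  qed
 qed
qed

section \<open>Limits of eigenfunctions\<close>

lemma flux_scaleR_any: "flux p (c *\<^sub>R x) = (\<bar>c\<bar> powr (p - 2) * c) *\<^sub>R flux p x"
 by (simp add: flux_def powr_mult)

text \<open>The form on both sides of the eigenvalue equation, with gradients or with values.\<close>

definition pair_int :: "real \<Rightarrow> ('a::euclidean_space \<Rightarrow> 'b::euclidean_space) \<Rightarrow> ('a \<Rightarrow> 'b) \<Rightarrow> real" where
 "pair_int p f g = (LINT x|lebesgue. flux p (f x) \<bullet> g x)"

lemma flux_measurable:
 assumes "f \<in> borel_measurable M" "p > 1" shows "(\<lambda>x. flux p (f x)) \<in> borel_measurable M"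
 using measurable_compose[OF assms(1) borel_measurable_flux[OF assms(2)]] .

lemma flux_integrable:
 assumes f: "f \<in> Lp p" and g: "g \<in> Lp p" and p: "p > 1"
 shows "integrable lebesgue (\<lambda>x. flux p (f x) \<bullet> g x)"
proof (rule Bochner_Integration.integrable_bound)
 show "integrable lebesgue (\<lambda>x. norm (f x) powr p + norm (g x) powr p)"
  by (intro Bochner_Integration.integrable_add Lp_integrable f g)
 show "(\<lambda>x. flux p (f x) \<bullet> g x) \<in> lmeas"
  by (intro borel_measurable_inner flux_measurable Lp_measurable[OF f] Lp_measurable[OF g] p)
 show "AE x in lebesgue. norm (flux p (f x) \<bullet> g x) \<le> norm (norm (f x) powr p + norm (g x) powr p)"
  using flux_inner_le[of 1 p] p by (intro AE_I2) simp
qed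

lemma pair_int_bound:
 assumes f: "f \<in> Lp p" and g: "g \<in> Lp p" and p: "p > 1" and \<eta>: "\<eta> > 0"
 shows "\<bar>pair_int p f g\<bar> \<le> \<eta> * pint p f + \<eta> powr (1 - p) * pint p g"
proof -
 have "norm (pair_int p f g) \<le> (LINT x|lebesgue. \<eta> * norm (f x) powr p + \<eta> powr (1 - p) * norm (g x) powr p)"
  unfolding pair_int_def using flux_inner_le[OF \<eta> p] Lp_integrable[OF f] Lp_integrable[OF g]
  by (intro norm_integral_le flux_integrable f g p) auto
 also have "\<dots> = \<eta> * pint p f + \<eta> powr (1 - p) * pint p g" using Lp_integrable[OF f] Lp_integrable[OF g] by (simp add: pint_def)
 finally show ?thesis by simp
qed

lemma pair_int_self: "pair_int p f f = pint p f"
 by (simp add: pair_int_def pint_def flux_inner_self)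

lemma pair_int_uminus_right: "pair_int p f (\<lambda>x. - g x) = - pair_int p f g"
 by (simp add: pair_int_def)

lemma pair_int_scaleR_left: "pair_int p (\<lambda>x. c *\<^sub>R f x) g = (\<bar>c\<bar> powr (p - 2) * c) * pair_int p f g"
 by (simp add: pair_int_def flux_scaleR_any)

lemma pair_int_cong_AE:
 fixes f g f' g' :: "'a::euclidean_space \<Rightarrow> 'b::euclidean_space"
 assumes "AE x in lebesgue. f x = f' x" "AE x in lebesgue. g x = g' x" "p > 1"
  and "f \<in> lmeas" "g \<in> lmeas" "f' \<in> lmeas" "g' \<in> lmeas"
 shows "pair_int p f g = pair_int p f' g'" unfolding pair_int_def
proof (rule integral_cong_AE)
 show "AE x in lebesgue. flux p (f x) \<bullet> g x = flux p (f' x) \<bullet> g' x" using assms(1,2) by eventually_elim simp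
qed (intro borel_measurable_inner flux_measurable assms)+

lemma pair_int_tendsto:
 fixes f :: "nat \<Rightarrow> 'a::euclidean_space \<Rightarrow> 'b::euclidean_space"
 assumes f: "\<And>n. f n \<in> Lp p" and h: "h \<in> Lp p" and g: "g \<in> Lp p" and lim: "(\<lambda>n. pint p (\<lambda>x. f n x - h x)) \<longlonglongrightarrow> 0" and p: "p > 1"
 shows "(\<lambda>n. pair_int p (f n) g) \<longlonglongrightarrow> pair_int p h g"
proof -
 have d: "(\<lambda>x. f n x - h x) \<in> Lp p" for n using Lp_diff(1)[OF f h] p by simp
 define B where "B = (pint p h + 1) + pint p h + pint p g"
 have B: "B \<ge> 0" unfolding B_def by (intro add_nonneg_nonneg pint_nonneg) simp
 have "(\<lambda>n. \<bar>pair_int p (f n) g - pair_int p h g\<bar>) \<longlonglongrightarrow> 0"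
 proof (rule real_tendsto_0_I)
  fix e :: real assume "e > 0"
  define \<delta> where "\<delta> = e / (2 * (B + 1))"
  have \<delta>: "\<delta> > 0" "\<delta> * B \<le> e / 2" using \<open>e > 0\<close> B by (auto simp: \<delta>_def field_simps)
  obtain C where C: "C \<ge> 0" "\<And>x y z::'b. \<bar>(flux p x - flux p y) \<bullet> z\<bar> \<le>
   \<delta> * (norm x powr p + norm y powr p + norm z powr p) + C * norm (x - y) powr p"
   by (rule abs_flux_diff_inner_le[OF p \<delta>(1)]) (rule that)
  have le: "\<bar>pair_int p (f n) g - pair_int p h g\<bar> \<le> \<delta> * (pint p (f n) + pint p h + pint p g) + C * pint p (\<lambda>x. f n x - h x)" for n
  proof -
   note i = Lp_integrable[OF f[of n]] Lp_integrable[OF h] Lp_integrable[OF g] Lp_integrable[OF d[of n]]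
   have ii: "integrable lebesgue (\<lambda>x. (flux p (f n x) - flux p (h x)) \<bullet> g x)"
    using flux_integrable[OF f[of n] g p] flux_integrable[OF h g p] by (simp add: inner_diff_left)
   have "\<bar>pair_int p (f n) g - pair_int p h g\<bar> = norm (LINT x|lebesgue. (flux p (f n x) - flux p (h x)) \<bullet> g x)"
    using flux_integrable[OF f[of n] g p] flux_integrable[OF h g p] by (simp add: pair_int_def inner_diff_left)
   also have "\<dots> \<le> (LINT x|lebesgue. \<delta> * (norm (f n x) powr p + norm (h x) powr p + norm (g x) powr p) + C * norm (f n x - h x) powr p)"
    using i C(2) by (intro norm_integral_le ii) auto
   also have "\<dots> = \<delta> * (pint p (f n) + pint p h + pint p g) + C * pint p (\<lambda>x. f n x - h x)" using i by (simp add: pint_def)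
   finally show ?thesis .
  qed
  have "(\<lambda>n. C * pint p (\<lambda>x. f n x - h x)) \<longlonglongrightarrow> C * 0" by (intro tendsto_intros lim)
  then have "eventually (\<lambda>n. C * pint p (\<lambda>x. f n x - h x) < e / 2) sequentially"
   using order_tendstoD(2)[of _ 0 sequentially "e / 2"] \<open>e > 0\<close> by simp
  moreover have "eventually (\<lambda>n. pint p (f n) < pint p h + 1) sequentially"
   by (rule order_tendstoD(2)[OF pint_tendsto[OF f h lim p]]) simp
  ultimately show "eventually (\<lambda>n. \<bar>pair_int p (f n) g - pair_int p h g\<bar> \<le> e) sequentially"
  proof eventually_elim
   case (elim n)
   have le_B: "pint p (f n) + pint p h + pint p g \<le> B" using elim by (simp add: B_def)
   have "\<delta> * (pint p (f n) + pint p h + pint p g) \<le> e / 2" using order_trans[OF mult_left_mono[OF le_B, of \<delta>] \<delta>(2)] \<delta>(1) by simp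
   then show ?case using le[of n] elim by linarith
  qed
 qed simp
 then show ?thesis by (simp add: tendsto_rabs_zero_iff LIM_zero_iff)
qed

lemma set_LINT_eq_LINT:
 fixes f :: "'a::euclidean_space \<Rightarrow> real"
 assumes [measurable]: "A \<in> sets lebesgue" "f \<in> lmeas" and "AE x in lebesgue. x \<notin> A \<longrightarrow> f x = 0"
 shows "(LINT x:A|lebesgue. f x) = (LINT x|lebesgue. f x)" unfolding set_lebesgue_integral_def
proof (rule integral_cong_AE)
 show "AE x in lebesgue. indicator A x *\<^sub>R f x = f x" using assms(3) by eventually_elim (auto simp: indicator_def)
qed measurable

lemma eigenfunction_iff:
 assumes p: "p > 1" and A: "A \<in> lmeasurable"
 shows "eigenfunction p A \<mu> u \<longleftrightarrow> u \<in> W1p0 p A \<and> \<not> (AE x in lebesgue. u x = 0) \<and>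
  (\<forall>\<phi>\<in>W1p0 p A. pair_int p (grad u) (grad \<phi>) = \<mu> * pair_int p u \<phi>)"
proof -
 have Am: "A \<in> sets lebesgue" using A by (rule fmeasurableD)
 have "(LINT x:A|lebesgue. norm (grad u x) powr (p - 2) * (grad u x \<bullet> grad \<phi> x)) = pair_int p (grad u) (grad \<phi>)"
  "(LINT x:A|lebesgue. \<bar>u x\<bar> powr (p - 2) * u x * \<phi> x) = pair_int p u \<phi>"
  if u: "u \<in> W1p0 p A" and \<phi>: "\<phi> \<in> W1p0 p A" for \<phi>
 proof -
  note uW = W1p0_W1p[OF u] and \<phi>W = W1p0_W1p[OF \<phi>]
  have 1: "norm (grad u x) powr (p - 2) * (grad u x \<bullet> grad \<phi> x) = flux p (grad u x) \<bullet> grad \<phi> x" for x by (simp add: flux_def)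
  have 2: "\<bar>u x\<bar> powr (p - 2) * u x * \<phi> x = flux p (u x) \<bullet> \<phi> x" for x by (simp add: flux_def)
  show "(LINT x:A|lebesgue. norm (grad u x) powr (p - 2) * (grad u x \<bullet> grad \<phi> x)) = pair_int p (grad u) (grad \<phi>)"
   unfolding 1 pair_int_def
  proof (rule set_LINT_eq_LINT[OF Am])
   show "(\<lambda>x. flux p (grad u x) \<bullet> grad \<phi> x) \<in> lmeas"
    by (intro borel_measurable_inner flux_measurable grad_measurable[OF uW] grad_measurable[OF \<phi>W] p)
   show "AE x in lebesgue. x \<notin> A \<longrightarrow> flux p (grad u x) \<bullet> grad \<phi> x = 0" using W1p0_vanishes(2)[OF p u] by eventually_elim simp
  qed
  show "(LINT x:A|lebesgue. \<bar>u x\<bar> powr (p - 2) * u x * \<phi> x) = pair_int p u \<phi>" unfolding 2 pair_int_def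
  proof (rule set_LINT_eq_LINT[OF Am])
   show "(\<lambda>x. flux p (u x) \<bullet> \<phi> x) \<in> lmeas"
    by (intro borel_measurable_inner flux_measurable W1p_measurable[OF uW] W1p_measurable[OF \<phi>W] p)
   show "AE x in lebesgue. x \<notin> A \<longrightarrow> flux p (u x) \<bullet> \<phi> x = 0" using W1p0_vanishes(1)[OF p u] by eventually_elim simp
  qed
 qed
 then show ?thesis unfolding eigenfunction_def by auto
qed

lemma eigenfunctionD:
 assumes "eigenfunction p A \<mu> u" "p > 1" "A \<in> lmeasurable"
 shows "u \<in> W1p0 p A" "pint p u > 0" "\<And>\<phi>. \<phi> \<in> W1p0 p A \<Longrightarrow> pair_int p (grad u) (grad \<phi>) = \<mu> * pair_int p u \<phi>"
  "pint p (grad u) = \<mu> * pint p u" "\<mu> \<ge> 0"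
proof -
 note e = assms(1)[unfolded eigenfunction_iff[OF assms(2,3)]]
 show u: "u \<in> W1p0 p A" using e by blast
 show eq: "pair_int p (grad u) (grad \<phi>) = \<mu> * pair_int p u \<phi>" if "\<phi> \<in> W1p0 p A" for \<phi> using e that by blast
 show pos: "pint p u > 0" using e pint_eq_0_iff[OF W1p_Lp[OF W1p0_W1p[OF u]]] pint_nonneg[of p u] by (simp add: less_le)
 show en: "pint p (grad u) = \<mu> * pint p u" using eq[OF u] by (simp add: pair_int_self)
 then show "\<mu> \<ge> 0" using pos pint_nonneg[of p "grad u"] by (simp add: zero_le_mult_iff)
qed

lemma W1p0_cmult:
 assumes p: "p > 1" and u: "u \<in> W1p0 p A"
 shows "(\<lambda>x. c * u x) \<in> W1p0 p A" "AE x in lebesgue. grad (\<lambda>x. c * u x) x = c *\<^sub>R grad u x"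
  "pint p (\<lambda>x. c * u x) = \<bar>c\<bar> powr p * pint p u" "pint p (grad (\<lambda>x. c * u x)) = \<bar>c\<bar> powr p * pint p (grad u)"
proof -
 note uW = W1p0_W1p[OF u]
 show 1: "(\<lambda>x. c * u x) \<in> W1p0 p A" using W1p0_lincomb[OF p u u, of c 0] by simp
 show 2: "AE x in lebesgue. grad (\<lambda>x. c * u x) x = c *\<^sub>R grad u x" using W1p_lincomb(2)[OF uW uW p, of c 0] by simp
 show "pint p (\<lambda>x. c * u x) = \<bar>c\<bar> powr p * pint p u" using pint_scaleR[of p c u] by simp
 have "pint p (grad (\<lambda>x. c * u x)) = pint p (\<lambda>x. c *\<^sub>R grad u x)"
 proof (rule pint_cong_AE[OF _ grad_measurable[OF W1p0_W1p[OF 1]]])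
  show "AE x in lebesgue. norm (grad (\<lambda>x. c * u x) x) = norm (c *\<^sub>R grad u x)" using 2 by eventually_elim simp
  show "(\<lambda>x. c *\<^sub>R grad u x) \<in> lmeas" using grad_measurable[OF uW] by simp
 qed
 then show "pint p (grad (\<lambda>x. c * u x)) = \<bar>c\<bar> powr p * pint p (grad u)" by (simp add: pint_scaleR)
qed

lemma normalize_W1p0:
 assumes p: "p > 1" and u: "u \<in> W1p0 p A" and pos: "pint p u > 0"
 obtains c where "c > 0" "(\<lambda>x. c * u x) \<in> W1p0 p A" "pint p (\<lambda>x. c * u x) = 1"
  "pint p (grad (\<lambda>x. c * u x)) = pint p (grad u) / pint p u"
proof -
 define c where "c = pint p u powr (- (1 / p))"
 have "c > 0" using pos by (simp add: c_def)
 have "- (1 / p) * p = - 1" using p by simp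
 then have "c powr p = pint p u powr (- 1)" unfolding c_def powr_powr by (simp only:)
 also have "\<dots> = 1 / pint p u" using pos by (rule powr_neg_one)
 finally have c: "c > 0" "\<bar>c\<bar> powr p = 1 / pint p u" using \<open>c > 0\<close> by simp_all
 show thesis by (rule that[OF c(1) W1p0_cmult(1)[OF p u]]) (use W1p0_cmult(3,4)[OF p u, of c] c(2) pos in auto)
qed

lemma eigenfunction_cmult:
 assumes e: "eigenfunction p A \<mu> u" and p: "p > 1" and A: "A \<in> lmeasurable" and c: "c \<noteq> 0"
 shows "eigenfunction p A \<mu> (\<lambda>x. c * u x)"
proof -
 note D = eigenfunctionD[OF e p A]
 note uW = W1p0_W1p[OF D(1)]
 note C = W1p0_cmult[OF p D(1), of c]
 have "pair_int p (grad (\<lambda>x. c * u x)) (grad \<phi>) = \<mu> * pair_int p (\<lambda>x. c * u x) \<phi>" if \<phi>: "\<phi> \<in> W1p0 p A" for \<phi>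
 proof -
  note [measurable] = grad_measurable[OF uW] grad_measurable[OF W1p0_W1p[OF \<phi>]]
  have "pair_int p (grad (\<lambda>x. c * u x)) (grad \<phi>) = pair_int p (\<lambda>x. c *\<^sub>R grad u x) (grad \<phi>)"
   by (rule pair_int_cong_AE[OF C(2) _ p grad_measurable[OF W1p0_W1p[OF C(1)]]]) auto
  then show ?thesis using D(3)[OF \<phi>] pair_int_scaleR_left[of p c "grad u" "grad \<phi>"] pair_int_scaleR_left[of p c u \<phi>] by simp
 qed
 moreover have "\<not> (AE x in lebesgue. c * u x = 0)" using e c by (simp add: eigenfunction_def)
 ultimately show ?thesis using C(1) by (simp add: eigenfunction_iff[OF p A])
qed

lemma normalized_eigenfunction:
 assumes e: "eigenvalue p A \<mu>" and p: "p > 1" and A: "A \<in> lmeasurable"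
 obtains u where "eigenfunction p A \<mu> u" "pint p u = 1" "pint p (grad u) = \<mu>"
proof -
 obtain u where u: "eigenfunction p A \<mu> u" using e by (auto simp: eigenvalue_def)
 note D = eigenfunctionD[OF u p A]
 obtain c where c: "c > 0" "(\<lambda>x. c * u x) \<in> W1p0 p A" "pint p (\<lambda>x. c * u x) = 1"
  "pint p (grad (\<lambda>x. c * u x)) = pint p (grad u) / pint p u" by (rule normalize_W1p0[OF p D(1,2)]) (rule that)
 show thesis by (rule that[of "\<lambda>x. c * u x"]) (use eigenfunction_cmult[OF u p A] c D(2,4) in auto)
qed

lemma W1p0_complete:
 fixes u :: "nat \<Rightarrow> 'a::euclidean_space \<Rightarrow> real"
 assumes u: "\<And>n. u n \<in> W1p0 p A" and p: "p > 1"
  and c1: "\<And>e. e > 0 \<Longrightarrow> \<exists>N. \<forall>m\<ge>N. \<forall>n\<ge>N. pint p (\<lambda>x. u m x - u n x) \<le> e"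
  and c2: "\<And>e. e > 0 \<Longrightarrow> \<exists>N. \<forall>m\<ge>N. \<forall>n\<ge>N. pint p (\<lambda>x. grad (u m) x - grad (u n) x) \<le> e"
 obtains v where "v \<in> W1p0 p A" "(\<lambda>n. pint p (\<lambda>x. u n x - v x)) \<longlonglongrightarrow> 0"
  "(\<lambda>n. pint p (\<lambda>x. grad (u n) x - grad v x)) \<longlonglongrightarrow> 0"
proof -
 obtain v where v: "v \<in> W1p p" "(\<lambda>n. pint p (\<lambda>x. u n x - v x)) \<longlonglongrightarrow> 0"
  "(\<lambda>n. pint p (\<lambda>x. grad (u n) x - grad v x)) \<longlonglongrightarrow> 0" by (rule W1p_complete[of u p, OF W1p0_W1p[OF u] p c1 c2]) (auto intro: that)
 show thesis by (rule that[OF W1p0_limit[OF p u v] v(2,3)])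
qed

lemma grad_diff_AE:
 assumes p: "p > 1" and u: "u \<in> W1p0 p A" and v: "v \<in> W1p0 p A"
 shows "(\<lambda>x. u x - v x) \<in> W1p0 p A" "AE x in lebesgue. grad (\<lambda>x. u x - v x) x = grad u x - grad v x"
 using W1p0_lincomb[OF p u v, of 1 "-1"] W1p_lincomb(2)[OF W1p0_W1p[OF u] W1p0_W1p[OF v] p, of 1 "-1"] by simp_all

text \<open>Test both equations with the difference and subtract: the left-hand sides give the monotonicity gap
 of the gradients, the right-hand sides are small with \<open>u - w\<close>.\<close>

lemma eigenfunctions_close:
 fixes A :: "'a::euclidean_space set"
 assumes p: "p > 1" and A: "A \<in> lmeasurable" and e: "e > 0"
 obtains d where "d > 0" "\<And>u w \<nu> \<mu>. eigenfunction p A \<nu> u \<Longrightarrow> eigenfunction p A \<mu> w \<Longrightarrow> pint p u = 1 \<Longrightarrow> pint p w = 1 \<Longrightarrow>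
  \<nu> \<le> \<Lambda> \<Longrightarrow> \<mu> \<le> \<Lambda> \<Longrightarrow> pint p (\<lambda>x. u x - w x) \<le> d \<Longrightarrow> pint p (\<lambda>x. grad u x - grad w x) \<le> e"
proof (cases "\<Lambda> \<ge> 0")
 case True
 define \<delta> where "\<delta> = e / (4 * (\<Lambda> + 1))"
 have \<delta>: "\<delta> > 0" "\<delta> * (2 * \<Lambda>) \<le> e / 2" using e True by (auto simp: \<delta>_def field_simps)
 obtain C where C: "C \<ge> 0" "\<And>x y::'a.
  norm (x - y) powr p \<le> \<delta> * (norm x powr p + norm y powr p) + C * ((flux p x - flux p y) \<bullet> (x - y))"
  by (rule norm_diff_powr_le_monotone[OF p \<delta>(1)]) (rule that)
 define \<eta> where "\<eta> = e / (8 * (C * \<Lambda> + 1))"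
 have C\<Lambda>: "C * \<Lambda> \<ge> 0" using C(1) True by simp
 then have \<eta>: "\<eta> > 0" "C * \<Lambda> * \<eta> * 2 \<le> e / 4" using e by (auto simp: \<eta>_def field_simps add_pos_nonneg intro!: divide_pos_pos)
 define d where "d = e / (8 * (C * \<Lambda> + 1) * \<eta> powr (1 - p))"
 have d: "d > 0" using e C\<Lambda> \<eta>(1) by (auto simp: d_def intro!: divide_pos_pos mult_pos_pos)
 have "\<eta> powr (1 - p) > 0" using \<eta>(1) by simp
 then have "\<eta> powr (1 - p) * d = e / (8 * (C * \<Lambda> + 1))" by (simp add: d_def)
 then have "C * \<Lambda> * (\<eta> powr (1 - p) * d) = (C * \<Lambda> / (C * \<Lambda> + 1)) * (e / 8)" by simp
 also have "\<dots> \<le> 1 * (e / 8)" using C\<Lambda> e by (intro mult_right_mono) auto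
 finally have d2: "C * \<Lambda> * (\<eta> powr (1 - p) * d) * 2 \<le> e / 4" by simp
 show thesis
 proof (rule that[OF d])
  fix u w \<nu> \<mu> assume uw: "eigenfunction p A \<nu> u" "eigenfunction p A \<mu> w" and n: "pint p u = 1" "pint p w = 1"
   and le: "\<nu> \<le> \<Lambda>" "\<mu> \<le> \<Lambda>" and close: "pint p (\<lambda>x. u x - w x) \<le> d"
  note U = eigenfunctionD[OF uw(1) p A] and W = eigenfunctionD[OF uw(2) p A]
  note uL = W1p_Lp[OF W1p0_W1p[OF U(1)]] and wL = W1p_Lp[OF W1p0_W1p[OF W(1)]]
  note guL = W1pD(2)[OF W1p0_W1p[OF U(1)]] and gwL = W1pD(2)[OF W1p0_W1p[OF W(1)]]
  note D = grad_diff_AE[OF p U(1) W(1)]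
  have dL: "(\<lambda>x. u x - w x) \<in> Lp p" using Lp_diff(1)[OF uL wL] p by simp
  have dgL: "(\<lambda>x. grad u x - grad w x) \<in> Lp p" using Lp_diff(1)[OF guL gwL] p by simp
  have eq: "pair_int p f (grad (\<lambda>x. u x - w x)) = pair_int p f (\<lambda>x. grad u x - grad w x)" if "f \<in> Lp p" for f
   by (rule pair_int_cong_AE[OF _ D(2) p Lp_measurable[OF that] grad_measurable[OF W1p0_W1p[OF D(1)]] Lp_measurable[OF that] Lp_measurable[OF dgL]]) simp
  have e1: "pair_int p (grad u) (\<lambda>x. grad u x - grad w x) = \<nu> * pair_int p u (\<lambda>x. u x - w x)"
   using U(3)[OF D(1)] eq[OF guL] by simp
  have e2: "pair_int p (grad w) (\<lambda>x. grad u x - grad w x) = \<mu> * pair_int p w (\<lambda>x. u x - w x)"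
   using W(3)[OF D(1)] eq[OF gwL] by simp
  have b: "\<bar>pair_int p f (\<lambda>x. u x - w x)\<bar> \<le> \<eta> + \<eta> powr (1 - p) * d" if "f \<in> Lp p" "pint p f = 1" for f
  proof -
   have "\<bar>pair_int p f (\<lambda>x. u x - w x)\<bar> \<le> \<eta> * 1 + \<eta> powr (1 - p) * pint p (\<lambda>x. u x - w x)"
    using pair_int_bound[OF that(1) dL p \<eta>(1)] that(2) by simp
   also have "\<dots> \<le> \<eta> * 1 + \<eta> powr (1 - p) * d" using close by (intro add_left_mono mult_left_mono) auto
   finally show ?thesis by simp
  qed
  have nn: "\<eta> + \<eta> powr (1 - p) * d \<ge> 0" using \<eta>(1) d by simp
  have b1: "\<nu> * pair_int p u (\<lambda>x. u x - w x) \<le> \<Lambda> * (\<eta> + \<eta> powr (1 - p) * d)" using b[OF uL n(1)] U(5) le(1) nn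
   by (intro order_trans[OF mult_left_mono[of _ "\<eta> + \<eta> powr (1 - p) * d"] mult_right_mono]) auto
  have b2: "- (\<mu> * pair_int p w (\<lambda>x. u x - w x)) \<le> \<Lambda> * (\<eta> + \<eta> powr (1 - p) * d)"
  proof -
   have "\<mu> * (- pair_int p w (\<lambda>x. u x - w x)) \<le> \<Lambda> * (\<eta> + \<eta> powr (1 - p) * d)" using b[OF wL n(2)] W(5) le(2) nn
    by (intro order_trans[OF mult_left_mono[of _ "\<eta> + \<eta> powr (1 - p) * d"] mult_right_mono]) auto
   then show ?thesis by simp
  qed
  have i1: "integrable lebesgue (\<lambda>x. flux p (grad u x) \<bullet> (grad u x - grad w x))" by (rule flux_integrable[OF guL dgL p])
  have i2: "integrable lebesgue (\<lambda>x. flux p (grad w x) \<bullet> (grad u x - grad w x))" by (rule flux_integrable[OF gwL dgL p])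
  note i = Lp_integrable[OF guL] Lp_integrable[OF gwL]
  have "pint p (\<lambda>x. grad u x - grad w x) \<le> (LINT x|lebesgue. \<delta> * (norm (grad u x) powr p + norm (grad w x) powr p) +
    C * (flux p (grad u x) \<bullet> (grad u x - grad w x) - flux p (grad w x) \<bullet> (grad u x - grad w x)))" unfolding pint_def
  proof (rule integral_mono[OF Lp_integrable[OF dgL]])
   show "integrable lebesgue (\<lambda>x. \<delta> * (norm (grad u x) powr p + norm (grad w x) powr p) +
    C * (flux p (grad u x) \<bullet> (grad u x - grad w x) - flux p (grad w x) \<bullet> (grad u x - grad w x)))" using i i1 i2 by simp
   show "norm (grad u x - grad w x) powr p \<le> \<delta> * (norm (grad u x) powr p + norm (grad w x) powr p) +
    C * (flux p (grad u x) \<bullet> (grad u x - grad w x) - flux p (grad w x) \<bullet> (grad u x - grad w x))" for x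
    using C(2)[of "grad u x" "grad w x"] by (simp add: inner_diff_left)
  qed
  also have "\<dots> = \<delta> * (pint p (grad u) + pint p (grad w)) +
    C * (pair_int p (grad u) (\<lambda>x. grad u x - grad w x) - pair_int p (grad w) (\<lambda>x. grad u x - grad w x))"
   using i i1 i2 by (simp add: pint_def pair_int_def)
  also have "\<dots> \<le> \<delta> * (2 * \<Lambda>) + C * (\<Lambda> * (\<eta> + \<eta> powr (1 - p) * d) + \<Lambda> * (\<eta> + \<eta> powr (1 - p) * d))"
   unfolding e1 e2 using \<delta>(1) C(1) b1 b2 U(4) W(4) n le by (intro add_mono mult_left_mono) auto
  also have "\<dots> = \<delta> * (2 * \<Lambda>) + C * \<Lambda> * \<eta> * 2 + C * \<Lambda> * (\<eta> powr (1 - p) * d) * 2" by (simp add: algebra_simps)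
  also have "\<dots> \<le> e / 2 + e / 4 + e / 4" by (intro add_mono \<delta>(2) \<eta>(2) d2)
  finally show "pint p (\<lambda>x. grad u x - grad w x) \<le> e" by simp
 qed
next
 case False
 show thesis
 proof (rule that[of 1])
  fix u w \<nu> \<mu> assume "eigenfunction p A \<nu> u" "\<nu> \<le> \<Lambda>"
  then have False using eigenfunctionD(5)[OF _ p A] False by fastforce
  then show "pint p (\<lambda>x. grad u x - grad w x) \<le> e" ..
 qed simp
qed

lemma eigenvalues_closed:
 assumes p: "p > 1" and A: "A \<in> lmeasurable" and ev: "\<And>k. eigenvalue p A (ev k)" and lim: "ev \<longlonglongrightarrow> \<mu>"
 shows "eigenvalue p A \<mu>"
proof -
 have "\<forall>k. \<exists>u. eigenfunction p A (ev k) u \<and> pint p u = 1 \<and> pint p (grad u) = ev k"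
 proof
  fix k show "\<exists>u. eigenfunction p A (ev k) u \<and> pint p u = 1 \<and> pint p (grad u) = ev k"
   by (rule normalized_eigenfunction[OF ev[of k] p A]) blast
 qed
 then obtain u where u: "\<And>k. eigenfunction p A (ev k) (u k)" "\<And>k. pint p (u k) = 1" "\<And>k. pint p (grad (u k)) = ev k"
  unfolding choice_iff by blast
 obtain \<Lambda> where \<Lambda>: "\<Lambda> \<ge> 1" "\<And>k. ev k \<le> \<Lambda>"
 proof -
  obtain K where "\<And>k. \<bar>ev k\<bar> \<le> K" using convergent_imp_Bseq[of ev] lim by (auto simp: convergent_def Bseq_def)
  then have "ev k \<le> max 1 K" for k by (meson abs_le_D1 max.coboundedI2)
  then show thesis using that[of "max 1 K"] by simp
 qed
 note D = eigenfunctionD[OF u(1) p A]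
 note uW = W1p0_W1p[OF D(1)]
 obtain r :: "nat \<Rightarrow> nat" where r: "strict_mono r" "\<And>e. e > 0 \<Longrightarrow> \<exists>N. \<forall>m\<ge>N. \<forall>n\<ge>N. pint p (\<lambda>x. u (r m) x - u (r n) x) \<le> e"
 proof (rule W1p_compact[of p A u \<Lambda>, OF p A uW W1p0_vanishes(1)[OF p D(1)]])
  show "pint p (u n) \<le> \<Lambda>" "pint p (grad (u n)) \<le> \<Lambda>" for n using u(2,3)[of n] \<Lambda>(1) \<Lambda>(2)[of n] by auto
 qed (rule that)
 have c2: "\<exists>N. \<forall>m\<ge>N. \<forall>n\<ge>N. pint p (\<lambda>x. grad (u (r m)) x - grad (u (r n)) x) \<le> e" if epos: "e > 0" for e
 proof -
  obtain d where d: "d > 0" "\<And>u w \<nu> \<mu>. eigenfunction p A \<nu> u \<Longrightarrow> eigenfunction p A \<mu> w \<Longrightarrow> pint p u = 1 \<Longrightarrow> pint p w = 1 \<Longrightarrow>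
   \<nu> \<le> \<Lambda> \<Longrightarrow> \<mu> \<le> \<Lambda> \<Longrightarrow> pint p (\<lambda>x. u x - w x) \<le> d \<Longrightarrow> pint p (\<lambda>x. grad u x - grad w x) \<le> e"
   by (rule eigenfunctions_close[OF p A epos, where \<Lambda> = \<Lambda>]) (rule that)
  obtain N where "\<forall>m\<ge>N. \<forall>n\<ge>N. pint p (\<lambda>x. u (r m) x - u (r n) x) \<le> d" using r(2)[OF d(1)] by blast
  then show ?thesis using d(2)[OF u(1) u(1) u(2) u(2) \<Lambda>(2) \<Lambda>(2)] by blast
 qed
 obtain v where v: "v \<in> W1p0 p A" "(\<lambda>n. pint p (\<lambda>x. u (r n) x - v x)) \<longlonglongrightarrow> 0"
  "(\<lambda>n. pint p (\<lambda>x. grad (u (r n)) x - grad v x)) \<longlonglongrightarrow> 0"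
  by (rule W1p0_complete[of "\<lambda>n. u (r n)", OF D(1) p r(2) c2]) (auto intro: that)
 note vW = W1p0_W1p[OF v(1)]
 have "(\<lambda>n. pint p (u (r n))) \<longlonglongrightarrow> pint p v" by (rule pint_tendsto[OF W1p_Lp[OF uW] W1p_Lp[OF vW] v(2) p])
 then have "pint p v = 1" by (simp add: u(2) LIMSEQ_const_iff)
 then have "\<not> (AE x in lebesgue. v x = 0)" using pint_eq_0_iff[OF W1p_Lp[OF vW]] by simp
 moreover have "pair_int p (grad v) (grad \<phi>) = \<mu> * pair_int p v \<phi>" if \<phi>: "\<phi> \<in> W1p0 p A" for \<phi>
 proof -
  note \<phi>W = W1p0_W1p[OF \<phi>]
  have "(\<lambda>n. pair_int p (grad (u (r n))) (grad \<phi>)) \<longlonglongrightarrow> pair_int p (grad v) (grad \<phi>)"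
   by (rule pair_int_tendsto[OF W1pD(2)[OF uW] W1pD(2)[OF vW] W1pD(2)[OF \<phi>W] v(3) p])
  moreover have "(\<lambda>n. ev (r n) * pair_int p (u (r n)) \<phi>) \<longlonglongrightarrow> \<mu> * pair_int p v \<phi>"
   using LIMSEQ_subseq_LIMSEQ[OF lim r(1)] unfolding comp_def
   by (intro tendsto_mult pair_int_tendsto[OF W1p_Lp[OF uW] W1p_Lp[OF vW] W1p_Lp[OF \<phi>W] v(2) p])
  ultimately show ?thesis using D(3)[OF \<phi>] LIMSEQ_unique by simp
 qed
 ultimately have "eigenfunction p A \<mu> v" using v(1) by (simp add: eigenfunction_iff[OF p A])
 then show ?thesis by (auto simp: eigenvalue_def)
qed

section \<open>The minimum of the Rayleigh quotient\<close>

definition rayleigh_inf :: "real \<Rightarrow> 'a::euclidean_space set \<Rightarrow> real" where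
 "rayleigh_inf p A = Inf {pint p (grad w) |w. w \<in> W1p0 p A \<and> pint p w = 1}"

lemma rayleigh_inf_bdd: "bdd_below {pint p (grad w) |w. w \<in> W1p0 p A \<and> pint p w = 1}"
 by (rule bdd_belowI[of _ 0]) (auto simp: pint_nonneg)

text \<open>The inequality of Poincare with its best constant.\<close>

lemma rayleigh_inf_le:
 assumes p: "p > 1" and w: "w \<in> W1p0 p A"
 shows "rayleigh_inf p A * pint p w \<le> pint p (grad w)"
proof (cases "pint p w = 0")
 case True
 then show ?thesis by (simp add: pint_nonneg)
next
 case False
 then have pos: "pint p w > 0" using pint_nonneg[of p w] by simp
 obtain c where c: "c > 0" "(\<lambda>x. c * w x) \<in> W1p0 p A" "pint p (\<lambda>x. c * w x) = 1"
  "pint p (grad (\<lambda>x. c * w x)) = pint p (grad w) / pint p w" by (rule normalize_W1p0[OF p w pos]) (rule that)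
 have "rayleigh_inf p A \<le> pint p (grad (\<lambda>x. c * w x))"
  unfolding rayleigh_inf_def by (rule cInf_lower[OF _ rayleigh_inf_bdd]) (use c in blast)
 then show ?thesis using pos c(4) by (simp add: field_simps)
qed

lemma rayleigh_inf_nonneg:
 assumes "w \<in> W1p0 p A" "pint p w = 1"
 shows "rayleigh_inf p A \<ge> 0" unfolding rayleigh_inf_def by (rule cInf_greatest) (use assms in \<open>auto simp: pint_nonneg\<close>)

lemma pint_diff_le:
 fixes f g :: "'a::euclidean_space \<Rightarrow> 'b::euclidean_space"
 assumes p: "p > 1" and f: "f \<in> Lp p" and g: "g \<in> Lp p"
  and C: "\<And>x y::'b. \<bar>norm x powr p - norm y powr p\<bar> \<le> \<delta> * (norm x powr p + norm y powr p) + C * norm (x - y) powr p"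
 shows "\<bar>pint p f - pint p g\<bar> \<le> \<delta> * (pint p f + pint p g) + C * pint p (\<lambda>x. f x - g x)"
proof -
 have d: "(\<lambda>x. f x - g x) \<in> Lp p" using Lp_diff(1)[OF f g] p by simp
 note i = Lp_integrable[OF f] Lp_integrable[OF g] Lp_integrable[OF d]
 have "\<bar>pint p f - pint p g\<bar> = norm (LINT x|lebesgue. norm (f x) powr p - norm (g x) powr p)" using i by (simp add: pint_def)
 also have "\<dots> \<le> (LINT x|lebesgue. \<delta> * (norm (f x) powr p + norm (g x) powr p) + C * norm (f x - g x) powr p)"
  using i C by (intro norm_integral_le) auto
 also have "\<dots> = \<delta> * (pint p f + pint p g) + C * pint p (\<lambda>x. f x - g x)" using i by (simp add: pint_def)
 finally show ?thesis .
qed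

lemma pint_close:
 assumes p: "p > 1" and e: "e > 0"
 obtains d where "d > 0" "\<And>f g :: 'a::euclidean_space \<Rightarrow> 'b::euclidean_space. f \<in> Lp p \<Longrightarrow> g \<in> Lp p \<Longrightarrow>
  pint p f \<le> 2 \<Longrightarrow> pint p g \<le> 2 \<Longrightarrow> pint p (\<lambda>x. f x - g x) \<le> d \<Longrightarrow> \<bar>pint p f - pint p g\<bar> \<le> e"
proof -
 have e8: "e / 8 > 0" using e by simp
 obtain C where C: "C \<ge> 0" "\<And>x y::'b. \<bar>norm x powr p - norm y powr p\<bar> \<le> e / 8 * (norm x powr p + norm y powr p) + C * norm (x - y) powr p"
  by (rule abs_norm_powr_diff_le[OF p e8]) (rule that)
 define d where "d = e / (2 * (C + 1))"
 have d: "d > 0" "C * d \<le> e / 2" using e C(1) by (auto simp: d_def field_simps)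
 show thesis
 proof (rule that[OF d(1)])
  fix f g :: "'a \<Rightarrow> 'b"
  assume fg: "f \<in> Lp p" "g \<in> Lp p" "pint p f \<le> 2" "pint p g \<le> 2" "pint p (\<lambda>x. f x - g x) \<le> d"
  have "\<bar>pint p f - pint p g\<bar> \<le> e / 8 * (pint p f + pint p g) + C * pint p (\<lambda>x. f x - g x)"
   by (rule pint_diff_le[OF p fg(1,2) C(2)])
  also have "\<dots> \<le> e / 8 * (2 + 2) + C * d" using fg e C(1) by (intro add_mono mult_left_mono) auto
  also have "\<dots> \<le> e" using d(2) by simp
  finally show "\<bar>pint p f - pint p g\<bar> \<le> e" .
 qed
qed

text \<open>A subsequence is Cauchy in \<open>L\<^sup>p\<close>, so the midpoint of two late members still has norm almost one, and
 its energy is at least almost \<open>m\<close>, the infimum. As both members have energy almost \<open>m\<close>, the convexity gap of their gradients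
 is small, and uniform convexity makes the gradients a Cauchy sequence as well.\<close>

lemma minimizing_sequence_converges:
 fixes w :: "nat \<Rightarrow> 'a::euclidean_space \<Rightarrow> real"
 assumes p: "p > 1" and A: "A \<in> lmeasurable" and w: "\<And>k. w k \<in> W1p0 p A" and n1: "\<And>k. pint p (w k) = 1"
  and lim: "(\<lambda>k. pint p (grad (w k))) \<longlonglongrightarrow> rayleigh_inf p A"
 obtains r :: "nat \<Rightarrow> nat" and v where "strict_mono r" "v \<in> W1p0 p A" "(\<lambda>n. pint p (\<lambda>x. w (r n) x - v x)) \<longlonglongrightarrow> 0"
  "pint p v = 1" "pint p (grad v) = rayleigh_inf p A"
proof -
 define m where "m = rayleigh_inf p A"
 have m0: "m \<ge> 0" unfolding m_def by (rule rayleigh_inf_nonneg[OF w[of 0] n1])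
 note wW = W1p0_W1p[OF w]
 note wL = W1p_Lp[OF wW] and gL = W1pD(2)[OF wW]
 obtain \<Lambda> where \<Lambda>: "\<Lambda> \<ge> 1" "\<And>k. pint p (grad (w k)) \<le> \<Lambda>"
 proof -
  obtain K where "\<And>k. \<bar>pint p (grad (w k))\<bar> \<le> K"
   using convergent_imp_Bseq[of "\<lambda>k. pint p (grad (w k))"] lim by (auto simp: convergent_def Bseq_def)
  then have "pint p (grad (w k)) \<le> max 1 K" for k by (meson abs_le_D1 max.coboundedI2)
  then show thesis using that[of "max 1 K"] by simp
 qed
 obtain r :: "nat \<Rightarrow> nat" where r: "strict_mono r" "\<And>e. e > 0 \<Longrightarrow> \<exists>N. \<forall>m\<ge>N. \<forall>n\<ge>N. pint p (\<lambda>x. w (r m) x - w (r n) x) \<le> e"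
 proof (rule W1p_compact[of p A w \<Lambda>, OF p A wW W1p0_vanishes(1)[OF p w]])
  show "pint p (w n) \<le> \<Lambda>" "pint p (grad (w n)) \<le> \<Lambda>" for n using n1[of n] \<Lambda>(1) \<Lambda>(2)[of n] by auto
 qed (rule that)
 have lim': "(\<lambda>k. pint p (grad (w (r k)))) \<longlonglongrightarrow> m" using LIMSEQ_subseq_LIMSEQ[OF lim r(1)] by (simp add: comp_def m_def)
 have c2: "\<exists>N. \<forall>i\<ge>N. \<forall>j\<ge>N. pint p (\<lambda>x. grad (w (r i)) x - grad (w (r j)) x) \<le> e" if epos: "e > 0" for e
 proof -
  define \<delta> where "\<delta> = e / (4 * \<Lambda>)"
  have \<delta>: "\<delta> > 0" "\<delta> * (\<Lambda> + \<Lambda>) = e / 2" using epos \<Lambda>(1) by (auto simp: \<delta>_def)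
  obtain C where C: "C \<ge> 0" "\<And>x y::'a. norm (x - y) powr p \<le> \<delta> * (norm x powr p + norm y powr p) +
   C * (norm x powr p + norm y powr p - 2 * norm ((1/2) *\<^sub>R (x + y)) powr p)"
   by (rule norm_diff_powr_le_gap[OF p \<delta>(1)]) (rule that)
  \<comment> \<open>The convexity gap will be at most \<open>2 \<tau> (1 + m)\<close>.\<close>
  define \<tau> where "\<tau> = e / (4 * (C + 1) * (1 + m))"
  have \<tau>: "\<tau> > 0" using epos C(1) m0 by (auto simp: \<tau>_def intro!: divide_pos_pos mult_pos_pos)
  have "2 * \<tau> * (1 + m) = (e / 2) / (C + 1)" using m0 C(1) by (simp only: \<tau>_def) (simp add: divide_simps)
  then have "C * (2 * \<tau> * (1 + m)) = (C / (C + 1)) * (e / 2)" by simp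
  also have "\<dots> \<le> 1 * (e / 2)" using C(1) epos by (intro mult_right_mono) auto
  finally have \<tau>2: "C * (2 * \<tau> * (1 + m)) \<le> e / 2" by simp
  obtain d where d: "d > 0" "\<And>f g :: 'a \<Rightarrow> real. f \<in> Lp p \<Longrightarrow> g \<in> Lp p \<Longrightarrow>
   pint p f \<le> 2 \<Longrightarrow> pint p g \<le> 2 \<Longrightarrow> pint p (\<lambda>x. f x - g x) \<le> d \<Longrightarrow> \<bar>pint p f - pint p g\<bar> \<le> \<tau>" by (rule pint_close[OF p \<tau>]) (rule that)
  obtain N1 where N1: "\<forall>i\<ge>N1. \<forall>j\<ge>N1. pint p (\<lambda>x. w (r i) x - w (r j) x) \<le> d" using r(2)[OF d(1)] by blast
  have "eventually (\<lambda>k. pint p (grad (w (r k))) < m + \<tau>) sequentially" using order_tendstoD(2)[OF lim', of "m + \<tau>"] \<tau> by simp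
  then obtain N2 where N2: "\<And>k. k \<ge> N2 \<Longrightarrow> pint p (grad (w (r k))) < m + \<tau>" by (auto simp: eventually_sequentially)
  show ?thesis
  proof (intro exI[of _ "max N1 N2"] allI impI)
   fix i j assume ij: "i \<ge> max N1 N2" "j \<ge> max N1 N2"
   define u where "u = w (r i)"
   define v where "v = w (r j)"
   have u: "u \<in> W1p0 p A" "pint p u = 1" "pint p (grad u) < m + \<tau>" "pint p (grad u) \<le> \<Lambda>"
    unfolding u_def using w n1 N2[of i] ij \<Lambda>(2) by auto
   have v: "v \<in> W1p0 p A" "pint p v = 1" "pint p (grad v) < m + \<tau>" "pint p (grad v) \<le> \<Lambda>"
    unfolding v_def using w n1 N2[of j] ij \<Lambda>(2) by auto
   have uv: "pint p (\<lambda>x. u x - v x) \<le> d" unfolding u_def v_def using N1 ij by simp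
   note uL = W1p_Lp[OF W1p0_W1p[OF u(1)]] and vL = W1p_Lp[OF W1p0_W1p[OF v(1)]]
   note guL = W1pD(2)[OF W1p0_W1p[OF u(1)]] and gvL = W1pD(2)[OF W1p0_W1p[OF v(1)]]
   define z where "z x = 1/2 * u x + 1/2 * v x" for x
   have z: "z \<in> W1p0 p A" "AE x in lebesgue. grad z x = (1/2) *\<^sub>R grad u x + (1/2) *\<^sub>R grad v x" unfolding z_def[abs_def]
    by (rule W1p0_lincomb[OF p u(1) v(1)] W1p_lincomb(2)[OF W1p0_W1p[OF u(1)] W1p0_W1p[OF v(1)] p])+
   note zL = W1p_Lp[OF W1p0_W1p[OF z(1)]]
   have half: "(1/2::real) powr p \<le> 1" using p by (intro powr_le1) auto
   have "pint p z \<le> 2"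
   proof -
    have "pint p z = pint p (\<lambda>x. (1/2) *\<^sub>R u x + (1/2) *\<^sub>R v x)" by (simp add: z_def[abs_def])
    also have "\<dots> \<le> 2 powr p * (pint p (\<lambda>x. (1/2) *\<^sub>R u x) + pint p (\<lambda>x. (1/2) *\<^sub>R v x))"
     using p by (intro Lp_add(2) Lp_scaleR uL vL) auto
    also have "\<dots> = 2 powr p * (2 * (1/2) powr p)" unfolding pint_scaleR u(2) v(2) by simp
    also have "\<dots> = 2" by (simp add: powr_divide)
    finally show ?thesis .
   qed
   moreover have "pint p (\<lambda>x. u x - z x) \<le> d"
   proof -
    have "(\<lambda>x. u x - z x) = (\<lambda>x. (1/2) *\<^sub>R (u x - v x))" by (auto simp: z_def field_simps)
    then have "pint p (\<lambda>x. u x - z x) = (1/2) powr p * pint p (\<lambda>x. u x - v x)"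
     using pint_scaleR[of p "1/2" "\<lambda>x. u x - v x"] by simp
    also have "\<dots> \<le> 1 * pint p (\<lambda>x. u x - v x)" using half by (intro mult_right_mono pint_nonneg)
    finally show ?thesis using uv by simp
   qed
   ultimately have "\<bar>pint p u - pint p z\<bar> \<le> \<tau>" using d(2)[OF uL zL] u(2) by simp
   then have z1: "pint p z \<ge> 1 - \<tau>" using u(2) by simp
   have "m * (1 - \<tau>) \<le> m * pint p z" using z1 m0 by (rule mult_left_mono)
   also have "\<dots> \<le> pint p (grad z)" unfolding m_def by (rule rayleigh_inf_le[OF p z(1)])
   also have "\<dots> = pint p (\<lambda>x. (1/2) *\<^sub>R (grad u x + grad v x))"
   proof (rule pint_cong_AE[OF _ grad_measurable[OF W1p0_W1p[OF z(1)]]])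
    show "AE x in lebesgue. norm (grad z x) = norm ((1/2) *\<^sub>R (grad u x + grad v x))"
     using z(2) by eventually_elim (simp add: scaleR_add_right)
    show "(\<lambda>x. (1/2) *\<^sub>R (grad u x + grad v x)) \<in> lmeas" using Lp_measurable[OF guL] Lp_measurable[OF gvL] by measurable
   qed
   finally have gz: "m * (1 - \<tau>) \<le> pint p (\<lambda>x. (1/2) *\<^sub>R (grad u x + grad v x))" .
   have midL: "(\<lambda>x. (1/2) *\<^sub>R (grad u x + grad v x)) \<in> Lp p" using p by (intro Lp_scaleR Lp_add(1) guL gvL) auto
   have dgL: "(\<lambda>x. grad u x - grad v x) \<in> Lp p" using Lp_diff(1)[OF guL gvL] p by simp
   note i = Lp_integrable[OF guL] Lp_integrable[OF gvL] Lp_integrable[OF midL] Lp_integrable[OF dgL]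
   have "pint p (\<lambda>x. grad u x - grad v x) \<le> (LINT x|lebesgue. \<delta> * (norm (grad u x) powr p + norm (grad v x) powr p) +
    C * (norm (grad u x) powr p + norm (grad v x) powr p - 2 * norm ((1/2) *\<^sub>R (grad u x + grad v x)) powr p))" unfolding pint_def
    by (rule integral_mono[OF i(4) _ C(2)])
     (intro Bochner_Integration.integrable_add Bochner_Integration.integrable_diff integrable_mult_right i)
   also have "\<dots> = \<delta> * (pint p (grad u) + pint p (grad v)) +
    C * (pint p (grad u) + pint p (grad v) - 2 * pint p (\<lambda>x. (1/2) *\<^sub>R (grad u x + grad v x)))" unfolding pint_def
    by (subst Bochner_Integration.integral_add Bochner_Integration.integral_diff integral_mult_right_zero;
      (intro Bochner_Integration.integrable_add Bochner_Integration.integrable_diff integrable_mult_right i)?)+ simp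
   also have "\<dots> \<le> \<delta> * (\<Lambda> + \<Lambda>) + C * (2 * \<tau> * (1 + m))"
   proof (intro add_mono mult_left_mono)
    have "pint p (grad u) + pint p (grad v) - 2 * pint p (\<lambda>x. (1/2) *\<^sub>R (grad u x + grad v x)) \<le>
     (m + \<tau>) + (m + \<tau>) - 2 * (m * (1 - \<tau>))" using u(3) v(3) gz by linarith
    also have "\<dots> = 2 * \<tau> * (1 + m)" by (simp add: algebra_simps)
    finally show "pint p (grad u) + pint p (grad v) - 2 * pint p (\<lambda>x. (1/2) *\<^sub>R (grad u x + grad v x)) \<le> 2 * \<tau> * (1 + m)" .
   qed (use u(4) v(4) \<delta>(1) C(1) in auto)
   also have "\<dots> \<le> e" using \<delta>(2) \<tau>2 by linarith
   finally show "pint p (\<lambda>x. grad (w (r i)) x - grad (w (r j)) x) \<le> e" by (simp add: u_def v_def)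
  qed
 qed
 obtain v where v: "v \<in> W1p0 p A" "(\<lambda>n. pint p (\<lambda>x. w (r n) x - v x)) \<longlonglongrightarrow> 0"
  "(\<lambda>n. pint p (\<lambda>x. grad (w (r n)) x - grad v x)) \<longlonglongrightarrow> 0"
  by (rule W1p0_complete[of "\<lambda>n. w (r n)", OF w p r(2) c2]) (auto intro: that)
 note vW = W1p0_W1p[OF v(1)]
 have "(\<lambda>n. pint p (w (r n))) \<longlonglongrightarrow> pint p v" by (rule pint_tendsto[OF wL W1p_Lp[OF vW] v(2) p])
 then have v1: "pint p v = 1" by (simp add: n1 LIMSEQ_const_iff)
 have "(\<lambda>n. pint p (grad (w (r n)))) \<longlonglongrightarrow> pint p (grad v)" by (rule pint_tendsto[OF gL W1pD(2)[OF vW] v(3) p])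
 then have "pint p (grad v) = rayleigh_inf p A" using lim' LIMSEQ_unique by (auto simp: m_def)
 then show thesis using that r(1) v(1,2) v1 by blast
qed

lemma pint_convex:
 assumes f: "f \<in> Lp p" and g: "g \<in> Lp p" and p: "p > 1"
 shows "pint p f + p * pair_int p f (\<lambda>x. g x - f x) \<le> pint p g"
proof -
 have d: "(\<lambda>x. g x - f x) \<in> Lp p" using Lp_diff(1)[OF g f] p by simp
 note i = Lp_integrable[OF f] Lp_integrable[OF g] flux_integrable[OF f d p]
 have "(LINT x|lebesgue. norm (f x) powr p + p * (flux p (f x) \<bullet> (g x - f x))) \<le> (LINT x|lebesgue. norm (g x) powr p)"
  by (rule integral_mono) (use i powr_convex[OF p] in auto)
 then show ?thesis using i by (simp add: pint_def pair_int_def)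
qed

text \<open>Compare \<open>v\<close> with \<open>v + t \<phi>\<close>. The tangent inequality \<open>pint_convex\<close>, at \<open>v + t \<phi>\<close> for the gradients and at \<open>v\<close>
 for the values, turns minimality into an inequality between the two forms as \<open>t \<rightarrow> 0\<close>; with \<open>-\<phi>\<close> it becomes an
 equation.\<close>

lemma minimizer_eigenfunction:
 assumes p: "p > 1" and A: "A \<in> lmeasurable" and v: "v \<in> W1p0 p A" "pint p v > 0"
  and min: "pint p (grad v) = rayleigh_inf p A * pint p v" and m0: "rayleigh_inf p A \<ge> 0"
 shows "eigenfunction p A (rayleigh_inf p A) v"
proof -
 define m where "m = rayleigh_inf p A"
 note vW = W1p0_W1p[OF v(1)]
 note vL = W1p_Lp[OF vW] and gvL = W1pD(2)[OF vW]
 have ge: "pair_int p (grad v) (grad \<phi>) \<ge> m * pair_int p v \<phi>" if \<phi>: "\<phi> \<in> W1p0 p A" for \<phi>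
 proof -
  note \<phi>L = W1p_Lp[OF W1p0_W1p[OF \<phi>]] and g\<phi>L = W1pD(2)[OF W1p0_W1p[OF \<phi>]]
  define t where "t n = 1 / real (Suc n)" for n
  have t: "t n > 0" for n by (simp add: t_def)
  define F where "F n x = grad v x + t n *\<^sub>R grad \<phi> x" for n x
  have FL: "F n \<in> Lp p" for n unfolding F_def[abs_def] using p by (intro Lp_add(1) gvL Lp_scaleR g\<phi>L) auto
  have est: "pair_int p (F n) (grad \<phi>) \<ge> m * pair_int p v \<phi>" for n
  proof -
   define z where "z x = 1 * v x + t n * \<phi> x" for x
   have z: "z \<in> W1p0 p A" "AE x in lebesgue. grad z x = 1 *\<^sub>R grad v x + t n *\<^sub>R grad \<phi> x" unfolding z_def[abs_def]
    by (rule W1p0_lincomb[OF p v(1) \<phi>] W1p_lincomb(2)[OF vW W1p0_W1p[OF \<phi>] p])+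
   have "m * pint p z \<le> pint p (grad z)" unfolding m_def by (rule rayleigh_inf_le[OF p z(1)])
   also have "pint p (grad z) = pint p (F n)"
    by (rule pint_cong_AE[OF _ grad_measurable[OF W1p0_W1p[OF z(1)]] Lp_measurable[OF FL]])
     (use z(2) in \<open>eventually_elim, simp add: F_def\<close>)
   finally have 1: "m * pint p z \<le> pint p (F n)" .
   have "pint p (F n) + p * pair_int p (F n) (\<lambda>x. grad v x - F n x) \<le> pint p (grad v)" by (rule pint_convex[OF FL gvL p])
   moreover have "pair_int p (F n) (\<lambda>x. grad v x - F n x) = - t n * pair_int p (F n) (grad \<phi>)" by (simp add: pair_int_def F_def)
   ultimately have 2: "pint p (F n) \<le> pint p (grad v) + p * t n * pair_int p (F n) (grad \<phi>)" by simp
   have "pint p v + p * pair_int p v (\<lambda>x. z x - v x) \<le> pint p z" by (rule pint_convex[OF vL W1p_Lp[OF W1p0_W1p[OF z(1)]] p])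
   moreover have "pair_int p v (\<lambda>x. z x - v x) = t n * pair_int p v \<phi>" by (simp add: pair_int_def z_def mult.left_commute)
   ultimately have "pint p v + p * t n * pair_int p v \<phi> \<le> pint p z" by simp
   then have "m * (pint p v + p * t n * pair_int p v \<phi>) \<le> m * pint p z" using m0 by (intro mult_left_mono) (auto simp: m_def)
   with 1 2 have "m * (pint p v + p * t n * pair_int p v \<phi>) \<le> pint p (grad v) + p * t n * pair_int p (F n) (grad \<phi>)" by linarith
   then have "(p * t n) * (m * pair_int p v \<phi>) \<le> (p * t n) * pair_int p (F n) (grad \<phi>)"
    using min by (simp add: m_def[symmetric] algebra_simps)
   then show ?thesis using t[of n] p by (simp add: mult_le_cancel_left)
  qed
  have "(\<lambda>n. pair_int p (F n) (grad \<phi>)) \<longlonglongrightarrow> pair_int p (grad v) (grad \<phi>)"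
  proof (rule pair_int_tendsto[OF FL gvL g\<phi>L _ p])
   have "pint p (\<lambda>x. F n x - grad v x) = t n powr p * pint p (grad \<phi>)" for n
    using pint_scaleR[of p "t n" "grad \<phi>"] t[of n] by (simp add: F_def)
   moreover have "(\<lambda>n. t n powr p * pint p (grad \<phi>)) \<longlonglongrightarrow> 0 powr p * pint p (grad \<phi>)"
    using LIMSEQ_Suc[OF lim_1_over_n] p unfolding t_def by (intro tendsto_intros tendsto_powr2) auto
   ultimately show "(\<lambda>n. pint p (\<lambda>x. F n x - grad v x)) \<longlonglongrightarrow> 0" using p by simp
  qed
  then show ?thesis by (rule LIMSEQ_le_const) (use est in blast)
 qed
 have "pair_int p (grad v) (grad \<phi>) = m * pair_int p v \<phi>" if \<phi>: "\<phi> \<in> W1p0 p A" for \<phi>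
 proof -
  note n = W1p0_cmult[OF p \<phi>, of "-1"]
  have "pair_int p (grad v) (grad (\<lambda>x. -1 * \<phi> x)) = pair_int p (grad v) (\<lambda>x. - grad \<phi> x)"
   by (rule pair_int_cong_AE[OF _ _ p grad_measurable[OF vW] grad_measurable[OF W1p0_W1p[OF n(1)]] grad_measurable[OF vW]])
    (use n(2) grad_measurable[OF W1p0_W1p[OF \<phi>]] in auto)
  then have "- pair_int p (grad v) (grad \<phi>) \<ge> m * - pair_int p v \<phi>"
   using ge[OF n(1)] pair_int_uminus_right[of p v \<phi>] by (simp add: pair_int_uminus_right)
  then show ?thesis using ge[OF \<phi>] by simp
 qed
 moreover have "\<not> (AE x in lebesgue. v x = 0)" using v(2) pint_eq_0_iff[OF vL] by simp
 ultimately show ?thesis using v(1) by (simp add: eigenfunction_iff[OF p A] m_def)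
qed

lemma rayleigh_inf_eigenvalue:
 assumes p: "p > 1" and A: "A \<in> lmeasurable" and e: "eigenvalue p A \<mu>"
 obtains v where "v \<in> W1p0 p A" "pint p v = 1" "pint p (grad v) = rayleigh_inf p A"
  "eigenfunction p A (rayleigh_inf p A) v" "rayleigh_inf p A \<ge> 0"
proof -
 obtain u where u: "eigenfunction p A \<mu> u" "pint p u = 1" "pint p (grad u) = \<mu>"
  by (rule normalized_eigenfunction[OF e p A]) (rule that)
 note uW = eigenfunctionD(1)[OF u(1) p A]
 have m0: "rayleigh_inf p A \<ge> 0" by (rule rayleigh_inf_nonneg[OF uW u(2)])
 have "\<forall>n. \<exists>w. w \<in> W1p0 p A \<and> pint p w = 1 \<and> pint p (grad w) < rayleigh_inf p A + 1 / real (Suc n)"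
 proof
  fix n
  have "Inf {pint p (grad w) |w. w \<in> W1p0 p A \<and> pint p w = 1} < rayleigh_inf p A + 1 / real (Suc n)"
   by (simp add: rayleigh_inf_def)
  from cInf_lessD[OF _ this] uW u(2)
  show "\<exists>w. w \<in> W1p0 p A \<and> pint p w = 1 \<and> pint p (grad w) < rayleigh_inf p A + 1 / real (Suc n)" by blast
 qed
 then obtain w where w: "\<And>n. w n \<in> W1p0 p A" "\<And>n. pint p (w n) = 1"
  "\<And>n. pint p (grad (w n)) < rayleigh_inf p A + 1 / real (Suc n)" unfolding choice_iff by blast
 have "(\<lambda>n. pint p (grad (w n))) \<longlonglongrightarrow> rayleigh_inf p A"
 proof (rule tendsto_sandwich[where f = "\<lambda>_. rayleigh_inf p A" and h = "\<lambda>n. rayleigh_inf p A + 1 / real (Suc n)"])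
  show "\<forall>\<^sub>F n in sequentially. rayleigh_inf p A \<le> pint p (grad (w n))" using rayleigh_inf_le[OF p w(1)] w(2) by simp
  show "\<forall>\<^sub>F n in sequentially. pint p (grad (w n)) \<le> rayleigh_inf p A + 1 / real (Suc n)"
   using w(3) by (intro always_eventually allI less_imp_le)
  have "(\<lambda>n. rayleigh_inf p A + 1 / real (Suc n)) \<longlonglongrightarrow> rayleigh_inf p A + 0"
   by (intro tendsto_add tendsto_const LIMSEQ_Suc[OF lim_1_over_n])
  then show "(\<lambda>n. rayleigh_inf p A + 1 / real (Suc n)) \<longlonglongrightarrow> rayleigh_inf p A" by simp
 qed simp
 then obtain r :: "nat \<Rightarrow> nat" and v where v: "strict_mono r" "v \<in> W1p0 p A"
  "(\<lambda>n. pint p (\<lambda>x. w (r n) x - v x)) \<longlonglongrightarrow> 0" "pint p v = 1" "pint p (grad v) = rayleigh_inf p A"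
  by (rule minimizing_sequence_converges[of p A w, OF p A w(1,2)]) (rule that)
 show thesis by (rule that[OF v(2,4,5) minimizer_eigenfunction[OF p A v(2)] m0]) (use v m0 in auto)
qed

lemma rayleigh_inf_le_eigenvalue:
 assumes p: "p > 1" and A: "A \<in> lmeasurable" and e: "eigenvalue p A \<mu>"
 shows "rayleigh_inf p A \<le> \<mu>"
proof -
 obtain u where u: "eigenfunction p A \<mu> u" "pint p u = 1" "pint p (grad u) = \<mu>"
  by (rule normalized_eigenfunction[OF e p A]) (rule that)
 show ?thesis using rayleigh_inf_le[OF p eigenfunctionD(1)[OF u(1) p A]] u by simp
qed

lemma first_eigenvalue_eq:
 assumes p: "p > 1" and A: "A \<in> lmeasurable" and e: "eigenvalue p A \<mu>"
 shows "first_eigenvalue p A = rayleigh_inf p A" unfolding first_eigenvalue_def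
proof (rule Least_equality)
 show "eigenvalue p A (rayleigh_inf p A)" by (rule rayleigh_inf_eigenvalue[OF p A e]) (auto simp: eigenvalue_def)
qed (rule rayleigh_inf_le_eigenvalue[OF p A])

section \<open>The inequality of Picone\<close>

text \<open>The tangent inequality, used at both points, confines the difference quotient between the two slopes.\<close>

lemma DERIV_abs_powr:
 fixes x :: real
 assumes p: "p > 1"
 shows "((\<lambda>x. \<bar>x\<bar> powr p) has_real_derivative p * flux p x) (at x)" unfolding has_field_derivative_iff
proof (rule Lim_transform2[OF tendsto_const])
 have "((\<lambda>y. p * \<bar>flux p y - flux p x\<bar>) \<longlongrightarrow> p * \<bar>flux p x - flux p x\<bar>) (at x)"
  using continuous_on_flux[OF p, of "UNIV :: real set" "\<lambda>x. x"]
  by (intro tendsto_intros) (auto simp: continuous_on_eq_continuous_at isCont_def)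
 then have l: "((\<lambda>y. p * \<bar>flux p y - flux p x\<bar>) \<longlongrightarrow> 0) (at x)" by simp
 show "((\<lambda>y. p * flux p x - (\<bar>y\<bar> powr p - \<bar>x\<bar> powr p) / (y - x)) \<longlongrightarrow> 0) (at x)"
 proof (rule Lim_null_comparison[OF _ l], unfold eventually_at_filter, intro always_eventually allI impI)
  fix y :: real assume y: "y \<noteq> x"
  have 1: "\<bar>x\<bar> powr p + p * (flux p x * (y - x)) \<le> \<bar>y\<bar> powr p" using powr_convex[OF p, of x y] by simp
  have 2: "\<bar>y\<bar> powr p + p * (flux p y * (x - y)) \<le> \<bar>x\<bar> powr p" using powr_convex[OF p, of y x] by simp
  have "\<bar>(p * flux p x - (\<bar>y\<bar> powr p - \<bar>x\<bar> powr p) / (y - x)) * (y - x)\<bar> =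
   \<bar>p * flux p x * (y - x) - (\<bar>y\<bar> powr p - \<bar>x\<bar> powr p)\<bar>" using y by (subst left_diff_distrib) simp
  also have "\<dots> \<le> p * (flux p y - flux p x) * (y - x)" using 1 2 by (simp add: algebra_simps)
  also have "\<dots> \<le> \<bar>p * (flux p y - flux p x) * (y - x)\<bar>" by simp
  also have "\<dots> = p * \<bar>flux p y - flux p x\<bar> * \<bar>y - x\<bar>" using p by (simp add: abs_mult)
  finally show "norm (p * flux p x - (\<bar>y\<bar> powr p - \<bar>x\<bar> powr p) / (y - x)) \<le> p * \<bar>flux p y - flux p x\<bar>"
   using y by (simp add: abs_mult)
 qed
qed

text \<open>Only nonnegative arguments matter below, but the chain rule asks for functions on the whole line.
 Reflecting at the point \<open>(0, f 0)\<close> keeps them continuously differentiable and bounded.\<close>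

lemma DERIV_odd_reflection:
 fixes f f' :: "real \<Rightarrow> real"
 assumes e: "e > 0" and f: "\<And>t. t > - e \<Longrightarrow> (f has_real_derivative f' t) (at t)"
 shows "((\<lambda>t. if t \<ge> 0 then f t else 2 * f 0 - f (- t)) has_real_derivative f' \<bar>t\<bar>) (at t)"
proof -
 let ?k = "\<lambda>t. if t \<ge> 0 then f t else 2 * f 0 - f (- t)"
 have r: "((\<lambda>t. 2 * f 0 - f (- t)) has_real_derivative f' (- t)) (at t)" if "- t > - e" for t
  using f[OF that] by (auto intro!: derivative_eq_intros DERIV_chain2[of f _ uminus])
 consider "t > 0" | "t = 0" | "t < 0" by linarith
 then show ?thesis
 proof cases
  case 1
  have "(?k has_real_derivative f' t) (at t)"
   by (rule has_field_derivative_transform_within_open[OF f, of t "{0<..}"]) (use 1 e in auto)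
  then show ?thesis using 1 by simp
 next
  case 3
  have "(?k has_real_derivative f' (- t)) (at t)"
   by (rule has_field_derivative_transform_within_open[OF r, of t "{..<0}"]) (use 3 e in auto)
  then show ?thesis using 3 by simp
 next
  case 2
  have "((\<lambda>y. (?k y - ?k 0) / (y - 0)) \<longlongrightarrow> f' 0) (at 0)"
  proof (rule filterlim_split_at)
   have "((\<lambda>y. (f y - f 0) / (y - 0)) \<longlongrightarrow> f' 0) (at_right 0)"
    using f[of 0] e unfolding has_field_derivative_iff filterlim_at_split by auto
   then show "((\<lambda>y. (?k y - ?k 0) / (y - 0)) \<longlongrightarrow> f' 0) (at_right 0)"
    by (rule Lim_transform_eventually) (auto simp: eventually_at_filter)
   have "((\<lambda>y. (2 * f 0 - f (- y) - (2 * f 0 - f (- 0))) / (y - 0)) \<longlongrightarrow> f' (- 0)) (at_left 0)"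
    using r[of 0] e unfolding has_field_derivative_iff filterlim_at_split by auto
   then show "((\<lambda>y. (?k y - ?k 0) / (y - 0)) \<longlongrightarrow> f' 0) (at_left 0)"
    by (rule tendsto_eq_rhs[OF Lim_transform_eventually]) (auto simp: eventually_at_filter)
  qed
  then show ?thesis unfolding has_field_derivative_iff 2 by simp
 qed
qed

text \<open>For small \<open>e\<close> a smoothed sign function; for large \<open>e\<close>, \<open>e * sat e\<close> is a smooth truncation that is
 bounded by \<open>e\<close> and tends to the identity.\<close>

definition sat :: "real \<Rightarrow> real \<Rightarrow> real" where
 "sat e t = t / (\<bar>t\<bar> + e)"

lemma DERIV_sat:
 assumes e: "e > 0" shows "(sat e has_real_derivative e / (\<bar>t\<bar> + e)\<^sup>2) (at t)"
proof -
 have "((\<lambda>t. if t \<ge> 0 then t / (t + e) else 2 * (0 / (0 + e)) - (- t) / (- t + e)) has_real_derivative e / (\<bar>t\<bar> + e)\<^sup>2) (at t)"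
 proof (rule DERIV_odd_reflection[OF e, of "\<lambda>t. t / (t + e)" "\<lambda>t. e / (t + e)\<^sup>2"])
  fix t assume "t > - e"
  then show "((\<lambda>t. t / (t + e)) has_real_derivative e / (t + e)\<^sup>2) (at t)"
   by (auto intro!: derivative_eq_intros simp: power2_eq_square)
 qed
 moreover have "(\<lambda>t. if t \<ge> 0 then t / (t + e) else 2 * (0 / (0 + e)) - (- t) / (- t + e)) = sat e"
  by (auto simp: sat_def fun_eq_iff)
 ultimately show ?thesis by simp
qed

lemma abs_sat_le: "e > 0 \<Longrightarrow> \<bar>sat e t\<bar> \<le> 1" "e > 0 \<Longrightarrow> \<bar>e * sat e t\<bar> \<le> \<bar>t\<bar>"
proof -
 assume e: "e > 0"
 have e2: "\<bar>\<bar>t\<bar> + e\<bar> = \<bar>t\<bar> + e" "\<bar>t\<bar> + e > 0" using e by auto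
 show "\<bar>sat e t\<bar> \<le> 1" using e e2(2) by (simp add: sat_def e2(1) pos_divide_le_eq)
 have "e * \<bar>t\<bar> \<le> \<bar>t\<bar> * (\<bar>t\<bar> + e)" by (simp add: algebra_simps)
 then show "\<bar>e * sat e t\<bar> \<le> \<bar>t\<bar>" using e e2(2) by (simp add: sat_def abs_mult e2(1) pos_divide_le_eq)
qed

lemma sat_deriv_le:
 fixes e t :: real
 assumes e: "e > 0" shows "0 \<le> e / (\<bar>t\<bar> + e)\<^sup>2" "e / (\<bar>t\<bar> + e)\<^sup>2 \<le> 1 / e"
proof -
 show "0 \<le> e / (\<bar>t\<bar> + e)\<^sup>2" using e by (intro divide_nonneg_nonneg[OF less_imp_le]) auto
 have "e\<^sup>2 \<le> (\<bar>t\<bar> + e)\<^sup>2" using e by (intro power_mono) auto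
 moreover have "(\<bar>t\<bar> + e)\<^sup>2 > 0" using e by (intro zero_less_power) auto
 ultimately show "e / (\<bar>t\<bar> + e)\<^sup>2 \<le> 1 / e" using e by (simp add: divide_simps power2_eq_square)
qed

definition reflected_powr :: "real \<Rightarrow> real \<Rightarrow> real \<Rightarrow> real" where
 "reflected_powr a e t = (if t \<ge> 0 then (t + e) powr a else 2 * (0 + e) powr a - (- t + e) powr a)"

lemma DERIV_reflected_powr:
 assumes e: "e > 0" shows "(reflected_powr a e has_real_derivative a * (\<bar>t\<bar> + e) powr (a - 1)) (at t)"
 unfolding reflected_powr_def[abs_def]
proof (rule DERIV_odd_reflection[OF e, of "\<lambda>t. (t + e) powr a" "\<lambda>t. a * (t + e) powr (a - 1)"])
 fix t assume "t > - e"
 then show "((\<lambda>t. (t + e) powr a) has_real_derivative a * (t + e) powr (a - 1)) (at t)" by (auto intro!: derivative_eq_intros)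
qed

lemma neg_powr_le:
 fixes a e t :: real
 assumes "a \<le> 0" "e > 0" shows "(\<bar>t\<bar> + e) powr a \<le> e powr a" using powr_mono2'[of a e "\<bar>t\<bar> + e"] assms by auto

lemma abs_reflected_powr_le:
 assumes "a \<le> 0" "e > 0" shows "\<bar>reflected_powr a e t\<bar> \<le> 2 * e powr a"
 proof -
 have "0 \<le> (\<bar>t\<bar> + e) powr a" "0 \<le> e powr a" by simp_all
 moreover have "(\<bar>t\<bar> + e) powr a \<le> e powr a" by (rule neg_powr_le[OF assms])
 moreover have "reflected_powr a e t = (\<bar>t\<bar> + e) powr a \<or> reflected_powr a e t = 2 * e powr a - (\<bar>t\<bar> + e) powr a"
  by (auto simp: reflected_powr_def)
 ultimately show ?thesis by (elim disjE) linarith+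
qed

lemma W1p0_product:
 fixes u w :: "'a::euclidean_space \<Rightarrow> real" and a a' b b' :: "real \<Rightarrow> real"
 assumes p: "p > 1" and u: "u \<in> W1p0 p A" and w: "w \<in> W1p0 p A"
  and a: "\<And>s. (a has_real_derivative a' s) (at s)" and b: "\<And>s. (b has_real_derivative b' s) (at s)"
  and ca: "continuous_on UNIV a'" and cb: "continuous_on UNIV b'"
  and ba: "\<And>s. \<bar>a s\<bar> \<le> K" "\<And>s. \<bar>a' s\<bar> \<le> K" and bb: "\<And>s. \<bar>b s\<bar> \<le> K" "\<And>s. \<bar>b' s\<bar> \<le> K"
  and 0: "a 0 * b 0 = 0"
 shows "(\<lambda>x. a (u x) * b (w x)) \<in> W1p0 p A"
  "AE x in lebesgue. grad (\<lambda>x. a (u x) * b (w x)) x = (a' (u x) * b (w x)) *\<^sub>R grad u x + (a (u x) * b' (w x)) *\<^sub>R grad w x"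
proof -
 have Ca: "continuous_on UNIV a" and Cb: "continuous_on UNIV b"
  using DERIV_isCont[OF a] DERIV_isCont[OF b] by (auto intro!: continuous_at_imp_continuous_on)
 have K: "K \<ge> 0" using ba(1)[of 0] by linarith
 have c: "continuous_on UNIV (\<lambda>z :: real \<times> real. f (fst z))" "continuous_on UNIV (\<lambda>z :: real \<times> real. f (snd z))"
  if "continuous_on UNIV f" for f :: "real \<Rightarrow> real" by (rule continuous_on_compose2[OF that]; auto intro!: continuous_intros)+
 have d: "((\<lambda>z. a (fst z) * b (snd z)) has_derivative (\<lambda>z. (a' s * b t) * fst z + (a s * b' t) * snd z)) (at (s, t))" for s t
 proof -
  have 1: "((\<lambda>z::real \<times> real. a (fst z)) has_derivative (\<lambda>z. fst z * a' s)) (at (s, t))"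
   by (rule DERIV_compose_FDERIV[where f = a and x = "(s, t)"]) (auto intro!: a derivative_intros)
  have 2: "((\<lambda>z::real \<times> real. b (snd z)) has_derivative (\<lambda>z. snd z * b' t)) (at (s, t))"
   by (rule DERIV_compose_FDERIV[where f = b and x = "(s, t)"]) (auto intro!: b derivative_intros)
  show ?thesis using has_derivative_mult[OF 1 2] by (simp add: algebra_simps)
 qed
 have bd: "\<bar>a' s * b t\<bar> \<le> K * K" "\<bar>a s * b' t\<bar> \<le> K * K" for s t
  using ba[of s] bb[of t] K by (auto simp: abs_mult intro!: mult_mono)
 note W = W1p_chain[of u p w "\<lambda>s t. a s * b t" "\<lambda>s t. a' s * b t" "\<lambda>s t. a s * b' t" "K * K",
  OF W1p0_W1p[OF u] W1p0_W1p[OF w] p d _ _ bd 0]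
 have 1: "continuous_on UNIV (\<lambda>z. a' (fst z) * b (snd z))" "continuous_on UNIV (\<lambda>z. a (fst z) * b' (snd z))"
  "continuous_on UNIV (\<lambda>z. a (fst z) * b (snd z))" by (intro continuous_intros c ca cb Ca Cb)+
 show "AE x in lebesgue. grad (\<lambda>x. a (u x) * b (w x)) x = (a' (u x) * b (w x)) *\<^sub>R grad u x + (a (u x) * b' (w x)) *\<^sub>R grad w x"
  by (rule W(2)[OF 1(1,2)])
 show "(\<lambda>x. a (u x) * b (w x)) \<in> W1p0 p A"
  by (rule W1p0_comp[OF p u w, where g = "\<lambda>s t. a s * b t"]) (rule 1(3) 0 W(1)[OF 1(1,2)])+
qed

definition picone_const :: "real \<Rightarrow> real" where
 "picone_const p = 2 * p / (p - 1) * ((p - 1) / (2 * p)) powr (1 - p)"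

lemma picone_const_nonneg: "p > 1 \<Longrightarrow> picone_const p \<ge> 0" by (simp add: picone_const_def)

text \<open>With \<open>r = (U / g) |b|\<close> the left-hand side is at most \<open>p r\<^sup>p\<^sup>-\<^sup>1 |a| - (p - 1) r\<^sup>p\<close>. The sharp inequality of
 Young gives Picone's bound; giving away half of the negative term also controls \<open>r\<close>, the quantity that
 governs where \<open>u / w\<close> is large.\<close>

lemma picone_pointwise:
 fixes a b :: "'a::real_inner"
 assumes p: "p > 1" and U: "U \<ge> 0" and t: "0 \<le> t" "t \<le> 1" and g: "g > 0"
  and G: "G = (p * flux p U * t * g powr (1 - p)) *\<^sub>R a + (U powr p * ((1 - p) * g powr (- p))) *\<^sub>R b"
 shows "flux p b \<bullet> G \<le> norm a powr p"
  "flux p b \<bullet> G \<le> (p - 1) / 2 * (picone_const p * norm a powr p - (U / g * norm b) powr p)"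
proof -
 define r where "r = U / g * norm b"
 have r0: "r \<ge> 0" using U g by (simp add: r_def)
 have rp: "r powr p = U powr p * g powr (- p) * norm b powr p"
  using U g by (simp add: r_def powr_mult powr_divide powr_minus field_simps)
 have fU: "flux p U = U powr (p - 1)" using U by (cases "U = 0") (auto simp: flux_def powr_diff power2_eq_square)
 have rq: "r powr (p - 1) = U powr (p - 1) * g powr (1 - p) * norm b powr (p - 1)"
  using U g by (simp add: r_def powr_mult powr_divide powr_diff field_simps)
 have "flux p b \<bullet> G = t * (p * U powr (p - 1) * g powr (1 - p)) * (flux p b \<bullet> a) - (p - 1) * r powr p"
  unfolding G inner_add_right inner_scaleR_right flux_inner_self fU rp by (simp add: algebra_simps)
 moreover have "t * (p * U powr (p - 1) * g powr (1 - p)) * (flux p b \<bullet> a) \<le> p * r powr (p - 1) * norm a"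
 proof -
  have "t * (p * U powr (p - 1) * g powr (1 - p)) * (flux p b \<bullet> a) \<le>
   t * (p * U powr (p - 1) * g powr (1 - p)) * (norm b powr (p - 1) * norm a)"
   using abs_flux_inner_le[of p b a] p t by (intro mult_left_mono) auto
  also have "\<dots> \<le> 1 * (p * U powr (p - 1) * g powr (1 - p)) * (norm b powr (p - 1) * norm a)"
   using p t by (intro mult_right_mono) auto
  finally show ?thesis unfolding rq by (simp add: algebra_simps)
 qed
 ultimately have le: "flux p b \<bullet> G \<le> p * r powr (p - 1) * norm a - (p - 1) * r powr p" by linarith
 show "flux p b \<bullet> G \<le> norm a powr p" using le Young_powr[OF p r0, of "norm a"] by simp
 have "r powr (p - 1) * norm a \<le> (p - 1) / (2 * p) * r powr p + ((p - 1) / (2 * p)) powr (1 - p) * norm a powr p"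
  using r0 p by (intro powr_m1_mult_le) auto
 then have "p * (r powr (p - 1) * norm a) \<le> p * ((p - 1) / (2 * p) * r powr p + ((p - 1) / (2 * p)) powr (1 - p) * norm a powr p)"
  using p by (intro mult_left_mono) auto
 also have "\<dots> = (p - 1) / 2 * r powr p + (p - 1) / 2 * (picone_const p * norm a powr p)"
  using p by (simp add: picone_const_def distrib_left)
 finally show "flux p b \<bullet> G \<le> (p - 1) / 2 * (picone_const p * norm a powr p - (U / g * norm b) powr p)"
  using le unfolding r_def[symmetric] by (simp add: right_diff_distrib)
qed

text \<open>The function \<open>U\<^sup>p (w + e)\<^sup>1\<^sup>-\<^sup>p\<close> with \<open>U\<close> the truncation of \<open>u\<close>: a product of two functions with bounded
 values and bounded derivatives.\<close>

lemma picone_test_function: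
 assumes p: "p > 1" and u: "u \<in> W1p0 p A" and w: "w \<in> W1p0 p A" and w0: "\<And>x. w x \<ge> 0"
  and e: "e > 0" and M: "M > 0"
 shows "(\<lambda>x. \<bar>M * sat M (u x)\<bar> powr p * reflected_powr (1 - p) e (w x)) \<in> W1p0 p A"
  "AE x in lebesgue. grad (\<lambda>x. \<bar>M * sat M (u x)\<bar> powr p * reflected_powr (1 - p) e (w x)) x =
   (p * flux p (M * sat M (u x)) * (M * (M / (\<bar>u x\<bar> + M)\<^sup>2)) * (w x + e) powr (1 - p)) *\<^sub>R grad u x +
   (\<bar>M * sat M (u x)\<bar> powr p * ((1 - p) * (w x + e) powr (- p))) *\<^sub>R grad w x"
proof -
 define K where "K = M powr p + p * M powr (p - 1) + 2 * e powr (1 - p) + (p - 1) * e powr (- p)"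
 have K: "M powr p \<le> K" "p * M powr (p - 1) \<le> K" "2 * e powr (1 - p) \<le> K" "(p - 1) * e powr (- p) \<le> K"
  using p by (auto simp: K_def)
 have sM: "\<bar>M * sat M s\<bar> \<le> M" for s using abs_sat_le(1)[OF M, of s] M by (simp add: abs_mult)
 have dM: "0 \<le> M * (M / (\<bar>s\<bar> + M)\<^sup>2)" "M * (M / (\<bar>s\<bar> + M)\<^sup>2) \<le> 1" for s
  using mult_left_mono[OF sat_deriv_le(1)[OF M], of M s] mult_left_mono[OF sat_deriv_le(2)[OF M], of M s] M by auto
 have a: "((\<lambda>s. \<bar>M * sat M s\<bar> powr p) has_real_derivative p * flux p (M * sat M s) * (M * (M / (\<bar>s\<bar> + M)\<^sup>2))) (at s)" for s
  by (rule DERIV_chain2[OF DERIV_abs_powr[OF p] DERIV_cmult[OF DERIV_sat[OF M]]])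
 have csat: "continuous_on UNIV (sat M)" using DERIV_isCont[OF DERIV_sat[OF M]] by (simp add: continuous_at_imp_continuous_on)
 have nz: "\<bar>s\<bar> + M \<noteq> 0" "\<bar>s\<bar> + e \<noteq> 0" for s using M e by auto
 have ca: "continuous_on UNIV (\<lambda>s. p * flux p (M * sat M s) * (M * (M / (\<bar>s\<bar> + M)\<^sup>2)))"
  using nz by (intro continuous_intros p csat) auto
 have cb: "continuous_on UNIV (\<lambda>t. (1 - p) * (\<bar>t\<bar> + e) powr (1 - p - 1))" using nz by (intro continuous_intros) auto
 have a1: "\<bar>\<bar>M * sat M s\<bar> powr p\<bar> \<le> K" for s using powr_mono2[OF _ _ sM, of p s] p K(1) by simp
 have a2: "\<bar>p * flux p (M * sat M s) * (M * (M / (\<bar>s\<bar> + M)\<^sup>2))\<bar> \<le> K" for s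
 proof -
  have "norm (flux p (M * sat M s)) \<le> M powr (p - 1)" unfolding norm_flux using sM p by (intro powr_mono2) auto
  then have "p * \<bar>flux p (M * sat M s)\<bar> \<le> p * M powr (p - 1)" using p by (intro mult_left_mono) auto
  moreover have "p * \<bar>flux p (M * sat M s)\<bar> * (M * (M / (\<bar>s\<bar> + M)\<^sup>2)) \<le> p * \<bar>flux p (M * sat M s)\<bar> * 1"
   using dM p by (intro mult_left_mono) auto
  moreover have "\<bar>p * flux p (M * sat M s) * (M * (M / (\<bar>s\<bar> + M)\<^sup>2))\<bar> = p * \<bar>flux p (M * sat M s)\<bar> * (M * (M / (\<bar>s\<bar> + M)\<^sup>2))"
   using dM(1)[of s] p by (simp only: abs_mult[of "_ * _" "M * (M / (\<bar>s\<bar> + M)\<^sup>2)"] abs_mult[of p] abs_of_nonneg)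
  ultimately show ?thesis using K(2) by linarith
 qed
 have b1: "\<bar>reflected_powr (1 - p) e t\<bar> \<le> K" for t using abs_reflected_powr_le[of "1 - p" e t] p e K(3) by linarith
 have b2: "\<bar>(1 - p) * (\<bar>t\<bar> + e) powr (1 - p - 1)\<bar> \<le> K" for t
 proof -
  have "(p - 1) * (\<bar>t\<bar> + e) powr (- p) \<le> (p - 1) * e powr (- p)" using p e by (intro mult_left_mono neg_powr_le) auto
  moreover have "\<bar>(1 - p) * (\<bar>t\<bar> + e) powr (1 - p - 1)\<bar> = (p - 1) * (\<bar>t\<bar> + e) powr (- p)" using p by (simp add: abs_mult)
  ultimately show ?thesis using K(4) by linarith
 qed
 have 0: "\<bar>M * sat M 0\<bar> powr p * reflected_powr (1 - p) e 0 = 0" using p by (simp add: sat_def)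
 note W = W1p0_product[OF p u w a DERIV_reflected_powr[OF e] ca cb a1 a2 b1 b2 0]
 show "(\<lambda>x. \<bar>M * sat M (u x)\<bar> powr p * reflected_powr (1 - p) e (w x)) \<in> W1p0 p A" by (rule W(1))
 show "AE x in lebesgue. grad (\<lambda>x. \<bar>M * sat M (u x)\<bar> powr p * reflected_powr (1 - p) e (w x)) x =
   (p * flux p (M * sat M (u x)) * (M * (M / (\<bar>u x\<bar> + M)\<^sup>2)) * (w x + e) powr (1 - p)) *\<^sub>R grad u x +
   (\<bar>M * sat M (u x)\<bar> powr p * ((1 - p) * (w x + e) powr (- p))) *\<^sub>R grad w x"
  using W(2) by eventually_elim (use w0 in \<open>simp add: reflected_powr_def\<close>)
qed

lemma pos_set_measurable:
 fixes w :: "'a::euclidean_space \<Rightarrow> real"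
 assumes [measurable]: "w \<in> lmeas"
 shows "{x. w x > 0} \<in> sets lebesgue"
proof -
 have "{x\<in>space lebesgue. w x > 0} \<in> sets lebesgue" by measurable
 then show ?thesis by simp
qed

lemma picone_estimate:
 assumes p: "p > 1" and A: "A \<in> lmeasurable" and ew: "eigenfunction p A \<mu> w" and w0: "\<And>x. w x \<ge> 0"
  and u: "u \<in> W1p0 p A" and u0: "\<And>x. u x \<ge> 0" and e: "e > 0" and M: "M > 0"
 shows "\<mu> * (LINT x|lebesgue. w x powr (p - 1) * ((M * sat M (u x)) powr p * (w x + e) powr (1 - p))) \<le>
   (LINT x|lebesgue. indicator {x. w x > 0} x * norm (grad u x) powr p)"
  "(\<lambda>x. M * sat M (u x) / (w x + e) * norm (grad w x)) \<in> Lp p"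
  "pint p (\<lambda>x. M * sat M (u x) / (w x + e) * norm (grad w x)) \<le> picone_const p * pint p (grad u)"
proof -
 note w = eigenfunctionD(1)[OF ew p A]
 define U where "U x = M * sat M (u x)" for x
 have U: "0 \<le> U x" "U x \<le> M" for x
 proof -
  have "M * sat M (u x) \<le> M * 1" using abs_sat_le(1)[OF M, of "u x"] M by (intro mult_left_mono) auto
  then show "U x \<le> M" by (simp add: U_def)
  show "0 \<le> U x" using u0[of x] M by (simp add: U_def sat_def)
 qed
 define \<phi> where "\<phi> x = \<bar>M * sat M (u x)\<bar> powr p * reflected_powr (1 - p) e (w x)" for x
 have \<phi>_eq: "\<phi> x = U x powr p * (w x + e) powr (1 - p)" for x
  using U(1)[of x] w0[of x] by (simp add: \<phi>_def U_def[symmetric] reflected_powr_def)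
 note T = picone_test_function[OF p u w w0 e M, folded \<phi>_def[abs_def], unfolded U_def[symmetric]]
 note \<phi>W = W1p0_W1p[OF T(1)] and uW = W1p0_W1p[OF u] and wW = W1p0_W1p[OF w]
 have [measurable]: "u \<in> lmeas" "w \<in> lmeas"
  "grad u \<in> lmeas" "grad w \<in> lmeas"
  using W1p_measurable[OF uW] W1p_measurable[OF wW] grad_measurable[OF uW] grad_measurable[OF wW] by auto
 have [measurable]: "U \<in> lmeas" unfolding U_def[abs_def] sat_def by measurable
 have dM: "0 \<le> M * (M / (\<bar>s\<bar> + M)\<^sup>2)" "M * (M / (\<bar>s\<bar> + M)\<^sup>2) \<le> 1" for s
  using mult_left_mono[OF sat_deriv_le(1)[OF M], of M s] mult_left_mono[OF sat_deriv_le(2)[OF M], of M s] M by auto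
 have g: "w x + e > 0" for x using w0[of x] e by simp
 have aU: "\<bar>U x\<bar> = U x" for x using U(1) by simp
 note P = picone_pointwise[OF p U(1) dM g]
 have iI: "integrable lebesgue (\<lambda>x. indicator {x. w x > 0} x * norm (grad u x) powr p)"
  using integrable_mult_indicator[OF _ Lp_integrable[OF W1pD(2)[OF uW]], of "{x. w x > 0}"] pos_set_measurable[of w] by simp
 have ifl: "integrable lebesgue (\<lambda>x. flux p (grad w x) \<bullet> grad \<phi> x)" by (rule flux_integrable[OF W1pD(2)[OF wW] W1pD(2)[OF \<phi>W] p])
 have pm: "pair_int p (grad w) (grad \<phi>) = \<mu> * pair_int p w \<phi>" by (rule eigenfunctionD(3)[OF ew p A T(1)])
 have fw: "flux p (w x) = w x powr (p - 1)" for x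
  using w0[of x] by (cases "w x = 0") (auto simp: flux_def powr_diff power2_eq_square)
 have pw: "pair_int p w \<phi> = (LINT x|lebesgue. w x powr (p - 1) * (U x powr p * (w x + e) powr (1 - p)))"
  by (simp add: pair_int_def fw \<phi>_eq)
 have "pair_int p (grad w) (grad \<phi>) \<le> (LINT x|lebesgue. indicator {x. w x > 0} x * norm (grad u x) powr p)" unfolding pair_int_def
 proof (rule integral_mono_AE[OF ifl iI])
  show "AE x in lebesgue. flux p (grad w x) \<bullet> grad \<phi> x \<le> indicator {x. w x > 0} x * norm (grad u x) powr p"
   using T(2) grad_eq_0_AE[OF wW p]
  proof eventually_elim
   case (elim x)
   show ?case
   proof (cases "w x = 0")
    case True then show ?thesis using elim(2) by simp
   next
    case False
    then have "w x > 0" using w0[of x] by simp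
    then show ?thesis using P(1)[OF elim(1)[unfolded aU]] by simp
   qed
  qed
 qed
 then show "\<mu> * (LINT x|lebesgue. w x powr (p - 1) * ((M * sat M (u x)) powr p * (w x + e) powr (1 - p))) \<le>
   (LINT x|lebesgue. indicator {x. w x > 0} x * norm (grad u x) powr p)" unfolding pm pw U_def .
 have RL: "(\<lambda>x. U x / (w x + e) * norm (grad w x)) \<in> Lp p"
 proof (rule Lp_dominated(1)[OF _ W1pD(2)[OF wW], where C = "M / e"])
  show "AE x in lebesgue. norm (U x / (w x + e) * norm (grad w x)) \<le> M / e * norm (grad w x)"
  proof (rule AE_I2)
   fix x
   have "U x / (w x + e) \<le> M / e" using U[of x] w0[of x] e by (intro frac_le) auto
   then show "norm (U x / (w x + e) * norm (grad w x)) \<le> M / e * norm (grad w x)"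
    using mult_right_mono[of "U x / (w x + e)" "M / e" "norm (grad w x)"] U(1)[of x] g[of x] by simp
  qed
 qed (use p M e in auto)
 then show "(\<lambda>x. M * sat M (u x) / (w x + e) * norm (grad w x)) \<in> Lp p" unfolding U_def .
 note iR = Lp_integrable[OF RL] and iu = Lp_integrable[OF W1pD(2)[OF uW]]
 have "0 \<le> pair_int p (grad w) (grad \<phi>)"
  unfolding pm pw using eigenfunctionD(5)[OF ew p A] by (intro mult_nonneg_nonneg integral_nonneg_AE AE_I2) auto
 also have "\<dots> \<le> (LINT x|lebesgue. (p - 1) / 2 * (picone_const p * norm (grad u x) powr p - norm (U x / (w x + e) * norm (grad w x)) powr p))"
  unfolding pair_int_def
 proof (rule integral_mono_AE[OF ifl])
  show "AE x in lebesgue. flux p (grad w x) \<bullet> grad \<phi> x \<le>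
   (p - 1) / 2 * (picone_const p * norm (grad u x) powr p - norm (U x / (w x + e) * norm (grad w x)) powr p)" using T(2)
  proof eventually_elim
   case (elim x)
   have "norm (U x / (w x + e) * norm (grad w x)) = U x / (w x + e) * norm (grad w x)" using U(1)[of x] g[of x] by simp
   then show ?case using P(2)[OF elim[unfolded aU]] by simp
  qed
 qed (intro Bochner_Integration.integrable_diff integrable_mult_right iR iu)
 also have "\<dots> = (p - 1) / 2 * (picone_const p * pint p (grad u) - pint p (\<lambda>x. U x / (w x + e) * norm (grad w x)))"
  unfolding pint_def using iR iu by simp
 finally show "pint p (\<lambda>x. M * sat M (u x) / (w x + e) * norm (grad w x)) \<le> picone_const p * pint p (grad u)"
  using p by (simp add: zero_le_mult_iff U_def)
qed

lemma truncation_tendsto: "(\<lambda>N. real (Suc N) * sat (real (Suc N)) s) \<longlonglongrightarrow> s"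
 and truncation_deriv_tendsto: "(\<lambda>N. real (Suc N) * (real (Suc N) / (\<bar>s\<bar> + real (Suc N))\<^sup>2)) \<longlonglongrightarrow> 1"
proof -
 have l: "(\<lambda>N. \<bar>s\<bar> * inverse (real (Suc N)) + 1) \<longlonglongrightarrow> \<bar>s\<bar> * 0 + 1" by (intro tendsto_intros LIMSEQ_inverse_real_of_nat)
 have nz: "\<bar>s\<bar> + real (Suc N) > 0" for N by (rule add_nonneg_pos) auto
 have eq: "\<bar>s\<bar> * inverse (real (Suc N)) + 1 = (\<bar>s\<bar> + real (Suc N)) / real (Suc N)" for N
  by (simp add: field_simps del: of_nat_Suc)
 have "(\<lambda>N. s / (\<bar>s\<bar> * inverse (real (Suc N)) + 1)) \<longlonglongrightarrow> s / (\<bar>s\<bar> * 0 + 1)" by (intro tendsto_divide l tendsto_const) auto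
 moreover have "s / (\<bar>s\<bar> * inverse (real (Suc N)) + 1) = real (Suc N) * sat (real (Suc N)) s" for N
  unfolding eq sat_def by (simp del: of_nat_Suc)
 ultimately show "(\<lambda>N. real (Suc N) * sat (real (Suc N)) s) \<longlonglongrightarrow> s" by simp
 have "(\<lambda>N. (1 / (\<bar>s\<bar> * inverse (real (Suc N)) + 1))\<^sup>2) \<longlonglongrightarrow> (1 / (\<bar>s\<bar> * 0 + 1))\<^sup>2"
  by (intro tendsto_power tendsto_divide l tendsto_const) auto
 moreover have "(1 / (\<bar>s\<bar> * inverse (real (Suc N)) + 1))\<^sup>2 = real (Suc N) * (real (Suc N) / (\<bar>s\<bar> + real (Suc N))\<^sup>2)" for N
  unfolding eq by (simp add: power_divide power2_eq_square del: of_nat_Suc)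
 ultimately show "(\<lambda>N. real (Suc N) * (real (Suc N) / (\<bar>s\<bar> + real (Suc N))\<^sup>2)) \<longlonglongrightarrow> 1" by simp
qed

lemma sat_tendsto_1:
 assumes t: "t > 0" shows "(\<lambda>N. sat (inverse (real (Suc N))) t) \<longlonglongrightarrow> 1"
  "(\<lambda>N. inverse (real (Suc N)) / (\<bar>t\<bar> + inverse (real (Suc N)))\<^sup>2) \<longlonglongrightarrow> 0"
proof -
 have "(\<lambda>N. t / (\<bar>t\<bar> + inverse (real (Suc N)))) \<longlonglongrightarrow> t / (\<bar>t\<bar> + 0)" using t by (intro tendsto_intros LIMSEQ_inverse_real_of_nat) auto
 then show "(\<lambda>N. sat (inverse (real (Suc N))) t) \<longlonglongrightarrow> 1" using t by (simp add: sat_def)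
 have "(\<lambda>N. inverse (real (Suc N)) / (\<bar>t\<bar> + inverse (real (Suc N)))\<^sup>2) \<longlonglongrightarrow> 0 / (\<bar>t\<bar> + 0)\<^sup>2"
  using t by (intro tendsto_intros LIMSEQ_inverse_real_of_nat) auto
 then show "(\<lambda>N. inverse (real (Suc N)) / (\<bar>t\<bar> + inverse (real (Suc N)))\<^sup>2) \<longlonglongrightarrow> 0" by simp
qed

text \<open>Let the truncation level tend to infinity and the shift to zero. On \<open>{w = 0}\<close> both the test function's
 weight \<open>w\<^sup>p\<^sup>-\<^sup>1\<close> and \<open>\<nabla>w\<close> vanish. As \<open>u x / 0 = 0\<close>, the function in the second claim is zero there.\<close>

lemma picone_limit:
 assumes p: "p > 1" and A: "A \<in> lmeasurable" and ew: "eigenfunction p A \<mu> w" and w0: "\<And>x. w x \<ge> 0"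
  and u: "u \<in> W1p0 p A" and u0: "\<And>x. u x \<ge> 0"
 shows "\<mu> * (LINT x|lebesgue. indicator {x. w x > 0} x * u x powr p) \<le>
   (LINT x|lebesgue. indicator {x. w x > 0} x * norm (grad u x) powr p)"
  and "(\<lambda>x. u x / w x * norm (grad w x)) \<in> Lp p"
proof -
 define e where "e N = inverse (real (Suc N))" for N
 \<comment> \<open>One index serves for the truncation level and for the shift.\<close>
 define U where "U N x = real (Suc N) * sat (real (Suc N)) (u x)" for N x
 note w = eigenfunctionD(1)[OF ew p A]
 note uW = W1p0_W1p[OF u] and wW = W1p0_W1p[OF w]
 have [measurable]: "u \<in> lmeas" "w \<in> lmeas"
  "grad u \<in> lmeas" "grad w \<in> lmeas"
  using W1p_measurable[OF uW] W1p_measurable[OF wW] grad_measurable[OF uW] grad_measurable[OF wW] by auto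
 have [measurable]: "{x. w x > 0} \<in> sets lebesgue" by (rule pos_set_measurable) measurable
 have [measurable]: "U N \<in> lmeas" for N unfolding U_def[abs_def] sat_def by measurable
 have e0: "e N > 0" for N by (simp add: e_def)
 have el: "e \<longlonglongrightarrow> 0" unfolding e_def[abs_def] by (rule LIMSEQ_inverse_real_of_nat)
 have U0: "0 \<le> U N x" "U N x \<le> u x" for N x
  using abs_sat_le(2)[of "real (Suc N)" "u x"] u0[of x] by (auto simp: U_def sat_def simp del: of_nat_Suc)
 have Ul: "(\<lambda>N. U N x) \<longlonglongrightarrow> u x" for x unfolding U_def by (rule truncation_tendsto)
 have M: "real (Suc N) > 0" for N by simp
 define s where "s N x = w x powr (p - 1) * (U N x powr p * (w x + e N) powr (1 - p))" for N x
 have "(\<lambda>N. LINT x|lebesgue. s N x) \<longlonglongrightarrow> (LINT x|lebesgue. indicator {x. w x > 0} x * u x powr p)"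
 proof (rule integral_dominated_convergence[where w = "\<lambda>x. norm (u x) powr p"])
  show "integrable lebesgue (\<lambda>x. norm (u x) powr p)" by (rule Lp_integrable[OF W1p_Lp[OF uW]])
  show "AE x in lebesgue. norm (s N x) \<le> norm (u x) powr p" for N
  proof (rule AE_I2)
   fix x
   have "w x powr (p - 1) * (w x + e N) powr (1 - p) = (w x / (w x + e N)) powr (p - 1)"
    using w0[of x] e0[of N] powr_minus_divide[of "w x + e N" "p - 1"] by (simp add: powr_divide)
   also have "\<dots> \<le> 1" using w0[of x] e0[of N] p by (intro powr_le1) auto
   finally have 1: "w x powr (p - 1) * (w x + e N) powr (1 - p) \<le> 1" .
   have "s N x = (w x powr (p - 1) * (w x + e N) powr (1 - p)) * U N x powr p" by (simp add: s_def algebra_simps)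
   also have "\<dots> \<le> 1 * u x powr p" using U0[of N x] p by (intro mult_mono 1 powr_mono2) auto
   finally show "norm (s N x) \<le> norm (u x) powr p" using u0[of x] by (simp add: s_def)
  qed
  show "AE x in lebesgue. (\<lambda>N. s N x) \<longlonglongrightarrow> indicator {x. w x > 0} x * u x powr p"
  proof (rule AE_I2)
   fix x
   show "(\<lambda>N. s N x) \<longlonglongrightarrow> indicator {x. w x > 0} x * u x powr p"
   proof (cases "w x > 0")
    case True
    have "(\<lambda>N. U N x powr p) \<longlonglongrightarrow> u x powr p" using Ul[of x] p U0(1) by (intro tendsto_powr2) (auto intro: always_eventually)
    moreover have "(\<lambda>N. (w x + e N) powr (1 - p)) \<longlonglongrightarrow> (w x + 0) powr (1 - p)" using True by (intro tendsto_intros el) auto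
    ultimately have l: "(\<lambda>N. s N x) \<longlonglongrightarrow> w x powr (p - 1) * (u x powr p * (w x + 0) powr (1 - p))"
     unfolding s_def by (intro tendsto_mult tendsto_const)
    have "w x powr (p - 1) * w x powr (1 - p) = 1" using True by (simp add: powr_add[symmetric])
    then have "w x powr (p - 1) * (u x powr p * (w x + 0) powr (1 - p)) = u x powr p" by (simp add: mult.left_commute)
    with l have "(\<lambda>N. s N x) \<longlonglongrightarrow> u x powr p" by (simp only:)
    then show ?thesis using True by simp
   next
    case False
    then have "w x = 0" using w0[of x] by simp
    then show ?thesis by (simp add: s_def)
   qed
  qed
 qed (auto simp: s_def)
 then have "(\<lambda>N. \<mu> * (LINT x|lebesgue. s N x)) \<longlonglongrightarrow> \<mu> * (LINT x|lebesgue. indicator {x. w x > 0} x * u x powr p)"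
  by (intro tendsto_intros)
 moreover have "\<mu> * (LINT x|lebesgue. s N x) \<le> (LINT x|lebesgue. indicator {x. w x > 0} x * norm (grad u x) powr p)" for N
  using picone_estimate(1)[OF p A ew w0 u u0 e0[of N] M[of N]] unfolding s_def U_def .
 ultimately show "\<mu> * (LINT x|lebesgue. indicator {x. w x > 0} x * u x powr p) \<le>
   (LINT x|lebesgue. indicator {x. w x > 0} x * norm (grad u x) powr p)" by (intro LIMSEQ_le_const2) auto
 define R where "R N x = U N x / (w x + e N) * norm (grad w x)" for N x
 have R: "R N \<in> Lp p" "pint p (R N) \<le> picone_const p * pint p (grad u)" for N
  using picone_estimate(2,3)[OF p A ew w0 u u0 e0[of N] M[of N]] unfolding R_def[abs_def] U_def by auto
 show "(\<lambda>x. u x / w x * norm (grad w x)) \<in> Lp p"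
 proof (rule Lp_of_nn_integral(1))
  show "(\<integral>\<^sup>+x. ennreal (norm (u x / w x * norm (grad w x)) powr p) \<partial>lebesgue) \<le> ennreal (picone_const p * pint p (grad u))"
  proof (rule nn_integral_lim_le[where f = "\<lambda>N x. ennreal (norm (R N x) powr p)"])
   show "(\<lambda>x. ennreal (norm (R N x) powr p)) \<in> lmeas" for N unfolding R_def[abs_def] by measurable
   show "(\<integral>\<^sup>+x. ennreal (norm (R N x) powr p) \<partial>lebesgue) \<le> ennreal (picone_const p * pint p (grad u))" for N
    unfolding nn_integral_pint[OF R(1)] using R(2) by (intro ennreal_leI)
   show "AE x in lebesgue. (\<lambda>N. ennreal (norm (R N x) powr p)) \<longlonglongrightarrow> ennreal (norm (u x / w x * norm (grad w x)) powr p)"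
    using grad_eq_0_AE[OF wW p]
   proof eventually_elim
    case (elim x)
    have "(\<lambda>N. R N x) \<longlonglongrightarrow> u x / w x * norm (grad w x)"
    proof (cases "w x = 0")
     case True
     then show ?thesis using elim by (simp add: R_def)
    next
     case False
     have "(\<lambda>N. R N x) \<longlonglongrightarrow> u x / (w x + 0) * norm (grad w x)" unfolding R_def using False by (intro tendsto_intros Ul el) auto
     then show ?thesis by simp
    qed
    then have "(\<lambda>N. norm (R N x) powr p) \<longlonglongrightarrow> norm (u x / w x * norm (grad w x)) powr p"
     using p by (intro tendsto_powr2 tendsto_norm) (auto intro: always_eventually)
    then show ?case by (intro tendsto_ennrealI)
   qed
  qed
 qed (use picone_const_nonneg[OF p] pint_nonneg[of p "grad u"] in auto)
qed

text \<open>Test the equation of \<open>u\<close> with \<open>U * sat e w\<close>, which tends to \<open>u\<close> on \<open>{w > 0}\<close> and vanishes elsewhere.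
 The part of its gradient that comes from the cut-off is \<open>U e / (w + e)\<^sup>2 \<nabla>w\<close>; it tends to zero and is dominated by
 \<open>(u / w) |\<nabla>w|\<close>, which is the reason for assuming the latter in \<open>L\<^sup>p\<close>.\<close>

lemma positivity_energy_identity:
 assumes p: "p > 1" and A: "A \<in> lmeasurable" and eu: "eigenfunction p A m u" and u0: "\<And>x. u x \<ge> 0"
  and w: "w \<in> W1p0 p A" and w0: "\<And>x. w x \<ge> 0" and H: "(\<lambda>x. u x / w x * norm (grad w x)) \<in> Lp p"
 shows "(LINT x|lebesgue. indicator {x. w x > 0} x * norm (grad u x) powr p) =
  m * (LINT x|lebesgue. indicator {x. w x > 0} x * u x powr p)"
proof -
 define e where "e N = inverse (real (Suc N))" for N
 define M where "M N = real (Suc N)" for N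
 define z where "z N x = (M N * sat (M N) (u x)) * sat (e N) (w x)" for N x
 note u = eigenfunctionD(1)[OF eu p A]
 note uW = W1p0_W1p[OF u] and wW = W1p0_W1p[OF w]
 have [measurable]: "u \<in> lmeas" "w \<in> lmeas"
  "grad u \<in> lmeas" "grad w \<in> lmeas"
  using W1p_measurable[OF uW] W1p_measurable[OF wW] grad_measurable[OF uW] grad_measurable[OF wW] by auto
 have [measurable]: "{x. w x > 0} \<in> sets lebesgue" by (rule pos_set_measurable) measurable
 have e0: "e N > 0" and M0: "M N > 0" for N by (auto simp: e_def M_def)
 have U0: "0 \<le> M N * sat (M N) (u x)" "M N * sat (M N) (u x) \<le> u x" for N x
  using abs_sat_le(2)[OF M0[of N], of "u x"] u0[of x] M0[of N] by (auto simp: sat_def)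
 have q0: "0 \<le> sat (e N) (w x)" "sat (e N) (w x) \<le> 1" for N x
  using abs_sat_le(1)[OF e0[of N], of "w x"] w0[of x] e0[of N] by (auto simp: sat_def)
 have dM: "0 \<le> M N * (M N / (\<bar>s\<bar> + M N)\<^sup>2)" "M N * (M N / (\<bar>s\<bar> + M N)\<^sup>2) \<le> 1" for s N
  using mult_left_mono[OF sat_deriv_le(1)[OF M0[of N], of s], of "M N"] mult_left_mono[OF sat_deriv_le(2)[OF M0[of N], of s], of "M N"] M0[of N] by auto
 have z: "z N \<in> W1p0 p A" "AE x in lebesgue. grad (z N) x =
   (M N * (M N / (\<bar>u x\<bar> + M N)\<^sup>2) * sat (e N) (w x)) *\<^sub>R grad u x +
   (M N * sat (M N) (u x) * (e N / (\<bar>w x\<bar> + e N)\<^sup>2)) *\<^sub>R grad w x" for N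
 proof -
  have nz: "\<bar>s\<bar> + M N \<noteq> 0" "\<bar>s\<bar> + e N \<noteq> 0" for s using M0[of N] e0[of N] by auto
  have c: "continuous_on UNIV (\<lambda>s. M N * (M N / (\<bar>s\<bar> + M N)\<^sup>2))" "continuous_on UNIV (\<lambda>t. e N / (\<bar>t\<bar> + e N)\<^sup>2)"
   using nz by (auto intro!: continuous_intros)
  define K where "K = M N + 1 + 1 / e N"
  have K: "M N \<le> K" "1 \<le> K" "1 / e N \<le> K" using M0[of N] e0[of N] by (auto simp: K_def)
  have 1: "\<bar>M N * sat (M N) s\<bar> \<le> K" for s
  proof -
   have "\<bar>M N * sat (M N) s\<bar> \<le> M N * 1"
    unfolding abs_mult using M0[of N] abs_sat_le(1)[OF M0[of N], of s] by (intro mult_mono) auto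
   then show ?thesis using K(1) by linarith
  qed
  have 2: "\<bar>M N * (M N / (\<bar>s\<bar> + M N)\<^sup>2)\<bar> \<le> K" for s using dM[of N s] K(2) by linarith
  have 3: "\<bar>sat (e N) t\<bar> \<le> K" for t using abs_sat_le(1)[OF e0[of N], of t] K(2) by linarith
  have 4: "\<bar>e N / (\<bar>t\<bar> + e N)\<^sup>2\<bar> \<le> K" for t using sat_deriv_le[OF e0[of N], of t] K(3) by linarith
  have 0: "M N * sat (M N) 0 * sat (e N) 0 = 0" by (simp add: sat_def)
  note W = W1p0_product[OF p u w DERIV_cmult[OF DERIV_sat[OF M0]] DERIV_sat[OF e0] c 1 2 3 4 0]
  show "z N \<in> W1p0 p A" unfolding z_def[abs_def] by (rule W(1))
  show "AE x in lebesgue. grad (z N) x =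
   (M N * (M N / (\<bar>u x\<bar> + M N)\<^sup>2) * sat (e N) (w x)) *\<^sub>R grad u x +
   (M N * sat (M N) (u x) * (e N / (\<bar>w x\<bar> + e N)\<^sup>2)) *\<^sub>R grad w x" unfolding z_def[abs_def] by (rule W(2))
 qed
 have Zm[measurable]: "z N \<in> lmeas" "grad (z N) \<in> lmeas" for N
  using W1p_measurable[OF W1p0_W1p[OF z(1)]] grad_measurable[OF W1p0_W1p[OF z(1)]] by auto
 have fm[measurable]: "(\<lambda>x. flux p (grad u x)) \<in> lmeas" "(\<lambda>x. flux p (u x)) \<in> lmeas" by (intro flux_measurable p; measurable)+
 have fu: "flux p (u x) * u x = u x powr p" for x using flux_inner_self[of p "u x"] u0[of x] by simp
 have "(\<lambda>N. pair_int p u (z N)) \<longlonglongrightarrow> (LINT x|lebesgue. indicator {x. w x > 0} x * u x powr p)" unfolding pair_int_def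
 proof (rule integral_dominated_convergence[where w = "\<lambda>x. norm (u x) powr p"])
  show "integrable lebesgue (\<lambda>x. norm (u x) powr p)" by (rule Lp_integrable[OF W1p_Lp[OF uW]])
  show "AE x in lebesgue. norm (flux p (u x) \<bullet> z N x) \<le> norm (u x) powr p" for N
  proof (rule AE_I2)
   fix x
   have "z N x \<le> u x * 1" unfolding z_def by (intro mult_mono U0 q0 u0)
   moreover have "z N x \<ge> 0" unfolding z_def by (intro mult_nonneg_nonneg U0(1) q0(1))
   moreover have "flux p (u x) \<ge> 0" using u0[of x] by (simp add: flux_def)
   ultimately have "flux p (u x) * z N x \<le> flux p (u x) * u x" "flux p (u x) * z N x \<ge> 0" by (auto intro: mult_left_mono)
   then show "norm (flux p (u x) \<bullet> z N x) \<le> norm (u x) powr p" using fu[of x] u0[of x] by simp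
  qed
  show "AE x in lebesgue. (\<lambda>N. flux p (u x) \<bullet> z N x) \<longlonglongrightarrow> indicator {x. w x > 0} x * u x powr p"
  proof (rule AE_I2)
   fix x
   show "(\<lambda>N. flux p (u x) \<bullet> z N x) \<longlonglongrightarrow> indicator {x. w x > 0} x * u x powr p"
   proof (cases "w x > 0")
    case True
    have "(\<lambda>N. flux p (u x) \<bullet> z N x) \<longlonglongrightarrow> flux p (u x) \<bullet> (u x * 1)"
     unfolding z_def M_def e_def by (intro tendsto_intros truncation_tendsto sat_tendsto_1 True)
    then show ?thesis using True fu[of x] by simp
   next
    case False
    then have "w x = 0" using w0[of x] by simp
    then show ?thesis by (simp add: z_def sat_def)
   qed
  qed
 qed measurable
 then have 1: "(\<lambda>N. m * pair_int p u (z N)) \<longlonglongrightarrow> m * (LINT x|lebesgue. indicator {x. w x > 0} x * u x powr p)"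
  by (intro tendsto_intros)
 have "(\<lambda>N. pair_int p (grad u) (grad (z N))) \<longlonglongrightarrow> (LINT x|lebesgue. indicator {x. w x > 0} x * norm (grad u x) powr p)"
  unfolding pair_int_def
 proof (rule integral_dominated_convergence[where w = "\<lambda>x. 2 * norm (grad u x) powr p + norm (u x / w x * norm (grad w x)) powr p"])
  show "integrable lebesgue (\<lambda>x. 2 * norm (grad u x) powr p + norm (u x / w x * norm (grad w x)) powr p)"
   by (intro Bochner_Integration.integrable_add integrable_mult_right Lp_integrable W1pD(2)[OF uW] H)
  show "AE x in lebesgue. norm (flux p (grad u x) \<bullet> grad (z N) x) \<le>
   2 * norm (grad u x) powr p + norm (u x / w x * norm (grad w x)) powr p" for N using z(2)[of N] grad_eq_0_AE[OF wW p]
  proof eventually_elim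
   case (elim x)
   define t where "t = M N * (M N / (\<bar>u x\<bar> + M N)\<^sup>2) * sat (e N) (w x)"
   define c where "c = M N * sat (M N) (u x) * (e N / (\<bar>w x\<bar> + e N)\<^sup>2)"
   have t: "0 \<le> t" "t \<le> 1" unfolding t_def by (intro mult_nonneg_nonneg mult_le_one dM q0)+
   have ch: "norm (c *\<^sub>R grad w x) \<le> norm (u x / w x * norm (grad w x))"
   proof (cases "w x = 0")
    case True then show ?thesis using elim(2) by simp
   next
    case False
    then have wp: "w x > 0" using w0[of x] by simp
    have "e N / (\<bar>w x\<bar> + e N)\<^sup>2 \<le> 1 / w x"
    proof -
     have "w x * e N \<le> (w x + e N)\<^sup>2" using wp e0[of N] by (simp add: power2_eq_square algebra_simps)
     moreover have "(w x + e N)\<^sup>2 > 0" using wp e0[of N] by (intro zero_less_power) auto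
     ultimately show ?thesis using wp by (simp add: divide_simps mult.commute)
    qed
    then have "c \<le> u x * (1 / w x)" unfolding c_def using U0[of N x] u0[of x] e0[of N] by (intro mult_mono) auto
    moreover have "c \<ge> 0" unfolding c_def by (rule mult_nonneg_nonneg[OF U0(1) sat_deriv_le(1)[OF e0]])
    ultimately show ?thesis using mult_right_mono[of c "u x / w x" "norm (grad w x)"] wp u0[of x] by simp
   qed
   have "flux p (grad u x) \<bullet> grad (z N) x = t * norm (grad u x) powr p + flux p (grad u x) \<bullet> (c *\<^sub>R grad w x)"
    unfolding elim(1) t_def[symmetric] c_def[symmetric] by (simp add: inner_add_right flux_inner_self)
   moreover have "\<bar>t * norm (grad u x) powr p\<bar> \<le> norm (grad u x) powr p" using t by (simp add: abs_mult mult_left_le_one_le)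
   moreover have "\<bar>flux p (grad u x) \<bullet> (c *\<^sub>R grad w x)\<bar> \<le> norm (grad u x) powr p + norm (u x / w x * norm (grad w x)) powr p"
   proof -
    have "\<bar>flux p (grad u x) \<bullet> (c *\<^sub>R grad w x)\<bar> \<le> 1 * norm (grad u x) powr p + 1 powr (1 - p) * norm (c *\<^sub>R grad w x) powr p"
     using p by (intro flux_inner_le) auto
    moreover have "norm (c *\<^sub>R grad w x) powr p \<le> norm (u x / w x * norm (grad w x)) powr p" using ch p by (intro powr_mono2) auto
    ultimately show ?thesis by simp
   qed
   ultimately show ?case by simp
  qed
  have "AE x in lebesgue. \<forall>N. grad (z N) x =
   (M N * (M N / (\<bar>u x\<bar> + M N)\<^sup>2) * sat (e N) (w x)) *\<^sub>R grad u x +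
   (M N * sat (M N) (u x) * (e N / (\<bar>w x\<bar> + e N)\<^sup>2)) *\<^sub>R grad w x" unfolding AE_all_countable using z(2) by blast
  then show "AE x in lebesgue. (\<lambda>N. flux p (grad u x) \<bullet> grad (z N) x) \<longlonglongrightarrow> indicator {x. w x > 0} x * norm (grad u x) powr p"
   using grad_eq_0_AE[OF wW p]
  proof eventually_elim
   case (elim x)
   show ?case
   proof (cases "w x > 0")
    case True
    have "(\<lambda>N. flux p (grad u x) \<bullet> ((M N * (M N / (\<bar>u x\<bar> + M N)\<^sup>2) * sat (e N) (w x)) *\<^sub>R grad u x +
     (M N * sat (M N) (u x) * (e N / (\<bar>w x\<bar> + e N)\<^sup>2)) *\<^sub>R grad w x)) \<longlonglongrightarrow>
     flux p (grad u x) \<bullet> ((1 * 1) *\<^sub>R grad u x + (u x * 0) *\<^sub>R grad w x)" unfolding M_def e_def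
     by (intro tendsto_inner tendsto_add tendsto_scaleR tendsto_const tendsto_mult[OF truncation_deriv_tendsto sat_tendsto_1(1)[OF True]]
       tendsto_mult[OF truncation_tendsto sat_tendsto_1(2)[OF True]])
    then show ?thesis unfolding elim(1)[rule_format] using True by (simp add: flux_inner_self)
   next
    case False
    then have "w x = 0" using w0[of x] by simp
    then show ?thesis unfolding elim(1)[rule_format] using elim(2) by (simp add: sat_def)
   qed
  qed
 qed measurable
 moreover have "pair_int p (grad u) (grad (z N)) = m * pair_int p u (z N)" for N by (rule eigenfunctionD(3)[OF eu p A z(1)])
 ultimately show ?thesis using 1 LIMSEQ_unique by simp
qed

lemma nonneg_eigenfunctions_meet:
 assumes p: "p > 1" and A: "A \<in> lmeasurable" and eu: "eigenfunction p A m u" and u0: "\<And>x. u x \<ge> 0"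
  and ew: "eigenfunction p A \<mu> w" and w0: "\<And>x. w x \<ge> 0" and meet: "\<not> (AE x in lebesgue. w x > 0 \<longrightarrow> u x = 0)"
 shows "\<mu> \<le> m"
proof -
 note u = eigenfunctionD(1)[OF eu p A] and w = eigenfunctionD(1)[OF ew p A]
 note L = picone_limit[OF p A ew w0 u u0]
 define I where "I = (LINT x|lebesgue. indicator {x. w x > 0} x * u x powr p)"
 have ms: "{x. w x > 0} \<in> sets lebesgue" by (rule pos_set_measurable[OF W1p_measurable[OF W1p0_W1p[OF w]]])
 have i: "integrable lebesgue (\<lambda>x. indicator {x. w x > 0} x * u x powr p)"
  using integrable_mult_indicator[OF ms Lp_integrable[OF W1p_Lp[OF W1p0_W1p[OF u]]]] u0 by simp
 have "I \<noteq> 0"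
 proof
  assume "I = 0"
  then have "AE x in lebesgue. indicator {x. w x > 0} x * u x powr p = 0"
   unfolding I_def by (subst (asm) integral_nonneg_eq_0_iff_AE[OF i]) auto
  then have "AE x in lebesgue. w x > 0 \<longrightarrow> u x = 0" by eventually_elim auto
  then show False using meet by simp
 qed
 moreover have "I \<ge> 0" unfolding I_def by (intro integral_nonneg_AE AE_I2) auto
 moreover have "\<mu> * I \<le> m * I" using L(1) positivity_energy_identity[OF p A eu u0 w w0 L(2)] by (simp add: I_def)
 ultimately show ?thesis by simp
qed

section \<open>Isolation of the first eigenvalue\<close>

text \<open>The quotient by almost everywhere equality has a one-dimensional span of eigenfunctions, so a single
 class generates them all.\<close>

lemma simple_eigenfunctions_proportional:
 assumes s: "simple_eigenvalue p A \<mu>" and u: "eigenfunction p A \<mu> u" and v: "eigenfunction p A \<mu> v"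
 obtains c where "AE x in lebesgue. v x = c * u x"
proof -
 define S where "S = ae_class ` {u. eigenfunction p A \<mu> u}"
 obtain B where B: "B \<subseteq> span S" "independent B" "span S \<subseteq> span B" "card B = dim (span S)" using basis_exists[of "span S"] by metis
 have "card B = 1" using B(4) s by (simp add: simple_eigenvalue_def S_def)
 then obtain e where e: "B = {e}" by (auto simp: card_1_singleton_iff)
 have sp: "ae_class w \<in> span {e}" if "eigenfunction p A \<mu> w" for w
  using that B(3) span_base[of "ae_class w" S] unfolding e S_def by blast
 obtain a where a: "ae_class u = a *\<^sub>R e" using sp[OF u] by (auto simp: span_singleton)
 obtain b where b: "ae_class v = b *\<^sub>R e" using sp[OF v] by (auto simp: span_singleton)
 have "a \<noteq> 0"
 proof
  assume "a = 0"
  then have "ae_class u = 0" using a by simp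
  then have "AE x in lebesgue. u x = 0" by (simp add: zero_ae_fun_def ae_fun.abs_eq_iff)
  then show False using u by (simp add: eigenfunction_def)
 qed
 then have "ae_class v = (b / a) *\<^sub>R ae_class u" using a b by simp
 then have "ae_class v = ae_class (\<lambda>x. (b / a) * u x)" by (simp add: scaleR_ae_fun.abs_eq)
 then have "AE x in lebesgue. v x = (b / a) * u x" unfolding ae_fun.abs_eq_iff .
 then show thesis by (rule that)
qed

lemma nonneg_eigenfunction_of_minimizer:
 assumes p: "p > 1" and A: "A \<in> lmeasurable" and v: "v \<in> W1p0 p A" "pint p v = 1"
  and g: "pint p (grad v) = rayleigh_inf p A"
 obtains u where "eigenfunction p A (rayleigh_inf p A) u" "\<And>x. u x \<ge> 0" "pint p u = 1"
proof -
 define u where "u x = \<bar>v x\<bar>" for x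
 note vW = W1p0_W1p[OF v(1)]
 note ab = W1p_abs[OF vW p]
 have cu: "continuous_on UNIV (\<lambda>z :: real \<times> real. \<bar>fst z\<bar>)" by (intro continuous_intros)
 have u: "u \<in> W1p0 p A" unfolding u_def[abs_def] by (rule W1p0_comp[OF p v(1) v(1), where g = "\<lambda>s t. \<bar>s\<bar>"]) (use cu ab(1) in auto)
 have u1: "pint p u = 1" unfolding v(2)[symmetric] by (simp add: pint_def u_def)
 have "pint p (grad u) = pint p (grad v)" unfolding u_def[abs_def]
  by (rule pint_cong_AE[OF ab(2) grad_measurable[OF ab(1)] grad_measurable[OF vW]])
 then have "eigenfunction p A (rayleigh_inf p A) u"
  using u u1 g rayleigh_inf_nonneg[OF v] by (intro minimizer_eigenfunction p A) auto
 then show thesis by (rule that) (simp_all add: u_def u1)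
qed

text \<open>Otherwise some minimizing sequence of nonnegative functions stays away from \<open>u\<close>. Its limit is a
 nonnegative normalized minimizer, hence an eigenfunction and a multiple of \<open>u\<close>, hence \<open>u\<close> itself.\<close>

lemma near_minimizer_close:
 fixes u :: "'a::euclidean_space \<Rightarrow> real"
 assumes p: "p > 1" and A: "A \<in> lmeasurable" and s: "simple_eigenvalue p A (rayleigh_inf p A)"
  and u: "eigenfunction p A (rayleigh_inf p A) u" "\<And>x. u x \<ge> 0" "pint p u = 1" and e: "e > 0"
 obtains d where "d > 0" "\<And>w. w \<in> W1p0 p A \<Longrightarrow> (\<forall>x. w x \<ge> 0) \<Longrightarrow> pint p w = 1 \<Longrightarrow>
  pint p (grad w) < rayleigh_inf p A + d \<Longrightarrow> pint p (\<lambda>x. w x - u x) < e"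
proof (rule ccontr)
 assume nt: "\<not> thesis"
 note found = that
 have no: "\<exists>w. w \<in> W1p0 p A \<and> (\<forall>x. w x \<ge> 0) \<and> pint p w = 1 \<and>
  pint p (grad w) < rayleigh_inf p A + d \<and> pint p (\<lambda>x. w x - u x) \<ge> e" if dpos: "d > 0" for d
 proof (rule ccontr)
  assume n: "\<not> ?thesis"
  have "pint p (\<lambda>x. w x - u x) < e" if "w \<in> W1p0 p A" "\<forall>x. w x \<ge> 0" "pint p w = 1" "pint p (grad w) < rayleigh_inf p A + d" for w
   by (rule ccontr) (use n that in \<open>auto simp: not_less\<close>)
  then have thesis by (rule found[OF dpos])
  with nt show False ..
 qed
 have "\<forall>k::nat. \<exists>w. w \<in> W1p0 p A \<and> (\<forall>x. w x \<ge> 0) \<and> pint p w = 1 \<and>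
  pint p (grad w) < rayleigh_inf p A + inverse (real (Suc k)) \<and> pint p (\<lambda>x. w x - u x) \<ge> e" by (intro allI no) simp
 then obtain w where w': "\<forall>k::nat. w k \<in> W1p0 p A \<and> (\<forall>x. w k x \<ge> 0) \<and> pint p (w k) = 1 \<and>
  pint p (grad (w k)) < rayleigh_inf p A + inverse (real (Suc k)) \<and> pint p (\<lambda>x. w k x - u x) \<ge> e" unfolding choice_iff by blast
 then have w: "w k \<in> W1p0 p A" "\<And>x. w k x \<ge> 0" "pint p (w k) = 1"
  "pint p (grad (w k)) < rayleigh_inf p A + inverse (real (Suc k))" "pint p (\<lambda>x. w k x - u x) \<ge> e" for k by auto
 have lim: "(\<lambda>k. pint p (grad (w k))) \<longlonglongrightarrow> rayleigh_inf p A"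
 proof (rule tendsto_sandwich[OF _ _ tendsto_const LIMSEQ_inverse_real_of_nat_add])
  show "\<forall>\<^sub>F k in sequentially. rayleigh_inf p A \<le> pint p (grad (w k))"
   using rayleigh_inf_le[OF p w(1)] w(3) by (intro always_eventually) simp
  show "\<forall>\<^sub>F k in sequentially. pint p (grad (w k)) \<le> rayleigh_inf p A + inverse (real (Suc k))"
   using w(4) by (intro always_eventually allI less_imp_le)
 qed
 obtain r :: "nat \<Rightarrow> nat" and v where r: "strict_mono r" "v \<in> W1p0 p A" "(\<lambda>n. pint p (\<lambda>x. w (r n) x - v x)) \<longlonglongrightarrow> 0"
  "pint p v = 1" "pint p (grad v) = rayleigh_inf p A" by (rule minimizing_sequence_converges[OF p A w(1) w(3) lim]) (rule that)
 have vL: "v \<in> Lp p" by (rule W1p_Lp[OF W1p0_W1p[OF r(2)]])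
 have wL: "w k \<in> Lp p" for k by (rule W1p_Lp[OF W1p0_W1p[OF w(1)]])
 obtain q :: "nat \<Rightarrow> nat" where q: "strict_mono q" "AE x in lebesgue. (\<lambda>n. w (r (q n)) x) \<longlonglongrightarrow> v x"
  by (rule Lp_tendsto_AE_subseq[of "\<lambda>n. w (r n)", OF wL vL r(3) p]) (rule that)
 have v0: "AE x in lebesgue. v x \<ge> 0" using q(2) by eventually_elim (rule LIMSEQ_le_const, use w(2) in auto)
 have "eigenfunction p A (rayleigh_inf p A) v"
  using r(2,4,5) rayleigh_inf_nonneg[OF r(2,4)] by (intro minimizer_eigenfunction p A) auto
 then obtain c where c: "AE x in lebesgue. v x = c * u x" by (rule simple_eigenfunctions_proportional[OF s u(1)])
 have um: "u \<in> lmeas" by (rule W1p_measurable[OF W1p0_W1p[OF eigenfunctionD(1)[OF u(1) p A]]])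
 have "pint p v = pint p (\<lambda>x. \<bar>c\<bar> *\<^sub>R u x)"
  by (rule pint_cong_AE) (use c Lp_measurable[OF vL] um in \<open>auto elim!: eventually_mono simp: abs_mult\<close>)
 then have "\<bar>c\<bar> powr p = 1" unfolding pint_scaleR r(4) u(3) by simp
 then have "(\<bar>c\<bar> powr p) powr (1 / p) = 1" by simp
 then have c1: "\<bar>c\<bar> = 1" using p by (simp add: powr_powr)
 have "AE x in lebesgue. v x = u x" using c v0
 proof eventually_elim
  case (elim x)
  have "\<bar>v x\<bar> = u x" using elim(1) c1 u(2)[of x] by (simp add: abs_mult)
  then show ?case using elim(2) by simp
 qed
 then have "pint p (\<lambda>x. w (r n) x - v x) = pint p (\<lambda>x. w (r n) x - u x)" for n
  by (intro pint_cong_AE) (use um Lp_measurable[OF vL] Lp_measurable[OF wL] in \<open>auto elim!: eventually_mono\<close>)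
 then have "(\<lambda>n. pint p (\<lambda>x. w (r n) x - u x)) \<longlonglongrightarrow> 0" using r(3) by simp
 then have "e \<le> 0" by (rule LIMSEQ_le_const) (use w(5) in auto)
 then show False using e by simp
qed

text \<open>Test the equation with the positive part.\<close>

lemma eigenfunction_pos_part:
 assumes p: "p > 1" and A: "A \<in> lmeasurable" and w: "eigenfunction p A \<mu> w" and pos: "pint p (\<lambda>x. max (w x) 0) > 0"
 obtains c where "c > 0" "(\<lambda>x. c * max (w x) 0) \<in> W1p0 p A" "pint p (\<lambda>x. c * max (w x) 0) = 1"
  "pint p (grad (\<lambda>x. c * max (w x) 0)) = \<mu>"
proof -
 define h where "h x = max (w x) 0" for x
 note w0 = eigenfunctionD(1)[OF w p A]
 note wW = W1p0_W1p[OF w0]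
 note pp = W1p_pos[OF wW p, folded h_def[abs_def]]
 have h: "h \<in> W1p0 p A" unfolding h_def[abs_def] by (rule W1p0_pos[OF p w0])
 have "pair_int p (grad w) (grad h) = pint p (grad h)" unfolding pair_int_def pint_def
 proof (rule integral_cong_AE)
  note [measurable] = grad_measurable[OF wW] grad_measurable[OF pp(1)]
  show "(\<lambda>x. flux p (grad w x) \<bullet> grad h x) \<in> lmeas" using flux_measurable[OF grad_measurable[OF wW] p] by measurable
  show "(\<lambda>x. norm (grad h x) powr p) \<in> lmeas" by measurable
  show "AE x in lebesgue. flux p (grad w x) \<bullet> grad h x = norm (grad h x) powr p"
   using pp(2) by eventually_elim (auto simp: flux_inner_self)
 qed
 moreover have "pair_int p w h = pint p h" unfolding pair_int_def pint_def
 proof (rule Bochner_Integration.integral_cong[OF refl])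
  show "flux p (w x) \<bullet> h x = norm (h x) powr p" for x using flux_inner_self[of p "w x"] by (auto simp: h_def max_def)
 qed
 ultimately have eq: "pint p (grad h) = \<mu> * pint p h" using eigenfunctionD(3)[OF w p A h] by simp
 have hpos: "pint p h > 0" using pos by (simp add: h_def[abs_def])
 obtain c where c: "c > 0" "(\<lambda>x. c * h x) \<in> W1p0 p A" "pint p (\<lambda>x. c * h x) = 1"
  "pint p (grad (\<lambda>x. c * h x)) = pint p (grad h) / pint p h" by (rule normalize_W1p0[OF p h hpos]) (rule that)
 show thesis by (rule that[OF c(1-3)[unfolded h_def]]) (use c(4) eq hpos in \<open>simp add: h_def\<close>)
qed

lemma eigenfunction_cong_AE:
 fixes w h :: "'a::euclidean_space \<Rightarrow> real"
 assumes w: "eigenfunction p A \<mu> w" and ae: "AE x in lebesgue. w x = h x" and hm: "h \<in> lmeas"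
  and p: "p > 1" and A: "A \<in> lmeasurable"
 shows "eigenfunction p A \<mu> h" unfolding eigenfunction_iff[OF p A]
proof (intro conjI ballI)
 note w0 = eigenfunctionD(1)[OF w p A]
 note wW = W1p0_W1p[OF w0]
 note h = W1p_cong_AE[OF wW ae hm]
 show "h \<in> W1p0 p A" by (rule W1p0_cong_AE[OF w0 ae hm])
 show "\<not> (AE x in lebesgue. h x = 0)"
 proof
  assume "AE x in lebesgue. h x = 0"
  with ae have "AE x in lebesgue. w x = 0" by eventually_elim simp
  then show False using w by (simp add: eigenfunction_def)
 qed
 fix \<phi> assume \<phi>: "\<phi> \<in> W1p0 p A"
 note \<phi>W = W1p0_W1p[OF \<phi>]
 have "pair_int p (grad h) (grad \<phi>) = pair_int p (grad w) (grad \<phi>)"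
  by (rule pair_int_cong_AE[OF h(2) _ p]) (auto intro: grad_measurable h(1) wW \<phi>W)
 moreover have "pair_int p w \<phi> = pair_int p h \<phi>" by (rule pair_int_cong_AE[OF ae _ p]) (auto intro: W1p_measurable h(1) wW \<phi>W)
 ultimately show "pair_int p (grad h) (grad \<phi>) = \<mu> * pair_int p h \<phi>" using eigenfunctionD(3)[OF w p A \<phi>] by simp
qed

text \<open>If both parts of \<open>w\<close> were nonzero, their normalizations would both be close to \<open>u\<close>; at each point one of
 them vanishes, so \<open>\<parallel>u\<parallel>\<^sup>p\<close> would be at most \<open>1/4 + 1/4\<close>. If \<open>w\<close> and \<open>u\<close> had disjoint supports, \<open>\<parallel>u\<parallel>\<^sup>p\<close>
 would be at most \<open>1/4\<close>.\<close>

lemma eigenvalue_le_of_near: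
 assumes p: "p > 1" and A: "A \<in> lmeasurable"
  and u: "eigenfunction p A m u" "\<And>x. u x \<ge> 0" "pint p u = 1"
  and near: "\<And>w. w \<in> W1p0 p A \<Longrightarrow> (\<forall>x. w x \<ge> 0) \<Longrightarrow> pint p w = 1 \<Longrightarrow>
   pint p (grad w) < m + d \<Longrightarrow> pint p (\<lambda>x. w x - u x) < 1 / 4"
  and w: "eigenfunction p A \<mu> w" and less: "\<mu> < m + d" and pos: "pint p (\<lambda>x. max (w x) 0) > 0"
 shows "\<mu> \<le> m"
proof -
 note uL = W1p_Lp[OF W1p0_W1p[OF eigenfunctionD(1)[OF u(1) p A]]]
 note wm = W1p_measurable[OF W1p0_W1p[OF eigenfunctionD(1)[OF w p A]]]
 obtain c where c: "c > 0" "(\<lambda>x. c * max (w x) 0) \<in> W1p0 p A" "pint p (\<lambda>x. c * max (w x) 0) = 1"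
  "pint p (grad (\<lambda>x. c * max (w x) 0)) = \<mu>" by (rule eigenfunction_pos_part[OF p A w pos]) (rule that)
 have cc: "pint p (\<lambda>x. c * max (w x) 0 - u x) < 1 / 4" using c less by (intro near) auto
 note cL = Lp_diff(1)[OF W1p_Lp[OF W1p0_W1p[OF c(2)]] uL]
 have mw: "eigenfunction p A \<mu> (\<lambda>x. - 1 * w x)" by (rule eigenfunction_cmult[OF w p A]) simp
 have "\<not> pint p (\<lambda>x. max (- 1 * w x) 0) > 0"
 proof
  assume npos: "pint p (\<lambda>x. max (- 1 * w x) 0) > 0"
  obtain b where b: "b > 0" "(\<lambda>x. b * max (- 1 * w x) 0) \<in> W1p0 p A" "pint p (\<lambda>x. b * max (- 1 * w x) 0) = 1"
   "pint p (grad (\<lambda>x. b * max (- 1 * w x) 0)) = \<mu>" by (rule eigenfunction_pos_part[OF p A mw npos]) (rule that)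
  have bb: "pint p (\<lambda>x. b * max (- 1 * w x) 0 - u x) < 1 / 4" using b less by (intro near) auto
  note bL = Lp_diff(1)[OF W1p_Lp[OF W1p0_W1p[OF b(2)]] uL]
  have p0: "p > 0" using p by simp
  have "pint p u \<le> pint p (\<lambda>x. c * max (w x) 0 - u x) + pint p (\<lambda>x. b * max (- 1 * w x) 0 - u x)"
   unfolding pint_def Bochner_Integration.integral_add[OF Lp_integrable[OF cL[OF p0]] Lp_integrable[OF bL[OF p0]], symmetric]
  proof (rule integral_mono)
   show "norm (u x) powr p \<le> norm (c * max (w x) 0 - u x) powr p + norm (b * max (- 1 * w x) 0 - u x) powr p" for x
    by (cases "w x \<ge> 0") (auto simp: max_def)
  qed (intro Bochner_Integration.integrable_add Lp_integrable uL cL bL p0)+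
  then show False using cc bb u(3) by simp
 qed
 then have "pint p (\<lambda>x. max (- 1 * w x) 0) = 0" using pint_nonneg[of p "\<lambda>x. max (- 1 * w x) 0"] by simp
 moreover have "(\<lambda>x. max (- 1 * w x) 0) \<in> Lp p" by (rule W1p_Lp[OF W1p0_W1p[OF W1p0_pos[OF p eigenfunctionD(1)[OF mw p A]]]])
 ultimately have "AE x in lebesgue. max (- 1 * w x) 0 = 0" using pint_eq_0_iff by blast
 then have wp: "AE x in lebesgue. w x = max (w x) 0" by eventually_elim auto
 define h where "h x = max (w x) 0" for x
 have hm: "h \<in> lmeas" unfolding h_def[abs_def] using wm by measurable
 have ewh: "eigenfunction p A \<mu> h" by (rule eigenfunction_cong_AE[OF w _ hm p A]) (use wp in \<open>simp add: h_def\<close>)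
 have h0: "h x \<ge> 0" for x by (simp add: h_def)
 show ?thesis
 proof (rule nonneg_eigenfunctions_meet[OF p A u(1,2) ewh h0])
  show "\<not> (AE x in lebesgue. h x > 0 \<longrightarrow> u x = 0)"
  proof
   assume dis: "AE x in lebesgue. h x > 0 \<longrightarrow> u x = 0"
   have p0: "p > 0" using p by simp
   have "pint p u \<le> pint p (\<lambda>x. c * max (w x) 0 - u x)" unfolding pint_def
   proof (rule integral_mono_AE[OF Lp_integrable[OF uL] Lp_integrable[OF cL[OF p0]]])
    show "AE x in lebesgue. norm (u x) powr p \<le> norm (c * max (w x) 0 - u x) powr p"
     using dis by eventually_elim (auto simp: h_def max_def)
   qed
   then show False using cc u(3) by simp
  qed
 qed
qed

lemma near_eigenvalue_eq:
 assumes p: "p > 1" and A: "A \<in> lmeasurable" and s: "simple_eigenvalue p A (rayleigh_inf p A)"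
 obtains d where "d > 0" "\<And>\<mu>. eigenvalue p A \<mu> \<Longrightarrow> \<mu> < rayleigh_inf p A + d \<Longrightarrow> \<mu> = rayleigh_inf p A"
proof -
 have "eigenvalue p A (rayleigh_inf p A)" using s by (simp add: simple_eigenvalue_def)
 then obtain v where v: "v \<in> W1p0 p A" "pint p v = 1" "pint p (grad v) = rayleigh_inf p A"
  by (rule rayleigh_inf_eigenvalue[OF p A]) (rule that)
 obtain u where u: "eigenfunction p A (rayleigh_inf p A) u" "\<And>x. u x \<ge> 0" "pint p u = 1"
  by (rule nonneg_eigenfunction_of_minimizer[OF p A v]) (rule that)
 have quarter: "(0::real) < 1 / 4" by simp
 obtain d where d: "d > 0" "\<And>w. w \<in> W1p0 p A \<Longrightarrow> (\<forall>x. w x \<ge> 0) \<Longrightarrow> pint p w = 1 \<Longrightarrow>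
  pint p (grad w) < rayleigh_inf p A + d \<Longrightarrow> pint p (\<lambda>x. w x - u x) < 1 / 4"
  by (rule near_minimizer_close[OF p A s u quarter]) (rule that)
 have "\<mu> = rayleigh_inf p A" if e: "eigenvalue p A \<mu>" and l: "\<mu> < rayleigh_inf p A + d" for \<mu>
 proof -
  obtain w where w: "eigenfunction p A \<mu> w" using e by (auto simp: eigenvalue_def)
  have mw: "eigenfunction p A \<mu> (\<lambda>x. - 1 * w x)" by (rule eigenfunction_cmult[OF w p A]) simp
  have "\<mu> \<le> rayleigh_inf p A"
  proof (cases "pint p (\<lambda>x. max (w x) 0) > 0 \<or> pint p (\<lambda>x. max (- 1 * w x) 0) > 0")
   case True
   then show ?thesis using eigenvalue_le_of_near[OF p A u d(2) w l] eigenvalue_le_of_near[OF p A u d(2) mw l] by blast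
  next
   case False
   have "(\<lambda>x. max (w x) 0) \<in> Lp p" "(\<lambda>x. max (- 1 * w x) 0) \<in> Lp p"
    by (rule W1p_Lp[OF W1p0_W1p[OF W1p0_pos[OF p eigenfunctionD(1)[OF w p A]]]]
      W1p_Lp[OF W1p0_W1p[OF W1p0_pos[OF p eigenfunctionD(1)[OF mw p A]]]])+
   moreover have "pint p (\<lambda>x. max (w x) 0) = 0" "pint p (\<lambda>x. max (- 1 * w x) 0) = 0"
    using False pint_nonneg[of p "\<lambda>x. max (w x) 0"] pint_nonneg[of p "\<lambda>x. max (- 1 * w x) 0"] by auto
   ultimately have "AE x in lebesgue. max (w x) 0 = 0" "AE x in lebesgue. max (- 1 * w x) 0 = 0" using pint_eq_0_iff by blast+
   then have "AE x in lebesgue. w x = 0" by eventually_elim (auto simp: max_def split: if_splits)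
   then show ?thesis using w by (simp add: eigenfunction_def)
  qed
  then show ?thesis using rayleigh_inf_le_eigenvalue[OF p A e] by simp
 qed
 then show thesis using that d(1) by blast
qed

theorem proposition3p11:
 fixes p :: real and A :: "(real ^ 'n) set"
 assumes "1 < p" and "p \<le> real CARD('n)"
  and "quasi_open p A" and "A \<in> lmeasurable"
 shows "(\<forall>ev \<mu>. (\<forall>k::nat. eigenvalue p A (ev k)) \<and> ev \<longlonglongrightarrow> \<mu> \<longrightarrow> eigenvalue p A \<mu>) \<and>
  (simple_eigenvalue p A (first_eigenvalue p A) \<longrightarrow>
    first_eigenvalue p A isolated_in {\<mu>. eigenvalue p A \<mu>})"
proof (intro conjI allI impI)
 fix ev \<mu> assume "(\<forall>k::nat. eigenvalue p A (ev k)) \<and> ev \<longlonglongrightarrow> \<mu>"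
 then have ev: "\<And>k. eigenvalue p A (ev k)" and lim: "ev \<longlonglongrightarrow> \<mu>" by auto
 show "eigenvalue p A \<mu>" by (rule eigenvalues_closed[OF assms(1,4) ev lim])
next
 assume s: "simple_eigenvalue p A (first_eigenvalue p A)"
 then have e: "eigenvalue p A (first_eigenvalue p A)" by (simp add: simple_eigenvalue_def)
 have eq: "first_eigenvalue p A = rayleigh_inf p A" by (rule first_eigenvalue_eq[OF assms(1,4) e])
 obtain d where d: "d > 0" "\<And>\<mu>. eigenvalue p A \<mu> \<Longrightarrow> \<mu> < rayleigh_inf p A + d \<Longrightarrow> \<mu> = rayleigh_inf p A"
  by (rule near_eigenvalue_eq[OF assms(1,4) s[unfolded eq]]) (rule that)
 have int: "{..<rayleigh_inf p A + d} \<inter> {\<mu>. eigenvalue p A \<mu>} = {rayleigh_inf p A}"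
  using d e[unfolded eq] by auto
 show "first_eigenvalue p A isolated_in {\<mu>. eigenvalue p A \<mu>}"
  unfolding isolated_in_def eq
 proof (intro conjI exI[of _ "{..<rayleigh_inf p A + d}"])
  show "rayleigh_inf p A \<in> {\<mu>. eigenvalue p A \<mu>}" using e[unfolded eq] by simp
 qed (rule open_lessThan int)+
qed

end
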